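(* Let $\Omega$ be a bounded $H^1,H^2$-extension domain of $\mathbb R^3$. Then the restricted tangential curl operator $$\mathbf{curl}_T:\mathcal B^2(\partial\Omega)\to\boldsymbol B_\perp(\partial\Omega),\qquad\mathrm{Tr}\,v\mapsto\mathbf{curl}_T(\mathrm{Tr}\,v)=\boldsymbol{\mathrm{Tr}}_T(\nabla v)\quad(v\in H^2(\Omega)),$$ is a well-defined, linear and continuous mapping.
   Context: All functions are real-valued. A bounded domain (bounded open connected set) $\Omega\subset\mathbb R^3$ is an $H^k$-extension domain ($k=1,2$) if there is a bounded linear operator $E_k:H^k(\Omega)\to H^k(\mathbb R^3)$ with $(E_ku)|_\Omega=u$ for all $u\in H^k(\Omega)$; it is an $H^1,H^2$-extension domain if it is both an $H^1$- and an $H^2$-extension domain. For an $H^1$-extension domain, the trace of $u\in H^1(\Omega)$ is defined for quasi-every $x\in\partial\Omega$ (with respect to the capacity associated with $H^1(\mathbb R^3)$) by $\mathrm{Tr}\,u(x)=\lim_{r\to0^+}\frac{1}{\lambda(\Omega\cap B_r(x))}\int_{\Omega\cap B_r(x)}u(y)\,dy$, where $\lambda$ is Lebesgue measure; functions on $\partial\Omega$ are identified when they agree quasi-everywhere. The trace space is $\mathcal B(\partial\Omega):=\mathrm{Tr}(H^1(\Omega))$ with norm $\|f\|_{\mathcal B(\partial\Omega)}=\min\{\|v\|_{H^1(\Omega)} : \mathrm{Tr}\,v=f\}$. It is known that $\mathcal B(\partial\Omega)$ is a Hilbert space and that $\mathrm{Ker}\,\mathrm{Tr}=H^1_0(\Omega)$.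 The space $\mathcal B^2(\partial\Omega):=\mathrm{Tr}(H^2(\Omega))$ is a Hilbert space with norm $\|f\|_{\mathcal B^2(\partial\Omega)}=\min\{\|v\|_{H^2(\Omega)}:v\in H^2(\Omega),\ \mathrm{Tr}\,v=f\}$. Vector-valued versions: $\boldsymbol H^1(\Omega)=H^1(\Omega)^3$, $\boldsymbol B(\partial\Omega)=\mathcal B(\partial\Omega)^3$, $\boldsymbol{\mathrm{Tr}}$ is the componentwise trace, $\boldsymbol B'(\partial\Omega)$ the dual of $\boldsymbol B(\partial\Omega)$. Tangential trace on $\boldsymbol H^1(\Omega)$: $\boldsymbol{\mathrm{Tr}}_T\boldsymbol u\in\boldsymbol B'(\partial\Omega)$ is the (well-defined) continuous functional with $\langle\boldsymbol{\mathrm{Tr}}_T\boldsymbol u,\boldsymbol{\mathrm{Tr}}\,\boldsymbol v\rangle=\int_\Omega(\boldsymbol u\cdot\mathbf{curl}\,\boldsymbol v-\boldsymbol v\cdot\mathbf{curl}\,\boldsymbol u)\,dx$ for all $\boldsymbol v\in\boldsymbol H^1(\Omega)$. $\boldsymbol B_\perp(\partial\Omega):=\boldsymbol{\mathrm{Tr}}_T(\boldsymbol H^1(\Omega))\subset\boldsymbol B'(\partial\Omega)$ has the quotient norm $\|\boldsymbol f\|_{\boldsymbol B_\perp}=\inf\{\|\boldsymbol v\|_{\boldsymbol H^1(\Omega)}:\boldsymbol v\in\boldsymbol H^1(\Omega),\ \boldsymbol{\mathrm{Tr}}_T\boldsymbol v=\boldsymbol f\}$. *)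

theory Defs
  imports "HOL-Analysis.Analysis"
begin

text \<open>
  Elements of function spaces are represented by functions on the whole of \<open>\<real>\<^sup>3\<close>.
  Only the values on the domain (or on its boundary) matter: elements of \<open>H\<^sup>k(\<Omega>)\<close> are identified
  when they agree almost everywhere on \<open>\<Omega>\<close>, functions on \<open>\<partial>\<Omega>\<close> when they agree quasi-everywhere
  on \<open>\<partial>\<Omega>\<close>.
\<close>

definition pderiv :: "3 \<Rightarrow> (real^3 \<Rightarrow> real) \<Rightarrow> real^3 \<Rightarrow> real" where
  "pderiv i \<phi> x = frechet_derivative \<phi> (at x) (axis i 1)"

fun C_k :: "nat \<Rightarrow> (real^3 \<Rightarrow> real) \<Rightarrow> bool" where
  "C_k 0 \<phi> \<longleftrightarrow> continuous_on UNIV \<phi>"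
| "C_k (Suc k) \<phi> \<longleftrightarrow> (\<forall>x. \<phi> differentiable (at x)) \<and> (\<forall>i. C_k k (pderiv i \<phi>))"

definition test_functions :: "(real^3) set \<Rightarrow> (real^3 \<Rightarrow> real) set" where
  "test_functions \<Omega> =
     {\<phi>. (\<forall>k. C_k k \<phi>) \<and> compact (closure {x. \<phi> x \<noteq> 0}) \<and> closure {x. \<phi> x \<noteq> 0} \<subseteq> \<Omega>}"

definition L2 :: "(real^3) set \<Rightarrow> (real^3 \<Rightarrow> real) set" where
  "L2 \<Omega> = {u. u \<in> borel_measurable (lebesgue_on \<Omega>) \<and> integrable (lebesgue_on \<Omega>) (\<lambda>x. (u x)\<^sup>2)}"

definition L2_norm :: "(real^3) set \<Rightarrow> (real^3 \<Rightarrow> real) \<Rightarrow> real" where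
  "L2_norm \<Omega> u = sqrt (integral\<^sup>L (lebesgue_on \<Omega>) (\<lambda>x. (u x)\<^sup>2))"

definition is_weak_pderiv ::
    "(real^3) set \<Rightarrow> 3 \<Rightarrow> (real^3 \<Rightarrow> real) \<Rightarrow> (real^3 \<Rightarrow> real) \<Rightarrow> bool" where
  "is_weak_pderiv \<Omega> i u g \<longleftrightarrow>
     (\<forall>\<phi>\<in>test_functions \<Omega>.
        integral\<^sup>L (lebesgue_on \<Omega>) (\<lambda>x. u x * pderiv i \<phi> x) =
        - integral\<^sup>L (lebesgue_on \<Omega>) (\<lambda>x. g x * \<phi> x))"

text \<open>A representative of the weak derivative, which is unique almost everywhere on \<open>\<Omega>\<close>.\<close>

definition weak_pderiv :: "(real^3) set \<Rightarrow> 3 \<Rightarrow> (real^3 \<Rightarrow> real) \<Rightarrow> real^3 \<Rightarrow> real" where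
  "weak_pderiv \<Omega> i u = (SOME g. g \<in> L2 \<Omega> \<and> is_weak_pderiv \<Omega> i u g)"

text \<open>The space \<open>H\<^sup>k(\<Omega>)\<close>.\<close>

fun sobolev :: "nat \<Rightarrow> (real^3) set \<Rightarrow> (real^3 \<Rightarrow> real) set" where
  "sobolev 0 \<Omega> = L2 \<Omega>"
| "sobolev (Suc k) \<Omega> = {u \<in> L2 \<Omega>. \<forall>i. \<exists>g\<in>sobolev k \<Omega>. is_weak_pderiv \<Omega> i u g}"

text \<open>For \<open>k = 2\<close> this is
  \<open>\<parallel>u\<parallel>\<^sup>2 + (\<Sum>i. \<parallel>\<partial>\<^sub>i u\<parallel>\<^sup>2) + (\<Sum>i. \<Sum>j. \<parallel>\<partial>\<^sub>j \<partial>\<^sub>i u\<parallel>\<^sup>2)\<close> under the root, with the full Hessian.\<close>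

fun sobolev_norm :: "nat \<Rightarrow> (real^3) set \<Rightarrow> (real^3 \<Rightarrow> real) \<Rightarrow> real" where
  "sobolev_norm 0 \<Omega> u = L2_norm \<Omega> u"
| "sobolev_norm (Suc k) \<Omega> u =
     sqrt ((L2_norm \<Omega> u)\<^sup>2 + (\<Sum>i\<in>UNIV. (sobolev_norm k \<Omega> (weak_pderiv \<Omega> i u))\<^sup>2))"

definition vsobolev :: "nat \<Rightarrow> (real^3) set \<Rightarrow> (real^3 \<Rightarrow> real^3) set" where
  "vsobolev k \<Omega> = {u. \<forall>i. (\<lambda>x. u x $ i) \<in> sobolev k \<Omega>}"

definition vsobolev_norm :: "nat \<Rightarrow> (real^3) set \<Rightarrow> (real^3 \<Rightarrow> real^3) \<Rightarrow> real" where
  "vsobolev_norm k \<Omega> u = L2_set (\<lambda>i. sobolev_norm k \<Omega> (\<lambda>x. u x $ i)) UNIV"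

definition weak_grad :: "(real^3) set \<Rightarrow> (real^3 \<Rightarrow> real) \<Rightarrow> real^3 \<Rightarrow> real^3" where
  "weak_grad \<Omega> v x = (\<chi> i. weak_pderiv \<Omega> i v x)"

definition weak_curl :: "(real^3) set \<Rightarrow> (real^3 \<Rightarrow> real^3) \<Rightarrow> real^3 \<Rightarrow> real^3" where
  "weak_curl \<Omega> u x =
     (let d = (\<lambda>i j. weak_pderiv \<Omega> i (\<lambda>y. u y $ j) x)
      in vector [d 2 3 - d 3 2, d 3 1 - d 1 3, d 1 2 - d 2 1])"

definition extension_operator ::
    "nat \<Rightarrow> (real^3) set \<Rightarrow> ((real^3 \<Rightarrow> real) \<Rightarrow> real^3 \<Rightarrow> real) \<Rightarrow> bool" where
  "extension_operator k \<Omega> E \<longleftrightarrow>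
     (\<forall>u\<in>sobolev k \<Omega>. E u \<in> sobolev k UNIV) \<and>
     (\<forall>u\<in>sobolev k \<Omega>. \<forall>v\<in>sobolev k \<Omega>.
        (AE x in lebesgue_on \<Omega>. u x = v x) \<longrightarrow> (AE x in lebesgue. E u x = E v x)) \<and>
     (\<forall>u\<in>sobolev k \<Omega>. \<forall>v\<in>sobolev k \<Omega>. \<forall>a b.
        AE x in lebesgue. E (\<lambda>y. a * u y + b * v y) x = a * E u x + b * E v x) \<and>
     (\<exists>C. \<forall>u\<in>sobolev k \<Omega>. sobolev_norm k UNIV (E u) \<le> C * sobolev_norm k \<Omega> u) \<and>
     (\<forall>u\<in>sobolev k \<Omega>. AE x in lebesgue_on \<Omega>. E u x = u x)"

definition extension_domain :: "nat \<Rightarrow> (real^3) set \<Rightarrow> bool" where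
  "extension_domain k \<Omega> \<longleftrightarrow>
     bounded \<Omega> \<and> open \<Omega> \<and> connected \<Omega> \<and> (\<exists>E. extension_operator k \<Omega> E)"

definition capacity :: "(real^3) set \<Rightarrow> ennreal" where
  "capacity A =
     (INF u \<in> {u \<in> sobolev 1 UNIV. \<exists>U. open U \<and> A \<subseteq> U \<and> (AE x in lebesgue. x \<in> U \<longrightarrow> u x \<ge> 1)}.
        ennreal ((sobolev_norm 1 UNIV u)\<^sup>2))"

definition qe_eq :: "(real^3) set \<Rightarrow> (real^3 \<Rightarrow> real) \<Rightarrow> (real^3 \<Rightarrow> real) \<Rightarrow> bool" where
  "qe_eq \<Omega> f g \<longleftrightarrow> capacity {x \<in> frontier \<Omega>. f x \<noteq> g x} = 0"

definition vqe_eq :: "(real^3) set \<Rightarrow> (real^3 \<Rightarrow> real^3) \<Rightarrow> (real^3 \<Rightarrow> real^3) \<Rightarrow> bool" where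
  "vqe_eq \<Omega> f g \<longleftrightarrow> (\<forall>i. qe_eq \<Omega> (\<lambda>x. f x $ i) (\<lambda>x. g x $ i))"

text \<open>For \<open>u\<close> in \<open>H\<^sup>1\<close> of an extension domain the limit exists quasi-everywhere on the boundary;
  the values of \<open>Tr \<Omega> u\<close> at all other points are irrelevant.\<close>

definition Tr :: "(real^3) set \<Rightarrow> (real^3 \<Rightarrow> real) \<Rightarrow> real^3 \<Rightarrow> real" where
  "Tr \<Omega> u x =
     Lim (at_right 0)
       (\<lambda>r. 1 / measure lebesgue (\<Omega> \<inter> ball x r) * integral\<^sup>L (lebesgue_on (\<Omega> \<inter> ball x r)) u)"

definition vTr :: "(real^3) set \<Rightarrow> (real^3 \<Rightarrow> real^3) \<Rightarrow> real^3 \<Rightarrow> real^3" where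
  "vTr \<Omega> u x = (\<chi> i. Tr \<Omega> (\<lambda>y. u y $ i) x)"

text \<open>\<open>trace_space 1 \<Omega>\<close> is \<open>B(\<partial>\<Omega>)\<close>, \<open>trace_space 2 \<Omega>\<close> is \<open>B\<^sup>2(\<partial>\<Omega>)\<close>.\<close>

definition trace_space :: "nat \<Rightarrow> (real^3) set \<Rightarrow> (real^3 \<Rightarrow> real) set" where
  "trace_space k \<Omega> = {f. \<exists>v\<in>sobolev k \<Omega>. qe_eq \<Omega> (Tr \<Omega> v) f}"

text \<open>The infimum is attained on \<open>trace_space k \<Omega>\<close> for \<open>k = 1, 2\<close>, that is, it is a minimum there.\<close>

definition trace_norm :: "nat \<Rightarrow> (real^3) set \<Rightarrow> (real^3 \<Rightarrow> real) \<Rightarrow> real" where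
  "trace_norm k \<Omega> f = Inf (sobolev_norm k \<Omega> ` {v \<in> sobolev k \<Omega>. qe_eq \<Omega> (Tr \<Omega> v) f})"

definition vtrace_space :: "(real^3) set \<Rightarrow> (real^3 \<Rightarrow> real^3) set" where
  "vtrace_space \<Omega> = {f. \<forall>i. (\<lambda>x. f x $ i) \<in> trace_space 1 \<Omega>}"

definition vtrace_norm :: "(real^3) set \<Rightarrow> (real^3 \<Rightarrow> real^3) \<Rightarrow> real" where
  "vtrace_norm \<Omega> f = L2_set (\<lambda>i. trace_norm 1 \<Omega> (\<lambda>x. f x $ i)) UNIV"

text \<open>The dual of the vector-valued trace space. Functionals are set to \<open>0\<close> off that space, so that
  equality of functionals is equality of functions and the vector space operations are pointwise.\<close>

definition vtrace_dual :: "(real^3) set \<Rightarrow> ((real^3 \<Rightarrow> real^3) \<Rightarrow> real) set" where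
  "vtrace_dual \<Omega> =
     {l. (\<forall>f. f \<notin> vtrace_space \<Omega> \<longrightarrow> l f = 0) \<and>
         (\<forall>f\<in>vtrace_space \<Omega>. \<forall>g\<in>vtrace_space \<Omega>. vqe_eq \<Omega> f g \<longrightarrow> l f = l g) \<and>
         (\<forall>f\<in>vtrace_space \<Omega>. \<forall>g\<in>vtrace_space \<Omega>. \<forall>a b.
            l (\<lambda>x. a *\<^sub>R f x + b *\<^sub>R g x) = a * l f + b * l g) \<and>
         (\<exists>C. \<forall>f\<in>vtrace_space \<Omega>. \<bar>l f\<bar> \<le> C * vtrace_norm \<Omega> f)}"

definition tangential_trace ::
    "(real^3) set \<Rightarrow> (real^3 \<Rightarrow> real^3) \<Rightarrow> (real^3 \<Rightarrow> real^3) \<Rightarrow> real" where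
  "tangential_trace \<Omega> u =
     (THE l. l \<in> vtrace_dual \<Omega> \<and>
        (\<forall>v\<in>vsobolev 1 \<Omega>.
           l (vTr \<Omega> v) =
           integral\<^sup>L (lebesgue_on \<Omega>) (\<lambda>x. u x \<bullet> weak_curl \<Omega> v x - v x \<bullet> weak_curl \<Omega> u x)))"

definition B_perp :: "(real^3) set \<Rightarrow> ((real^3 \<Rightarrow> real^3) \<Rightarrow> real) set" where
  "B_perp \<Omega> = tangential_trace \<Omega> ` vsobolev 1 \<Omega>"

definition B_perp_norm :: "(real^3) set \<Rightarrow> ((real^3 \<Rightarrow> real^3) \<Rightarrow> real) \<Rightarrow> real" where
  "B_perp_norm \<Omega> l = Inf (vsobolev_norm 1 \<Omega> ` {v \<in> vsobolev 1 \<Omega>. tangential_trace \<Omega> v = l})"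

text \<open>That this does not depend on the choice of \<open>v\<close> is a theorem, not part of the definition.\<close>

definition curl_T :: "(real^3) set \<Rightarrow> (real^3 \<Rightarrow> real) \<Rightarrow> (real^3 \<Rightarrow> real^3) \<Rightarrow> real" where
  "curl_T \<Omega> f =
     (THE l. \<exists>v\<in>sobolev 2 \<Omega>. qe_eq \<Omega> (Tr \<Omega> v) f \<and> l = tangential_trace \<Omega> (weak_grad \<Omega> v))"

end

theory Submission imports Defs begin

text \<open>
  Integration by parts turns \<open>\<langle>Tr\<^sub>T (\<nabla>v), Tr w\<rangle>\<close> into a combination of the forms
  \<open>\<integral>\<^sub>\<Omega> \<partial>\<^sub>i v \<partial>\<^sub>j q - \<partial>\<^sub>j v \<partial>\<^sub>i q\<close> with \<open>q\<close> a component of \<open>w\<close>, and the theorem reduces to the claim that such a form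
  vanishes as soon as \<open>v\<close> (or, by antisymmetry, \<open>q\<close>) has trace zero quasi-everywhere.

  If \<open>v\<close> vanishes near \<open>\<partial>\<Omega>\<close>, mollification and the symmetry of second derivatives give the claim. In general,
  a smooth approximation of an extension of \<open>v\<close> converges uniformly together with its ball averages outside
  open sets of small capacity; the measure density \<open>\<lambda>(\<Omega> \<inter> B\<^sub>r(x)) \<ge> c r\<^sup>3\<close> at boundary points, which follows from the
  extension property for \<open>H\<^sup>2\<close>, transfers this to averages over \<open>\<Omega> \<inter> B\<^sub>r(x)\<close>. So the trace exists quasi-everywhere, and
  where it is zero the extension of \<open>v\<close> is small nearby. Truncating the small values of \<open>v\<close> and cutting off along an
  open set of small capacity yields functions that vanish near \<open>\<partial>\<Omega>\<close> and converge to \<open>v\<close> in \<open>H\<^sup>1\<close>.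

  The control of ball averages outside a set of small capacity comes from a weak-type estimate in \<open>H\<^sup>1\<close>: the
  minimiser of an obstacle problem is a supersolution, hence dominates its own averages up to a constant.
\<close>

section \<open>Smooth functions\<close>

text \<open>The vanishing of the forms is used twice. In \<open>q\<close> it makes the functional
  that defines \<open>tangential_trace\<close> depend on the trace of \<open>w\<close> alone, so
  that the definite description there is met; in \<open>v\<close> it makes \<open>curl_T\<close>
  independent of the lift. Continuity is then immediate: the gradient of a lift is itself a
  competitor in \<open>B_perp_norm\<close>.

  The obstacle is that the hypothesis concerns limits of averages over \<Omega> \<inter> B_r(x) at
  quasi-every boundary point, whereas only functions vanishing on an open neighbourhood of the
  boundary can be mollified inside \<Omega>. To bridge the two one needs, for a given
  \<open>w\<close>, a function in H^1 that dominates all ball averages of \<open>w\<close>: it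
  bounds the capacity of the bad set and at the same time serves as profile of the cutoff. A bound
  on the measure of the bad set alone would give neither. Energy minimisation supplies such a
  function with norm controlled by that of \<open>w\<close>. Since the errors of the smooth
  approximation decrease geometrically, the dominating functions can be summed, and one open set
  handles all later approximations and all radii.\<close>

definition smooth :: "(real^3 \<Rightarrow> real) \<Rightarrow> bool" where
  "smooth f \<longleftrightarrow> (\<forall>k. C_k k f)"

lemma pderiv_eq:
  assumes "(f has_derivative f') (at x)"
  shows "pderiv i f x = f' (axis i 1)"
  using frechet_derivative_at[OF assms] by (simp add: pderiv_def)

lemma pderiv_has_derivative:
  assumes "f differentiable (at x)"
  shows "(f has_derivative (\<lambda>h. \<Sum>i\<in>UNIV. h $ i * pderiv i f x)) (at x)"
proof -
  have d: "(f has_derivative frechet_derivative f (at x)) (at x)"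
    using assms frechet_derivative_works by blast
  interpret linear "frechet_derivative f (at x)"
    using d has_derivative_linear by blast
  have "frechet_derivative f (at x) h = (\<Sum>i\<in>UNIV. h $ i * pderiv i f x)" for h
  proof -
    have "h = (\<Sum>i\<in>UNIV. h $ i *\<^sub>R axis i 1)"
      by (simp add: basis_expansion scalar_mult_eq_scaleR[symmetric])
    then have "frechet_derivative f (at x) h = frechet_derivative f (at x) (\<Sum>i\<in>UNIV. h $ i *\<^sub>R axis i 1)"
      by simp
    then show ?thesis
      by (simp add: sum scale pderiv_def)
  qed
  then show ?thesis
    using d by presburger
qed

lemma sum_axis: "(\<Sum>j\<in>UNIV. axis i 1 $ j * f j) = (f i :: real)" for i :: "3"
proof -
  have "(\<Sum>j\<in>UNIV. axis i 1 $ j * f j) = (\<Sum>j\<in>UNIV. if j = i then f j else 0)"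
    by (rule sum.cong) (auto simp: axis_def)
  then show ?thesis by simp
qed

lemma C_k_Suc_imp: "C_k (Suc k) f \<Longrightarrow> C_k k f"
proof (induction k arbitrary: f)
  case 0
  then show ?case
    by (auto intro!: continuous_at_imp_continuous_on differentiable_imp_continuous_within)
next
  case (Suc k)
  then show ?case
    by auto
qed

lemma C_k_const: "C_k k (\<lambda>x. c)"
proof (induction k arbitrary: c)
  case (Suc k)
  have "pderiv i (\<lambda>x. c) = (\<lambda>x. 0)" for i
    by (rule ext, subst pderiv_eq[OF has_derivative_const]) simp
  then show ?case
    using Suc by simp
qed simp

lemma pderiv_add:
  assumes "f differentiable (at x)" "g differentiable (at x)"
  shows "pderiv i (\<lambda>x. f x + g x) x = pderiv i f x + pderiv i g x"
  by (subst pderiv_eq[OF has_derivative_add[OF pderiv_has_derivative[OF assms(1)] pderiv_has_derivative[OF assms(2)]]])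
     (simp add: sum_axis)

lemma pderiv_mult:
  assumes "f differentiable (at x)" "g differentiable (at x)"
  shows "pderiv i (\<lambda>x. f x * g x) x = f x * pderiv i g x + pderiv i f x * g x"
  by (subst pderiv_eq[OF has_derivative_mult[OF pderiv_has_derivative[OF assms(1)] pderiv_has_derivative[OF assms(2)]]])
     (simp add: sum_axis)

lemma pderiv_cmult:
  assumes "f differentiable (at x)"
  shows "pderiv i (\<lambda>x. c * f x) x = c * pderiv i f x"
  using pderiv_mult[of "\<lambda>x. c" x f i] assms pderiv_eq[OF has_derivative_const, of i c x] by simp

lemma pderiv_coord: "pderiv i (\<lambda>x. x $ j) x = (if i = j then 1 else 0)"
  by (subst pderiv_eq[OF bounded_linear_imp_has_derivative[OF bounded_linear_vec_nth]]) (simp add: axis_def)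

lemma pderiv_comp:
  assumes "g differentiable (at x)" "(F has_real_derivative F') (at (g x))"
  shows "pderiv i (\<lambda>x. F (g x)) x = F' * pderiv i g x"
proof -
  have "((\<lambda>x. F (g x)) has_derivative (\<lambda>h. F' * (\<Sum>i\<in>UNIV. h $ i * pderiv i g x))) (at x)"
    using has_derivative_compose[OF pderiv_has_derivative[OF assms(1)] assms(2)[unfolded has_field_derivative_def]]
    by simp
  from pderiv_eq[OF this] show ?thesis
    by (simp add: sum_axis)
qed

lemma differentiable_comp:
  fixes g :: "real^3 \<Rightarrow> real"
  assumes "g differentiable (at x)" "(F has_real_derivative F') (at (g x))"
  shows "(\<lambda>x. F (g x) :: real) differentiable (at x)"
  using has_derivative_compose[OF pderiv_has_derivative[OF assms(1)] assms(2)[unfolded has_field_derivative_def]]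
  by (auto simp: differentiable_def)

lemma pderiv_affine:
  assumes "\<And>x. f differentiable (at x)"
  shows "pderiv i (\<lambda>x. f (a + c *\<^sub>R x)) x = c * pderiv i f (a + c *\<^sub>R x)"
proof -
  have "((\<lambda>x. f (a + c *\<^sub>R x)) has_derivative (\<lambda>h. \<Sum>i\<in>UNIV. (c *\<^sub>R h) $ i * pderiv i f (a + c *\<^sub>R x))) (at x)"
    by (rule has_derivative_compose[OF _ pderiv_has_derivative[OF assms], where f="\<lambda>x. a + c *\<^sub>R x" and f'="\<lambda>h. c *\<^sub>R h"])
       (auto intro!: derivative_eq_intros)
  from pderiv_eq[OF this] show ?thesis
    by (simp add: sum_axis mult.assoc sum_distrib_left[symmetric])
qed

lemma differentiable_affine:
  assumes "\<And>x. f differentiable (at x)"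
  shows "(\<lambda>x. f (a + c *\<^sub>R x :: real^3) :: real) differentiable (at x)"
  by (rule differentiable_compose[of f]) (auto intro!: assms derivative_intros)

lemma C_k_add: "C_k k f \<Longrightarrow> C_k k g \<Longrightarrow> C_k k (\<lambda>x. f x + g x)"
proof (induction k arbitrary: f g)
  case (Suc k)
  then have "pderiv i (\<lambda>x. f x + g x) = (\<lambda>x. pderiv i f x + pderiv i g x)" for i
    by (intro ext pderiv_add) auto
  then show ?case
    using Suc by (auto intro: derivative_intros)
qed (auto intro: continuous_intros)

lemma C_k_mult: "C_k k f \<Longrightarrow> C_k k g \<Longrightarrow> C_k k (\<lambda>x. f x * g x)"
proof (induction k arbitrary: f g)
  case (Suc k)
  then have "pderiv i (\<lambda>x. f x * g x) = (\<lambda>x. f x * pderiv i g x + pderiv i f x * g x)" for i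
    by (intro ext pderiv_mult) auto
  moreover have "C_k k f" "C_k k g"
    using Suc.prems C_k_Suc_imp by auto
  ultimately show ?case
    using Suc by (auto intro!: C_k_add derivative_intros)
qed (auto intro: continuous_intros)

lemma C_k_coord: "C_k k (\<lambda>x. x $ j)"
proof (cases k)
  case (Suc n)
  have "pderiv i (\<lambda>x. x $ j) = (\<lambda>x. if i = j then 1 else 0)" for i
    by (rule ext) (rule pderiv_coord)
  then show ?thesis
    using Suc by (auto intro!: C_k_const bounded_linear_imp_differentiable bounded_linear_vec_nth)
qed (auto intro: continuous_intros)

lemma C_k_affine: "C_k k f \<Longrightarrow> C_k k (\<lambda>x. f (a + c *\<^sub>R x))"
proof (induction k arbitrary: f)
  case 0
  then show ?case
    by (auto intro!: continuous_on_compose2[of UNIV f] continuous_intros)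
next
  case (Suc k)
  then have "pderiv i (\<lambda>x. f (a + c *\<^sub>R x)) = (\<lambda>x. c * pderiv i f (a + c *\<^sub>R x))" for i
    by (intro ext pderiv_affine) auto
  then show ?case
    using Suc by (auto intro!: C_k_mult C_k_const differentiable_affine)
qed

text \<open>The outer functions range over a family closed under differentiation on
  \<open>S\<close>, so the induction on \<open>k\<close> may replace \<open>F\<close> by its
  derivative without leaving the family. Working on \<open>S\<close>, which contains all values of
  \<open>g\<close>, admits outer functions that are smooth on part of the line only, such as
  powers.\<close>

lemma C_k_comp:
  assumes fam: "\<And>F. F \<in> \<F> \<Longrightarrow> \<exists>F'\<in>\<F>. \<forall>t\<in>S. (F has_real_derivative F' t) (at t)"
    and gS: "\<And>x. g x \<in> S" and "C_k k g" "F \<in> \<F>"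
  shows "C_k k (\<lambda>x. F (g x))"
  using assms(3,4)
proof (induction k arbitrary: F)
  case 0
  obtain F' where "\<And>t. t \<in> S \<Longrightarrow> (F has_real_derivative F' t) (at t)"
    using fam 0 by blast
  then have "continuous_on S F"
    by (meson DERIV_isCont continuous_at_imp_continuous_on)
  then show ?case
    using 0 gS by (auto intro!: continuous_on_compose2[of S F])
next
  case (Suc k)
  obtain F' where F': "F' \<in> \<F>" "\<And>t. t \<in> S \<Longrightarrow> (F has_real_derivative F' t) (at t)"
    using fam Suc by blast
  have "pderiv i (\<lambda>x. F (g x)) = (\<lambda>x. F' (g x) * pderiv i g x)" for i
    using Suc F' gS by (intro ext pderiv_comp) auto
  moreover have "C_k k g"
    using Suc.prems(1) by (rule C_k_Suc_imp)
  moreover have "C_k k (\<lambda>x. F' (g x))" "(\<lambda>x. F (g x)) differentiable (at x)" for x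
    using Suc.prems gS by (auto intro!: Suc.IH calculation F' intro: differentiable_comp)
  ultimately show ?case
    using Suc.prems(1) by (simp add: C_k_mult)
qed

lemma smooth_const: "smooth (\<lambda>x. c)"
  and smooth_coord: "smooth (\<lambda>x. x $ j)"
  and smooth_add: "smooth f \<Longrightarrow> smooth g \<Longrightarrow> smooth (\<lambda>x. f x + g x)"
  and smooth_mult: "smooth f \<Longrightarrow> smooth g \<Longrightarrow> smooth (\<lambda>x. f x * g x)"
  and smooth_affine: "smooth f \<Longrightarrow> smooth (\<lambda>x. f (a + c *\<^sub>R x))"
  by (simp_all add: smooth_def C_k_const C_k_coord C_k_add C_k_mult C_k_affine)

lemma smooth_diff: "smooth f \<Longrightarrow> smooth g \<Longrightarrow> smooth (\<lambda>x. f x - g x)"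
  using smooth_add[of f "\<lambda>x. (-1) * g x"] smooth_mult[OF smooth_const[of "-1"], of g] by simp

lemma smooth_translate: "smooth f \<Longrightarrow> smooth (\<lambda>y. f (y - x))"
  using smooth_affine[of f "-x" 1] by simp

lemma smooth_sum: "(\<And>i. i \<in> A \<Longrightarrow> smooth (f i)) \<Longrightarrow> smooth (\<lambda>x. \<Sum>i\<in>A. f i x)"
  by (induction A rule: infinite_finite_induct) (auto intro: smooth_const smooth_add)

lemma smooth_norm_sq: "smooth (\<lambda>x. (norm x)\<^sup>2)"
proof -
  have "(\<lambda>x::real^3. (norm x)\<^sup>2) = (\<lambda>x. \<Sum>i\<in>UNIV. x $ i * x $ i)"
    by (auto simp: fun_eq_iff dot_square_norm[symmetric] inner_vec_def)
  then show ?thesis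
    by (auto intro!: smooth_sum smooth_mult smooth_coord)
qed

lemma smooth_comp:
  assumes "\<And>F. F \<in> \<F> \<Longrightarrow> \<exists>F'\<in>\<F>. \<forall>t\<in>S. (F has_real_derivative F' t) (at t)"
    and "\<And>x. g x \<in> S" "smooth g" "F \<in> \<F>"
  shows "smooth (\<lambda>x. F (g x))"
  using C_k_comp[of \<F> S g] assms unfolding smooth_def by blast

lemma smooth_powr:
  assumes "smooth g" "\<And>x. g x > 0"
  shows "smooth (\<lambda>x. g x powr a)"
proof (rule smooth_comp[where \<F>="{\<lambda>t. c * t powr a |c a. True}" and S="{0<..}"
      and g=g and F="\<lambda>t. t powr a"])
  fix F assume "F \<in> {\<lambda>t::real. c * t powr a |c a. True}"
  then obtain c a where F: "F = (\<lambda>t. c * t powr a)" by blast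
  have "\<forall>t\<in>{0<..}. (F has_real_derivative (c * a) * t powr (a - 1)) (at t)"
    unfolding F by (auto intro!: derivative_eq_intros)
  then show "\<exists>F'\<in>{\<lambda>t. c * t powr a |c a. True}. \<forall>t\<in>{0<..}. (F has_real_derivative F' t) (at t)"
    by (intro bexI[of _ "\<lambda>t. (c * a) * t powr (a - 1)"]) auto
next
  show "(\<lambda>t. t powr a) \<in> {\<lambda>t. c * t powr a |c a. True}"
    by (intro CollectI exI[of _ 1] exI[of _ a]) auto
qed (use assms in auto)

lemma smooth_pderiv: "smooth f \<Longrightarrow> smooth (pderiv i f)"
  unfolding smooth_def by (metis C_k.simps(2))

lemma smooth_differentiable: "smooth f \<Longrightarrow> f differentiable (at x)"
  unfolding smooth_def by (metis C_k.simps(2))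

lemma smooth_continuous: "smooth f \<Longrightarrow> continuous_on UNIV f"
  unfolding smooth_def by (metis C_k.simps(1))

lemma smooth_borel [measurable]: "smooth f \<Longrightarrow> f \<in> borel_measurable borel"
  using smooth_continuous borel_measurable_continuous_onI by blast

lemma smooth_isCont: "smooth f \<Longrightarrow> isCont f x"
  using smooth_continuous continuous_on_eq_continuous_at open_UNIV by blast

text \<open>\<open>exp_cutoff [:1:]\<close> is the flat function \<open>exp (-1/t)\<close>; polynomials in \<open>1/t\<close> as prefactors make the
  family closed under differentiation.\<close>

definition exp_cutoff :: "real poly \<Rightarrow> real \<Rightarrow> real" where
  "exp_cutoff p t = (if t > 0 then poly p (1/t) * exp (- (1/t)) else 0)"

lemma poly_exp_tendsto_0: "((\<lambda>x. poly p x * exp (- x)) \<longlongrightarrow> 0) (at_top :: real filter)"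
proof -
  have "((\<lambda>x. \<Sum>i\<le>degree p. coeff p i * (x ^ i / exp x)) \<longlongrightarrow> (\<Sum>i\<le>degree p. coeff p i * 0)) at_top"
    by (intro tendsto_intros tendsto_power_div_exp_0)
  then show ?thesis
    by (simp add: poly_altdef sum_distrib_right exp_minus divide_inverse mult.assoc)
qed

text \<open>For t > 0 the derivative of p(1/t) exp(-1/t) is t^(-2) (p - p')(1/t) exp(-1/t), and
  t^(-2) is \<open>monom 1 2\<close> at 1/t. At t = 0 the difference quotient from the right is the
  same kind of function with \<open>pCons 0 p\<close> in place of \<open>p\<close>, so the
  exponential wins; from the left it is identically 0.\<close>

lemma exp_cutoff_deriv:
  "(exp_cutoff p has_real_derivative exp_cutoff (monom 1 2 * (p - Polynomial.pderiv p)) t) (at t)"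
proof -
  consider "t > 0" | "t < 0" | "t = 0" by linarith
  then show ?thesis
  proof cases
    case 1
    have "((\<lambda>t. poly p (1/t) * exp (- (1/t))) has_real_derivative
        exp_cutoff (monom 1 2 * (p - Polynomial.pderiv p)) t) (at t)"
      using 1 by (auto intro!: derivative_eq_intros DERIV_chain2[OF poly_DERIV]
          simp: exp_cutoff_def poly_monom field_simps power2_eq_square)
    then show ?thesis
      by (rule DERIV_cong_ev[THEN iffD1, rotated -1])
         (use 1 in \<open>auto intro!: eventually_mono[OF eventually_nhds_in_open[of "{0<..}"]] simp: exp_cutoff_def\<close>)
  next
    case 2
    have "((\<lambda>t. 0) has_real_derivative 0) (at t)" by simp
    then have "(exp_cutoff p has_real_derivative 0) (at t)"
      by (rule DERIV_cong_ev[THEN iffD1, rotated -1])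
         (use 2 in \<open>auto intro!: eventually_mono[OF eventually_nhds_in_open[of "{..<0}"]] simp: exp_cutoff_def\<close>)
    then show ?thesis using 2 by (simp add: exp_cutoff_def)
  next
    case 3
    have "((\<lambda>h. exp_cutoff p h / h) \<longlongrightarrow> 0) (at 0)"
    proof (rule filterlim_split_at_real)
      show "((\<lambda>h. exp_cutoff p h / h) \<longlongrightarrow> 0) (at_left 0)"
        by (rule tendsto_eventually) (auto simp: eventually_at_filter exp_cutoff_def)
      have "((\<lambda>x. poly (pCons 0 p) (inverse x) * exp (- inverse x)) \<longlongrightarrow> 0) (at_right 0)"
        by (rule filterlim_compose[OF poly_exp_tendsto_0 filterlim_inverse_at_top_right])
      then show "((\<lambda>h. exp_cutoff p h / h) \<longlongrightarrow> 0) (at_right 0)"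
        by (rule Lim_transform_eventually) (auto simp: eventually_at_filter exp_cutoff_def field_simps)
    qed
    then show ?thesis
      using 3 by (simp add: has_field_derivative_iff exp_cutoff_def)
  qed
qed

lemma smooth_exp_cutoff: "smooth g \<Longrightarrow> smooth (\<lambda>x. exp_cutoff p (g x))"
  by (rule smooth_comp[where \<F>="range exp_cutoff" and S=UNIV]) (auto intro: exp_cutoff_deriv)

lemma exp_cutoff_one: "exp_cutoff 1 t \<ge> 0" "exp_cutoff 1 t > 0 \<longleftrightarrow> t > 0"
  by (auto simp: exp_cutoff_def)

section \<open>Test functions and their supports\<close>

lemma test_functionsI:
  assumes "smooth f" "bounded K" "closed K" "K \<subseteq> \<Omega>" "\<And>x. x \<notin> K \<Longrightarrow> f x = 0"
  shows "f \<in> test_functions \<Omega>"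
proof -
  have "closure {x. f x \<noteq> 0} \<subseteq> K"
    using assms by (intro closure_minimal) auto
  moreover have "compact (closure {x. f x \<noteq> 0})"
    using calculation assms(2) by (simp add: bounded_subset compact_eq_bounded_closed)
  ultimately show ?thesis
    using assms unfolding test_functions_def smooth_def by auto
qed

lemma test_smooth: "f \<in> test_functions \<Omega> \<Longrightarrow> smooth f"
  by (simp add: test_functions_def smooth_def)

lemma test_support:
  assumes "f \<in> test_functions \<Omega>"
  obtains K where "compact K" "K \<subseteq> \<Omega>" "\<And>x. x \<notin> K \<Longrightarrow> f x = 0" "\<And>x i. x \<notin> K \<Longrightarrow> pderiv i f x = 0"
proof
  let ?K = "closure {x. f x \<noteq> 0}"
  show "compact ?K" "?K \<subseteq> \<Omega>"
    using assms by (auto simp: test_functions_def)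
  show f0: "f x = 0" if "x \<notin> ?K" for x
    using that closure_subset[of "{x. f x \<noteq> 0}"] by blast
  show "pderiv i f x = 0" if "x \<notin> ?K" for x i
  proof -
    have "(f has_derivative (\<lambda>h. 0)) (at x)"
    proof (rule has_derivative_transform_within_open[OF has_derivative_const[of 0]])
      show "open (- ?K)" by (rule open_Compl) (rule closed_closure)
    qed (use f0 that in \<open>simp_all only: Compl_iff simp_thms\<close>)
    then show ?thesis by (simp add: pderiv_eq)
  qed
qed

lemma test_pderiv: "f \<in> test_functions \<Omega> \<Longrightarrow> pderiv i f \<in> test_functions \<Omega>"
proof -
  assume f: "f \<in> test_functions \<Omega>"
  obtain K where "compact K" "K \<subseteq> \<Omega>" "\<And>x. x \<notin> K \<Longrightarrow> pderiv i f x = 0"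
    by (metis f test_support)
  then show ?thesis
    by (intro test_functionsI[of _ K] smooth_pderiv test_smooth[OF f]) (auto simp: compact_imp_bounded compact_imp_closed)
qed

lemma test_mult_smooth: 
  assumes "f \<in> test_functions \<Omega>" "smooth g" shows "(\<lambda>x. f x * g x) \<in> test_functions \<Omega>"
proof -
  obtain K where "compact K" "K \<subseteq> \<Omega>" "\<And>x. x \<notin> K \<Longrightarrow> f x = 0"
    by (metis assms(1) test_support)
  then show ?thesis
    by (intro test_functionsI[of _ K] smooth_mult[OF test_smooth[OF assms(1)] assms(2)])
       (simp_all add: compact_imp_bounded compact_imp_closed)
qed

lemma test_mono: "f \<in> test_functions A \<Longrightarrow> A \<subseteq> B \<Longrightarrow> f \<in> test_functions B"
  by (auto simp: test_functions_def)

lemma test_add: 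
  assumes "f \<in> test_functions \<Omega>" "g \<in> test_functions \<Omega>" shows "(\<lambda>x. f x + g x) \<in> test_functions \<Omega>"
proof -
  obtain K where "compact K" "K \<subseteq> \<Omega>" "\<And>x. x \<notin> K \<Longrightarrow> f x = 0"
    by (metis assms(1) test_support)
  moreover obtain L where "compact L" "L \<subseteq> \<Omega>" "\<And>x. x \<notin> L \<Longrightarrow> g x = 0"
    by (metis assms(2) test_support)
  ultimately show ?thesis
    using assms
    by (intro test_functionsI[of _ "K \<union> L"] smooth_add[OF test_smooth[OF assms(1)] test_smooth[OF assms(2)]])
       (simp_all add: compact_imp_bounded compact_imp_closed closed_Un)
qed

lemma test_translate:
  assumes "f \<in> test_functions UNIV" shows "(\<lambda>y. f (y - x)) \<in> test_functions UNIV"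
proof -
  obtain K where K: "compact K" "\<And>x. x \<notin> K \<Longrightarrow> f x = 0"
    by (metis assms test_support)
  have "compact ((+) x ` K)"
    using K compact_translation by blast
  moreover have "f (y - x) = 0" if "y \<notin> (+) x ` K" for y
  proof (rule K(2))
    show "y - x \<notin> K"
      using that by (metis add_diff_cancel_left' diff_add_cancel add.commute image_eqI)
  qed
  ultimately show ?thesis
    by (intro test_functionsI[of _ "(+) x ` K"] smooth_translate test_smooth[OF assms])
       (auto simp: compact_imp_bounded compact_imp_closed)
qed

lemma test_bounded:
  assumes "f \<in> test_functions \<Omega>"
  obtains M where "M > 0" "\<And>x. \<bar>f x\<bar> \<le> M"
proof -
  obtain K where K: "compact K" "\<And>x. x \<notin> K \<Longrightarrow> f x = 0"
    by (metis assms test_support)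
  have "compact (f ` K)"
    by (intro compact_continuous_image K continuous_on_subset[OF smooth_continuous[OF test_smooth[OF assms]]]) auto
  then obtain M where "M > 0" "\<forall>y\<in>f ` K. norm y \<le> M"
    using bounded_pos compact_imp_bounded by metis
  have "\<bar>f x\<bar> \<le> M" for x
    using \<open>M > 0\<close> \<open>\<forall>y\<in>f ` K. norm y \<le> M\<close> K(2)[of x] by (cases "x \<in> K") auto
  then show ?thesis
    using \<open>M > 0\<close> that by blast
qed

section \<open>A bump on the unit ball and a plateau function\<close>

definition bump :: "real^3 \<Rightarrow> real" where
  "bump x = exp_cutoff 1 (1 - (norm x)\<^sup>2)"

lemma smooth_bump: "smooth bump"
  unfolding bump_def by (intro smooth_exp_cutoff smooth_diff smooth_const smooth_norm_sq)

lemma bump_nonneg: "bump x \<ge> 0"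
  by (simp add: bump_def exp_cutoff_one)

lemma bump_pos: "bump x > 0 \<longleftrightarrow> norm x < 1"
  by (simp add: bump_def exp_cutoff_one abs_square_less_1)

lemma bump_zero: "norm x \<ge> 1 \<Longrightarrow> bump x = 0"
  using bump_pos bump_nonneg by (metis linorder_not_less order_antisym)

text \<open>The quotient a / (a + b), with a positive exactly for |x| < 2 and b positive exactly for
  |x| > 1. These two regions cover the space, so the denominator never vanishes. The reciprocal is
  written as the power -1 to fit \<open>smooth_powr\<close>.\<close>

definition cutoff :: "real^3 \<Rightarrow> real" where
  "cutoff x = exp_cutoff 1 (4 - (norm x)\<^sup>2) *
     (exp_cutoff 1 (4 - (norm x)\<^sup>2) + exp_cutoff 1 ((norm x)\<^sup>2 - 1)) powr (- 1)"

lemma cutoff_denom: "exp_cutoff 1 (4 - (norm x)\<^sup>2) + exp_cutoff 1 ((norm x)\<^sup>2 - 1) > 0"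
proof (cases "(norm x)\<^sup>2 < 4")
  case True
  then show ?thesis by (intro add_pos_nonneg) (auto simp: exp_cutoff_one)
next
  case False
  then show ?thesis by (intro add_nonneg_pos) (auto simp: exp_cutoff_one)
qed

lemma smooth_cutoff: "smooth cutoff"
  unfolding cutoff_def
  by (intro smooth_mult smooth_powr smooth_add smooth_exp_cutoff smooth_diff smooth_const smooth_norm_sq cutoff_denom)

lemma cutoff_bounds: "0 \<le> cutoff x" "cutoff x \<le> 1"
  using cutoff_denom[of x] exp_cutoff_one(1)
  by (auto simp: cutoff_def powr_minus field_simps)

lemma cutoff_one: "norm x \<le> 1 \<Longrightarrow> cutoff x = 1"
proof -
  assume "norm x \<le> 1"
  then have "(norm x)\<^sup>2 \<le> 1" by (simp add: power_le_one)
  then have "exp_cutoff 1 ((norm x)\<^sup>2 - 1) = 0" by (simp add: exp_cutoff_def)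
  then show ?thesis
    using cutoff_denom[of x] by (auto simp: cutoff_def powr_minus)
qed

lemma cutoff_zero: "norm x \<ge> 2 \<Longrightarrow> cutoff x = 0"
proof -
  assume "norm x \<ge> 2"
  then have "(norm x)\<^sup>2 \<ge> 2\<^sup>2" by (intro power_mono) auto
  then show ?thesis by (simp add: cutoff_def exp_cutoff_def)
qed

lemma test_bump: "bump \<in> test_functions UNIV"
  by (rule test_functionsI[of _ "cball 0 1"]) (auto simp: smooth_bump bump_zero)

lemma test_cutoff: "cutoff \<in> test_functions UNIV"
  by (rule test_functionsI[of _ "cball 0 2"]) (auto simp: smooth_cutoff cutoff_zero)

section \<open>Square integrable functions\<close>

text \<open>The measure is a parameter because the same estimates serve \<open>lborel\<close>, on
  which convolutions live, and \<open>lebesgue_on \<Omega>\<close>, on which the Sobolev spaces are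
  defined.\<close>

definition sq_int :: "'a measure \<Rightarrow> ('a \<Rightarrow> real) set" where
  "sq_int M = {u \<in> borel_measurable M. integrable M (\<lambda>x. (u x)\<^sup>2)}"

definition l2n :: "'a measure \<Rightarrow> ('a \<Rightarrow> real) \<Rightarrow> real" where
  "l2n M u = sqrt (\<integral>x. (u x)\<^sup>2 \<partial>M)"

lemma sq_int_meas [measurable_dest]: "u \<in> sq_int M \<Longrightarrow> u \<in> borel_measurable M"
  and sq_int_sq: "u \<in> sq_int M \<Longrightarrow> integrable M (\<lambda>x. (u x)\<^sup>2)"
  by (auto simp: sq_int_def)

lemma l2n_nonneg [simp]: "0 \<le> l2n M u"
  by (simp add: l2n_def)

lemma l2n_sq: "(l2n M u)\<^sup>2 = (\<integral>x. (u x)\<^sup>2 \<partial>M)"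
  by (simp add: l2n_def)

lemma l2n_zero [simp]: "l2n M (\<lambda>x. 0) = 0"
  by (simp add: l2n_def)

lemma sq_int_bound:
  assumes "u \<in> sq_int M" "v \<in> borel_measurable M" "AE x in M. \<bar>v x\<bar> \<le> c * \<bar>u x\<bar>"
  shows "v \<in> sq_int M"
proof -
  have "AE x in M. norm ((v x)\<^sup>2) \<le> norm (c\<^sup>2 * (u x)\<^sup>2)"
    using assms(3)
  proof eventually_elim
    case (elim x)
    then have "\<bar>v x\<bar>\<^sup>2 \<le> (c * \<bar>u x\<bar>)\<^sup>2"
      by (intro power_mono) auto
    then show ?case by (simp add: power_mult_distrib)
  qed
  then have "integrable M (\<lambda>x. (v x)\<^sup>2)"
    by (rule Bochner_Integration.integrable_bound[OF integrable_mult_right[OF sq_int_sq[OF assms(1)]], rotated])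
       (intro borel_measurable_power assms)
  then show ?thesis
    using assms by (simp add: sq_int_def)
qed

lemma sq_int_mult:
  assumes "u \<in> sq_int M" "v \<in> sq_int M"
  shows "integrable M (\<lambda>x. u x * v x)"
proof (rule Bochner_Integration.integrable_bound[of M "\<lambda>x. (u x)\<^sup>2 + (v x)\<^sup>2"])
  have "\<bar>u x * v x\<bar> \<le> (u x)\<^sup>2 + (v x)\<^sup>2" for x
  proof -
    have "0 \<le> (\<bar>u x\<bar> - \<bar>v x\<bar>)\<^sup>2 + (u x)\<^sup>2 + (v x)\<^sup>2" by simp
    then have "2 * (\<bar>u x\<bar> * \<bar>v x\<bar>) \<le> 2 * ((u x)\<^sup>2 + (v x)\<^sup>2)" by (simp add: power2_diff)
    then show ?thesis by (simp add: abs_mult)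
  qed
  then show "AE x in M. norm (u x * v x) \<le> norm ((u x)\<^sup>2 + (v x)\<^sup>2)"
    by simp
  show "integrable M (\<lambda>x. (u x)\<^sup>2 + (v x)\<^sup>2)"
    by (intro Bochner_Integration.integrable_add sq_int_sq assms)
  show "(\<lambda>x. u x * v x) \<in> borel_measurable M"
    by (intro borel_measurable_times sq_int_meas assms)
qed

lemma sq_int_cmult: "u \<in> sq_int M \<Longrightarrow> (\<lambda>x. c * u x) \<in> sq_int M"
  by (rule sq_int_bound[of u M _ "\<bar>c\<bar>"]) (auto simp: abs_mult dest: sq_int_meas)

lemma sq_int_add:
  assumes "u \<in> sq_int M" "v \<in> sq_int M"
  shows "(\<lambda>x. u x + v x) \<in> sq_int M"
proof -
  have "integrable M (\<lambda>x. (u x)\<^sup>2 + (v x)\<^sup>2 + 2 * (u x * v x))"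
    by (intro Bochner_Integration.integrable_add integrable_mult_right sq_int_sq sq_int_mult assms)
  also have "(\<lambda>x. (u x)\<^sup>2 + (v x)\<^sup>2 + 2 * (u x * v x)) = (\<lambda>x. (u x + v x)\<^sup>2)"
    by (simp add: power2_sum mult.assoc)
  finally show ?thesis
    using borel_measurable_add[OF sq_int_meas[OF assms(1)] sq_int_meas[OF assms(2)]]
    unfolding sq_int_def by blast
qed

lemma sq_int_diff: "u \<in> sq_int M \<Longrightarrow> v \<in> sq_int M \<Longrightarrow> (\<lambda>x. u x - v x) \<in> sq_int M"
  using sq_int_add[of u M "\<lambda>x. (-1) * v x"] sq_int_cmult[of v M "-1"] by simp

lemma sq_int_zero: "(\<lambda>x. 0) \<in> sq_int M"
  by (simp add: sq_int_def)

lemma sq_int_sum: "(\<And>i. i \<in> A \<Longrightarrow> f i \<in> sq_int M) \<Longrightarrow> (\<lambda>x. \<Sum>i\<in>A. f i x) \<in> sq_int M"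
  by (induction A rule: infinite_finite_induct) (auto intro: sq_int_add sq_int_zero)

lemma sq_int_abs: "u \<in> sq_int M \<Longrightarrow> (\<lambda>x. \<bar>u x\<bar>) \<in> sq_int M"
  by (rule sq_int_bound[of u M _ 1]) (auto dest: sq_int_meas)

lemma sq_int_bounded_mult:
  assumes "u \<in> sq_int M" "v \<in> borel_measurable M" "\<And>x. \<bar>v x\<bar> \<le> c"
  shows "(\<lambda>x. v x * u x) \<in> sq_int M"
  by (rule sq_int_bound[of u M _ c]) (use assms in \<open>auto simp: abs_mult mult_right_mono dest: sq_int_meas\<close>)

lemma sq_int_cong_AE:
  assumes "u \<in> sq_int M" "v \<in> borel_measurable M" "AE x in M. u x = v x"
  shows "v \<in> sq_int M"
  by (rule sq_int_bound[of u M _ 1]) (use assms in auto)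

lemma l2n_cong_AE:
  assumes "u \<in> borel_measurable M" "v \<in> borel_measurable M" "AE x in M. u x = v x"
  shows "l2n M u = l2n M v"
  unfolding l2n_def by (rule arg_cong[of _ _ sqrt], rule integral_cong_AE) (use assms in auto)

lemma l2n_mono:
  assumes "v \<in> sq_int M" "AE x in M. \<bar>u x\<bar> \<le> \<bar>v x\<bar>"
  shows "l2n M u \<le> l2n M v"
  unfolding l2n_def real_sqrt_le_iff
proof (rule integral_mono_AE')
  show "AE x in M. (u x)\<^sup>2 \<le> (v x)\<^sup>2"
    using assms(2) by eventually_elim (simp add: abs_le_square_iff)
qed (use assms sq_int_sq in auto)

lemma l2n_cmult: "l2n M (\<lambda>x. c * u x) = \<bar>c\<bar> * l2n M u"
  by (simp add: l2n_def power_mult_distrib real_sqrt_mult)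

lemma l2n_abs: "l2n M (\<lambda>x. \<bar>u x\<bar>) = l2n M u"
  by (simp add: l2n_def)

lemma l2n_commute: "l2n M (\<lambda>x. u x - v x) = l2n M (\<lambda>x. v x - u x)"
  by (simp add: l2n_def power2_commute)

lemma CS_ineq:
  assumes "u \<in> sq_int M" "v \<in> sq_int M"
  shows "\<bar>\<integral>x. u x * v x \<partial>M\<bar> \<le> l2n M u * l2n M v"
proof -
  define A B C where "A = (\<integral>x. (u x)\<^sup>2 \<partial>M)" and "B = (\<integral>x. u x * v x \<partial>M)" and "C = (\<integral>x. (v x)\<^sup>2 \<partial>M)"
  \<comment> \<open>The nonnegative quadratic in t is used at its minimiser -B/A. If A = 0 and B
    were nonzero, t = -(C + 1)/(2B) would give it the value -1.\<close>
  have q: "0 \<le> t\<^sup>2 * A + 2 * t * B + C" for t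
  proof -
    have "0 \<le> (\<integral>x. (t * u x + v x)\<^sup>2 \<partial>M)" by simp
    also have "\<dots> = (\<integral>x. t\<^sup>2 * (u x)\<^sup>2 + 2 * t * (u x * v x) + (v x)\<^sup>2 \<partial>M)"
      by (rule Bochner_Integration.integral_cong) (auto simp: power2_eq_square algebra_simps)
    also have "\<dots> = t\<^sup>2 * A + 2 * t * B + C"
      using sq_int_sq[OF assms(1)] sq_int_sq[OF assms(2)] sq_int_mult[OF assms]
      by (simp add: A_def B_def C_def)
    finally show ?thesis .
  qed
  have "B\<^sup>2 \<le> A * C"
  proof (cases "A = 0")
    case True
    have "B = 0"
    proof (rule ccontr)
      assume "B \<noteq> 0"
      then show False using q[of "- (C + 1) / (2 * B)"] True by (simp add: field_simps)
    qed
    then show ?thesis using True by simp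
  next
    case False
    then have "A > 0" unfolding A_def by (metis integral_nonneg_AE AE_I2 less_eq_real_def zero_le_power2)
    then show ?thesis using q[of "- B / A"] by (simp add: field_simps power2_eq_square)
  qed
  then have "sqrt (B\<^sup>2) \<le> sqrt (A * C)" by (rule real_sqrt_le_mono)
  then have "\<bar>B\<bar> \<le> sqrt A * sqrt C" by (simp only: real_sqrt_abs real_sqrt_mult)
  then show ?thesis by (simp add: A_def B_def C_def l2n_def)
qed

lemma l2n_triangle:
  assumes "u \<in> sq_int M" "v \<in> sq_int M"
  shows "l2n M (\<lambda>x. u x + v x) \<le> l2n M u + l2n M v"
proof -
  have "(l2n M (\<lambda>x. u x + v x))\<^sup>2 = (\<integral>x. (u x)\<^sup>2 + 2 * (u x * v x) + (v x)\<^sup>2 \<partial>M)"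
    unfolding l2n_sq by (rule Bochner_Integration.integral_cong) (auto simp: power2_eq_square algebra_simps)
  also have "\<dots> = (l2n M u)\<^sup>2 + 2 * (\<integral>x. u x * v x \<partial>M) + (l2n M v)\<^sup>2"
    using sq_int_sq[OF assms(1)] sq_int_sq[OF assms(2)] sq_int_mult[OF assms] by (simp add: l2n_sq)
  also have "\<dots> \<le> (l2n M u + l2n M v)\<^sup>2"
    using CS_ineq[OF assms] by (simp add: power2_sum)
  finally show ?thesis
    by (rule power2_le_imp_le) simp
qed

lemma l2n_triangle_diff:
  assumes "u \<in> sq_int M" "v \<in> sq_int M"
  shows "l2n M (\<lambda>x. u x - v x) \<le> l2n M u + l2n M v"
  using l2n_triangle[OF assms(1) sq_int_cmult[OF assms(2), of "-1"]] l2n_cmult[of M "-1" v] by simp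

lemma l2n_triangle3:
  assumes "u \<in> sq_int M" "v \<in> sq_int M" "w \<in> sq_int M"
  shows "l2n M (\<lambda>x. u x - w x) \<le> l2n M (\<lambda>x. u x - v x) + l2n M (\<lambda>x. v x - w x)"
  using l2n_triangle[OF sq_int_diff[OF assms(1,2)] sq_int_diff[OF assms(2,3)]] by simp

lemma l2n_sum:
  assumes "\<And>i. i \<in> A \<Longrightarrow> f i \<in> sq_int M"
  shows "l2n M (\<lambda>x. \<Sum>i\<in>A. f i x) \<le> (\<Sum>i\<in>A. l2n M (f i))"
  using assms
proof (induction A rule: infinite_finite_induct)
  case (insert i A)
  then show ?case
    using l2n_triangle[of "f i" M "\<lambda>x. \<Sum>i\<in>A. f i x"] sq_int_sum[of A f M] by fastforce
qed auto

lemma l2n_eq_0: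
  assumes "u \<in> sq_int M" "l2n M u = 0"
  shows "AE x in M. u x = 0"
proof -
  have "(\<integral>x. (u x)\<^sup>2 \<partial>M) = 0"
    using assms by (simp add: l2n_def)
  then show ?thesis
    using integral_nonneg_eq_0_iff_AE[of M "\<lambda>x. (u x)\<^sup>2"] sq_int_sq[OF assms(1)] by simp
qed

lemma tendsto_integral_l2n:
  assumes f: "\<And>n. f n \<in> sq_int M" "g \<in> sq_int M" "h \<in> sq_int M"
    and lim: "(\<lambda>n. l2n M (\<lambda>x. f n x - g x)) \<longlonglongrightarrow> 0"
  shows "(\<lambda>n. \<integral>x. f n x * h x \<partial>M) \<longlonglongrightarrow> (\<integral>x. g x * h x \<partial>M)"
proof (rule LIM_zero_cancel, rule Lim_null_comparison)
  have "(\<integral>x. f n x * h x \<partial>M) - (\<integral>x. g x * h x \<partial>M) = (\<integral>x. (f n x - g x) * h x \<partial>M)" for n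
    using sq_int_mult[OF f(1,3)] sq_int_mult[OF f(2,3)]
    by (simp add: left_diff_distrib Bochner_Integration.integral_diff)
  then show "\<forall>\<^sub>F n in sequentially. norm ((\<integral>x. f n x * h x \<partial>M) - (\<integral>x. g x * h x \<partial>M)) \<le> l2n M (\<lambda>x. f n x - g x) * l2n M h"
    using CS_ineq[OF sq_int_diff[OF f(1,2)] f(3)] by simp
  show "(\<lambda>n. l2n M (\<lambda>x. f n x - g x) * l2n M h) \<longlonglongrightarrow> 0"
    using tendsto_mult_left_zero[OF lim] by simp
qed

section \<open>Fatou's lemma and completeness of L^2\<close>

lemma nn_integral_sq_int:
  assumes "u \<in> sq_int M"
  shows "(\<integral>\<^sup>+x. ennreal ((u x)\<^sup>2) \<partial>M) = ennreal ((l2n M u)\<^sup>2)"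
  by (simp add: l2n_sq nn_integral_eq_integral sq_int_sq[OF assms])

lemma sq_intI_nn:
  assumes "u \<in> borel_measurable M" "(\<integral>\<^sup>+x. ennreal ((u x)\<^sup>2) \<partial>M) \<le> ennreal (B\<^sup>2)" "B \<ge> 0"
  shows "u \<in> sq_int M" "l2n M u \<le> B"
proof -
  have "integrable M (\<lambda>x. (u x)\<^sup>2)"
    using assms(1) le_less_trans[OF assms(2) ennreal_less_top]
    by (intro integrableI_bounded) auto
  then show u: "u \<in> sq_int M"
    using assms by (simp add: sq_int_def)
  have "ennreal ((l2n M u)\<^sup>2) \<le> ennreal (B\<^sup>2)"
    using nn_integral_sq_int[OF u] assms by simp
  then have "(l2n M u)\<^sup>2 \<le> B\<^sup>2" by simp
  then show "l2n M u \<le> B"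
    using assms(3) power2_le_imp_le by blast
qed

lemma sq_int_fatou:
  assumes f: "\<And>n. f n \<in> sq_int M" and B: "\<And>n. l2n M (f n) \<le> B" and g: "g \<in> borel_measurable M"
    and lim: "AE x in M. (\<lambda>n. f n x) \<longlonglongrightarrow> g x"
  shows "g \<in> sq_int M" "l2n M g \<le> B"
proof -
  have B0: "B \<ge> 0" using B[of 0] l2n_nonneg order_trans by blast
  have "(\<integral>\<^sup>+x. ennreal ((g x)\<^sup>2) \<partial>M) = (\<integral>\<^sup>+x. liminf (\<lambda>n. ennreal ((f n x)\<^sup>2)) \<partial>M)"
  proof (rule nn_integral_cong_AE)
    show "AE x in M. ennreal ((g x)\<^sup>2) = liminf (\<lambda>n. ennreal ((f n x)\<^sup>2))"
      using lim
    proof eventually_elim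
      case (elim x)
      then have "(\<lambda>n. ennreal ((f n x)\<^sup>2)) \<longlonglongrightarrow> ennreal ((g x)\<^sup>2)"
        by (intro tendsto_intros) auto
      then show ?case
        by (metis lim_imp_Liminf trivial_limit_sequentially)
    qed
  qed
  also have "\<dots> \<le> liminf (\<lambda>n. \<integral>\<^sup>+x. ennreal ((f n x)\<^sup>2) \<partial>M)"
    by (intro nn_integral_liminf measurable_compose[OF borel_measurable_power[OF sq_int_meas[OF f]] measurable_ennreal])
  also have "\<dots> \<le> ennreal (B\<^sup>2)"
  proof (rule Liminf_le[OF trivial_limit_sequentially], rule always_eventually, rule allI)
    fix n show "(\<integral>\<^sup>+x. ennreal ((f n x)\<^sup>2) \<partial>M) \<le> ennreal (B\<^sup>2)"
      using B by (simp add: nn_integral_sq_int[OF f] power_mono)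
  qed
  finally show "g \<in> sq_int M" "l2n M g \<le> B"
    using sq_intI_nn[OF g _ B0] by blast+
qed

text \<open>The partial sums of the absolute values increase and their norms stay below the sum of
  the norms. By monotone convergence the supremum of their squares is integrable, hence finite
  almost everywhere.\<close>

lemma sq_int_abs_summable:
  assumes f: "\<And>n. f n \<in> sq_int M" and s: "summable (\<lambda>n. l2n M (f n))"
  shows "AE x in M. summable (\<lambda>n. \<bar>f n x\<bar>)"
proof -
  define T where "T m x = (\<Sum>k<m. \<bar>f k x\<bar>)" for m x
  define B where "B = (\<Sum>n. l2n M (f n))"
  have T: "T m \<in> sq_int M" for m
    unfolding T_def by (intro sq_int_sum sq_int_abs f)
  have TB: "l2n M (T m) \<le> B" for m
  proof -
    have "l2n M (T m) \<le> (\<Sum>k<m. l2n M (\<lambda>x. \<bar>f k x\<bar>))"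
      unfolding T_def by (intro l2n_sum sq_int_abs f)
    also have "\<dots> \<le> B"
      unfolding B_def l2n_abs by (intro sum_le_suminf s) auto
    finally show ?thesis .
  qed
  have B0: "B \<ge> 0" using TB[of 0] l2n_nonneg order_trans by blast
  have mono: "T m x \<le> T n x" if "m \<le> n" for m n x
    unfolding T_def using that by (intro sum_mono2) auto
  have [measurable]: "T m \<in> borel_measurable M" for m
    using T sq_int_meas by blast
  have T0: "T m x \<ge> 0" for m x unfolding T_def by (auto intro: sum_nonneg)
  have "(\<integral>\<^sup>+x. (SUP m. ennreal ((T m x)\<^sup>2)) \<partial>M) = (SUP m. \<integral>\<^sup>+x. ennreal ((T m x)\<^sup>2) \<partial>M)"
    by (rule nn_integral_monotone_convergence_SUP)
       (auto simp: incseq_def le_fun_def intro!: ennreal_leI power_mono mono T0)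
  also have "\<dots> \<le> ennreal (B\<^sup>2)"
    by (intro SUP_least) (simp add: nn_integral_sq_int[OF T] power_mono TB)
  finally have "(\<integral>\<^sup>+x. (SUP m. ennreal ((T m x)\<^sup>2)) \<partial>M) \<noteq> \<infinity>"
    by (auto simp: top_unique)
  then have "AE x in M. (SUP m. ennreal ((T m x)\<^sup>2)) \<noteq> \<infinity>"
    by (intro nn_integral_PInf_AE) auto
  then show ?thesis
  proof eventually_elim
    case (elim x)
    then obtain c where c: "(SUP m. ennreal ((T m x)\<^sup>2)) = ennreal c" "c \<ge> 0"
      by (cases "SUP m. ennreal ((T m x)\<^sup>2)") auto
    have "T m x \<le> c + 1" for m
    proof -
      have "ennreal ((T m x)\<^sup>2) \<le> ennreal c"
        unfolding c(1)[symmetric] by (rule SUP_upper) simp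
      then have "(T m x)\<^sup>2 \<le> c" using c(2) by simp
      also have "c \<le> (c + 1)\<^sup>2" using c(2) by (simp add: power2_eq_square algebra_simps)
      finally show ?thesis using c(2) by (intro power2_le_imp_le[of "T m x"]) auto
    qed
    then show ?case
      by (intro bounded_imp_summable[of _ "c + 1"]) (auto simp: T_def lessThan_Suc_atMost[symmetric] simp del: sum.lessThan_Suc)
  qed
qed

text \<open>Completeness in the form of absolutely convergent series, with an explicit pointwise
  sum. The tail estimate is Fatou's lemma applied to the partial sums of the shifted series; its
  case n = 0 is the last bound.\<close>

lemma sq_int_series:
  assumes f: "\<And>n. f n \<in> sq_int M" and s: "summable (\<lambda>n. l2n M (f n))"
  obtains g where "g \<in> sq_int M" "AE x in M. (\<lambda>n. f n x) sums g x"
    "\<And>n. l2n M (\<lambda>x. g x - (\<Sum>k<n. f k x)) \<le> (\<Sum>k. l2n M (f (k + n)))"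
    "l2n M g \<le> (\<Sum>k. l2n M (f k))"
proof -
  define g where "g x = (\<Sum>n. f n x)" for x
  have fm [measurable]: "f n \<in> borel_measurable M" for n using f sq_int_meas by blast
  have gm [measurable]: "g \<in> borel_measurable M" unfolding g_def by measurable
  have sums: "AE x in M. (\<lambda>n. f n x) sums g x"
    using sq_int_abs_summable[OF f s]
    by eventually_elim (auto simp: g_def intro: summable_sums summable_rabs_cancel)
  have tail: "(\<lambda>x. g x - (\<Sum>k<n. f k x)) \<in> sq_int M \<and> l2n M (\<lambda>x. g x - (\<Sum>k<n. f k x)) \<le> (\<Sum>k. l2n M (f (k + n)))" for n
  proof -
    have b: "l2n M (\<lambda>x. \<Sum>k<m. f (k + n) x) \<le> (\<Sum>k. l2n M (f (k + n)))" for m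
    proof -
      have "l2n M (\<lambda>x. \<Sum>k<m. f (k + n) x) \<le> (\<Sum>k<m. l2n M (f (k + n)))"
        by (intro l2n_sum f)
      also have "\<dots> \<le> (\<Sum>k. l2n M (f (k + n)))"
        using s by (intro sum_le_suminf) (auto intro: summable_ignore_initial_segment)
      finally show ?thesis .
    qed
    have l: "AE x in M. (\<lambda>m. \<Sum>k<m. f (k + n) x) \<longlonglongrightarrow> g x - (\<Sum>k<n. f k x)"
      using sums
    proof eventually_elim
      case (elim x)
      then show ?case
        using sums_split_initial_segment[OF elim, of n] unfolding sums_def by simp
    qed
    show ?thesis
      using sq_int_fatou[OF sq_int_sum[OF f] b _ l] by auto
  qed
  show ?thesis
    using tail[of 0] tail sums by (intro that[of g]) auto
qed

lemma l2n_AE_subseq: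
  assumes f: "\<And>n. f n \<in> sq_int M" and lim: "(\<lambda>n. l2n M (f n)) \<longlonglongrightarrow> 0"
  shows "\<exists>r::nat\<Rightarrow>nat. strict_mono r \<and> (AE x in M. (\<lambda>n. f (r n) x) \<longlonglongrightarrow> 0)"
proof -
  have "(\<lambda>n. (l2n M (f n))\<^sup>2) \<longlonglongrightarrow> 0\<^sup>2"
    by (intro tendsto_intros lim)
  then have "(\<lambda>n. \<integral>x. norm ((f n x)\<^sup>2) \<partial>M) \<longlonglongrightarrow> 0"
    by (simp add: l2n_sq)
  then obtain r :: "nat \<Rightarrow> nat" where "strict_mono r" and "AE x in M. (\<lambda>n. (f (r n) x)\<^sup>2) \<longlonglongrightarrow> 0"
    using tendsto_L1_AE_subseq[of M "\<lambda>n x. (f n x)\<^sup>2"] sq_int_sq[OF f] by blast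
  moreover have "(\<lambda>n. f (r n) x) \<longlonglongrightarrow> 0" if "(\<lambda>n. (f (r n) x)\<^sup>2) \<longlonglongrightarrow> 0" for x
    using tendsto_real_sqrt[OF that] by (simp add: tendsto_rabs_zero_iff)
  ultimately show ?thesis
    by (metis (mono_tags, lifting) eventually_mono)
qed

lemma l2n_summable_AE_tendsto:
  assumes f: "\<And>n. f n \<in> sq_int M" and s: "summable (\<lambda>n. l2n M (f n))"
  shows "AE x in M. (\<lambda>n. f n x) \<longlonglongrightarrow> 0"
  using sq_int_abs_summable[OF f s]
  by eventually_elim (auto dest!: summable_LIMSEQ_zero simp: tendsto_rabs_zero_iff)

section \<open>Integration over the whole space\<close>

lemma lborel_integral_affine:
  fixes f :: "'a::euclidean_space \<Rightarrow> real"
  assumes [measurable]: "f \<in> borel_measurable borel" and c: "c \<noteq> 0"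
  shows "(\<integral>x. f x \<partial>lborel) = \<bar>c\<bar> ^ DIM('a) * (\<integral>x. f (t + c *\<^sub>R x) \<partial>lborel)"
proof -
  have "(\<integral>x. f x \<partial>lborel) = (\<integral>x. f x \<partial>(density (distr lborel borel (\<lambda>x. t + c *\<^sub>R x)) (\<lambda>_. \<bar>c\<bar>^DIM('a))))"
    using lborel_affine[OF c, of t] by simp
  then show ?thesis
    by (simp add: integral_density integral_distr)
qed

lemma lborel_nn_integral_affine:
  fixes f :: "'a::euclidean_space \<Rightarrow> ennreal"
  assumes [measurable]: "f \<in> borel_measurable borel" and c: "c \<noteq> 0"
  shows "(\<integral>\<^sup>+x. f x \<partial>lborel) = ennreal (\<bar>c\<bar> ^ DIM('a)) * (\<integral>\<^sup>+x. f (t + c *\<^sub>R x) \<partial>lborel)"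
proof -
  have "(\<integral>\<^sup>+x. f x \<partial>lborel) = (\<integral>\<^sup>+x. f x \<partial>(density (distr lborel borel (\<lambda>x. t + c *\<^sub>R x)) (\<lambda>_. \<bar>c\<bar>^DIM('a))))"
    using lborel_affine[OF c, of t] by simp
  then show ?thesis
    by (simp add: nn_integral_density nn_integral_distr nn_integral_cmult)
qed

lemma lborel_integrable_affine:
  fixes f :: "'a::euclidean_space \<Rightarrow> real"
  assumes f: "integrable lborel f" and c: "c \<noteq> 0"
  shows "integrable lborel (\<lambda>x. f (t + c *\<^sub>R x))"
proof -
  have [measurable]: "f \<in> borel_measurable borel" using f by auto
  have "(\<integral>\<^sup>+x. ennreal (norm (f x)) \<partial>lborel) = ennreal (\<bar>c\<bar> ^ DIM('a)) * (\<integral>\<^sup>+x. ennreal (norm (f (t + c *\<^sub>R x))) \<partial>lborel)"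
    by (rule lborel_nn_integral_affine[OF _ c]) measurable
  moreover have "(\<integral>\<^sup>+x. ennreal (norm (f x)) \<partial>lborel) < \<infinity>"
    using f by (simp add: integrable_iff_bounded)
  ultimately have "(\<integral>\<^sup>+x. ennreal (norm (f (t + c *\<^sub>R x))) \<partial>lborel) < \<infinity>"
    using c by (auto simp: ennreal_mult_less_top)
  then show ?thesis
    by (intro integrableI_bounded) auto
qed

lemma lborel_integral_translate:
  fixes f :: "'a::euclidean_space \<Rightarrow> real"
  assumes [measurable]: "f \<in> borel_measurable borel"
  shows "(\<integral>x. f (x + a) \<partial>lborel) = (\<integral>x. f x \<partial>lborel)" "(\<integral>x. f (x - a) \<partial>lborel) = (\<integral>x. f x \<partial>lborel)"
    "(\<integral>x. f (a - x) \<partial>lborel) = (\<integral>x. f x \<partial>lborel)"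
  using lborel_integral_affine[OF assms, of 1 a] lborel_integral_affine[OF assms, of 1 "-a"]
    lborel_integral_affine[OF assms, of "-1" a]
  by (simp_all add: add.commute)

lemma sq_int_affine:
  fixes u :: "'a::euclidean_space \<Rightarrow> real"
  assumes "u \<in> sq_int lborel" "c \<noteq> 0"
  shows "(\<lambda>x. u (t + c *\<^sub>R x)) \<in> sq_int lborel"
    "(l2n lborel u)\<^sup>2 = \<bar>c\<bar> ^ DIM('a) * (l2n lborel (\<lambda>x. u (t + c *\<^sub>R x)))\<^sup>2"
proof -
  have [measurable]: "u \<in> borel_measurable borel" using sq_int_meas[OF assms(1)] by simp
  show "(\<lambda>x. u (t + c *\<^sub>R x)) \<in> sq_int lborel"
    using lborel_integrable_affine[OF sq_int_sq[OF assms(1)] assms(2)] by (simp add: sq_int_def)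
  show "(l2n lborel u)\<^sup>2 = \<bar>c\<bar> ^ DIM('a) * (l2n lborel (\<lambda>x. u (t + c *\<^sub>R x)))\<^sup>2"
    unfolding l2n_sq by (rule lborel_integral_affine[OF _ assms(2)]) measurable
qed

lemma sq_int_translate:
  fixes u :: "'a::euclidean_space \<Rightarrow> real"
  assumes "u \<in> sq_int lborel"
  shows "(\<lambda>x. u (x - t)) \<in> sq_int lborel" "l2n lborel (\<lambda>x. u (x - t)) = l2n lborel u"
  using sq_int_affine[OF assms, of 1 "-t"] by simp_all

lemma integrable_bounded_support:
  fixes f :: "'a::euclidean_space \<Rightarrow> real"
  assumes "f \<in> borel_measurable borel" "\<And>x. \<bar>f x\<bar> \<le> M" "\<And>x. norm x > R \<Longrightarrow> f x = 0"
  shows "integrable lborel f"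
proof (rule Bochner_Integration.integrable_bound[of _ "\<lambda>x. M * indicator (cball 0 R) x"])
  show "integrable lborel (\<lambda>x. M * indicator (cball 0 R) x :: real)"
    by (intro integrable_mult_right integrable_real_indicator) (use emeasure_bounded_finite[OF bounded_cball] in auto)
  show "AE x in lborel. norm (f x) \<le> norm (M * indicator (cball 0 R) x :: real)"
    using assms(2,3) by (auto simp: indicator_def intro!: AE_I2 order_trans[OF _ abs_ge_self])
qed (use assms in auto)

lemma sq_int_bounded_support:
  fixes f :: "'a::euclidean_space \<Rightarrow> real"
  assumes [measurable]: "f \<in> borel_measurable borel" and b: "\<And>x. \<bar>f x\<bar> \<le> M" "\<And>x. norm x > R \<Longrightarrow> f x = 0"
  shows "f \<in> sq_int lborel"
proof -
  have "integrable lborel (\<lambda>x. (f x)\<^sup>2)"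
  proof (rule integrable_bounded_support)
    show "\<bar>(f x)\<^sup>2\<bar> \<le> M\<^sup>2" for x
      using power_mono[OF b(1) abs_ge_zero, of x 2] by simp
    show "norm x > R \<Longrightarrow> (f x)\<^sup>2 = 0" for x
      using b(2) by simp
  qed measurable
  then show ?thesis by (simp add: sq_int_def)
qed

lemma test_bounded_support:
  assumes "f \<in> test_functions \<Omega>"
  obtains R where "R > 0" "\<And>x. norm x > R \<Longrightarrow> f x = 0"
proof -
  obtain K where K: "compact K" "\<And>x. x \<notin> K \<Longrightarrow> f x = 0"
    by (metis assms test_support)
  then obtain R where "R > 0" "\<forall>x\<in>K. norm x \<le> R"
    using bounded_pos compact_imp_bounded by metis
  then show ?thesis
    using K(2) that[of R] by (metis not_le)
qed

lemma test_integrable: "f \<in> test_functions \<Omega> \<Longrightarrow> integrable lborel f"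
  by (metis test_bounded test_bounded_support integrable_bounded_support smooth_borel test_smooth)

lemma test_sq_int: "f \<in> test_functions \<Omega> \<Longrightarrow> f \<in> sq_int lborel"
  by (metis test_bounded test_bounded_support sq_int_bounded_support smooth_borel test_smooth)

text \<open>Difference quotients integrate to zero by translation invariance.\<close>

lemma integral_pderiv_eq_0:
  assumes "C_k 1 f" and supp: "\<And>x. norm x > R \<Longrightarrow> f x = 0"
  shows "(\<integral>x. pderiv i f x \<partial>lborel) = 0"
proof -
  have diff: "f differentiable (at x)" and cd: "continuous_on UNIV (pderiv i f)" for x
    using assms(1) by auto
  have cf: "continuous_on UNIV f"
    using C_k_Suc_imp[of 0 f] assms(1) by simp
  have [measurable]: "f \<in> borel_measurable borel" "pderiv i f \<in> borel_measurable borel"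
    using cf cd borel_measurable_continuous_onI by auto
  have p0: "pderiv i f x = 0" if "norm x > R" for x
  proof -
    have "(f has_derivative (\<lambda>h. 0)) (at x)"
    proof (rule has_derivative_transform_within_open[OF has_derivative_const[of 0]])
      show "open (- cball (0::real^3) R)" by (rule open_Compl) simp
    qed (use supp that in \<open>auto simp: not_le\<close>)
    then show ?thesis by (simp add: pderiv_eq)
  qed
  have "compact (pderiv i f ` cball 0 R)"
    by (intro compact_continuous_image continuous_on_subset[OF cd]) auto
  then obtain M where M0: "M > 0" and "\<forall>y\<in>pderiv i f ` cball 0 R. norm y \<le> M"
    using bounded_pos compact_imp_bounded by metis
  then have M: "\<bar>pderiv i f x\<bar> \<le> M" for x
    using p0[of x] by (cases "norm x > R") auto
  define e where "e = (axis i 1 :: real^3)"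
  have ne: "norm e = 1" by (simp add: e_def)
  define g where "g n x = (f (x + (1 / real (Suc n)) *\<^sub>R e) - f x) * real (Suc n)" for n x
  have line: "((\<lambda>s. f (x + s *\<^sub>R e)) has_real_derivative pderiv i f (x + s *\<^sub>R e)) (at s)" for x s
  proof -
    have "((\<lambda>s. f (x + s *\<^sub>R e)) has_derivative (\<lambda>h. \<Sum>j\<in>UNIV. (h *\<^sub>R e) $ j * pderiv j f (x + s *\<^sub>R e))) (at s)"
      by (rule has_derivative_compose[OF _ pderiv_has_derivative[OF diff]]) (auto intro!: derivative_eq_intros)
    then show ?thesis
      unfolding has_field_derivative_def e_def
      by (simp add: mult.assoc sum_distrib_left[symmetric] sum_axis mult.commute[of _ "pderiv i f _"])
  qed
  have bound: "\<bar>g n x\<bar> \<le> M" for n x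
  proof -
    obtain z where "f (x + (1 / real (Suc n)) *\<^sub>R e) - f (x + 0 *\<^sub>R e) = (1 / real (Suc n) - 0) * pderiv i f (x + z *\<^sub>R e)"
      using MVT2[of 0 "1 / real (Suc n)" "\<lambda>s. f (x + s *\<^sub>R e)" "\<lambda>s. pderiv i f (x + s *\<^sub>R e)"] line by auto
    then have "g n x = pderiv i f (x + z *\<^sub>R e)" by (simp add: g_def)
    then show ?thesis using M by simp
  qed
  have "(\<lambda>n. \<integral>x. g n x \<partial>lborel) \<longlonglongrightarrow> (\<integral>x. pderiv i f x \<partial>lborel)"
  proof (rule integral_dominated_convergence[where w="\<lambda>x. M * indicator (cball 0 (R + 1)) x"])
    show "integrable lborel (\<lambda>x. M * indicator (cball 0 (R + 1)) x :: real)" 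
      by (intro integrable_mult_right integrable_real_indicator) (use emeasure_bounded_finite[OF bounded_cball] in auto)
    show "AE x in lborel. (\<lambda>n. g n x) \<longlonglongrightarrow> pderiv i f x"
    proof (rule AE_I2)
      fix x
      have "((\<lambda>h. (f (x + h *\<^sub>R e) - f x) / h) \<longlongrightarrow> pderiv i f x) (at 0)"
        using line[of x 0] by (simp add: has_field_derivative_iff)
      moreover have "filterlim (\<lambda>n. 1 / real (Suc n)) (at 0) sequentially"
        by (rule filterlim_atI[OF LIMSEQ_Suc[OF lim_1_over_n]]) auto
      ultimately have "(\<lambda>n. (f (x + (1 / real (Suc n)) *\<^sub>R e) - f x) / (1 / real (Suc n))) \<longlonglongrightarrow> pderiv i f x"
        by (rule filterlim_compose)
      then show "(\<lambda>n. g n x) \<longlonglongrightarrow> pderiv i f x" by (simp add: g_def)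
    qed
    show "AE x in lborel. norm (g n x) \<le> M * indicator (cball 0 (R + 1)) x" for n
    proof (rule AE_I2)
      fix x
      show "norm (g n x) \<le> M * indicator (cball 0 (R + 1)) x"
      proof (cases "norm x \<le> R + 1")
        case True
        then show ?thesis using bound by simp
      next
        case False
        have "norm x \<le> norm (x + (1 / real (Suc n)) *\<^sub>R e) + norm ((1 / real (Suc n)) *\<^sub>R e)"
          by (metis add_diff_cancel norm_triangle_ineq4)
        moreover have "norm ((1 / real (Suc n)) *\<^sub>R e) \<le> 1" by (simp add: ne)
        ultimately have "norm (x + (1 / real (Suc n)) *\<^sub>R e) > R" "norm x > R" using False by linarith+
        then show ?thesis using supp M0 by (simp add: g_def)
      qed
    qed
  qed (auto simp: g_def)
  moreover have "(\<integral>x. g n x \<partial>lborel) = 0" for n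
  proof -
    have "compact (f ` cball 0 R)"
      by (intro compact_continuous_image continuous_on_subset[OF cf]) auto
    then obtain N where N0: "N > 0" and "\<forall>y\<in>f ` cball 0 R. norm y \<le> N"
      using bounded_pos compact_imp_bounded by metis
    then have N: "\<bar>f x\<bar> \<le> N" for x
      using supp[of x] by (cases "norm x > R") auto
    have fi: "integrable lborel f"
      by (rule integrable_bounded_support[OF _ N supp]) auto
    moreover have "integrable lborel (\<lambda>x. f (x + a))" for a
      using lborel_integrable_affine[OF fi, of 1 a] by (simp add: add.commute)
    ultimately show ?thesis
      by (simp add: g_def lborel_integral_translate)
  qed
  ultimately show ?thesis
    by (simp add: LIMSEQ_const_iff)
qed

text \<open>Only one continuous derivative is asked of \<open>u\<close>, because the chain rule in
  H^1 applies this to compositions with outer functions that are merely continuously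
  differentiable.\<close>

lemma integral_by_parts:
  assumes "C_k 1 u" "\<phi> \<in> test_functions \<Omega>"
  shows "(\<integral>x. u x * pderiv i \<phi> x \<partial>lborel) = - (\<integral>x. pderiv i u x * \<phi> x \<partial>lborel)"
proof -
  have s: "smooth \<phi>" using assms(2) test_smooth by blast
  have cu: "continuous_on UNIV u" "continuous_on UNIV (pderiv i u)"
    using assms(1) C_k_Suc_imp[of 0 u] by auto
  have [measurable]: "u \<in> borel_measurable borel" "pderiv i u \<in> borel_measurable borel"
    using cu borel_measurable_continuous_onI by auto
  obtain R where R: "R > 0" "\<And>x. norm x > R \<Longrightarrow> \<phi> x = 0"
    by (metis assms(2) test_bounded_support)
  obtain R' where R': "R' > 0" "\<And>x. norm x > R' \<Longrightarrow> pderiv i \<phi> x = 0"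
    by (metis test_pderiv[OF assms(2)] test_bounded_support)
  have int: "integrable lborel (\<lambda>x. a x * b x)" if "continuous_on UNIV a" "continuous_on UNIV b"
    "\<And>x. norm x > r \<Longrightarrow> b x = 0" for a b :: "real^3 \<Rightarrow> real" and r
  proof -
    have c: "continuous_on UNIV (\<lambda>x. a x * b x)" using that by (intro continuous_intros)
    have "compact ((\<lambda>x. a x * b x) ` cball 0 r)"
      by (intro compact_continuous_image continuous_on_subset[OF c]) auto
    then obtain N where N0: "N > 0" and "\<forall>y\<in>(\<lambda>x. a x * b x) ` cball 0 r. norm y \<le> N"
      using bounded_pos compact_imp_bounded by metis
    then have N: "\<bar>a x * b x\<bar> \<le> N" for x
      using that(3)[of x] by (cases "norm x > r") auto
    show ?thesis
      by (rule integrable_bounded_support[OF _ N, where R=r]) (use c that borel_measurable_continuous_onI in auto)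
  qed
  have "(\<integral>x. pderiv i (\<lambda>x. u x * \<phi> x) x \<partial>lborel) = 0"
    by (rule integral_pderiv_eq_0[of _ R]) (use assms s R in \<open>auto simp: smooth_def simp del: C_k.simps intro!: C_k_mult\<close>)
  moreover have "pderiv i (\<lambda>x. u x * \<phi> x) x = u x * pderiv i \<phi> x + pderiv i u x * \<phi> x" for x
    using assms(1) smooth_differentiable[OF s] by (intro pderiv_mult) auto
  ultimately show ?thesis
    using int[OF cu(1) smooth_continuous[OF smooth_pderiv[OF s]] R'(2)] int[OF cu(2) smooth_continuous[OF s] R(2)]
    by simp
qed

section \<open>Convolution and mollification\<close>

lemma l2n_dominated:
  assumes f: "\<And>n. f n \<in> borel_measurable M" and w: "w \<in> sq_int M"
    and dom: "\<And>n x. \<bar>f n x\<bar> \<le> w x" and lim: "AE x in M. (\<lambda>n. f n x) \<longlonglongrightarrow> 0"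
  shows "(\<lambda>n. l2n M (f n)) \<longlonglongrightarrow> 0"
proof -
  have "(\<lambda>n. \<integral>x. (f n x)\<^sup>2 \<partial>M) \<longlonglongrightarrow> (\<integral>x. 0 \<partial>M)"
  proof (rule integral_dominated_convergence[where w="\<lambda>x. (w x)\<^sup>2"])
    show "AE x in M. (\<lambda>n. (f n x)\<^sup>2) \<longlonglongrightarrow> 0"
      using lim
    proof eventually_elim
      case (elim x)
      show ?case using tendsto_power[OF elim, of 2] by simp
    qed
    show "AE x in M. norm ((f n x)\<^sup>2) \<le> (w x)\<^sup>2" for n
      using power_mono[OF dom abs_ge_zero, of n _ 2] by simp
    show "(\<lambda>x. (f n x)\<^sup>2) \<in> borel_measurable M" for n
      by (intro borel_measurable_power f)
  qed (use sq_int_sq[OF w] in auto)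
  then have "(\<lambda>n. sqrt (\<integral>x. (f n x)\<^sup>2 \<partial>M)) \<longlonglongrightarrow> sqrt 0"
    by (intro tendsto_real_sqrt) simp
  then show ?thesis by (simp add: l2n_def)
qed

lemma sq_int_indicator_cball: "(\<lambda>x::'a::euclidean_space. c * indicator (cball 0 R) x) \<in> sq_int lborel"
  by (rule sq_int_bounded_support[of _ "\<bar>c\<bar>" R]) (auto simp: indicator_def)

lemma clip_abs: "\<bar>max (- k) (min k t)\<bar> \<le> \<bar>t\<bar>" "\<bar>max (- k) (min k t)\<bar> \<le> k"
  "\<bar>max (- k) (min k t) - t\<bar> \<le> \<bar>t\<bar>" if "k \<ge> 0" for k t :: real
  using that by (auto simp: max_def min_def)

text \<open>Values and domain are truncated at the same level n; the error is dominated by |u|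
  itself, so dominated convergence applies.\<close>

lemma sq_int_dense_bounded:
  fixes u :: "'a::euclidean_space \<Rightarrow> real"
  assumes u: "u \<in> sq_int lborel" and e: "e > 0"
  obtains v M where "v \<in> borel_measurable borel" "M > 0" "\<And>x. \<bar>v x\<bar> \<le> M" "\<And>x. norm x > M \<Longrightarrow> v x = 0"
    "l2n lborel (\<lambda>x. u x - v x) < e"
proof -
  have [measurable]: "u \<in> borel_measurable borel" using sq_int_meas[OF u] by simp
  define v where "v n x = max (- real n) (min (real n) (u x)) * indicator (cball 0 (real n)) x" for n x
  have "(\<lambda>n. l2n lborel (\<lambda>x. u x - v n x)) \<longlonglongrightarrow> 0"
  proof (rule l2n_dominated[OF _ sq_int_abs[OF u]])
    show "AE x in lborel. (\<lambda>n. u x - v n x) \<longlonglongrightarrow> 0"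
    proof (rule AE_I2)
      fix x
      have "\<forall>\<^sub>F n in sequentially. \<bar>u x\<bar> \<le> real n \<and> norm x \<le> real n"
        by (rule eventually_sequentiallyI[of "nat \<lceil>max \<bar>u x\<bar> (norm x)\<rceil>"]) linarith
      then have "\<forall>\<^sub>F n in sequentially. u x - v n x = 0"
        by eventually_elim (auto simp: v_def max_def min_def)
      then show "(\<lambda>n. u x - v n x) \<longlonglongrightarrow> 0" by (rule tendsto_eventually)
    qed
    show "\<bar>u x - v n x\<bar> \<le> \<bar>u x\<bar>" for n x
      using clip_abs(3)[of "real n" "u x"] by (auto simp: v_def indicator_def)
    show "(\<lambda>x. u x - v n x) \<in> borel_measurable lborel" for n
      unfolding v_def
      by (intro borel_measurable_diff borel_measurable_times borel_measurable_max borel_measurable_min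
          borel_measurable_indicator) auto
  qed
  then have "\<forall>\<^sub>F n in sequentially. l2n lborel (\<lambda>x. u x - v n x) < e"
    using e by (rule order_tendstoD(2))
  then have "\<forall>\<^sub>F n in sequentially. n \<ge> 1 \<and> l2n lborel (\<lambda>x. u x - v n x) < e"
    by (intro eventually_conj eventually_ge_at_top)
  then obtain n where "n \<ge> 1" "l2n lborel (\<lambda>x. u x - v n x) < e"
    using eventually_happens'[OF sequentially_bot] by blast
  moreover have "v n \<in> borel_measurable borel"
    unfolding v_def by (intro borel_measurable_times borel_measurable_max borel_measurable_min borel_measurable_indicator) auto
  ultimately show ?thesis
    using clip_abs(2)[of "real n"] by (intro that[of "v n" "real n"]) (auto simp: v_def indicator_def)
qed

text \<open>Measurability yields continuous functions converging almost everywhere, but without any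
  control of their size. Clipping them to the range [-M, M] and multiplying by a continuous plateau
  function \<open>q\<close> provides the majorant for dominated convergence without changing the
  limit.\<close>

lemma sq_int_dense_continuous:
  fixes u :: "'a::euclidean_space \<Rightarrow> real"
  assumes u: "u \<in> sq_int lborel" and e: "e > 0"
  obtains f R where "continuous_on UNIV f" "\<And>x. norm x > R \<Longrightarrow> f x = 0" "f \<in> sq_int lborel" "R > 0"
    "l2n lborel (\<lambda>x. u x - f x) < e"
proof -
  obtain v M where v [measurable]: "v \<in> borel_measurable borel" and M: "M > 0" "\<And>x. \<bar>v x\<bar> \<le> M" "\<And>x. norm x > M \<Longrightarrow> v x = 0"
    and uv: "l2n lborel (\<lambda>x. u x - v x) < e / 2"
    by (rule sq_int_dense_bounded[OF u half_gt_zero[OF e]]) blast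
  have "v measurable_on UNIV"
    by (rule lebesgue_measurable_imp_measurable_on) (auto intro: measurable_completion)
  then obtain N g where N: "negligible N" and g: "\<And>n. continuous_on UNIV (g n)"
    and lim: "\<And>x. x \<notin> N \<Longrightarrow> (\<lambda>n. g n x) \<longlonglongrightarrow> v x"
    unfolding measurable_on_def by auto
  define q where "q x = max 0 (min 1 (M + 1 - norm x))" for x :: 'a
  define h where "h n x = max (- M) (min M (g n x)) * q x" for n x
  have hc: "continuous_on UNIV (h n)" for n
    unfolding h_def q_def by (intro continuous_intros g)
  then have [measurable]: "h n \<in> borel_measurable borel" for n
    by (rule borel_measurable_continuous_onI)
  have q: "0 \<le> q x" "q x \<le> 1" for x by (auto simp: q_def)
  have hb: "\<bar>h n x\<bar> \<le> M" for n x
    using mult_mono[OF clip_abs(2)[of M "g n x"] q(2)[of x]] M(1) q[of x] by (simp add: h_def abs_mult)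
  have hs: "h n x = 0" if "norm x > M + 1" for n x
    using that by (simp add: h_def q_def)
  have "(\<lambda>n. l2n lborel (\<lambda>x. v x - h n x)) \<longlonglongrightarrow> 0"
  proof (rule l2n_dominated[OF _ sq_int_indicator_cball[of "2 * M" "M + 1"]])
    show "\<bar>v x - h n x\<bar> \<le> 2 * M * indicator (cball 0 (M + 1)) x" for n x
    proof (cases "norm x \<le> M + 1")
      case True
      then show ?thesis using hb[of n x] M(2)[of x] by simp
    next
      case False
      then show ?thesis using hs[of x n] M(3)[of x] by simp
    qed
    have "AE x in lebesgue. x \<notin> N"
      using N unfolding negligible_iff_null_sets by (rule AE_not_in)
    then have "AE x in lborel. x \<notin> N" by (simp add: AE_completion_iff)
    then show "AE x in lborel. (\<lambda>n. v x - h n x) \<longlonglongrightarrow> 0"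
    proof eventually_elim
      case (elim x)
      have "(\<lambda>n. v x - h n x) \<longlonglongrightarrow> v x - max (- M) (min M (v x)) * q x"
        unfolding h_def by (intro tendsto_intros lim elim)
      also have "v x - max (- M) (min M (v x)) * q x = 0"
        using M(2)[of x] M(3)[of x] by (cases "norm x > M") (auto simp: q_def max_def min_def abs_le_iff)
      finally show ?case .
    qed
  qed auto
  then have "\<forall>\<^sub>F n in sequentially. l2n lborel (\<lambda>x. v x - h n x) < e / 2"
    using e by (intro order_tendstoD(2)) auto
  then obtain n where n: "l2n lborel (\<lambda>x. v x - h n x) < e / 2"
    by (meson eventually_happens trivial_limit_sequentially)
  have hS: "h n \<in> sq_int lborel"
    by (rule sq_int_bounded_support[of _ M "M + 1"]) (use hb hs in auto)
  have vS: "v \<in> sq_int lborel"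
    by (rule sq_int_bounded_support[of _ M M]) (use M in auto)
  have "l2n lborel (\<lambda>x. u x - h n x) < e"
    using l2n_triangle3[OF u vS hS] uv n by linarith
  then show ?thesis
    using hc hs hS M(1) by (intro that[of "h n" "M + 1"]) auto
qed

lemma translation_continuous:
  fixes u :: "'a::euclidean_space \<Rightarrow> real"
  assumes u: "u \<in> sq_int lborel" and e: "e > 0"
  obtains d where "d > 0" "\<And>z. norm z < d \<Longrightarrow> l2n lborel (\<lambda>x. u (x - z) - u x) \<le> e"
proof -
  obtain f R where fc: "continuous_on UNIV f" and fs: "\<And>x. norm x > R \<Longrightarrow> f x = 0" and f: "f \<in> sq_int lborel" and R: "R > 0"
    and uf: "l2n lborel (\<lambda>x. u x - f x) < e / 3"
    by (rule sq_int_dense_continuous[OF u divide_pos_pos[OF e zero_less_numeral]]) blast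
  define B where "B = l2n lborel (indicator (cball (0::'a) (R + 1)) :: 'a \<Rightarrow> real)"
  have B: "B \<ge> 0" by (simp add: B_def)
  \<comment> \<open>Chosen so that \<open>e'\<close> times the norm of the indicator of the ball of
    radius R + 1 is at most e/3. That ball contains the support of \<open>f\<close> and of its
    translates by less than 1; the \<open>+ 1\<close> in the denominator avoids a division by
    zero.\<close>
  define e' where "e' = e / (3 * (B + 1))"
  have e': "e' > 0" using e B by (simp add: e'_def)
  have "uniformly_continuous_on (cball 0 (R + 2)) f"
    by (rule compact_uniformly_continuous[OF continuous_on_subset[OF fc]]) auto
  then obtain d where d: "d > 0" "\<And>x y. x \<in> cball 0 (R + 2) \<Longrightarrow> y \<in> cball 0 (R + 2) \<Longrightarrow> dist y x < d \<Longrightarrow> dist (f y) (f x) < e'"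
    unfolding uniformly_continuous_on_def using e' by metis
  show ?thesis
  proof (rule that[of "min d 1"])
    fix z :: 'a assume z: "norm z < min d 1"
    have pt: "\<bar>f (x - z) - f x\<bar> \<le> \<bar>e' * indicator (cball 0 (R + 1)) x\<bar>" for x
    proof (cases "norm x \<le> R + 1")
      case True
      have "norm (x - z) \<le> R + 2"
        using norm_triangle_ineq4[of x z] True z by simp
      then have "dist (f (x - z)) (f x) < e'"
        using True z by (intro d(2)) (auto simp: dist_norm norm_minus_commute)
      then show ?thesis using True e' by (simp add: dist_real_def)
    next
      case False
      have "norm (x - z) > R"
        using norm_triangle_ineq2[of x z] False z by simp
      then show ?thesis using False fs by simp
    qed
    have ff: "l2n lborel (\<lambda>x. f (x - z) - f x) \<le> e / 3"
    proof -
      have "l2n lborel (\<lambda>x. f (x - z) - f x) \<le> l2n lborel (\<lambda>x::'a. e' * indicator (cball 0 (R + 1)) x)"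
        using l2n_mono[OF sq_int_indicator_cball, of "\<lambda>x. f (x - z) - f x"] pt by simp
      also have "\<dots> = e' * B" using e' by (simp add: l2n_cmult B_def)
      also have "\<dots> \<le> e' * (B + 1)" using e' by simp
      also have "\<dots> = e / 3" using B by (simp add: e'_def field_simps)
      finally show ?thesis .
    qed
    have uz: "(\<lambda>x. u (x - z)) \<in> sq_int lborel" "(\<lambda>x. f (x - z)) \<in> sq_int lborel"
      using sq_int_translate u f by auto
    have "l2n lborel (\<lambda>x. u (x - z) - f (x - z)) = l2n lborel (\<lambda>x. u x - f x)"
      using sq_int_translate(2)[OF sq_int_diff[OF u f]] by simp
    then show "l2n lborel (\<lambda>x. u (x - z) - u x) \<le> e"
      using l2n_triangle3[OF uz(1) uz(2) u] l2n_triangle3[OF uz(2) f u] ff uf l2n_commute[of lborel u f] by linarith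
  qed (use d in auto)
qed

section \<open>Convolution and approximate identities\<close>

definition conv :: "(real^3 \<Rightarrow> real) \<Rightarrow> (real^3 \<Rightarrow> real) \<Rightarrow> real^3 \<Rightarrow> real" where
  "conv \<eta> u x = (\<integral>y. u y * \<eta> (x - y) \<partial>lborel)"

lemma conv_measurable [measurable]:
  assumes [measurable]: "u \<in> borel_measurable borel" "\<eta> \<in> borel_measurable borel"
  shows "conv \<eta> u \<in> borel_measurable borel"
proof -
  have "(\<lambda>x. \<integral>y. u y * \<eta> (x - y) \<partial>lborel) \<in> borel_measurable borel"
    by (rule lborel.borel_measurable_lebesgue_integral) measurable
  then show ?thesis by (simp add: conv_def[abs_def])
qed

lemma conv_swap:
  assumes [measurable]: "u \<in> borel_measurable borel" "\<eta> \<in> borel_measurable borel"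
  shows "conv \<eta> u x = (\<integral>z. u (x - z) * \<eta> z \<partial>lborel)"
  using lborel_integral_translate(3)[of "\<lambda>y. u y * \<eta> (x - y)" x] by (simp add: conv_def)

lemma sq_int_reflect: "u \<in> sq_int lborel \<Longrightarrow> (\<lambda>z. u (x - z :: 'a::euclidean_space)) \<in> sq_int lborel"
  using sq_int_affine(1)[of u "-1" x] by simp

text \<open>Minkowski's inequality in the form of a weighted Cauchy--Schwarz inequality; the mass of \<open>\<kappa>\<close> near the
  origin sees small translations only.\<close>

lemma conv_approx:
  fixes u \<kappa> :: "real^3 \<Rightarrow> real"
  assumes u: "u \<in> sq_int lborel" and \<kappa>: "\<kappa> \<in> sq_int lborel" "integrable lborel \<kappa>" "\<And>z. \<kappa> z \<ge> 0"
    and M: "(\<integral>z. \<kappa> z \<partial>lborel) \<le> M" and e: "e \<ge> 0" "\<And>z. norm z < d \<Longrightarrow> l2n lborel (\<lambda>x. u (x - z) - u x) \<le> e"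
    and T: "(\<integral>z. \<kappa> z * indicator {z. norm z \<ge> d} z \<partial>lborel) \<le> T"
  shows "(\<lambda>x. conv \<kappa> u x - (\<integral>z. \<kappa> z \<partial>lborel) * u x) \<in> sq_int lborel"
    "l2n lborel (\<lambda>x. conv \<kappa> u x - (\<integral>z. \<kappa> z \<partial>lborel) * u x) \<le> sqrt (M * (e\<^sup>2 * M + 4 * (l2n lborel u)\<^sup>2 * T))"
proof -
  have [measurable]: "u \<in> borel_measurable borel" "\<kappa> \<in> borel_measurable borel"
    using sq_int_meas[OF u] sq_int_meas[OF \<kappa>(1)] by auto
  define m where "m = (\<integral>z. \<kappa> z \<partial>lborel)"
  have m: "0 \<le> m" "m \<le> M" using \<kappa>(3) M by (auto simp: m_def)
  have T0: "0 \<le> T" by (rule order_trans[OF _ T]) (use \<kappa>(3) in \<open>auto intro!: Bochner_Integration.integral_nonneg\<close>)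
  define U where "U = l2n lborel u"
  define B where "B = M * (e\<^sup>2 * M + 4 * U\<^sup>2 * T)"
  have B: "B \<ge> 0" using m T0 by (auto simp: B_def intro!: mult_nonneg_nonneg add_nonneg_nonneg)
  define W where "W z = l2n lborel (\<lambda>x. u (x - z) - u x)" for z
  have uz: "(\<lambda>x. u (x - z)) \<in> sq_int lborel" for z using sq_int_translate u by auto
  have W2: "W z \<le> 2 * U" for z
    unfolding W_def U_def using l2n_triangle_diff[OF uz u, of z] sq_int_translate(2)[OF u, of z] by simp
  have W0: "W z \<ge> 0" for z by (simp add: W_def)
  have pt: "ennreal ((conv \<kappa> u x - m * u x)\<^sup>2) \<le> (\<integral>\<^sup>+z. ennreal ((u (x - z) - u x)\<^sup>2 * \<kappa> z) \<partial>lborel) * ennreal m" for x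
  proof -
    have i1: "integrable lborel (\<lambda>z. u (x - z) * \<kappa> z)"
      by (rule sq_int_mult[OF sq_int_reflect[OF u] \<kappa>(1)])
    have i2: "integrable lborel (\<lambda>z. (u (x - z) - u x) * \<kappa> z)"
      using i1 \<kappa>(2) by (simp add: left_diff_distrib)
    have "(\<integral>z. (u (x - z) - u x) * \<kappa> z \<partial>lborel) = (\<integral>z. u (x - z) * \<kappa> z - u x * \<kappa> z \<partial>lborel)"
      by (simp only: left_diff_distrib)
    also have "\<dots> = conv \<kappa> u x - m * u x"
      using i1 \<kappa>(2) by (subst Bochner_Integration.integral_diff) (auto simp: m_def conv_swap)
    finally have "conv \<kappa> u x - m * u x = (\<integral>z. (u (x - z) - u x) * \<kappa> z \<partial>lborel)" ..
    then have "ennreal \<bar>conv \<kappa> u x - m * u x\<bar> \<le> (\<integral>\<^sup>+z. ennreal (\<bar>u (x - z) - u x\<bar> * \<kappa> z) \<partial>lborel)"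
      using integral_norm_bound_ennreal[OF i2] by (simp add: abs_mult abs_of_nonneg[OF \<kappa>(3)])
    also have "\<dots> = (\<integral>\<^sup>+z. ennreal (\<bar>u (x - z) - u x\<bar> * sqrt (\<kappa> z)) * ennreal (sqrt (\<kappa> z)) \<partial>lborel)"
      using \<kappa>(3) by (intro nn_integral_cong) (simp add: ennreal_mult'[symmetric] mult.assoc)
    finally have "(ennreal \<bar>conv \<kappa> u x - m * u x\<bar>)\<^sup>2 \<le> (\<integral>\<^sup>+z. ennreal (\<bar>u (x - z) - u x\<bar> * sqrt (\<kappa> z)) * ennreal (sqrt (\<kappa> z)) \<partial>lborel)\<^sup>2"
      by (rule power_mono) simp
    also have "\<dots> \<le> (\<integral>\<^sup>+z. (ennreal (\<bar>u (x - z) - u x\<bar> * sqrt (\<kappa> z)))\<^sup>2 \<partial>lborel) * (\<integral>\<^sup>+z. (ennreal (sqrt (\<kappa> z)))\<^sup>2 \<partial>lborel)"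
      by (rule Cauchy_Schwarz_nn_integral) measurable
    also have "(\<integral>\<^sup>+z. (ennreal (\<bar>u (x - z) - u x\<bar> * sqrt (\<kappa> z)))\<^sup>2 \<partial>lborel) = (\<integral>\<^sup>+z. ennreal ((u (x - z) - u x)\<^sup>2 * \<kappa> z) \<partial>lborel)"
      using \<kappa>(3) by (intro nn_integral_cong) (simp add: ennreal_power power_mult_distrib)
    also have "(\<integral>\<^sup>+z. (ennreal (sqrt (\<kappa> z)))\<^sup>2 \<partial>lborel) = ennreal m"
      using \<kappa> by (simp add: ennreal_power nn_integral_eq_integral m_def)
    finally show ?thesis by (simp add: ennreal_power)
  qed
  have "(\<integral>\<^sup>+x. ennreal ((conv \<kappa> u x - m * u x)\<^sup>2) \<partial>lborel) \<le>
      (\<integral>\<^sup>+x. (\<integral>\<^sup>+z. ennreal ((u (x - z) - u x)\<^sup>2 * \<kappa> z) \<partial>lborel) * ennreal m \<partial>lborel)"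
    by (intro nn_integral_mono pt)
  also have "\<dots> = (\<integral>\<^sup>+x. (\<integral>\<^sup>+z. ennreal ((u (x - z) - u x)\<^sup>2 * \<kappa> z) \<partial>lborel) \<partial>lborel) * ennreal m"
    by (rule nn_integral_multc) measurable
  also have "(\<integral>\<^sup>+x. (\<integral>\<^sup>+z. ennreal ((u (x - z) - u x)\<^sup>2 * \<kappa> z) \<partial>lborel) \<partial>lborel) =
      (\<integral>\<^sup>+z. (\<integral>\<^sup>+x. ennreal ((u (x - z) - u x)\<^sup>2 * \<kappa> z) \<partial>lborel) \<partial>lborel)"
    by (rule lborel_pair.Fubini'[symmetric]) measurable
  also have "\<dots> = (\<integral>\<^sup>+z. ennreal ((W z)\<^sup>2 * \<kappa> z) \<partial>lborel)"
  proof (intro nn_integral_cong)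
    fix z
    have "(\<integral>\<^sup>+x. ennreal ((u (x - z) - u x)\<^sup>2 * \<kappa> z) \<partial>lborel) = (\<integral>\<^sup>+x. ennreal ((u (x - z) - u x)\<^sup>2) * ennreal (\<kappa> z) \<partial>lborel)"
      using \<kappa>(3) by (simp add: ennreal_mult')
    also have "\<dots> = ennreal ((W z)\<^sup>2) * ennreal (\<kappa> z)"
      using nn_integral_sq_int[OF sq_int_diff[OF uz u]] by (simp add: nn_integral_multc W_def)
    finally show "(\<integral>\<^sup>+x. ennreal ((u (x - z) - u x)\<^sup>2 * \<kappa> z) \<partial>lborel) = ennreal ((W z)\<^sup>2 * \<kappa> z)"
      using \<kappa>(3) by (simp add: ennreal_mult')
  qed
  \<comment> \<open>Small translations cost at most \<open>e\<close>. For the others only W \<le> 2U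
    is known, and its square puts the factor 4 in front of the tail mass.\<close>
  also have "\<dots> \<le> (\<integral>\<^sup>+z. ennreal (e\<^sup>2 * \<kappa> z + 4 * U\<^sup>2 * (\<kappa> z * indicator {z. norm z \<ge> d} z)) \<partial>lborel)"
  proof (intro nn_integral_mono ennreal_leI)
    fix z
    show "(W z)\<^sup>2 * \<kappa> z \<le> e\<^sup>2 * \<kappa> z + 4 * U\<^sup>2 * (\<kappa> z * indicator {z. norm z \<ge> d} z)"
    proof (cases "norm z < d")
      case True
      have "(W z)\<^sup>2 \<le> e\<^sup>2" using e(2)[OF True] W0 by (intro power_mono) (auto simp: W_def)
      then show ?thesis using True \<kappa>(3)[of z] by (simp add: mult_right_mono)
    next
      case False
      have "(W z)\<^sup>2 \<le> (2 * U)\<^sup>2" using W2 W0 by (intro power_mono) auto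
      then have "(W z)\<^sup>2 * \<kappa> z \<le> 4 * U\<^sup>2 * \<kappa> z" using \<kappa>(3)[of z] by (intro mult_right_mono) (auto simp: power_mult_distrib)
      then show ?thesis using False \<kappa>(3)[of z] by (simp add: add_increasing)
    qed
  qed
  also have "\<dots> = ennreal (\<integral>z. e\<^sup>2 * \<kappa> z + 4 * U\<^sup>2 * (\<kappa> z * indicator {z. norm z \<ge> d} z) \<partial>lborel)"
    using \<kappa> by (intro nn_integral_eq_integral)
      (auto intro!: Bochner_Integration.integrable_add integrable_mult_right integrable_mult_indicator[where f=\<kappa>, simplified mult.commute] add_nonneg_nonneg mult_nonneg_nonneg simp: integrable_real_mult_indicator)
  also have "(\<integral>z. e\<^sup>2 * \<kappa> z + 4 * U\<^sup>2 * (\<kappa> z * indicator {z. norm z \<ge> d} z) \<partial>lborel) =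
      e\<^sup>2 * m + 4 * U\<^sup>2 * (\<integral>z. \<kappa> z * indicator {z. norm z \<ge> d} z \<partial>lborel)"
    using \<kappa>(2) by (simp add: integrable_real_mult_indicator m_def)
  also have "ennreal \<dots> * ennreal m \<le> ennreal B"
  proof -
    have "(e\<^sup>2 * m + 4 * U\<^sup>2 * (\<integral>z. \<kappa> z * indicator {z. norm z \<ge> d} z \<partial>lborel)) * m \<le> (e\<^sup>2 * M + 4 * U\<^sup>2 * T) * M"
      using m T T0 by (intro mult_mono add_mono mult_left_mono) (auto intro!: add_nonneg_nonneg mult_nonneg_nonneg)
    then show ?thesis
      unfolding ennreal_mult''[OF m(1), symmetric] B_def by (intro ennreal_leI) (simp add: mult.commute)
  qed
  finally have "(\<integral>\<^sup>+x. ennreal ((conv \<kappa> u x - m * u x)\<^sup>2) \<partial>lborel) \<le> ennreal ((sqrt B)\<^sup>2)"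
    using B by (simp add: mult_right_mono)
  then show "(\<lambda>x. conv \<kappa> u x - (\<integral>z. \<kappa> z \<partial>lborel) * u x) \<in> sq_int lborel"
    "l2n lborel (\<lambda>x. conv \<kappa> u x - (\<integral>z. \<kappa> z \<partial>lborel) * u x) \<le> sqrt (M * (e\<^sup>2 * M + 4 * (l2n lborel u)\<^sup>2 * T))"
    using sq_intI_nn[of "\<lambda>x. conv \<kappa> u x - m * u x" lborel "sqrt B"] B by (auto simp: m_def B_def U_def)
qed

text \<open>The kernels are not normalised: their masses are merely bounded, and the convolution is
  compared with the actual mass times \<open>u\<close>. For the kernels \<open>ckern\<close> of the
  potential estimate only an upper bound of the mass is established.\<close>

lemma conv_approx_identity:
  fixes u :: "real^3 \<Rightarrow> real" and \<kappa> :: "nat \<Rightarrow> real^3 \<Rightarrow> real"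
  assumes u: "u \<in> sq_int lborel" and \<kappa>: "\<And>n. \<kappa> n \<in> sq_int lborel" "\<And>n. integrable lborel (\<kappa> n)" "\<And>n z. \<kappa> n z \<ge> 0"
    and M: "\<And>n. (\<integral>z. \<kappa> n z \<partial>lborel) \<le> M"
    and T: "\<And>d. d > 0 \<Longrightarrow> (\<lambda>n. \<integral>z. \<kappa> n z * indicator {z. norm z \<ge> d} z \<partial>lborel) \<longlonglongrightarrow> 0"
  shows "(\<lambda>x. conv (\<kappa> n) u x - (\<integral>z. \<kappa> n z \<partial>lborel) * u x) \<in> sq_int lborel"
    "(\<lambda>n. l2n lborel (\<lambda>x. conv (\<kappa> n) u x - (\<integral>z. \<kappa> n z \<partial>lborel) * u x)) \<longlonglongrightarrow> 0"
proof -
  obtain d where d: "d > 0" "\<And>z. norm z < d \<Longrightarrow> l2n lborel (\<lambda>x. u (x - z) - u x) \<le> 1"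
    by (rule translation_continuous[OF u zero_less_one]) blast
  show "(\<lambda>x. conv (\<kappa> n) u x - (\<integral>z. \<kappa> n z \<partial>lborel) * u x) \<in> sq_int lborel"
    by (rule conv_approx(1)[OF u \<kappa> M _ d(2) order_refl]) auto
  have M0: "M \<ge> 0" using M[of 0] \<kappa>(3) by (meson Bochner_Integration.integral_nonneg order_trans)
  show "(\<lambda>n. l2n lborel (\<lambda>x. conv (\<kappa> n) u x - (\<integral>z. \<kappa> n z \<partial>lborel) * u x)) \<longlonglongrightarrow> 0"
  proof (rule order_tendstoI)
    fix a :: real assume "a > 0"
    define e where "e = a / (2 * (M + 1))"
    have e: "e > 0" using \<open>a > 0\<close> M0 by (simp add: e_def)
    obtain d where d: "d > 0" "\<And>z. norm z < d \<Longrightarrow> l2n lborel (\<lambda>x. u (x - z) - u x) \<le> e"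
      by (rule translation_continuous[OF u e]) blast
    have "(\<lambda>n. sqrt (M * (e\<^sup>2 * M + 4 * (l2n lborel u)\<^sup>2 * (\<integral>z. \<kappa> n z * indicator {z. norm z \<ge> d} z \<partial>lborel))))
        \<longlonglongrightarrow> sqrt (M * (e\<^sup>2 * M + 4 * (l2n lborel u)\<^sup>2 * 0))"
      by (intro tendsto_intros T d)
    moreover have "sqrt (M * (e\<^sup>2 * M + 4 * (l2n lborel u)\<^sup>2 * 0)) < a"
    proof -
      have "M * (e\<^sup>2 * M) = (e * M)\<^sup>2" by (simp add: power2_eq_square)
      then have "sqrt (M * (e\<^sup>2 * M + 4 * (l2n lborel u)\<^sup>2 * 0)) = e * M" using e M0 by simp
      also have "\<dots> \<le> e * (M + 1)" using e by simp
      also have "\<dots> < a" using \<open>a > 0\<close> M0 by (simp add: e_def field_simps add_pos_nonneg)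
      finally show ?thesis .
    qed
    ultimately have "\<forall>\<^sub>F n in sequentially. sqrt (M * (e\<^sup>2 * M + 4 * (l2n lborel u)\<^sup>2 * (\<integral>z. \<kappa> n z * indicator {z. norm z \<ge> d} z \<partial>lborel))) < a"
      by (rule order_tendstoD(2))
    then show "\<forall>\<^sub>F n in sequentially. l2n lborel (\<lambda>x. conv (\<kappa> n) u x - (\<integral>z. \<kappa> n z \<partial>lborel) * u x) < a"
    proof eventually_elim
      case (elim n)
      then show ?case
        using conv_approx(2)[where d=d, OF u \<kappa>[of n] M[of n] less_imp_le[OF e] d(2) order_refl] by linarith
    qed
  next
    fix a :: real assume "a < 0"
    then show "\<forall>\<^sub>F n in sequentially. a < l2n lborel (\<lambda>x. conv (\<kappa> n) u x - (\<integral>z. \<kappa> n z \<partial>lborel) * u x)"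
      by (intro always_eventually allI less_le_trans[OF _ l2n_nonneg])
  qed
qed

section \<open>Smoothness of convolutions\<close>

lemma test_Lipschitz:
  assumes "\<eta> \<in> test_functions \<Omega>"
  obtains L where "L > 0" "\<And>a b. \<bar>\<eta> a - \<eta> b\<bar> \<le> L * norm (a - b)"
proof -
  have "\<exists>M. \<forall>x. \<bar>pderiv i \<eta> x\<bar> \<le> M" for i
    using test_bounded[OF test_pderiv[OF assms]] by metis
  then obtain M where M: "\<And>i x. \<bar>pderiv i \<eta> x\<bar> \<le> M i" by metis
  define L where "L = (\<Sum>i\<in>UNIV. M i) + 1"
  have M0: "M i \<ge> 0" for i using M[of i 0] by linarith
  have L: "L > 0" using M0 by (auto simp: L_def intro!: add_nonneg_pos sum_nonneg)
  have "norm (\<eta> a - \<eta> b) \<le> L * norm (a - b)" for a b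
  proof (rule differentiable_bound[of UNIV])
    show "(\<eta> has_derivative (\<lambda>h. \<Sum>i\<in>UNIV. h $ i * pderiv i \<eta> x)) (at x within UNIV)" for x
      using pderiv_has_derivative[OF smooth_differentiable[OF test_smooth[OF assms]]] by simp
    show "onorm (\<lambda>h. \<Sum>i\<in>UNIV. h $ i * pderiv i \<eta> x) \<le> L" for x
    proof (rule onorm_bound)
      fix h :: "real^3"
      have "norm (\<Sum>i\<in>UNIV. h $ i * pderiv i \<eta> x) \<le> (\<Sum>i\<in>UNIV. M i * norm h)"
        using M component_le_norm_cart[of h] M0
        by (intro sum_norm_le) (simp add: abs_mult mult.commute[of "\<bar>h $ _\<bar>"] mult_mono)
      also have "\<dots> \<le> L * norm h" by (simp add: L_def sum_distrib_right[symmetric] distrib_right)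
      finally show "norm (\<Sum>i\<in>UNIV. h $ i * pderiv i \<eta> x) \<le> L * norm h" .
    qed (use L in simp)
  qed auto
  then show ?thesis using that[OF L] by simp
qed

text \<open>Differentiation under the integral sign, tested along sequences tending to 0. The
  first-order remainder of \<open>\<eta>\<close>, divided by the increment, tends to 0 pointwise; it
  is bounded by the Lipschitz constant plus the bounds of the derivatives, and it vanishes off a
  ball around \<open>x\<close> of radius R + K, where K bounds the increments. The product of |u|
  with this majorant is integrable by Cauchy-Schwarz.\<close>

lemma conv_has_derivative:
  assumes u: "u \<in> sq_int lborel" and \<eta>: "\<eta> \<in> test_functions UNIV"
  shows "(conv \<eta> u has_derivative (\<lambda>h. \<Sum>i\<in>UNIV. h $ i * conv (pderiv i \<eta>) u x)) (at x)"
  unfolding has_derivative_at tendsto_at_iff_sequentially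
proof (intro conjI allI impI)
  show "bounded_linear (\<lambda>h::real^3. \<Sum>i\<in>UNIV. h $ i * conv (pderiv i \<eta>) u x)"
    by (auto simp: linear_conv_bounded_linear[symmetric] sum.distrib sum_distrib_left algebra_simps intro!: linearI)
  fix X :: "nat \<Rightarrow> real^3" assume X: "\<forall>n. X n \<in> UNIV - {0}" "X \<longlonglongrightarrow> 0"
  have [measurable]: "u \<in> borel_measurable borel" using sq_int_meas[OF u] by simp
  have s\<eta>: "smooth \<eta>" using \<eta> test_smooth by blast
  have [measurable]: "\<eta> \<in> borel_measurable borel" "pderiv i \<eta> \<in> borel_measurable borel" for i
    using s\<eta> smooth_pderiv by (auto intro: smooth_borel)
  define D where "D a h = (\<Sum>i\<in>UNIV. h $ i * pderiv i \<eta> a)" for a h :: "real^3"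
  define r where "r n y = (\<eta> (x + X n - y) - \<eta> (x - y) - D (x - y) (X n)) / norm (X n)" for n y
  have int: "integrable lborel (\<lambda>y. u y * \<zeta> (a - y))" if "\<zeta> \<in> test_functions UNIV" for \<zeta> a
    by (rule sq_int_mult[OF u sq_int_reflect[OF test_sq_int[OF that]]])
  have eq: "(conv \<eta> u (x + X n) - conv \<eta> u x - (\<Sum>i\<in>UNIV. X n $ i * conv (pderiv i \<eta>) u x)) / norm (X n) =
      (\<integral>y. u y * r n y \<partial>lborel)" for n
  proof -
    have i3: "integrable lborel (\<lambda>y. \<Sum>i\<in>UNIV. X n $ i * (u y * pderiv i \<eta> (x - y)))"
      by (intro Bochner_Integration.integrable_sum integrable_mult_right int test_pderiv \<eta>)
    have "(\<Sum>i\<in>UNIV. X n $ i * conv (pderiv i \<eta>) u x) = (\<integral>y. (\<Sum>i\<in>UNIV. X n $ i * (u y * pderiv i \<eta> (x - y))) \<partial>lborel)"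
      unfolding conv_def using int[OF test_pderiv[OF \<eta>]]
      by (subst Bochner_Integration.integral_sum) auto
    then have "conv \<eta> u (x + X n) - conv \<eta> u x - (\<Sum>i\<in>UNIV. X n $ i * conv (pderiv i \<eta>) u x) =
        (\<integral>y. u y * \<eta> (x + X n - y) - u y * \<eta> (x - y) - (\<Sum>i\<in>UNIV. X n $ i * (u y * pderiv i \<eta> (x - y))) \<partial>lborel)"
      using int[OF \<eta>] i3 by (simp add: conv_def)
    also have "\<dots> = (\<integral>y. norm (X n) * (u y * r n y) \<partial>lborel)"
    proof (rule Bochner_Integration.integral_cong[OF refl])
      fix y
      have "norm (X n) * (u y * r n y) = u y * (\<eta> (x + X n - y) - \<eta> (x - y) - D (x - y) (X n))"
        using X(1) by (simp add: r_def)
      then show "u y * \<eta> (x + X n - y) - u y * \<eta> (x - y) - (\<Sum>i\<in>UNIV. X n $ i * (u y * pderiv i \<eta> (x - y))) =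
          norm (X n) * (u y * r n y)"
        by (simp add: D_def right_diff_distrib sum_distrib_left mult.left_commute)
    qed
    finally show ?thesis using X(1) by simp
  qed
  obtain L where L: "L > 0" "\<And>a b. \<bar>\<eta> a - \<eta> b\<bar> \<le> L * norm (a - b)"
    using test_Lipschitz[OF \<eta>] by metis
  have "\<exists>M. \<forall>x. \<bar>pderiv i \<eta> x\<bar> \<le> M" for i
    using test_bounded[OF test_pderiv[OF \<eta>]] by metis
  then obtain M where M: "\<And>i x. \<bar>pderiv i \<eta> x\<bar> \<le> M i" by metis
  have M0: "M i \<ge> 0" for i using M[of i 0] by linarith
  obtain R where R: "R > 0" "\<And>x. norm x > R \<Longrightarrow> \<eta> x = 0" using test_bounded_support[OF \<eta>] by metis
  obtain K where K: "K > 0" "\<And>n. norm (X n) \<le> K"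
    using convergent_imp_Bseq[OF convergentI[OF X(2)]] unfolding Bseq_def by auto
  have p0: "pderiv i \<eta> z = 0" if "norm z > R" for i z
  proof -
    have "(\<eta> has_derivative (\<lambda>h. 0)) (at z)"
    proof (rule has_derivative_transform_within_open[OF has_derivative_const[of 0]])
      show "open (- cball (0::real^3) R)" by (rule open_Compl) simp
    qed (use R that in \<open>auto simp: not_le\<close>)
    then show ?thesis by (simp add: pderiv_eq)
  qed
  define C where "C = L + (\<Sum>i\<in>UNIV. M i)"
  have C: "C \<ge> 0" using L(1) M0 by (auto simp: C_def intro!: add_nonneg_nonneg sum_nonneg)
  define w where "w y = C * indicator (cball 0 (R + K)) (x - y)" for y
  have w: "w \<in> sq_int lborel"
    unfolding w_def by (rule sq_int_reflect[OF sq_int_indicator_cball])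
  have rb: "\<bar>r n y\<bar> \<le> w y" for n y
  proof (cases "norm (x - y) \<le> R + K")
    case True
    have nX: "norm (X n) > 0" using X(1) by simp
    have "\<bar>D (x - y) (X n)\<bar> \<le> (\<Sum>i\<in>UNIV. M i * norm (X n))"
    proof -
      have "\<bar>X n $ i * pderiv i \<eta> (x - y)\<bar> \<le> M i * norm (X n)" for i
        using mult_mono[OF component_le_norm_cart[of "X n" i] M[of i "x - y"]] by (simp add: abs_mult mult.commute)
      then show ?thesis
        unfolding D_def by (intro order_trans[OF sum_abs] sum_mono)
    qed
    moreover have "\<bar>\<eta> (x + X n - y) - \<eta> (x - y)\<bar> \<le> L * norm (X n)"
      using L(2)[of "x + X n - y" "x - y"] by simp
    ultimately have "\<bar>\<eta> (x + X n - y) - \<eta> (x - y) - D (x - y) (X n)\<bar> \<le> C * norm (X n)"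
      by (simp add: C_def distrib_right sum_distrib_right)
    then have "\<bar>r n y\<bar> \<le> C" using nX by (simp add: r_def pos_divide_le_eq)
    then show ?thesis using True by (simp add: w_def)
  next
    case False
    have "norm (x - y) \<le> norm (x + X n - y) + norm (X n)"
      by (metis add_diff_cancel add_diff_eq diff_add_eq norm_triangle_ineq4)
    then have "norm (x + X n - y) > R" "norm (x - y) > R" using False K(1) K(2)[of n] by linarith+
    then have "r n y = 0" using R(2) p0 by (simp add: r_def D_def)
    then show ?thesis using C by (simp add: w_def)
  qed
  have "(\<lambda>n. \<integral>y. u y * r n y \<partial>lborel) \<longlonglongrightarrow> (\<integral>y. 0 \<partial>(lborel::(real^3) measure))"
  proof (rule integral_dominated_convergence[where w="\<lambda>y. \<bar>u y\<bar> * w y"])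
    show "integrable lborel (\<lambda>y. \<bar>u y\<bar> * w y)"
      by (rule sq_int_mult[OF sq_int_abs[OF u] w])
    show "AE y in lborel. norm (u y * r n y) \<le> \<bar>u y\<bar> * w y" for n
      using rb by (auto simp: abs_mult intro!: mult_left_mono)
    show "AE y in lborel. (\<lambda>n. u y * r n y) \<longlonglongrightarrow> 0"
    proof (rule AE_I2)
      fix y
      have "(\<eta> has_derivative D (x - y)) (at (x - y))"
        unfolding D_def[abs_def] by (rule pderiv_has_derivative[OF smooth_differentiable[OF s\<eta>]])
      then have "((\<lambda>h. norm (\<eta> (x - y + h) - \<eta> (x - y) - D (x - y) h) / norm h) \<longlongrightarrow> 0) (at 0)"
        unfolding has_derivative_at by blast
      then have "(\<lambda>n. norm (\<eta> (x - y + X n) - \<eta> (x - y) - D (x - y) (X n)) / norm (X n)) \<longlonglongrightarrow> 0"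
        unfolding tendsto_at_iff_sequentially using X by (auto simp: o_def)
      then have "(\<lambda>n. \<bar>r n y\<bar>) \<longlonglongrightarrow> 0"
        by (simp add: r_def diff_add_eq)
      then have "(\<lambda>n. r n y) \<longlonglongrightarrow> 0" by (simp add: tendsto_rabs_zero_iff)
      then show "(\<lambda>n. u y * r n y) \<longlonglongrightarrow> 0" by (rule tendsto_mult_right_zero)
    qed
    show "(\<lambda>y. u y * r n y) \<in> borel_measurable lborel" for n
      unfolding r_def D_def by measurable
  qed auto
  then have "(\<lambda>n. \<bar>(conv \<eta> u (x + X n) - conv \<eta> u x - (\<Sum>i\<in>UNIV. X n $ i * conv (pderiv i \<eta>) u x)) / norm (X n)\<bar>) \<longlonglongrightarrow> 0"
    unfolding eq by (simp add: tendsto_rabs_zero_iff)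
  then show "((\<lambda>h. norm (conv \<eta> u (x + h) - conv \<eta> u x - (\<Sum>i\<in>UNIV. h $ i * conv (pderiv i \<eta>) u x)) / norm h) \<circ> X) \<longlonglongrightarrow> 0"
    by (simp add: o_def)
qed

lemma pderiv_conv:
  assumes "u \<in> sq_int lborel" "\<eta> \<in> test_functions UNIV"
  shows "pderiv i (conv \<eta> u) = conv (pderiv i \<eta>) u"
  by (rule ext, subst pderiv_eq[OF conv_has_derivative[OF assms]]) (simp add: sum_axis)

lemma C_k_conv:
  assumes "u \<in> sq_int lborel"
  shows "\<eta> \<in> test_functions UNIV \<Longrightarrow> C_k k (conv \<eta> u)"
proof (induction k arbitrary: \<eta>)
  case 0
  then show ?case
    using conv_has_derivative[OF assms 0]
    by (auto intro!: continuous_at_imp_continuous_on has_derivative_continuous)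
next
  case (Suc k)
  then show ?case
    using conv_has_derivative[OF assms Suc.prems]
    by (auto simp: pderiv_conv assms differentiable_def intro!: Suc.IH test_pderiv)
qed

lemma smooth_conv: "u \<in> sq_int lborel \<Longrightarrow> \<eta> \<in> test_functions UNIV \<Longrightarrow> smooth (conv \<eta> u)"
  by (simp add: smooth_def C_k_conv)

section \<open>Mollifiers\<close>

definition mollifier :: "nat \<Rightarrow> real^3 \<Rightarrow> real" where
  "mollifier n x = bump (real (Suc n) *\<^sub>R x) / (\<integral>y. bump (real (Suc n) *\<^sub>R y) \<partial>lborel)"

lemma mollifier_zero: "norm x \<ge> 1 / real (Suc n) \<Longrightarrow> mollifier n x = 0"
  by (simp add: mollifier_def bump_zero field_simps del: of_nat_Suc)

lemma bump_integral_pos: "(\<integral>y. bump (real (Suc n) *\<^sub>R y) \<partial>lborel) > 0"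
proof -
  have i: "integrable lborel (\<lambda>y. bump (real (Suc n) *\<^sub>R y))"
    using lborel_integrable_affine[OF test_integrable[OF test_bump], of "real (Suc n)" 0] by simp
  have "\<not> (AE y in lborel. bump (real (Suc n) *\<^sub>R y) = 0)"
  proof
    assume "AE y in lborel. bump (real (Suc n) *\<^sub>R y) = 0"
    then have "AE y in lborel. y \<notin> ball (0::real^3) (1 / real (Suc n))"
    proof eventually_elim
      case (elim y)
      then have "\<not> norm (real (Suc n) *\<^sub>R y) < 1"
        using bump_pos[of "real (Suc n) *\<^sub>R y"] by simp
      then show ?case by (simp add: field_simps del: of_nat_Suc)
    qed
    then have "emeasure lborel (ball (0::real^3) (1 / real (Suc n))) = 0"
      by (subst (asm) AE_iff_measurable[of "ball 0 (1 / real (Suc n))"]) (auto simp del: of_nat_Suc)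
    then show False
      using emeasure_ball[of "1 / real (Suc n)" "0::real^3"] unit_ball_vol_pos[of "real DIM(real^3)"] by simp
  qed
  then have "(\<integral>y. bump (real (Suc n) *\<^sub>R y) \<partial>lborel) \<noteq> 0"
    using integral_nonneg_eq_0_iff_AE[OF i] bump_nonneg by simp
  moreover have "(\<integral>y. bump (real (Suc n) *\<^sub>R y) \<partial>lborel) \<ge> 0"
    using bump_nonneg by simp
  ultimately show ?thesis by linarith
qed

lemma mollifier_nonneg: "mollifier n x \<ge> 0"
  using bump_integral_pos[of n] bump_nonneg by (simp add: mollifier_def)

lemma mollifier_test: "mollifier n \<in> test_functions UNIV"
proof (rule test_functionsI[of _ "cball 0 (1 / real (Suc n))"])
  have "smooth (\<lambda>x. (1 / (\<integral>y. bump (real (Suc n) *\<^sub>R y) \<partial>lborel)) * bump (0 + real (Suc n) *\<^sub>R x))"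
    by (intro smooth_mult smooth_const smooth_affine smooth_bump)
  then show "smooth (mollifier n)" by (simp add: mollifier_def[abs_def])
qed (auto intro: mollifier_zero)

lemma mollifier_integral: "(\<integral>x. mollifier n x \<partial>lborel) = 1"
  using bump_integral_pos[of n] by (simp add: mollifier_def)

lemma mollify_tendsto:
  assumes u: "u \<in> sq_int lborel"
  shows "conv (mollifier n) u \<in> sq_int lborel"
    "(\<lambda>n. l2n lborel (\<lambda>x. conv (mollifier n) u x - u x)) \<longlonglongrightarrow> 0"
proof -
  have T: "(\<lambda>n. \<integral>z. mollifier n z * indicator {z. norm z \<ge> d} z \<partial>lborel) \<longlonglongrightarrow> 0" if d: "d > 0" for d
  proof (rule tendsto_eventually)
    obtain N where N: "1 / real (Suc N) < d" by (rule nat_approx_posE[OF d])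
    show "\<forall>\<^sub>F n in sequentially. (\<integral>z. mollifier n z * indicator {z. norm z \<ge> d} z \<partial>lborel) = 0"
    proof (rule eventually_sequentiallyI[of N])
      fix n assume "N \<le> n"
      then have "1 / real (Suc n) \<le> 1 / real (Suc N)" by (simp add: frac_le)
      then have "mollifier n z * indicator {z. norm z \<ge> d} z = 0" for z
        using N mollifier_zero[of n z] by (cases "norm z \<ge> d") auto
      then show "(\<integral>z. mollifier n z * indicator {z. norm z \<ge> d} z \<partial>lborel) = 0"
        by (simp only: integral_zero)
    qed
  qed
  note * = conv_approx_identity[OF u test_sq_int[OF mollifier_test] test_integrable[OF mollifier_test] mollifier_nonneg
      eq_refl[OF mollifier_integral] T, unfolded mollifier_integral, simplified]
  show "(\<lambda>n. l2n lborel (\<lambda>x. conv (mollifier n) u x - u x)) \<longlonglongrightarrow> 0"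
    by (rule *(2))
  show "conv (mollifier n) u \<in> sq_int lborel"
    using sq_int_add[OF *(1)[of n] u] by simp
qed

section \<open>The Sobolev space of the whole space\<close>

text \<open>The derivatives are an explicit argument and everything is Borel with respect to
  \<open>lborel\<close>. Calculus in H^1 can then be done with formulas for the derivatives instead
  of the chosen representatives \<open>weak_pderiv\<close>.\<close>

definition H1 :: "(real^3 \<Rightarrow> real) \<Rightarrow> (3 \<Rightarrow> real^3 \<Rightarrow> real) \<Rightarrow> bool" where
  "H1 u D \<longleftrightarrow> u \<in> sq_int lborel \<and> (\<forall>i. D i \<in> sq_int lborel) \<and>
     (\<forall>i. \<forall>\<phi>\<in>test_functions UNIV. (\<integral>x. u x * pderiv i \<phi> x \<partial>lborel) = - (\<integral>x. D i x * \<phi> x \<partial>lborel))"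

text \<open>Equivalent to the Hilbert norm, with a trivial triangle inequality.\<close>

definition h1n :: "(real^3 \<Rightarrow> real) \<Rightarrow> (3 \<Rightarrow> real^3 \<Rightarrow> real) \<Rightarrow> real" where
  "h1n u D = l2n lborel u + (\<Sum>i\<in>UNIV. l2n lborel (D i))"

lemma H1_D:
  assumes "H1 u D"
  shows "u \<in> sq_int lborel" "D i \<in> sq_int lborel"
    "\<phi> \<in> test_functions UNIV \<Longrightarrow> (\<integral>x. u x * pderiv i \<phi> x \<partial>lborel) = - (\<integral>x. D i x * \<phi> x \<partial>lborel)"
  using assms by (auto simp: H1_def)

lemma H1_meas [measurable_dest]:
  assumes "H1 u D"
  shows "u \<in> borel_measurable borel" "D i \<in> borel_measurable borel"
  using sq_int_meas[OF H1_D(1)[OF assms]] sq_int_meas[OF H1_D(2)[OF assms]] by auto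

lemma h1n_nonneg [simp]: "0 \<le> h1n u D"
  by (simp add: h1n_def add_nonneg_nonneg sum_nonneg)

lemma l2n_le_h1n: "l2n lborel u \<le> h1n u D" "l2n lborel (D i) \<le> h1n u D"
proof -
  have "l2n lborel (D i) \<le> (\<Sum>i\<in>UNIV. l2n lborel (D i))"
    by (rule member_le_sum) auto
  then show "l2n lborel (D i) \<le> h1n u D"
    using l2n_nonneg[of lborel u] unfolding h1n_def by linarith
qed (simp add: h1n_def sum_nonneg)

lemma H1_add:
  assumes "H1 u D" "H1 v E"
  shows "H1 (\<lambda>x. u x + v x) (\<lambda>i x. D i x + E i x)"
  unfolding H1_def
proof (intro conjI allI ballI)
  fix i \<phi> assume \<phi>: "\<phi> \<in> test_functions (UNIV :: (real^3) set)"
  note t = test_sq_int[OF \<phi>] test_sq_int[OF test_pderiv[OF \<phi>, of i]]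
  show "(\<integral>x. (u x + v x) * pderiv i \<phi> x \<partial>lborel) = - (\<integral>x. (D i x + E i x) * \<phi> x \<partial>lborel)"
    using H1_D(3)[OF assms(1) \<phi>, of i] H1_D(3)[OF assms(2) \<phi>, of i]
      sq_int_mult[OF H1_D(1)[OF assms(1)] t(2)] sq_int_mult[OF H1_D(1)[OF assms(2)] t(2)]
      sq_int_mult[OF H1_D(2)[OF assms(1)] t(1), of i] sq_int_mult[OF H1_D(2)[OF assms(2)] t(1), of i]
    by (simp add: distrib_right)
qed (intro sq_int_add H1_D(1)[OF assms(1)] H1_D(1)[OF assms(2)] H1_D(2)[OF assms(1)] H1_D(2)[OF assms(2)])+

lemma H1_cmult:
  assumes "H1 u D"
  shows "H1 (\<lambda>x. c * u x) (\<lambda>i x. c * D i x)"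
  unfolding H1_def
  using assms H1_D(3)[OF assms] by (auto simp: mult.assoc intro!: sq_int_cmult H1_D(1)[OF assms] H1_D(2)[OF assms])

lemma H1_diff:
  assumes "H1 u D" "H1 v E"
  shows "H1 (\<lambda>x. u x - v x) (\<lambda>i x. D i x - E i x)"
  using H1_add[OF assms(1) H1_cmult[OF assms(2), of "-1"]] by simp

lemma H1_zero: "H1 (\<lambda>x. 0) (\<lambda>i x. 0)"
  by (auto simp: H1_def sq_int_zero)

lemma H1_sum:
  assumes "\<And>k. k \<in> A \<Longrightarrow> H1 (u k) (D k)"
  shows "H1 (\<lambda>x. \<Sum>k\<in>A. u k x) (\<lambda>i x. \<Sum>k\<in>A. D k i x)"
  using assms by (induction A rule: infinite_finite_induct) (auto intro: H1_zero H1_add)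

lemma h1n_add:
  assumes "H1 u D" "H1 v E"
  shows "h1n (\<lambda>x. u x + v x) (\<lambda>i x. D i x + E i x) \<le> h1n u D + h1n v E"
proof -
  have "(\<Sum>i\<in>UNIV. l2n lborel (\<lambda>x. D i x + E i x)) \<le> (\<Sum>i\<in>UNIV. l2n lborel (D i) + l2n lborel (E i))"
    by (intro sum_mono l2n_triangle H1_D(2)[OF assms(1)] H1_D(2)[OF assms(2)])
  then show ?thesis
    using l2n_triangle[OF H1_D(1)[OF assms(1)] H1_D(1)[OF assms(2)]] by (simp add: h1n_def sum.distrib)
qed

lemma h1n_cmult: "h1n (\<lambda>x. c * u x) (\<lambda>i x. c * D i x) = \<bar>c\<bar> * h1n u D"
  by (simp add: h1n_def l2n_cmult sum_distrib_left distrib_left)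

lemma H1_cong_AE:
  assumes H: "H1 u D" and m: "v \<in> borel_measurable borel" "\<And>i. E i \<in> borel_measurable borel"
    and ae: "AE x in lborel. u x = v x" "\<And>i. AE x in lborel. D i x = E i x"
  shows "H1 v E"
  unfolding H1_def
proof (intro conjI allI ballI)
  show "v \<in> sq_int lborel" "E i \<in> sq_int lborel" for i
    using sq_int_cong_AE[OF H1_D(1)[OF H] _ ae(1)] sq_int_cong_AE[OF H1_D(2)[OF H] _ ae(2)] m by simp_all
  fix i \<phi> assume \<phi>: "\<phi> \<in> test_functions (UNIV :: (real^3) set)"
  have [measurable]: "\<phi> \<in> borel_measurable borel" "pderiv i \<phi> \<in> borel_measurable borel"
    using \<phi> test_smooth smooth_pderiv smooth_borel by blast+
  have "(\<integral>x. v x * pderiv i \<phi> x \<partial>lborel) = (\<integral>x. u x * pderiv i \<phi> x \<partial>lborel)"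
    using ae(1) m H1_meas[OF H] by (intro integral_cong_AE) auto
  moreover have "(\<integral>x. E i x * \<phi> x \<partial>lborel) = (\<integral>x. D i x * \<phi> x \<partial>lborel)"
    using ae(2)[of i] m H1_meas[OF H] by (intro integral_cong_AE) auto
  ultimately show "(\<integral>x. v x * pderiv i \<phi> x \<partial>lborel) = - (\<integral>x. E i x * \<phi> x \<partial>lborel)"
    using H1_D(3)[OF H \<phi>] by simp
qed

lemma H1_limit:
  assumes H: "\<And>n. H1 (u n) (D n)" and u: "v \<in> sq_int lborel" "\<And>i. E i \<in> sq_int lborel"
    and lim: "(\<lambda>n. l2n lborel (\<lambda>x. u n x - v x)) \<longlonglongrightarrow> 0" "\<And>i. (\<lambda>n. l2n lborel (\<lambda>x. D n i x - E i x)) \<longlonglongrightarrow> 0"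
  shows "H1 v E"
  unfolding H1_def
proof (intro conjI allI ballI u)
  fix i \<phi> assume \<phi>: "\<phi> \<in> test_functions (UNIV :: (real^3) set)"
  have "(\<lambda>n. \<integral>x. u n x * pderiv i \<phi> x \<partial>lborel) \<longlonglongrightarrow> (\<integral>x. v x * pderiv i \<phi> x \<partial>lborel)"
    by (rule tendsto_integral_l2n[OF H1_D(1)[OF H] u(1) test_sq_int[OF test_pderiv[OF \<phi>]] lim(1)])
  moreover have "(\<lambda>n. - (\<integral>x. D n i x * \<phi> x \<partial>lborel)) \<longlonglongrightarrow> - (\<integral>x. E i x * \<phi> x \<partial>lborel)"
    by (intro tendsto_minus tendsto_integral_l2n[OF H1_D(2)[OF H] u(2) test_sq_int[OF \<phi>] lim(2)])
  ultimately show "(\<integral>x. v x * pderiv i \<phi> x \<partial>lborel) = - (\<integral>x. E i x * \<phi> x \<partial>lborel)"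
    using H1_D(3)[OF H \<phi>] by (simp add: LIMSEQ_unique)
qed

lemma H1_smooth:
  assumes "smooth u" "u \<in> sq_int lborel" "\<And>i. pderiv i u \<in> sq_int lborel"
  shows "H1 u (\<lambda>i. pderiv i u)"
  unfolding H1_def using assms by (auto simp: smooth_def simp del: C_k.simps intro!: integral_by_parts)

lemma H1_test: "\<phi> \<in> test_functions \<Omega> \<Longrightarrow> H1 \<phi> (\<lambda>i. pderiv i \<phi>)"
  by (intro H1_smooth test_smooth test_sq_int test_pderiv)

lemma test_reflect:
  assumes "\<eta> \<in> test_functions UNIV"
  shows "(\<lambda>y. \<eta> (x - y)) \<in> test_functions UNIV" "pderiv i (\<lambda>y. \<eta> (x - y)) y = - pderiv i \<eta> (x - y)"
proof -
  have s: "smooth \<eta>" using assms test_smooth by blast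
  obtain R where R: "R > 0" "\<And>x. norm x > R \<Longrightarrow> \<eta> x = 0" using test_bounded_support[OF assms] by metis
  show "(\<lambda>y. \<eta> (x - y)) \<in> test_functions UNIV"
  proof (rule test_functionsI)
    show "smooth (\<lambda>y. \<eta> (x - y))" using smooth_affine[OF s, of x "-1"] by simp
    show "y \<notin> cball x R \<Longrightarrow> \<eta> (x - y) = 0" for y using R(2)[of "x - y"] by (simp add: dist_norm)
  qed auto
  show "pderiv i (\<lambda>y. \<eta> (x - y)) y = - pderiv i \<eta> (x - y)"
    using pderiv_affine[OF smooth_differentiable[OF s], of i x "-1" y] by simp
qed

lemma pderiv_conv_H1:
  assumes H: "H1 u D" and \<eta>: "\<eta> \<in> test_functions UNIV"
  shows "pderiv i (conv \<eta> u) = conv \<eta> (D i)"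
proof
  fix x
  have "(\<integral>y. u y * pderiv i (\<lambda>y. \<eta> (x - y)) y \<partial>lborel) = - (\<integral>y. D i y * \<eta> (x - y) \<partial>lborel)"
    by (rule H1_D(3)[OF H test_reflect(1)[OF \<eta>]])
  then show "pderiv i (conv \<eta> u) x = conv \<eta> (D i) x"
    by (simp add: pderiv_conv[OF H1_D(1)[OF H] \<eta>] test_reflect(2)[OF \<eta>] conv_def)
qed

lemma mollify_H1:
  assumes H: "H1 u D"
  shows "smooth (conv (mollifier n) u)" "H1 (conv (mollifier n) u) (\<lambda>i. conv (mollifier n) (D i))"
    "pderiv i (conv (mollifier n) u) = conv (mollifier n) (D i)"
    "(\<lambda>n. h1n (\<lambda>x. conv (mollifier n) u x - u x) (\<lambda>i x. conv (mollifier n) (D i) x - D i x)) \<longlonglongrightarrow> 0"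
proof -
  show s: "smooth (conv (mollifier n) u)"
    by (intro smooth_conv H1_D(1)[OF H] mollifier_test)
  show p: "pderiv i (conv (mollifier n) u) = conv (mollifier n) (D i)" for i
    by (rule pderiv_conv_H1[OF H mollifier_test])
  show "H1 (conv (mollifier n) u) (\<lambda>i. conv (mollifier n) (D i))"
    using H1_smooth[OF s] mollify_tendsto(1)[OF H1_D(1)[OF H]] mollify_tendsto(1)[OF H1_D(2)[OF H]] by (simp add: p)
  have "(\<lambda>n. h1n (\<lambda>x. conv (mollifier n) u x - u x) (\<lambda>i x. conv (mollifier n) (D i) x - D i x)) \<longlonglongrightarrow> 0 + (\<Sum>i\<in>(UNIV :: 3 set). 0)"
    unfolding h1n_def
    by (intro tendsto_add tendsto_sum mollify_tendsto(2) H1_D(1)[OF H] H1_D(2)[OF H])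
  then show "(\<lambda>n. h1n (\<lambda>x. conv (mollifier n) u x - u x) (\<lambda>i x. conv (mollifier n) (D i) x - D i x)) \<longlonglongrightarrow> 0"
    by simp
qed

section \<open>Smooth approximation and uniqueness of weak derivatives\<close>

lemma H1_smooth_approx:
  assumes H: "H1 u D" and e: "e > 0"
  obtains v where "smooth v" "H1 v (\<lambda>i. pderiv i v)" "h1n (\<lambda>x. v x - u x) (\<lambda>i x. pderiv i v x - D i x) < e"
proof -
  have "\<forall>\<^sub>F n in sequentially. h1n (\<lambda>x. conv (mollifier n) u x - u x) (\<lambda>i x. conv (mollifier n) (D i) x - D i x) < e"
    by (rule order_tendstoD(2)[OF mollify_H1(4)[OF H] e])
  then obtain n where n: "h1n (\<lambda>x. conv (mollifier n) u x - u x) (\<lambda>i x. conv (mollifier n) (D i) x - D i x) < e"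
    using eventually_happens'[OF sequentially_bot] by blast
  have "(\<lambda>i. pderiv i (conv (mollifier n) u)) = (\<lambda>i. conv (mollifier n) (D i))"
    by (rule ext) (rule mollify_H1(3)[OF H])
  then show ?thesis
    using n mollify_H1(1,2)[OF H, of n] mollify_H1(3)[OF H, of _ n]
    by (intro that[of "conv (mollifier n) u"]) simp_all
qed

lemma H1_smooth_seq:
  fixes e :: "nat \<Rightarrow> real"
  assumes H: "H1 u D" and e: "\<And>n. e n > 0"
  obtains v where "\<And>n. smooth (v n)" "\<And>n. H1 (v n) (\<lambda>i. pderiv i (v n))"
    "\<And>n. h1n (\<lambda>x. v n x - u x) (\<lambda>i x. pderiv i (v n) x - D i x) < e n"
proof -
  have "\<exists>v. smooth v \<and> H1 v (\<lambda>i. pderiv i v) \<and> h1n (\<lambda>x. v x - u x) (\<lambda>i x. pderiv i v x - D i x) < e n" for n :: nat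
    by (rule H1_smooth_approx[OF H e[of n]]) blast
  then have "\<exists>v. \<forall>n. smooth (v n) \<and> H1 (v n) (\<lambda>i. pderiv i (v n)) \<and> h1n (\<lambda>x. v n x - u x) (\<lambda>i x. pderiv i (v n) x - D i x) < e n"
    by (intro choice allI)
  then show ?thesis using that by blast
qed

text \<open>For a point x of \<Omega> the mollifier reflected at x is a test function in \<Omega> as
  soon as its radius is small, so the mollifications of \<open>g\<close> at x are eventually 0.
  Along a subsequence they converge to \<open>g\<close> almost everywhere.\<close>

lemma fundamental_lemma:
  assumes g: "g \<in> sq_int lborel" and \<Omega>: "open \<Omega>"
    and z: "\<And>\<phi>. \<phi> \<in> test_functions \<Omega> \<Longrightarrow> (\<integral>x. g x * \<phi> x \<partial>lborel) = 0"
  shows "AE x in lborel. x \<in> \<Omega> \<longrightarrow> g x = 0"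
proof -
  obtain r :: "nat \<Rightarrow> nat" where r: "strict_mono r" and ae: "AE x in lborel. (\<lambda>n. conv (mollifier (r n)) g x - g x) \<longlonglongrightarrow> 0"
    using l2n_AE_subseq[OF sq_int_diff[OF mollify_tendsto(1)[OF g] g] mollify_tendsto(2)[OF g]] by auto
  show ?thesis
    using ae
  proof (eventually_elim, intro impI)
    fix x assume l: "(\<lambda>n. conv (mollifier (r n)) g x - g x) \<longlonglongrightarrow> 0" and x: "x \<in> \<Omega>"
    obtain e where e: "e > 0" "ball x e \<subseteq> \<Omega>"
      using \<Omega> x open_contains_ball by metis
    obtain N where N: "1 / real (Suc N) < e" by (rule nat_approx_posE[OF e(1)])
    have "conv (mollifier n) g x = 0" if "n \<ge> N" for n
      unfolding conv_def
    proof (rule z, rule test_functionsI)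
      have lt: "1 / real (Suc n) < e"
        using that N by (smt (verit) frac_le of_nat_0_less_iff of_nat_mono zero_less_Suc Suc_le_mono)
      show "cball x (1 / real (Suc n)) \<subseteq> \<Omega>"
        using lt e(2) by (auto simp: subset_iff)
      show "y \<notin> cball x (1 / real (Suc n)) \<Longrightarrow> mollifier n (x - y) = 0" for y
        by (intro mollifier_zero) (simp add: dist_norm)
      show "smooth (\<lambda>y. mollifier n (x - y))"
        by (rule test_smooth[OF test_reflect(1)[OF mollifier_test]])
    qed auto
    then have "\<forall>\<^sub>F n in sequentially. conv (mollifier (r n)) g x - g x = - g x"
      using order_trans[OF _ seq_suble[OF r]] by (intro eventually_sequentiallyI[of N]) simp
    then have "(\<lambda>n. conv (mollifier (r n)) g x - g x) \<longlonglongrightarrow> - g x"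
      by (rule tendsto_eventually)
    from LIMSEQ_unique[OF l this] show "g x = 0" by simp
  qed
qed

lemma H1_unique:
  assumes "H1 u D" "H1 u E"
  shows "AE x in lborel. D i x = E i x"
proof -
  have "AE x in lborel. x \<in> UNIV \<longrightarrow> D i x - E i x = 0"
  proof (rule fundamental_lemma)
    show "(\<lambda>x. D i x - E i x) \<in> sq_int lborel"
      by (intro sq_int_diff H1_D(2)[OF assms(1)] H1_D(2)[OF assms(2)])
    fix \<phi> assume \<phi>: "\<phi> \<in> test_functions (UNIV :: (real^3) set)"
    show "(\<integral>x. (D i x - E i x) * \<phi> x \<partial>lborel) = 0"
      using H1_D(3)[OF assms(1) \<phi>, of i] H1_D(3)[OF assms(2) \<phi>, of i]
        sq_int_mult[OF H1_D(2)[OF assms(1)] test_sq_int[OF \<phi>], of i] sq_int_mult[OF H1_D(2)[OF assms(2)] test_sq_int[OF \<phi>], of i]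
      by (simp add: left_diff_distrib)
  qed simp
  then show ?thesis by simp
qed

lemma summable_l2n_pow2:
  assumes "\<And>n. l2n M (f n) < (1/2) ^ n"
  shows "summable (\<lambda>n. l2n M (f n))"
  by (rule summable_comparison_test'[of "\<lambda>n. (1/2) ^ n" 0]) (use assms in \<open>auto intro: less_imp_le summable_geometric\<close>)

lemma pow2_tendsto_l2n:
  assumes "\<And>n. l2n M (f n) < (1/2) ^ n"
  shows "(\<lambda>n. l2n M (f n)) \<longlonglongrightarrow> 0"
  using summable_LIMSEQ_zero[OF summable_l2n_pow2[OF assms]] .

section \<open>Chain and product rules\<close>

lemma Lipschitz_of_deriv_bound:
  fixes F F' :: "real \<Rightarrow> real"
  assumes "\<And>t. (F has_real_derivative F' t) (at t)" "\<And>t. \<bar>F' t\<bar> \<le> M"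
  shows "\<bar>F a - F b\<bar> \<le> M * \<bar>a - b\<bar>"
  using field_differentiable_bound[of UNIV F F' M a b] assms by auto

text \<open>With smooth approximations v_n of \<open>u\<close>, the error F'(v_n) Dv_n - F'(u) Du
  splits into F'(v_n) (Dv_n - Du), which \<open>M\<close> controls, and (F'(v_n) - F'(u)) Du, for
  which only pointwise convergence is available and dominated convergence with majorant 2M |Du| is
  used. The rate 2^(-n) makes v_n converge almost everywhere without passing to a subsequence. The
  condition F 0 = 0 keeps F(u) square integrable.\<close>

lemma H1_chain:
  assumes H: "H1 u D" and F: "\<And>t. (F has_real_derivative F' t) (at t)" "continuous_on UNIV F'" "\<And>t. \<bar>F' t\<bar> \<le> M" "F 0 = 0"
  shows "H1 (\<lambda>x. F (u x)) (\<lambda>i x. F' (u x) * D i x)"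
proof -
  have [measurable]: "u \<in> borel_measurable borel" "D i \<in> borel_measurable borel" for i using H1_meas[OF H] by auto
  have Fc: "continuous_on UNIV F"
    using F(1) DERIV_isCont continuous_at_imp_continuous_on by blast
  have [measurable]: "F \<in> borel_measurable borel" "F' \<in> borel_measurable borel"
    using Fc F(2) borel_measurable_continuous_onI by auto
  have M0: "M \<ge> 0" using F(3)[of 0] by linarith
  have FL: "\<bar>F a - F b\<bar> \<le> M * \<bar>a - b\<bar>" for a b by (rule Lipschitz_of_deriv_bound[OF F(1,3)])
  obtain v where v: "\<And>n. smooth (v n)" "\<And>n. H1 (v n) (\<lambda>i. pderiv i (v n))"
    "\<And>n. h1n (\<lambda>x. v n x - u x) (\<lambda>i x. pderiv i (v n) x - D i x) < (1/2) ^ n"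
    using H1_smooth_seq[OF H, of "\<lambda>n. (1/2)^n"] by auto
  have v1: "l2n lborel (\<lambda>x. v n x - u x) < (1/2) ^ n" for n
    using v(3)[of n] l2n_le_h1n(1) le_less_trans by blast
  have v2: "l2n lborel (\<lambda>x. pderiv i (v n) x - D i x) < (1/2) ^ n" for n i
    using v(3)[of n] l2n_le_h1n(2)[where D="\<lambda>i x. pderiv i (v n) x - D i x"] le_less_trans by blast
  have [measurable]: "v n \<in> borel_measurable borel" "pderiv i (v n) \<in> borel_measurable borel" for n i
    using v(1) smooth_pderiv smooth_borel by blast+
  have uS: "(\<lambda>x. F (u x)) \<in> sq_int lborel"
    by (rule sq_int_bound[OF H1_D(1)[OF H], of _ M]) (use FL[of _ 0] F(4) in auto)
  have DS: "(\<lambda>x. F' (u x) * D i x) \<in> sq_int lborel" for i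
    by (rule sq_int_bounded_mult[OF H1_D(2)[OF H], of _ M]) (use F(3) in auto)
  have vu: "AE x in lborel. (\<lambda>n. v n x - u x) \<longlonglongrightarrow> 0"
    by (rule l2n_summable_AE_tendsto[OF sq_int_diff[OF H1_D(1)[OF v(2)] H1_D(1)[OF H]] summable_l2n_pow2[OF v1]])
  show ?thesis
    unfolding H1_def
  proof (intro conjI allI ballI uS DS)
    fix i \<phi> assume \<phi>: "\<phi> \<in> test_functions (UNIV :: (real^3) set)"
    have \<phi>s: "\<phi> \<in> sq_int lborel" and p\<phi>: "pderiv i \<phi> \<in> sq_int lborel"
      using test_sq_int test_pderiv \<phi> by blast+
    have [measurable]: "\<phi> \<in> borel_measurable borel" using sq_int_meas[OF \<phi>s] by simp
    have FvS: "(\<lambda>x. F (v n x)) \<in> sq_int lborel" for n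
      by (rule sq_int_bound[OF H1_D(1)[OF v(2)[of n]], of _ M]) (use FL[of _ 0] F(4) in auto)
    have ibp: "(\<integral>x. F (v n x) * pderiv i \<phi> x \<partial>lborel) = - (\<integral>x. F' (v n x) * pderiv i (v n) x * \<phi> x \<partial>lborel)" for n
    proof -
      have p: "pderiv i (\<lambda>x. F (v n x)) = (\<lambda>x. F' (v n x) * pderiv i (v n) x)" for i
        by (intro ext pderiv_comp smooth_differentiable v F)
      have "C_k 1 (\<lambda>x. F (v n x))"
        using v(1)[of n] smooth_continuous[OF v(1)[of n]] smooth_continuous[OF smooth_pderiv[OF v(1)[of n]]]
        by (auto simp: p intro!: differentiable_comp[OF smooth_differentiable[OF v(1)] F(1)] continuous_intros continuous_on_compose2[OF F(2)])
      then show ?thesis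
        using integral_by_parts[OF _ \<phi>, of "\<lambda>x. F (v n x)" i] by (simp add: p)
    qed
    have l1: "(\<lambda>n. l2n lborel (\<lambda>x. F (v n x) - F (u x))) \<longlonglongrightarrow> 0"
    proof (rule Lim_null_comparison)
      show "(\<lambda>n. M * l2n lborel (\<lambda>x. v n x - u x)) \<longlonglongrightarrow> 0"
        using tendsto_mult_right_zero[OF pow2_tendsto_l2n[OF v1], of M] .
      have "l2n lborel (\<lambda>x. F (v n x) - F (u x)) \<le> l2n lborel (\<lambda>x. M * (v n x - u x))" for n
        using FL M0 by (intro l2n_mono sq_int_cmult sq_int_diff H1_D(1)[OF v(2)] H1_D(1)[OF H]) (auto simp: abs_mult)
      then show "\<forall>\<^sub>F n in sequentially. norm (l2n lborel (\<lambda>x. F (v n x) - F (u x))) \<le> M * l2n lborel (\<lambda>x. v n x - u x)"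
        using M0 by (simp add: l2n_cmult)
    qed
    have l2: "(\<lambda>n. l2n lborel (\<lambda>x. F' (v n x) * (pderiv i (v n) x - D i x))) \<longlonglongrightarrow> 0"
    proof (rule Lim_null_comparison)
      show "(\<lambda>n. M * l2n lborel (\<lambda>x. pderiv i (v n) x - D i x)) \<longlonglongrightarrow> 0"
        using tendsto_mult_right_zero[OF pow2_tendsto_l2n[OF v2], of M] .
      have "l2n lborel (\<lambda>x. F' (v n x) * (pderiv i (v n) x - D i x)) \<le> l2n lborel (\<lambda>x. M * (pderiv i (v n) x - D i x))" for n
        using F(3) M0 by (intro l2n_mono sq_int_cmult sq_int_diff H1_D(2)[OF v(2)] H1_D(2)[OF H]) (auto simp: abs_mult mult_right_mono)
      then show "\<forall>\<^sub>F n in sequentially. norm (l2n lborel (\<lambda>x. F' (v n x) * (pderiv i (v n) x - D i x))) \<le> M * l2n lborel (\<lambda>x. pderiv i (v n) x - D i x)"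
        using M0 by (simp add: l2n_cmult)
    qed
    have l3: "(\<lambda>n. l2n lborel (\<lambda>x. (F' (v n x) - F' (u x)) * D i x)) \<longlonglongrightarrow> 0"
    proof (rule l2n_dominated[OF _ sq_int_cmult[OF sq_int_abs[OF H1_D(2)[OF H, of i]], of "2 * M"]])
      show "\<bar>(F' (v n x) - F' (u x)) * D i x\<bar> \<le> 2 * M * \<bar>D i x\<bar>" for n x
        using abs_triangle_ineq4[of "F' (v n x)" "F' (u x)"] F(3)[of "v n x"] F(3)[of "u x"]
        by (auto simp: abs_mult intro!: mult_right_mono)
      show "AE x in lborel. (\<lambda>n. (F' (v n x) - F' (u x)) * D i x) \<longlonglongrightarrow> 0"
        using vu
      proof eventually_elim
        case (elim x)
        then have "(\<lambda>n. v n x) \<longlonglongrightarrow> u x" by (simp add: LIM_zero_iff)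
        then have "(\<lambda>n. F' (v n x)) \<longlonglongrightarrow> F' (u x)"
          using F(2) by (intro isCont_tendsto_compose[of _ F']) (auto simp: continuous_on_eq_continuous_at)
        then have "(\<lambda>n. F' (v n x) - F' (u x)) \<longlonglongrightarrow> 0" by (simp add: LIM_zero_iff)
        then show ?case by (rule tendsto_mult_left_zero)
      qed
    qed measurable
    have FpS: "(\<lambda>x. F' (v n x) * pderiv i (v n) x) \<in> sq_int lborel" for n
      by (rule sq_int_bounded_mult[OF H1_D(2)[OF v(2)], of _ M]) (use F(3) in auto)
    have l4: "(\<lambda>n. l2n lborel (\<lambda>x. F' (v n x) * pderiv i (v n) x - F' (u x) * D i x)) \<longlonglongrightarrow> 0"
    proof (rule Lim_null_comparison)
      show "(\<lambda>n. l2n lborel (\<lambda>x. F' (v n x) * (pderiv i (v n) x - D i x)) + l2n lborel (\<lambda>x. (F' (v n x) - F' (u x)) * D i x)) \<longlonglongrightarrow> 0"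
        using tendsto_add[OF l2 l3] by simp
      have "l2n lborel (\<lambda>x. F' (v n x) * pderiv i (v n) x - F' (u x) * D i x) \<le>
          l2n lborel (\<lambda>x. F' (v n x) * (pderiv i (v n) x - D i x)) + l2n lborel (\<lambda>x. (F' (v n x) - F' (u x)) * D i x)" for n
      proof -
        have s: "(\<lambda>x. F' (v n x) * D i x) \<in> sq_int lborel"
          by (rule sq_int_bounded_mult[OF H1_D(2)[OF H], of _ M]) (use F(3) in auto)
        show ?thesis
          using l2n_triangle3[OF FpS s DS, of n i] by (simp add: left_diff_distrib right_diff_distrib)
      qed
      then show "\<forall>\<^sub>F n in sequentially. norm (l2n lborel (\<lambda>x. F' (v n x) * pderiv i (v n) x - F' (u x) * D i x)) \<le>
          l2n lborel (\<lambda>x. F' (v n x) * (pderiv i (v n) x - D i x)) + l2n lborel (\<lambda>x. (F' (v n x) - F' (u x)) * D i x)"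
        by simp
    qed
    have "(\<lambda>n. \<integral>x. F (v n x) * pderiv i \<phi> x \<partial>lborel) \<longlonglongrightarrow> (\<integral>x. F (u x) * pderiv i \<phi> x \<partial>lborel)"
      by (rule tendsto_integral_l2n[OF FvS uS p\<phi> l1])
    moreover have "(\<lambda>n. - (\<integral>x. F' (v n x) * pderiv i (v n) x * \<phi> x \<partial>lborel)) \<longlonglongrightarrow> - (\<integral>x. F' (u x) * D i x * \<phi> x \<partial>lborel)"
      by (intro tendsto_minus tendsto_integral_l2n[OF FpS DS \<phi>s l4])
    ultimately show "(\<integral>x. F (u x) * pderiv i \<phi> x \<partial>lborel) = - (\<integral>x. F' (u x) * D i x * \<phi> x \<partial>lborel)"
      unfolding ibp by (rule LIMSEQ_unique)
  qed
qed

text \<open>\<open>G'\<close> is only the pointwise limit of the derivatives and need not be a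
  derivative of \<open>G\<close>. This reaches functions with a corner, where \<open>G'\<close>
  takes whatever value the limit has.\<close>

lemma H1_chain_limit:
  assumes H: "H1 u D" and F: "\<And>n t. (F n has_real_derivative F' n t) (at t)" "\<And>n. continuous_on UNIV (F' n)"
      "\<And>n t. \<bar>F' n t\<bar> \<le> M" "\<And>n. F n 0 = 0"
    and lim: "\<And>t. (\<lambda>n. F n t) \<longlonglongrightarrow> G t" "\<And>t. (\<lambda>n. F' n t) \<longlonglongrightarrow> G' t"
  shows "H1 (\<lambda>x. G (u x)) (\<lambda>i x. G' (u x) * D i x)"
    "(\<lambda>n. l2n lborel (\<lambda>x. F n (u x) - G (u x))) \<longlonglongrightarrow> 0"
    "(\<lambda>n. l2n lborel (\<lambda>x. F' n (u x) * D i x - G' (u x) * D i x)) \<longlonglongrightarrow> 0"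
proof -
  have [measurable]: "u \<in> borel_measurable borel" "D i \<in> borel_measurable borel" for i using H1_meas[OF H] by auto
  have Fc: "continuous_on UNIV (F n)" for n
    using F(1) DERIV_isCont continuous_at_imp_continuous_on by blast
  have [measurable]: "F n \<in> borel_measurable borel" "F' n \<in> borel_measurable borel" for n
    using Fc F(2) borel_measurable_continuous_onI by auto
  have [measurable]: "G \<in> borel_measurable borel" "G' \<in> borel_measurable borel"
    using lim by (auto intro: borel_measurable_LIMSEQ_real[where u=F] borel_measurable_LIMSEQ_real[where u=F'])
  have M0: "M \<ge> 0" using F(3)[of 0 0] by linarith
  have Fb: "\<bar>F n t\<bar> \<le> M * \<bar>t\<bar>" for n t
    using Lipschitz_of_deriv_bound[OF F(1,3), of n t 0] F(4) by simp
  have Gb: "\<bar>G t\<bar> \<le> M * \<bar>t\<bar>" for t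
    by (rule LIMSEQ_le_const2[OF tendsto_rabs[OF lim(1)]]) (use Fb in auto)
  have G'b: "\<bar>G' t\<bar> \<le> M" for t
    by (rule LIMSEQ_le_const2[OF tendsto_rabs[OF lim(2)]]) (use F(3) in auto)
  have uS: "(\<lambda>x. G (u x)) \<in> sq_int lborel"
    by (rule sq_int_bound[OF H1_D(1)[OF H], of _ M]) (use Gb in auto)
  have DS: "(\<lambda>x. G' (u x) * D i x) \<in> sq_int lborel" for i
    by (rule sq_int_bounded_mult[OF H1_D(2)[OF H], of _ M]) (use G'b in auto)
  show l1: "(\<lambda>n. l2n lborel (\<lambda>x. F n (u x) - G (u x))) \<longlonglongrightarrow> 0"
  proof (rule l2n_dominated[OF _ sq_int_cmult[OF sq_int_abs[OF H1_D(1)[OF H]], of "2 * M"]])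
    show "\<bar>F n (u x) - G (u x)\<bar> \<le> 2 * M * \<bar>u x\<bar>" for n x
      using Fb[of n "u x"] Gb[of "u x"] by linarith
    show "AE x in lborel. (\<lambda>n. F n (u x) - G (u x)) \<longlonglongrightarrow> 0"
      using lim(1) by (simp add: LIM_zero_iff)
  qed measurable
  show l2: "(\<lambda>n. l2n lborel (\<lambda>x. F' n (u x) * D i x - G' (u x) * D i x)) \<longlonglongrightarrow> 0" for i
  proof (rule l2n_dominated[OF _ sq_int_cmult[OF sq_int_abs[OF H1_D(2)[OF H, of i]], of "2 * M"]])
    show "\<bar>F' n (u x) * D i x - G' (u x) * D i x\<bar> \<le> 2 * M * \<bar>D i x\<bar>" for n x
      unfolding left_diff_distrib[symmetric] abs_mult
      using F(3)[of n "u x"] G'b[of "u x"] by (intro mult_right_mono) linarith+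
    show "AE x in lborel. (\<lambda>n. F' n (u x) * D i x - G' (u x) * D i x) \<longlonglongrightarrow> 0"
      using lim(2) by (intro AE_I2) (simp add: LIM_zero_iff tendsto_mult_right)
  qed measurable
  show "H1 (\<lambda>x. G (u x)) (\<lambda>i x. G' (u x) * D i x)"
    by (rule H1_limit[OF H1_chain[OF H F] uS DS l1 l2])
qed

lemma H1_abs:
  assumes H: "H1 u D"
  shows "H1 (\<lambda>x. \<bar>u x\<bar>) (\<lambda>i x. sgn (u x) * D i x)" "h1n (\<lambda>x. \<bar>u x\<bar>) (\<lambda>i x. sgn (u x) * D i x) \<le> h1n u D"
proof -
  define e where "e n = 1 / real (Suc n)" for n
  have e: "e n > 0" for n by (simp add: e_def)
  have e0: "e \<longlonglongrightarrow> 0" unfolding e_def by (rule LIMSEQ_Suc[OF lim_1_over_n])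
  \<comment> \<open>A smooth approximation of |t| that vanishes at 0 and has derivative bounded by
    1; the derivative at 0 is 0, which is also \<open>sgn 0\<close>.\<close>
  define F where "F n t = sqrt (t\<^sup>2 + (e n)\<^sup>2) - e n" for n t
  define F' where "F' n t = t / sqrt (t\<^sup>2 + (e n)\<^sup>2)" for n t
  have pos: "t\<^sup>2 + (e n)\<^sup>2 > 0" for n t using e[of n] by (simp add: add_nonneg_pos)
  show "H1 (\<lambda>x. \<bar>u x\<bar>) (\<lambda>i x. sgn (u x) * D i x)"
  proof (rule H1_chain_limit(1)[OF H, where F=F and F'=F' and M=1])
    show "(F n has_real_derivative F' n t) (at t)" for n t
      unfolding F_def F'_def using pos[of t n]
      by (auto intro!: derivative_eq_intros simp: field_simps)
    show "continuous_on UNIV (F' n)" for n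
      unfolding F'_def using e[of n] by (intro continuous_intros) auto
    show "\<bar>F' n t\<bar> \<le> 1" for n t
    proof -
      have "\<bar>t\<bar> \<le> sqrt (t\<^sup>2 + (e n)\<^sup>2)" by (rule real_le_rsqrt) simp
      then show ?thesis using pos[of t n] by (simp add: F'_def)
    qed
    show "F n 0 = 0" for n using e[of n] by (simp add: F_def)
    show "(\<lambda>n. F n t) \<longlonglongrightarrow> \<bar>t\<bar>" for t
    proof -
      have "(\<lambda>n. F n t) \<longlonglongrightarrow> sqrt (t\<^sup>2 + 0\<^sup>2) - 0"
        unfolding F_def by (intro tendsto_intros e0)
      then show ?thesis by simp
    qed
    show "(\<lambda>n. F' n t) \<longlonglongrightarrow> sgn t" for t
    proof (cases "t = 0")
      case False
      have "(\<lambda>n. F' n t) \<longlonglongrightarrow> t / sqrt (t\<^sup>2 + 0\<^sup>2)"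
        unfolding F'_def using False by (intro tendsto_intros e0) auto
      then show ?thesis using False by (simp add: sgn_if abs_if split: if_splits)
    qed (simp add: F'_def)
  qed
  have "l2n lborel (\<lambda>x. sgn (u x) * D i x) \<le> l2n lborel (D i)" for i
    by (rule l2n_mono[OF H1_D(2)[OF H]]) (auto simp: abs_mult sgn_real_def)
  then show "h1n (\<lambda>x. \<bar>u x\<bar>) (\<lambda>i x. sgn (u x) * D i x) \<le> h1n u D"
    unfolding h1n_def l2n_abs by (intro add_left_mono sum_mono)
qed

text \<open>The product of two functions in \<open>H\<^sup>1\<close> is only integrable, so its weak derivative is stated directly.\<close>

lemma H1_product:
  assumes H: "H1 u D" "H1 v E" and \<phi>: "\<phi> \<in> test_functions UNIV"
  shows "(\<integral>x. u x * v x * pderiv i \<phi> x \<partial>lborel) = - (\<integral>x. (D i x * v x + u x * E i x) * \<phi> x \<partial>lborel)"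
proof -
  obtain M where M: "\<And>x. \<bar>\<phi> x\<bar> \<le> M" using test_bounded[OF \<phi>] by metis
  obtain M' where M': "\<And>x. \<bar>pderiv i \<phi> x\<bar> \<le> M'" using test_bounded[OF test_pderiv[OF \<phi>]] by metis
  have [measurable]: "\<phi> \<in> borel_measurable borel" "pderiv i \<phi> \<in> borel_measurable borel"
    using \<phi> test_smooth smooth_pderiv smooth_borel by blast+
  have bm: "(\<lambda>x. \<phi> x * f x) \<in> sq_int lborel" "(\<lambda>x. pderiv i \<phi> x * f x) \<in> sq_int lborel" if "f \<in> sq_int lborel" for f
    using sq_int_bounded_mult[OF that _ M] sq_int_bounded_mult[OF that _ M'] by auto
  \<comment> \<open>For smooth \<open>v\<close> the product of \<open>\<phi>\<close> and
    \<open>v\<close> is again a test function, so the weak derivative of \<open>u\<close> can be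
    tested with it. The general case is the limit of this one.\<close>
  have step: "(\<integral>x. u x * v x * pderiv i \<phi> x \<partial>lborel) = - (\<integral>x. (D i x * v x + u x * E i x) * \<phi> x \<partial>lborel)"
    if v: "smooth v" "H1 v (\<lambda>i. pderiv i v)" and E: "E = (\<lambda>i. pderiv i v)" for v E
  proof -
    have t: "(\<lambda>x. \<phi> x * v x) \<in> test_functions UNIV" using test_mult_smooth[OF \<phi> v(1)] .
    have p: "pderiv i (\<lambda>x. \<phi> x * v x) x = \<phi> x * pderiv i v x + pderiv i \<phi> x * v x" for x
      by (intro pderiv_mult smooth_differentiable test_smooth[OF \<phi>] v)
    have i1: "integrable lborel (\<lambda>x. u x * (\<phi> x * pderiv i v x))" "integrable lborel (\<lambda>x. u x * (pderiv i \<phi> x * v x))"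
        "integrable lborel (\<lambda>x. D i x * (\<phi> x * v x))"
      using sq_int_mult[OF H1_D(1)[OF H(1)] bm(1)[OF H1_D(2)[OF v(2)]]] sq_int_mult[OF H1_D(1)[OF H(1)] bm(2)[OF H1_D(1)[OF v(2)]]]
        sq_int_mult[OF H1_D(2)[OF H(1)] bm(1)[OF H1_D(1)[OF v(2)]]] by auto
    have "(\<integral>x. u x * (\<phi> x * pderiv i v x) + u x * (pderiv i \<phi> x * v x) \<partial>lborel) = - (\<integral>x. D i x * (\<phi> x * v x) \<partial>lborel)"
      using H1_D(3)[OF H(1) t, of i] by (simp add: p distrib_left)
    then have "(\<integral>x. u x * (\<phi> x * pderiv i v x) \<partial>lborel) + (\<integral>x. u x * (pderiv i \<phi> x * v x) \<partial>lborel) = - (\<integral>x. D i x * (\<phi> x * v x) \<partial>lborel)"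
      using i1 by simp
    moreover have "(\<integral>x. (D i x * v x + u x * E i x) * \<phi> x \<partial>lborel) = (\<integral>x. D i x * (\<phi> x * v x) + u x * (\<phi> x * pderiv i v x) \<partial>lborel)"
      by (rule Bochner_Integration.integral_cong) (auto simp: E algebra_simps)
    moreover have "(\<integral>x. u x * v x * pderiv i \<phi> x \<partial>lborel) = (\<integral>x. u x * (pderiv i \<phi> x * v x) \<partial>lborel)"
      by (rule Bochner_Integration.integral_cong) (auto simp: algebra_simps)
    ultimately show ?thesis
      using i1 by simp
  qed
  obtain w where w: "\<And>n. smooth (w n)" "\<And>n. H1 (w n) (\<lambda>i. pderiv i (w n))"
    "\<And>n. h1n (\<lambda>x. w n x - v x) (\<lambda>i x. pderiv i (w n) x - E i x) < (1/2) ^ n"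
    using H1_smooth_seq[OF H(2), of "\<lambda>n. (1/2)^n"] by auto
  have w1: "(\<lambda>n. l2n lborel (\<lambda>x. w n x - v x)) \<longlonglongrightarrow> 0"
    by (rule pow2_tendsto_l2n) (use w(3) l2n_le_h1n(1) le_less_trans in blast)
  have w2: "(\<lambda>n. l2n lborel (\<lambda>x. pderiv i (w n) x - E i x)) \<longlonglongrightarrow> 0"
    by (rule pow2_tendsto_l2n) (use w(3) l2n_le_h1n(2)[where D="\<lambda>i x. pderiv i (w _) x - E i x"] le_less_trans in blast)
  have A: "(\<lambda>n. \<integral>x. w n x * (pderiv i \<phi> x * u x) \<partial>lborel) \<longlonglongrightarrow> (\<integral>x. v x * (pderiv i \<phi> x * u x) \<partial>lborel)"
    by (rule tendsto_integral_l2n[OF H1_D(1)[OF w(2)] H1_D(1)[OF H(2)] bm(2)[OF H1_D(1)[OF H(1)]] w1])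
  have B: "(\<lambda>n. - ((\<integral>x. w n x * (\<phi> x * D i x) \<partial>lborel) + (\<integral>x. pderiv i (w n) x * (\<phi> x * u x) \<partial>lborel))) \<longlonglongrightarrow>
      - ((\<integral>x. v x * (\<phi> x * D i x) \<partial>lborel) + (\<integral>x. E i x * (\<phi> x * u x) \<partial>lborel))"
    by (intro tendsto_minus tendsto_add tendsto_integral_l2n[OF H1_D(1)[OF w(2)] H1_D(1)[OF H(2)] bm(1)[OF H1_D(2)[OF H(1)]] w1]
        tendsto_integral_l2n[OF H1_D(2)[OF w(2)] H1_D(2)[OF H(2)] bm(1)[OF H1_D(1)[OF H(1)]] w2])
  have S: "(\<integral>x. z x * (pderiv i \<phi> x * u x) \<partial>lborel) = (\<integral>x. u x * z x * pderiv i \<phi> x \<partial>lborel)" for z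
    by (rule Bochner_Integration.integral_cong) (auto simp: algebra_simps)
  have T: "(\<integral>x. z x * (\<phi> x * D i x) \<partial>lborel) + (\<integral>x. Z i x * (\<phi> x * u x) \<partial>lborel) = (\<integral>x. (D i x * z x + u x * Z i x) * \<phi> x \<partial>lborel)"
    if "H1 z Z" for z Z
    using sq_int_mult[OF H1_D(1)[OF that] bm(1)[OF H1_D(2)[OF H(1), of i]]] sq_int_mult[OF H1_D(2)[OF that, of i] bm(1)[OF H1_D(1)[OF H(1)]]]
    by (subst Bochner_Integration.integral_add[symmetric]) (auto simp: algebra_simps intro!: Bochner_Integration.integral_cong)
  from LIMSEQ_unique[OF A[unfolded S step[OF w(1,2) refl]] B[unfolded T[OF H(2)] T[OF w(2)]]] show ?thesis .
qed

lemma H1_mult_bounded: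
  assumes H: "H1 u D" "H1 v E" and b: "\<And>x. \<bar>u x\<bar> \<le> M" "\<And>x. \<bar>v x\<bar> \<le> N"
  shows "H1 (\<lambda>x. u x * v x) (\<lambda>i x. D i x * v x + u x * E i x)"
proof -
  have m: "u \<in> borel_measurable lborel" "v \<in> borel_measurable lborel" using H1_meas[OF H(1)] H1_meas[OF H(2)] by auto
  have "(\<lambda>x. D i x * v x) \<in> sq_int lborel" for i
    using sq_int_bounded_mult[OF H1_D(2)[OF H(1)] m(2) b(2)] by (simp add: mult.commute)
  then have "(\<lambda>x. D i x * v x + u x * E i x) \<in> sq_int lborel" for i
    by (intro sq_int_add sq_int_bounded_mult[OF H1_D(2)[OF H(2)] m(1) b(1)])
  moreover have "(\<lambda>x. u x * v x) \<in> sq_int lborel"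
    by (rule sq_int_bounded_mult[OF H1_D(1)[OF H(2)] m(1) b(1)])
  ultimately show ?thesis
    unfolding H1_def using H1_product[OF H] by simp
qed

text \<open>Completeness of H^1. Both kinds of convergence are kept: the pointwise sum carries
  inequalities such as an obstacle constraint to the limit, and convergence in norm carries the
  energy.\<close>

lemma H1_series:
  assumes H: "\<And>n. H1 (u n) (D n)" and s: "summable (\<lambda>n. h1n (u n) (D n))"
  obtains v E where "H1 v E" "AE x in lborel. (\<lambda>n. u n x) sums v x" "h1n v E \<le> (\<Sum>n. h1n (u n) (D n))"
    "(\<lambda>n. l2n lborel (\<lambda>x. (\<Sum>k<n. u k x) - v x)) \<longlonglongrightarrow> 0" "\<forall>i. (\<lambda>n. l2n lborel (\<lambda>x. (\<Sum>k<n. D k i x) - E i x)) \<longlonglongrightarrow> 0"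
proof -
  have su: "summable (\<lambda>n. l2n lborel (u n))"
    by (rule summable_comparison_test'[OF s, of 0]) (use l2n_le_h1n in auto)
  have sD: "summable (\<lambda>n. l2n lborel (D n i))" for i
    by (rule summable_comparison_test'[OF s, of 0]) (use l2n_le_h1n in auto)
  obtain v where v: "v \<in> sq_int lborel" "AE x in lborel. (\<lambda>n. u n x) sums v x"
    "\<And>n. l2n lborel (\<lambda>x. v x - (\<Sum>k<n. u k x)) \<le> (\<Sum>k. l2n lborel (u (k + n)))" "l2n lborel v \<le> (\<Sum>k. l2n lborel (u k))"
    using sq_int_series[OF H1_D(1)[OF H] su] by blast
  have *: "\<exists>e. e \<in> sq_int lborel \<and> (\<forall>n. l2n lborel (\<lambda>x. e x - (\<Sum>k<n. D k i x)) \<le> (\<Sum>k. l2n lborel (D (k + n) i))) \<and>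
      l2n lborel e \<le> (\<Sum>k. l2n lborel (D k i))" for i
  proof -
    obtain e where "e \<in> sq_int lborel" "AE x in lborel. (\<lambda>n. D n i x) sums e x"
      "\<And>n. l2n lborel (\<lambda>x. e x - (\<Sum>k<n. D k i x)) \<le> (\<Sum>k. l2n lborel (D (k + n) i))" "l2n lborel e \<le> (\<Sum>k. l2n lborel (D k i))"
      using sq_int_series[OF H1_D(2)[OF H] sD, of i] by blast
    then show ?thesis by (intro exI[of _ e] conjI allI)
  qed
  obtain E where E: "\<And>i. E i \<in> sq_int lborel" "\<And>i n. l2n lborel (\<lambda>x. E i x - (\<Sum>k<n. D k i x)) \<le> (\<Sum>k. l2n lborel (D (k + n) i))"
    "\<And>i. l2n lborel (E i) \<le> (\<Sum>k. l2n lborel (D k i))"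
  proof -
    assume that: "\<And>E. (\<And>i. E i \<in> sq_int lborel) \<Longrightarrow>
      (\<And>i n. l2n lborel (\<lambda>x. E i x - (\<Sum>k<n. D k i x)) \<le> (\<Sum>k. l2n lborel (D (k + n) i))) \<Longrightarrow>
      (\<And>i. l2n lborel (E i) \<le> (\<Sum>k. l2n lborel (D k i))) \<Longrightarrow> thesis"
    from * have "\<exists>E. \<forall>i. E i \<in> sq_int lborel \<and> (\<forall>n. l2n lborel (\<lambda>x. E i x - (\<Sum>k<n. D k i x)) \<le> (\<Sum>k. l2n lborel (D (k + n) i))) \<and>
      l2n lborel (E i) \<le> (\<Sum>k. l2n lborel (D k i))"
      by (intro choice allI)
    then show thesis using that by blast
  qed
  have l1: "(\<lambda>n. l2n lborel (\<lambda>x. (\<Sum>k<n. u k x) - v x)) \<longlonglongrightarrow> 0"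
  proof (rule Lim_null_comparison)
    show "(\<lambda>n. \<Sum>k. l2n lborel (u (k + n))) \<longlonglongrightarrow> 0" by (rule suminf_exist_split2[OF su])
    show "\<forall>\<^sub>F n in sequentially. norm (l2n lborel (\<lambda>x. (\<Sum>k<n. u k x) - v x)) \<le> (\<Sum>k. l2n lborel (u (k + n)))"
      using v(3) by (simp add: l2n_commute[of lborel _ v])
  qed
  have l2: "(\<lambda>n. l2n lborel (\<lambda>x. (\<Sum>k<n. D k i x) - E i x)) \<longlonglongrightarrow> 0" for i
  proof (rule Lim_null_comparison)
    show "(\<lambda>n. \<Sum>k. l2n lborel (D (k + n) i)) \<longlonglongrightarrow> 0" by (rule suminf_exist_split2[OF sD])
    show "\<forall>\<^sub>F n in sequentially. norm (l2n lborel (\<lambda>x. (\<Sum>k<n. D k i x) - E i x)) \<le> (\<Sum>k. l2n lborel (D (k + n) i))"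
      using E(2) by (simp add: l2n_commute[of lborel _ "E i"])
  qed
  have "H1 v E"
    by (rule H1_limit[OF H1_sum[OF H] v(1) E(1) l1 l2])
  moreover have "h1n v E \<le> (\<Sum>n. h1n (u n) (D n))"
  proof -
    have "(\<Sum>n. h1n (u n) (D n)) = (\<Sum>n. l2n lborel (u n)) + (\<Sum>i\<in>UNIV. \<Sum>n. l2n lborel (D n i))"
      unfolding h1n_def using su sD by (simp add: suminf_add[symmetric] suminf_sum summable_sum)
    then show ?thesis
      unfolding h1n_def using v(4) E(3) by (simp add: add_mono sum_mono)
  qed
  ultimately show ?thesis
    using that v(2) l1 l2 by blast
qed

section \<open>An obstacle problem and averages over balls\<close>

text \<open>The square of the Hilbert norm. Unlike \<open>h1n\<close> it satisfies the parallelogram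
  identity, on which the minimisation rests.\<close>

definition h1q :: "(real^3 \<Rightarrow> real) \<Rightarrow> (3 \<Rightarrow> real^3 \<Rightarrow> real) \<Rightarrow> real" where
  "h1q u D = (l2n lborel u)\<^sup>2 + (\<Sum>i\<in>UNIV. (l2n lborel (D i))\<^sup>2)"

lemma h1q_nonneg: "0 \<le> h1q u D"
  by (simp add: h1q_def sum_nonneg)

lemma l2n_le_sqrt_h1q: "l2n lborel u \<le> sqrt (h1q u D)" "l2n lborel (D i) \<le> sqrt (h1q u D)"
proof -
  have "(l2n lborel (D i))\<^sup>2 \<le> (\<Sum>i\<in>UNIV. (l2n lborel (D i))\<^sup>2)"
    by (rule member_le_sum) auto
  then have "(l2n lborel (D i))\<^sup>2 \<le> h1q u D"
    unfolding h1q_def by (meson add_increasing zero_le_power2)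
  then show "l2n lborel (D i) \<le> sqrt (h1q u D)" by (rule real_le_rsqrt)
  show "l2n lborel u \<le> sqrt (h1q u D)"
    by (rule real_le_rsqrt) (simp add: h1q_def sum_nonneg)
qed

lemma h1n_le_h1q: "h1n u D \<le> 4 * sqrt (h1q u D)"
proof -
  have "(\<Sum>i\<in>UNIV. l2n lborel (D i)) \<le> (\<Sum>i\<in>(UNIV::3 set). sqrt (h1q u D))"
    by (intro sum_mono l2n_le_sqrt_h1q)
  then show ?thesis
    using l2n_le_sqrt_h1q(1)[of u D] by (simp add: h1n_def)
qed

lemma h1q_le_h1n: "sqrt (h1q u D) \<le> h1n u D"
proof -
  have "sqrt (h1q u D) = sqrt ((l2n lborel u)\<^sup>2 + (L2_set (\<lambda>i. l2n lborel (D i)) UNIV)\<^sup>2)"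
    by (simp add: h1q_def L2_set_def sum_nonneg)
  also have "\<dots> \<le> l2n lborel u + L2_set (\<lambda>i. l2n lborel (D i)) UNIV"
    by (rule sqrt_sum_squares_le_sum) auto
  also have "L2_set (\<lambda>i. l2n lborel (D i)) UNIV \<le> (\<Sum>i\<in>UNIV. l2n lborel (D i))"
    by (rule L2_set_le_sum) auto
  finally show ?thesis by (simp add: h1n_def)
qed

lemma l2n_sq_add:
  assumes "u \<in> sq_int M" "v \<in> sq_int M"
  shows "(l2n M (\<lambda>x. u x + t * v x))\<^sup>2 = (l2n M u)\<^sup>2 + 2 * t * (\<integral>x. u x * v x \<partial>M) + t\<^sup>2 * (l2n M v)\<^sup>2"
proof -
  have "(l2n M (\<lambda>x. u x + t * v x))\<^sup>2 = (\<integral>x. (u x)\<^sup>2 + 2 * t * (u x * v x) + t\<^sup>2 * (v x)\<^sup>2 \<partial>M)"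
    unfolding l2n_sq by (rule Bochner_Integration.integral_cong) (auto simp: power2_eq_square algebra_simps)
  then show ?thesis
    using sq_int_sq[OF assms(1)] sq_int_sq[OF assms(2)] sq_int_mult[OF assms] by (simp add: l2n_sq)
qed

lemma h1q_add:
  assumes "H1 u D" "H1 v E"
  shows "h1q (\<lambda>x. u x + t * v x) (\<lambda>i x. D i x + t * E i x) =
    h1q u D + 2 * t * ((\<integral>x. u x * v x \<partial>lborel) + (\<Sum>i\<in>UNIV. \<integral>x. D i x * E i x \<partial>lborel)) + t\<^sup>2 * h1q v E"
  unfolding h1q_def l2n_sq_add[OF H1_D(1)[OF assms(1)] H1_D(1)[OF assms(2)]] l2n_sq_add[OF H1_D(2)[OF assms(1)] H1_D(2)[OF assms(2)]]
  by (simp add: sum.distrib sum_distrib_left algebra_simps)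

lemma h1q_parallelogram:
  assumes "H1 u D" "H1 v E"
  shows "h1q (\<lambda>x. u x - v x) (\<lambda>i x. D i x - E i x) + h1q (\<lambda>x. u x + v x) (\<lambda>i x. D i x + E i x) = 2 * h1q u D + 2 * h1q v E"
  using h1q_add[OF assms, of 1] h1q_add[OF assms, of "-1"] by simp

lemma h1q_cmult: "h1q (\<lambda>x. c * u x) (\<lambda>i x. c * D i x) = c\<^sup>2 * h1q u D"
  by (simp add: h1q_def l2n_cmult power_mult_distrib sum_distrib_left distrib_left)

lemma l2n_diff_le:
  assumes "u \<in> sq_int M" "v \<in> sq_int M"
  shows "\<bar>l2n M u - l2n M v\<bar> \<le> l2n M (\<lambda>x. u x - v x)"
  using l2n_triangle[OF sq_int_diff[OF assms] assms(2)] l2n_triangle[OF sq_int_diff[OF assms(2,1)] assms(1)] l2n_commute[of M u v]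
  by simp

lemma l2n_tendsto:
  assumes "\<And>n. u n \<in> sq_int M" "v \<in> sq_int M" "(\<lambda>n. l2n M (\<lambda>x. u n x - v x)) \<longlonglongrightarrow> 0"
  shows "(\<lambda>n. l2n M (u n)) \<longlonglongrightarrow> l2n M v"
  by (rule LIM_zero_cancel, rule Lim_null_comparison[OF _ assms(3)]) (use l2n_diff_le[OF assms(1,2)] in simp)

text \<open>The direct method in the closed convex set of functions above |w|. Midpoints of
  admissible functions are admissible, so the parallelogram identity turns near-minimality into a
  Cauchy estimate. Adding t \<phi> with t > 0 and \<phi> \<ge> 0 preserves admissibility, so the
  first variation at the minimiser is nonnegative: weakly, -\<Delta>h + h \<ge> 0.\<close>

lemma obstacle:
  assumes w: "H1 w D"
  obtains h B where "H1 h B" "AE x in lborel. \<bar>w x\<bar> \<le> h x" "h1n h B \<le> 4 * h1n w D"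
    "\<And>\<phi>. \<phi> \<in> test_functions UNIV \<Longrightarrow> (\<And>x. \<phi> x \<ge> 0) \<Longrightarrow>
      0 \<le> (\<integral>x. h x * \<phi> x \<partial>lborel) + (\<Sum>i\<in>UNIV. \<integral>x. B i x * pderiv i \<phi> x \<partial>lborel)"
proof -
  define adm where "adm h B \<longleftrightarrow> H1 h B \<and> (AE x in lborel. \<bar>w x\<bar> \<le> h x)" for h B
  define S where "S = {q. \<exists>h B. adm h B \<and> q = h1q h B}"
  define I where "I = Inf S"
  have adm0: "adm (\<lambda>x. \<bar>w x\<bar>) (\<lambda>i x. sgn (w x) * D i x)"
    using H1_abs(1)[OF w] by (simp add: adm_def)
  have Sne: "S \<noteq> {}" using adm0 by (auto simp: S_def)
  have Sbd: "bdd_below S" using h1q_nonneg by (auto simp: S_def intro!: bdd_belowI[of _ 0])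
  have I: "I \<le> h1q h B" if "adm h B" for h B
    unfolding I_def by (rule cInf_lower[OF _ Sbd]) (use that in \<open>auto simp: S_def\<close>)
  have "\<exists>h B. adm h B \<and> h1q h B < I + (1/4) ^ n" for n
    using cInf_lessD[OF Sne, of "I + (1/4) ^ n"] by (auto simp: I_def S_def)
  then obtain h B where hB: "\<And>n. adm (h n) (B n)" "\<And>n. h1q (h n) (B n) < I + (1/4) ^ n"
    by metis
  have hH: "H1 (h n) (B n)" for n using hB(1) by (simp add: adm_def)
  define f where "f n x = h (Suc n) x - h n x" for n x
  define F where "F n i x = B (Suc n) i x - B n i x" for n i x
  have fF: "H1 (f n) (F n)" for n
    unfolding f_def[abs_def] F_def[abs_def] by (rule H1_diff[OF hH hH])
  \<comment> \<open>The energies exceed the infimum by less than 4^(-n), so the energy of a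
    difference is at most (5/2) 4^(-n), hence at most (2 * 2^(-n))^2. Passing from the root of
    \<open>h1q\<close> to \<open>h1n\<close> costs the factor 4.\<close>
  have "h1n (f n) (F n) \<le> 8 * (1/2) ^ n" for n
  proof -
    have "adm (\<lambda>x. (1/2) * (h (Suc n) x + h n x)) (\<lambda>i x. (1/2) * (B (Suc n) i x + B n i x))"
      unfolding adm_def
    proof (intro conjI H1_cmult H1_add hH)
      have "AE x in lborel. \<bar>w x\<bar> \<le> h (Suc n) x" "AE x in lborel. \<bar>w x\<bar> \<le> h n x"
        using hB(1) by (auto simp: adm_def)
      then show "AE x in lborel. \<bar>w x\<bar> \<le> (1/2) * (h (Suc n) x + h n x)"
        by eventually_elim simp
    qed
    from I[OF this] have "4 * I \<le> h1q (\<lambda>x. h (Suc n) x + h n x) (\<lambda>i x. B (Suc n) i x + B n i x)"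
      unfolding h1q_cmult by (simp add: power2_eq_square)
    then have "h1q (f n) (F n) \<le> 2 * (I + (1/4) ^ Suc n) + 2 * (I + (1/4) ^ n) - 4 * I"
    proof -
      have ar: "X \<le> 2 * (I + p) + 2 * (I + q) - 4 * I"
        if "X + Y = 2 * a + 2 * b" "4 * I \<le> Y" "a < I + p" "b < I + q" for X Y a b p q :: real
        using that by (simp add: algebra_simps)
      show ?thesis
        unfolding f_def F_def by (rule ar[OF h1q_parallelogram[OF hH hH] \<open>4 * I \<le> _\<close> hB(2) hB(2)])
    qed
    also have "\<dots> \<le> (2 * (1/2) ^ n)\<^sup>2"
      by (simp add: power_mult_distrib power2_eq_square[of "_ ^ n"] power_mult_distrib[symmetric])
    finally have "sqrt (h1q (f n) (F n)) \<le> 2 * (1/2) ^ n"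
      by (intro real_le_lsqrt) (auto simp: h1q_nonneg)
    then show ?thesis using h1n_le_h1q[of "f n" "F n"] by linarith
  qed
  moreover have "summable (\<lambda>n. 8 * (1/2 :: real) ^ n)"
    by (intro summable_mult summable_geometric) simp
  ultimately have s: "summable (\<lambda>n. h1n (f n) (F n))"
    by (intro summable_comparison_test'[of "\<lambda>n. 8 * (1/2) ^ n" 0 "\<lambda>n. h1n (f n) (F n)"]) simp_all
  obtain v E where v: "H1 v E" "AE x in lborel. (\<lambda>n. f n x) sums v x" and "h1n v E \<le> (\<Sum>n. h1n (f n) (F n))"
    and v':
    "(\<lambda>n. l2n lborel (\<lambda>x. (\<Sum>k<n. f k x) - v x)) \<longlonglongrightarrow> 0" "\<forall>i. (\<lambda>n. l2n lborel (\<lambda>x. (\<Sum>k<n. F k i x) - E i x)) \<longlonglongrightarrow> 0"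
    by (rule H1_series[OF fF s])
  note v = v v' 
  have fs: "(\<Sum>k<n. f k x) = h n x - h 0 x" "(\<Sum>k<n. F k i x) = B n i x - B 0 i x" for n i x
    unfolding f_def F_def by (rule sum_lessThan_telescope)+
  define g where "g x = h 0 x + v x" for x
  define G where "G i x = B 0 i x + E i x" for i x
  have gG: "H1 g G" unfolding g_def[abs_def] G_def[abs_def] by (rule H1_add[OF hH v(1)])
  have l1: "(\<lambda>n. l2n lborel (\<lambda>x. h n x - g x)) \<longlonglongrightarrow> 0"
    using v(3) by (simp add: fs g_def algebra_simps)
  have l2: "(\<lambda>n. l2n lborel (\<lambda>x. B n i x - G i x)) \<longlonglongrightarrow> 0" for i
    using spec[OF v(4), of i] by (simp add: fs G_def algebra_simps)
  have "AE x in lborel. \<forall>n. \<bar>w x\<bar> \<le> h n x"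
    using hB(1) by (auto simp: adm_def AE_all_countable)
  then have gw: "AE x in lborel. \<bar>w x\<bar> \<le> g x"
    using v(2)
  proof eventually_elim
    case (elim x)
    have "(\<lambda>n. (h n x - h 0 x) + h 0 x) \<longlonglongrightarrow> v x + h 0 x"
      using elim(2) unfolding sums_def fs by (intro tendsto_add) auto
    then have "(\<lambda>n. h n x) \<longlonglongrightarrow> g x" by (simp add: g_def add.commute)
    then show ?case by (rule LIMSEQ_le_const) (use elim(1) in auto)
  qed
  have "(\<lambda>n. h1q (h n) (B n)) \<longlonglongrightarrow> h1q g G"
    unfolding h1q_def
    by (intro tendsto_intros l2n_tendsto l1 l2 H1_D(1)[OF hH] H1_D(2)[OF hH] H1_D(1)[OF gG] H1_D(2)[OF gG])
  moreover have "(\<lambda>n. I + (1/4) ^ n) \<longlonglongrightarrow> I + 0"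
    by (intro tendsto_add tendsto_const LIMSEQ_power_zero) auto
  ultimately have gI: "h1q g G \<le> I"
    using hB(2) by (intro LIMSEQ_le) (auto intro: less_imp_le)
  show ?thesis
  proof (rule that[OF gG gw])
    \<comment> \<open>The competitor |w| bounds the minimal energy. The factor 4 again comes from
      \<open>h1n_le_h1q\<close>, one unit for the function and one for each of the three
      derivatives.\<close>
    have "h1n g G \<le> 4 * sqrt I"
      using h1n_le_h1q[of g G] gI real_sqrt_le_mono[OF gI] by linarith
    also have "sqrt I \<le> sqrt (h1q (\<lambda>x. \<bar>w x\<bar>) (\<lambda>i x. sgn (w x) * D i x))"
      by (rule real_sqrt_le_mono[OF I[OF adm0]])
    also have "\<dots> \<le> h1n w D"
      using h1q_le_h1n H1_abs(2)[OF w] order_trans by blast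
    finally show "h1n g G \<le> 4 * h1n w D" by simp
  next
    fix \<phi> :: "real^3 \<Rightarrow> real" assume \<phi>: "\<phi> \<in> test_functions UNIV" "\<And>x. \<phi> x \<ge> 0"
    define ip where "ip = (\<integral>x. g x * \<phi> x \<partial>lborel) + (\<Sum>i\<in>UNIV. \<integral>x. G i x * pderiv i \<phi> x \<partial>lborel)"
    define Q where "Q = h1q \<phi> (\<lambda>i. pderiv i \<phi>)"
    have Q: "Q \<ge> 0" by (simp add: Q_def h1q_nonneg)
    have *: "0 \<le> 2 * ip + t * Q" if t: "t > 0" for t
    proof -
      have "adm (\<lambda>x. g x + t * \<phi> x) (\<lambda>i x. G i x + t * pderiv i \<phi> x)"
        unfolding adm_def
      proof (intro conjI H1_add gG H1_cmult H1_test[OF \<phi>(1)])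
        show "AE x in lborel. \<bar>w x\<bar> \<le> g x + t * \<phi> x"
          using gw by eventually_elim (use \<phi>(2) t in \<open>simp add: add_increasing2\<close>)
      qed
      from I[OF this] have "I \<le> h1q g G + 2 * t * ip + t\<^sup>2 * Q"
        unfolding h1q_add[OF gG H1_test[OF \<phi>(1)]] by (simp add: ip_def Q_def)
      then have "0 \<le> t * (2 * ip + t * Q)" using gI by (simp add: algebra_simps power2_eq_square)
      then show ?thesis using t by (simp add: zero_le_mult_iff)
    qed
    show "0 \<le> (\<integral>x. g x * \<phi> x \<partial>lborel) + (\<Sum>i\<in>UNIV. \<integral>x. G i x * pderiv i \<phi> x \<partial>lborel)"
    proof (rule ccontr)
      assume "\<not> ?thesis"
      then have ip: "ip < 0" by (simp add: ip_def)
      \<comment> \<open>At t = -ip/(Q + 1) the quadratic contribution tQ is at most -ip, so 2 ip +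
        tQ \<le> ip < 0.\<close>
      have "- ip / (Q + 1) * Q \<le> - ip"
        using ip Q by (simp add: field_simps)
      then show False using *[of "- ip / (Q + 1)"] ip Q by (simp add: divide_neg_pos)
    qed
  qed
qed

text \<open>The regularised Newtonian potential \<open>npot (-1/2) s\<close> with its derivatives.\<close>

definition npot :: "real \<Rightarrow> real \<Rightarrow> real^3 \<Rightarrow> real" where
  "npot a s z = ((norm z)\<^sup>2 + s\<^sup>2) powr a"

lemma npot_base_pos: "s > 0 \<Longrightarrow> (norm z)\<^sup>2 + s\<^sup>2 > 0"
  by (simp add: add_nonneg_pos)

lemma smooth_npot: "s > 0 \<Longrightarrow> smooth (npot a s)"
  unfolding npot_def[abs_def] by (intro smooth_powr smooth_add smooth_norm_sq smooth_const npot_base_pos)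

lemma npot_nonneg: "0 \<le> npot a s z"
  by (simp add: npot_def)

lemma pderiv_npot:
  assumes "s > 0"
  shows "pderiv i (npot a s) z = 2 * a * z $ i * npot (a - 1) s z"
proof -
  have n: "(\<lambda>z::real^3. (norm z)\<^sup>2 + s\<^sup>2) differentiable (at z)"
    by (rule smooth_differentiable) (intro smooth_add smooth_norm_sq smooth_const)
  have "((\<lambda>z::real^3. (norm z)\<^sup>2 + s\<^sup>2) has_derivative (\<lambda>h. 2 * (z \<bullet> h))) (at z)"
    by (auto intro!: derivative_eq_intros simp: power2_norm_eq_inner inner_commute)
  then have "pderiv i (\<lambda>z::real^3. (norm z)\<^sup>2 + s\<^sup>2) z = 2 * z $ i"
    by (simp add: pderiv_eq inner_axis)
  moreover have "((\<lambda>t. t powr a) has_real_derivative a * ((norm z)\<^sup>2 + s\<^sup>2) powr (a - 1)) (at ((norm z)\<^sup>2 + s\<^sup>2))"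
    using npot_base_pos[OF assms] by (auto intro!: derivative_eq_intros)
  ultimately show ?thesis
    unfolding npot_def[abs_def] by (subst pderiv_comp[OF n]) auto
qed

lemma npot_mult: "s > 0 \<Longrightarrow> ((norm z)\<^sup>2 + s\<^sup>2) * npot a s z = npot (a + 1) s z"
  using npot_base_pos[of s z] by (simp add: npot_def powr_add)

lemma npot_le_one: "s > 0 \<Longrightarrow> norm z \<ge> 1 \<Longrightarrow> a \<le> 0 \<Longrightarrow> npot a s z \<le> 1"
proof -
  assume a: "s > 0" "norm z \<ge> 1" "a \<le> 0"
  have "1 \<le> (norm z)\<^sup>2" using a(2) by (simp add: one_le_power)
  then have "(norm z)\<^sup>2 + s\<^sup>2 \<ge> 1" by (simp add: add_increasing2)
  then have "((norm z)\<^sup>2 + s\<^sup>2) powr a \<le> ((norm z)\<^sup>2 + s\<^sup>2) powr 0"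
    using a by (intro powr_mono) auto
  then show ?thesis using npot_base_pos[OF a(1), of z] by (auto simp: npot_def split: if_splits)
qed

lemma coord_npot_le_one:
  assumes a: "s > 0" "norm z \<ge> 1" "a \<le> -1"
  shows "\<bar>z $ i\<bar> * npot a s z \<le> 1"
proof -
  have "\<bar>z $ i\<bar> \<le> norm z" by (rule component_le_norm_cart)
  also have "\<dots> \<le> (norm z)\<^sup>2 + s\<^sup>2"
    using a(2) by (simp add: power2_eq_square add_increasing2 mult_left_mono[of 1 "norm z" "norm z", simplified])
  finally have "\<bar>z $ i\<bar> * npot a s z \<le> ((norm z)\<^sup>2 + s\<^sup>2) * npot a s z"
    by (rule mult_right_mono) (rule npot_nonneg)
  also have "\<dots> \<le> 1"
    unfolding npot_mult[OF a(1)] using a by (intro npot_le_one) auto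
  finally show ?thesis .
qed

lemma norm_sq_sum: "(\<Sum>i\<in>UNIV. (z $ i)\<^sup>2) = (norm z)\<^sup>2" for z :: "real^3"
  by (simp add: norm_vec_def L2_set_def sum_nonneg)

lemma pderiv_locally_const:
  assumes "open U" "z \<in> U" "\<And>y. y \<in> U \<Longrightarrow> f y = c"
  shows "pderiv i f z = 0"
proof -
  have "(f has_derivative (\<lambda>h. 0)) (at z)"
    by (rule has_derivative_transform_within_open[OF has_derivative_const[of c] assms(1,2)]) (simp add: assms(3))
  then show ?thesis by (simp add: pderiv_eq)
qed

section \<open>The localised potential, its Laplacian and its kernel\<close>

lemma cutoff_derivs_zero:
  assumes "norm z < 1 \<or> norm z > 2"
  shows "pderiv i cutoff z = 0" "pderiv j (pderiv i cutoff) z = 0"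
proof -
  have o: "open (ball (0::real^3) 1)" "open (- cball (0::real^3) 2)" by auto
  have 1: "pderiv i cutoff y = 0" if "y \<in> ball 0 1" for y
    by (rule pderiv_locally_const[OF o(1) that, of _ 1]) (auto simp: cutoff_one)
  have 2: "pderiv i cutoff y = 0" if "y \<in> - cball 0 2" for y
    by (rule pderiv_locally_const[OF o(2) that, of _ 0]) (auto simp: cutoff_zero)
  show "pderiv i cutoff z = 0" using assms 1[of z] 2[of z] by auto
  show "pderiv j (pderiv i cutoff) z = 0"
    using assms
  proof
    assume "norm z < 1"
    then show ?thesis by (intro pderiv_locally_const[OF o(1) _ 1]) auto
  next
    assume "norm z > 2"
    then show ?thesis by (intro pderiv_locally_const[OF o(2) _ 2]) auto
  qed
qed

definition cpot :: "real \<Rightarrow> real^3 \<Rightarrow> real" where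
  "cpot s z = cutoff z * npot (-1/2) s z"

text \<open>The Laplacian of (|z|^2 + s^2)^(-1/2) is -3 s^2 (|z|^2 + s^2)^(-5/2). Up to sign and
  cutoff this is the kernel here, 3 s^(-3) (1 + |z/s|^2)^(-5/2), which concentrates at the origin as
  s tends to 0.\<close>

definition ckern :: "real \<Rightarrow> real^3 \<Rightarrow> real" where
  "ckern s z = 3 * s\<^sup>2 * cutoff z * npot (-5/2) s z"

text \<open>The part of the Laplacian of \<open>cpot s\<close> in which a derivative falls on the
  cutoff. It vanishes outside the shell 1 \<le> |z| \<le> 2, on which the potential and its gradient
  are bounded independently of \<open>s\<close>.\<close>

definition cerr :: "real \<Rightarrow> real^3 \<Rightarrow> real" where
  "cerr s z = (\<Sum>i\<in>UNIV. pderiv i (pderiv i cutoff) z * npot (-1/2) s z - 2 * pderiv i cutoff z * (z $ i * npot (-3/2) s z))"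

lemma cpot_test: "s > 0 \<Longrightarrow> cpot s \<in> test_functions UNIV"
  unfolding cpot_def[abs_def] by (rule test_mult_smooth[OF test_cutoff smooth_npot])

lemma cpot_nonneg: "0 \<le> cpot s z"
  by (simp add: cpot_def cutoff_bounds npot_nonneg)

lemma ckern_nonneg: "0 \<le> ckern s z"
  by (simp add: ckern_def cutoff_bounds npot_nonneg)

lemma ckern_test: "s > 0 \<Longrightarrow> ckern s \<in> test_functions UNIV"
proof -
  assume s: "s > 0"
  have "(\<lambda>z. cutoff z * (3 * s\<^sup>2 * npot (-5/2) s z)) \<in> test_functions UNIV"
    by (intro test_mult_smooth test_cutoff smooth_mult smooth_const smooth_npot s)
  then show ?thesis by (simp add: ckern_def[abs_def] mult_ac)
qed

lemma ckern_minus: "ckern s (x - y) = ckern s (y - x)"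
  by (simp add: ckern_def cutoff_def npot_def norm_minus_commute)

lemma laplacian_cpot:
  assumes s: "s > 0"
  shows "(\<Sum>i\<in>UNIV. pderiv i (pderiv i (cpot s)) z) = cerr s z - ckern s z"
proof -
  note d = smooth_differentiable
  note sp = smooth_pderiv[OF smooth_cutoff] smooth_cutoff smooth_npot[OF s]
  have p1: "pderiv i (cpot s) = (\<lambda>z. cutoff z * (- 1 * (z $ i * npot (-3/2) s z)) + pderiv i cutoff z * npot (-1/2) s z)" for i
    unfolding cpot_def[abs_def]
    by (rule ext, subst pderiv_mult) (auto simp: pderiv_npot[OF s] intro!: d sp)
  have zn: "pderiv i (\<lambda>z. z $ i * npot (-3/2) s z) z = npot (-3/2) s z - 3 * (z $ i)\<^sup>2 * npot (-5/2) s z" for i z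
    by (subst pderiv_mult) (auto simp: pderiv_npot[OF s] pderiv_coord power2_eq_square intro!: d sp smooth_coord)
  have p2: "pderiv i (pderiv i (cpot s)) z = cutoff z * (3 * (z $ i)\<^sup>2 * npot (-5/2) s z - npot (-3/2) s z)
      + (pderiv i (pderiv i cutoff) z * npot (-1/2) s z - 2 * pderiv i cutoff z * (z $ i * npot (-3/2) s z))" for i
  proof -
    have 1: "pderiv i (\<lambda>z. cutoff z * (- 1 * (z $ i * npot (-3/2) s z))) z =
        cutoff z * (- 1 * (npot (-3/2) s z - 3 * (z $ i)\<^sup>2 * npot (-5/2) s z)) + pderiv i cutoff z * (- 1 * (z $ i * npot (-3/2) s z))"
      by (subst pderiv_mult) (simp_all only: pderiv_cmult[OF d[OF smooth_mult[OF smooth_coord sp(3)]]] zn d[OF sp(2)] d[OF smooth_mult[OF smooth_const smooth_mult[OF smooth_coord sp(3)]]])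
    have 2: "pderiv i (\<lambda>z. pderiv i cutoff z * npot (-1/2) s z) z = pderiv i cutoff z * (- 1 * (z $ i * npot (-3/2) s z)) + pderiv i (pderiv i cutoff) z * npot (-1/2) s z"
      by (subst pderiv_mult) (auto simp: pderiv_npot[OF s] intro!: d sp)
    show ?thesis
      unfolding p1
      by (subst pderiv_add)
         (auto simp: 1[simplified] 2[simplified] algebra_simps intro!: d smooth_mult sp smooth_coord smooth_const smooth_mult[OF smooth_const[of "-1"], simplified])
  qed
  have "(\<Sum>i\<in>UNIV. cutoff z * (3 * (z $ i)\<^sup>2 * npot (-5/2) s z - npot (-3/2) s z)) =
      cutoff z * (3 * (norm z)\<^sup>2 * npot (-5/2) s z - 3 * npot (-3/2) s z)"
    by (simp add: sum_distrib_left[symmetric] sum_subtractf sum_distrib_right[symmetric] norm_sq_sum)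
  also have "\<dots> = - ckern s z"
  proof -
    \<comment> \<open>Once both terms carry the power -5/2, what remains of 3 |z|^2 - 3 (|z|^2 +
      s^2) is -3 s^2.\<close>
    have "npot (-3/2) s z = ((norm z)\<^sup>2 + s\<^sup>2) * npot (-5/2) s z"
      using npot_mult[OF s, of z "-5/2"] by simp
    then show ?thesis by (simp add: ckern_def algebra_simps)
  qed
  finally have "(\<Sum>i\<in>UNIV. cutoff z * (3 * (z $ i)\<^sup>2 * npot (-5/2) s z - npot (-3/2) s z)) = - ckern s z" .
  then show ?thesis
    by (simp add: p2 sum.distrib cerr_def)
qed

lemma cutoff_const:
  obtains C where "C > 0" "\<And>z. (\<Sum>i\<in>UNIV. \<bar>pderiv i (pderiv i cutoff) z\<bar> + 2 * \<bar>pderiv i cutoff z\<bar>) \<le> C"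
proof -
  have "\<exists>M. \<forall>x. \<bar>pderiv i (pderiv i cutoff) x\<bar> \<le> M" for i
    using test_bounded[OF test_pderiv[OF test_pderiv[OF test_cutoff]]] by metis
  then obtain M where M: "\<And>i x. \<bar>pderiv i (pderiv i cutoff) x\<bar> \<le> M i" by metis
  have "\<exists>M. \<forall>x. \<bar>pderiv i cutoff x\<bar> \<le> M" for i
    using test_bounded[OF test_pderiv[OF test_cutoff]] by metis
  then obtain N where N: "\<And>i x. \<bar>pderiv i cutoff x\<bar> \<le> N i" by metis
  have b: "(\<Sum>i\<in>UNIV. \<bar>pderiv i (pderiv i cutoff) z\<bar> + 2 * \<bar>pderiv i cutoff z\<bar>) \<le> (\<Sum>i\<in>UNIV. M i + 2 * N i)" for z
    by (intro sum_mono add_mono M mult_left_mono N) auto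
  have "(\<Sum>i\<in>UNIV. M i + 2 * N i) \<ge> 0"
    by (rule order_trans[OF _ b[of 0]]) (auto intro: sum_nonneg)
  then show ?thesis
    using b by (intro that[of "(\<Sum>i\<in>UNIV. M i + 2 * N i) + 1"]) (auto intro: order_trans[OF b])
qed

lemma cerr_bound:
  assumes C: "\<And>z. (\<Sum>i\<in>UNIV. \<bar>pderiv i (pderiv i cutoff) z\<bar> + 2 * \<bar>pderiv i cutoff z\<bar>) \<le> C" and s: "s > 0"
  shows "\<bar>cerr s z\<bar> \<le> C * indicator (cball 0 2) z"
proof (cases "norm z < 1 \<or> norm z > 2")
  case True
  have "0 \<le> C" by (rule order_trans[OF _ C[of 0]]) (auto intro: sum_nonneg)
  then show ?thesis using cutoff_derivs_zero[OF True] by (simp add: cerr_def indicator_def)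
next
  case False
  then have z: "norm z \<ge> 1" "norm z \<le> 2" by auto
  have "\<bar>cerr s z\<bar> \<le> (\<Sum>i\<in>UNIV. \<bar>pderiv i (pderiv i cutoff) z\<bar> + 2 * \<bar>pderiv i cutoff z\<bar>)"
    unfolding cerr_def
  proof (intro order_trans[OF sum_abs] sum_mono)
    fix i
    have "\<bar>pderiv i (pderiv i cutoff) z * npot (-1/2) s z\<bar> \<le> \<bar>pderiv i (pderiv i cutoff) z\<bar>"
      using npot_le_one[OF s z(1), of "-1/2"] npot_nonneg[of "-1/2" s z] by (simp add: abs_mult mult_left_le)
    moreover have "\<bar>pderiv i cutoff z * (z $ i * npot (-3/2) s z)\<bar> \<le> \<bar>pderiv i cutoff z\<bar>"
      using coord_npot_le_one[OF s z(1), of "-3/2" i] npot_nonneg[of "-3/2" s z] by (simp add: abs_mult mult_left_le)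
    ultimately show "\<bar>pderiv i (pderiv i cutoff) z * npot (-1/2) s z - 2 * pderiv i cutoff z * (z $ i * npot (-3/2) s z)\<bar>
        \<le> \<bar>pderiv i (pderiv i cutoff) z\<bar> + 2 * \<bar>pderiv i cutoff z\<bar>"
      by linarith
  qed
  also have "\<dots> \<le> C" by (rule C)
  finally show ?thesis using z by simp
qed

lemma cerr_test: "s > 0 \<Longrightarrow> cerr s \<in> test_functions UNIV"
proof -
  assume s: "s > 0"
  have *: "smooth (cerr s)"
    unfolding cerr_def[abs_def]
    by (intro smooth_sum smooth_diff smooth_mult smooth_const smooth_coord smooth_npot smooth_pderiv smooth_cutoff s)
  show ?thesis
  proof (rule test_functionsI[OF *, of "cball 0 2"])
    fix z :: "real^3" assume "z \<notin> cball 0 2"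
    then have "norm z < 1 \<or> norm z > 2" by auto
    from cutoff_derivs_zero[OF this] show "cerr s z = 0" by (simp add: cerr_def)
  qed auto
qed

text \<open>Integrating the divergence of \<open>cutoff z * z / (|z|\<^sup>2 + s\<^sup>2)\<close> bounds the potential uniformly in \<open>s\<close>.\<close>

lemma cpot_l2_bound:
  obtains K where "K > 0" "\<And>s. s > 0 \<Longrightarrow> l2n lborel (cpot s) \<le> K"
proof -
  obtain C where C: "C > 0" "\<And>z. (\<Sum>i\<in>UNIV. \<bar>pderiv i (pderiv i cutoff) z\<bar> + 2 * \<bar>pderiv i cutoff z\<bar>) \<le> C"
    by (rule cutoff_const) blast
  define V where "V = (\<integral>z. C * indicator (cball 0 2) (z::real^3) \<partial>lborel)"
  have iV: "integrable lborel (\<lambda>z::real^3. C * indicator (cball 0 2) z)"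
    by (rule integrable_bounded_support[of _ C 2]) (use C in \<open>auto simp: indicator_def\<close>)
  have V: "V \<ge> 0" unfolding V_def using C by (intro Bochner_Integration.integral_nonneg) auto
  show ?thesis
  proof (rule that[of "sqrt V + 1"])
    show "sqrt V + 1 > 0" using V by (simp add: add_nonneg_pos)
    fix s :: real assume s: "s > 0"
    define f where "f i z = cutoff z * (z $ i * npot (-1) s z)" for i z
    have ft: "f i \<in> test_functions UNIV" for i
      unfolding f_def[abs_def] by (intro test_mult_smooth test_cutoff smooth_mult smooth_coord smooth_npot s)
    have pf: "pderiv i (f i) z = cutoff z * (npot (-1) s z - 2 * (z $ i)\<^sup>2 * npot (-2) s z) + pderiv i cutoff z * (z $ i * npot (-1) s z)" for i z
    proof -
      have "pderiv i (\<lambda>z. z $ i * npot (-1) s z) z = npot (-1) s z - 2 * (z $ i)\<^sup>2 * npot (-2) s z"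
        by (subst pderiv_mult) (auto simp: pderiv_npot[OF s] pderiv_coord power2_eq_square intro!: smooth_differentiable smooth_coord smooth_npot s)
      then show ?thesis
        unfolding f_def[abs_def] by (subst pderiv_mult) (auto intro!: smooth_differentiable smooth_mult smooth_cutoff smooth_coord smooth_npot s)
    qed
    have pt: "(cpot s z)\<^sup>2 \<le> (\<Sum>i\<in>UNIV. pderiv i (f i) z) + C * indicator (cball 0 2) z" for z
    proof -
      \<comment> \<open>Hence the divergence 3 \<open>npot (-1) s\<close> - 2 |z|^2
        \<open>npot (-2) s\<close> of the field z \<open>npot (-1) s\<close> is at least
        \<open>npot (-1) s\<close>, which is the square of the potential.\<close>
      have n2: "(norm z)\<^sup>2 * npot (-2) s z \<le> npot (-1) s z"
        using npot_mult[OF s, of z "-2"] npot_nonneg[of "-2" s z] by (simp add: distrib_right) (metis add_increasing2 mult_nonneg_nonneg order_refl zero_le_power2)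
      have "(cpot s z)\<^sup>2 = (cutoff z)\<^sup>2 * npot (-1) s z"
        using npot_base_pos[OF s, of z] by (simp add: cpot_def npot_def power_mult_distrib power2_eq_square[of "_ powr _"] powr_add[symmetric])
      also have "\<dots> \<le> cutoff z * npot (-1) s z"
        using cutoff_bounds[of z] npot_nonneg[of "-1" s z]
        by (intro mult_right_mono) (auto simp: power2_eq_square mult_left_le)
      also have "\<dots> \<le> cutoff z * (3 * npot (-1) s z - 2 * ((norm z)\<^sup>2 * npot (-2) s z))"
        using n2 cutoff_bounds(1)[of z] by (intro mult_left_mono) auto
      also have "\<dots> = (\<Sum>i\<in>UNIV. cutoff z * (npot (-1) s z - 2 * (z $ i)\<^sup>2 * npot (-2) s z))"
        by (simp add: sum_distrib_left[symmetric] sum_subtractf sum_distrib_right[symmetric] norm_sq_sum)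
      also have "\<dots> = (\<Sum>i\<in>UNIV. pderiv i (f i) z) - (\<Sum>i\<in>UNIV. pderiv i cutoff z * (z $ i * npot (-1) s z))"
        by (simp add: pf sum.distrib)
      also have "\<dots> \<le> (\<Sum>i\<in>UNIV. pderiv i (f i) z) + C * indicator (cball 0 2) z"
      proof (cases "norm z < 1 \<or> norm z > 2")
        case True
        then show ?thesis using cutoff_derivs_zero[OF True] C(1) by simp
      next
        case False
        then have z: "norm z \<ge> 1" "norm z \<le> 2" by auto
        have "\<bar>\<Sum>i\<in>UNIV. pderiv i cutoff z * (z $ i * npot (-1) s z)\<bar> \<le> (\<Sum>i\<in>UNIV. \<bar>pderiv i (pderiv i cutoff) z\<bar> + 2 * \<bar>pderiv i cutoff z\<bar>)"
        proof (intro order_trans[OF sum_abs] sum_mono)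
          fix i
          have "\<bar>pderiv i cutoff z * (z $ i * npot (-1) s z)\<bar> \<le> \<bar>pderiv i cutoff z\<bar>"
            using coord_npot_le_one[OF s z(1), of "-1" i] npot_nonneg[of "-1" s z] by (simp add: abs_mult mult_left_le)
          then show "\<bar>pderiv i cutoff z * (z $ i * npot (-1) s z)\<bar> \<le> \<bar>pderiv i (pderiv i cutoff) z\<bar> + 2 * \<bar>pderiv i cutoff z\<bar>"
            by linarith
        qed
        then show ?thesis using C(2)[of z] z by (simp add: abs_le_iff)
      qed
      finally show ?thesis .
    qed
    have ip: "integrable lborel (pderiv i (f i))" for i by (rule test_integrable[OF test_pderiv[OF ft]])
    have p0: "(\<integral>z. pderiv i (f i) z \<partial>lborel) = 0" for i
    proof -
      obtain R where "\<And>x. norm x > R \<Longrightarrow> f i x = 0" using test_bounded_support[OF ft] by metis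
      then show ?thesis using integral_pderiv_eq_0[of "f i" R i] test_smooth[OF ft, of i] by (simp add: smooth_def del: C_k.simps)
    qed
    have "(l2n lborel (cpot s))\<^sup>2 \<le> (\<integral>z. (\<Sum>i\<in>UNIV. pderiv i (f i) z) + C * indicator (cball 0 2) z \<partial>lborel)"
      unfolding l2n_sq using pt ip iV
      by (intro integral_mono sq_int_sq test_sq_int[OF cpot_test[OF s]] Bochner_Integration.integrable_add Bochner_Integration.integrable_sum) auto
    also have "\<dots> = V"
      using ip iV by (simp add: p0 V_def)
    finally have "l2n lborel (cpot s) \<le> sqrt V" by (rule real_le_rsqrt)
    then show "l2n lborel (cpot s) \<le> sqrt V + 1" by simp
  qed
qed

text \<open>The Laplacian of the compactly supported \<open>cpot s\<close> integrates to 0, so the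
  kernel has the same mass as \<open>cerr s\<close>, for which \<open>cerr_bound\<close> is uniform
  in \<open>s\<close>.\<close>

lemma ckern_mass:
  assumes s: "s > 0" and C: "\<And>z. (\<Sum>i\<in>UNIV. \<bar>pderiv i (pderiv i cutoff) z\<bar> + 2 * \<bar>pderiv i cutoff z\<bar>) \<le> C"
  shows "(\<integral>z. ckern s z \<partial>lborel) \<le> (\<integral>z. C * indicator (cball 0 2) (z::real^3) \<partial>lborel)"
proof -
  have C0: "0 \<le> C" by (rule order_trans[OF _ C[of 0]]) (auto intro: sum_nonneg)
  have iV: "integrable lborel (\<lambda>z::real^3. C * indicator (cball 0 2) z)"
    by (rule integrable_bounded_support[of _ C 2]) (use C0 in \<open>auto simp: indicator_def\<close>)
  have t: "pderiv i (cpot s) \<in> test_functions UNIV" for i by (rule test_pderiv[OF cpot_test[OF s]])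
  have ip: "integrable lborel (pderiv i (pderiv i (cpot s)))" for i by (rule test_integrable[OF test_pderiv[OF t]])
  have p0: "(\<integral>z. pderiv i (pderiv i (cpot s)) z \<partial>lborel) = 0" for i
  proof -
    obtain R where "\<And>x. norm x > R \<Longrightarrow> pderiv i (cpot s) x = 0" using test_bounded_support[OF t] by metis
    then show ?thesis using integral_pderiv_eq_0[of "pderiv i (cpot s)" R i] test_smooth[OF t, of i] by (simp add: smooth_def del: C_k.simps)
  qed
  have "(\<integral>z. ckern s z \<partial>lborel) = (\<integral>z. cerr s z - (\<Sum>i\<in>UNIV. pderiv i (pderiv i (cpot s)) z) \<partial>lborel)"
    by (simp add: laplacian_cpot[OF s])
  also have "\<dots> = (\<integral>z. cerr s z \<partial>lborel)"
    using ip test_integrable[OF cerr_test[OF s]] by (simp add: p0)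
  also have "\<dots> \<le> (\<integral>z. C * indicator (cball 0 2) (z::real^3) \<partial>lborel)"
    using cerr_bound[OF C s] by (intro integral_mono test_integrable[OF cerr_test[OF s]] iV) (simp add: abs_le_iff)
  finally show ?thesis .
qed

text \<open>At distance at least \<open>d\<close> from the origin the power in the kernel is bounded
  by d^(-5), so the factor s^2 in front forces decay; the cutoff confines the integral to a fixed
  ball.\<close>

lemma ckern_tail:
  assumes d: "d > 0"
  shows "(\<lambda>n. \<integral>z. ckern (1 / real (Suc n)) z * indicator {z. norm z \<ge> d} z \<partial>lborel) \<longlonglongrightarrow> 0"
proof (rule Lim_null_comparison)
  define V :: real where "V = (\<integral>z. indicator (cball (0::real^3) 2) z \<partial>(lborel :: (real^3) measure))"
  define c where "c = 3 * (d\<^sup>2) powr (-5/2)"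
  have c: "c \<ge> 0" by (simp add: c_def)
  have iV: "integrable lborel (\<lambda>z::real^3. indicator (cball 0 2) z :: real)"
    by (rule integrable_bounded_support[of _ 1 2]) (auto simp: indicator_def)
  show "(\<lambda>n. (1 / real (Suc n))\<^sup>2 * (c * V)) \<longlonglongrightarrow> 0"
    using tendsto_mult_left_zero[OF tendsto_power[OF LIMSEQ_Suc[OF lim_1_over_n], of 2, simplified], of "c * V"]
    by simp
  have "(\<integral>z. ckern s z * indicator {z. norm z \<ge> d} z \<partial>lborel) \<le> s\<^sup>2 * (c * V)" if s: "s > 0" for s
  proof -
    have "ckern s z * indicator {z. norm z \<ge> d} z \<le> s\<^sup>2 * (c * indicator (cball 0 2) z)" for z
    proof (cases "norm z \<ge> d \<and> norm z \<le> 2")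
      case True
      have "d\<^sup>2 \<le> (norm z)\<^sup>2 + s\<^sup>2" using True d by (simp add: add_increasing2 power_mono)
      then have "npot (-5/2) s z \<le> (d\<^sup>2) powr (-5/2)"
        unfolding npot_def using d by (intro powr_mono2') auto
      then have "cutoff z * npot (-5/2) s z \<le> 1 * (d\<^sup>2) powr (-5/2)"
        using cutoff_bounds[of z] by (intro mult_mono) (auto simp: npot_nonneg)
      then have "3 * s\<^sup>2 * (cutoff z * npot (-5/2) s z) \<le> 3 * s\<^sup>2 * (1 * (d\<^sup>2) powr (-5/2))"
        by (intro mult_left_mono) auto
      then show ?thesis using True by (simp add: ckern_def c_def mult_ac)
    next
      case False
      then show ?thesis using cutoff_zero[of z] c by (auto simp: ckern_def indicator_def)
    qed
    then have "(\<integral>z. ckern s z * indicator {z. norm z \<ge> d} z \<partial>lborel) \<le> (\<integral>z. s\<^sup>2 * (c * indicator (cball 0 2) (z::real^3)) \<partial>lborel)"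
      using iV test_integrable[OF ckern_test[OF s]]
      by (intro integral_mono) (auto intro!: integrable_real_mult_indicator)
    then show ?thesis by (simp add: V_def)
  qed
  moreover have "(\<integral>z. ckern s z * indicator {z. norm z \<ge> d} z \<partial>lborel) \<ge> 0" for s
    using ckern_nonneg by (intro Bochner_Integration.integral_nonneg) auto
  ultimately show "\<forall>\<^sub>F n in sequentially. norm (\<integral>z. ckern (1 / real (Suc n)) z * indicator {z. norm z \<ge> d} z \<partial>lborel) \<le> (1 / real (Suc n))\<^sup>2 * (c * V)"
    by simp
qed

text \<open>At scale \<open>r\<close> the kernel is at least a constant times r^(-3) on the ball of
  radius \<open>r\<close>, so it dominates the averaging kernel of that ball. The restriction to
  \<open>r \<le> 1\<close> keeps the ball where the cutoff equals 1; the constant comes from |z|^2 +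
  r^2 \<le> 2 r^2.\<close>

lemma ckern_lower:
  assumes "0 < r" "r \<le> 1" "norm z < r"
  shows "r ^ 3 * ckern r z \<ge> 3 * 2 powr (-5/2)"
proof -
  have c1: "cutoff z = 1" using assms by (intro cutoff_one) auto
  have "(norm z)\<^sup>2 + r\<^sup>2 \<le> 2 * r\<^sup>2" using assms by (simp add: power_mono)
  then have "(2 * r\<^sup>2) powr (-5/2) \<le> npot (-5/2) r z"
    unfolding npot_def using assms npot_base_pos[of r z] by (intro powr_mono2') auto
  moreover have "(2 * r\<^sup>2) powr (-5/2) = 2 powr (-5/2) * r powr (-5)"
    using assms by (simp add: powr_mult powr_powr powr_numeral[symmetric] del: powr_numeral)
  ultimately have A: "r ^ 3 * (3 * r\<^sup>2 * (2 powr (-5/2) * r powr (-5))) \<le> r ^ 3 * ckern r z"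
    using assms by (auto simp: ckern_def c1 intro!: mult_left_mono)
  have B: "r ^ 3 * (3 * r\<^sup>2 * (2 powr (-5/2) * r powr (-5))) = 3 * 2 powr (-5/2)"
  proof -
    have "r powr (-5) * (r ^ 3 * r\<^sup>2) = 1"
      using assms by (simp add: powr_minus powr_numeral power_add[symmetric])
    moreover have "r ^ 3 * (3 * r\<^sup>2 * (2 powr (-5/2) * r powr (-5))) = 3 * 2 powr (-5/2) * (r powr (-5) * (r ^ 3 * r\<^sup>2))"
      by (simp only: mult_ac)
    ultimately show ?thesis by (simp only: mult_1_right)
  qed
  show ?thesis using A unfolding B .
qed

section \<open>Averages of supersolutions and the weak-type estimate\<close>

lemma test_translate_pderiv:
  assumes "f \<in> test_functions UNIV"
  shows "pderiv i (\<lambda>y. f (y - x)) = (\<lambda>y. pderiv i f (y - x))"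
  using pderiv_affine[OF smooth_differentiable[OF test_smooth[OF assms]], of i "-x" 1] by (simp add: fun_eq_iff)

text \<open>For \<open>s \<le> r\<close> the difference of potentials \<open>cpot s - cpot r\<close>
  is nonnegative, so its translate to \<open>x\<close> may be inserted into the supersolution
  inequality. With both derivatives moved onto the potential, its Laplacian produces the two kernel
  averages of \<open>h\<close>. The other terms, from the zero-order part of the inequality and from
  the cutoff, are bounded by the L^2 norm of \<open>h\<close>, uniformly in \<open>s\<close>,
  \<open>r\<close> and \<open>x\<close>.\<close>

lemma superharmonic_average:
  assumes h: "H1 h B" "AE x in lborel. 0 \<le> h x"
    and sup: "\<And>\<phi>. \<phi> \<in> test_functions UNIV \<Longrightarrow> (\<And>x. \<phi> x \<ge> 0) \<Longrightarrow>
      0 \<le> (\<integral>x. h x * \<phi> x \<partial>lborel) + (\<Sum>i\<in>UNIV. \<integral>x. B i x * pderiv i \<phi> x \<partial>lborel)"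
    and C: "C > 0" "\<And>z. (\<Sum>i\<in>UNIV. \<bar>pderiv i (pderiv i cutoff) z\<bar> + 2 * \<bar>pderiv i cutoff z\<bar>) \<le> C"
    and K: "\<And>s. s > 0 \<Longrightarrow> l2n lborel (cpot s) \<le> K"
    and s: "0 < s" "s \<le> r"
  shows "conv (ckern r) h x \<le> conv (ckern s) h x + l2n lborel h * (K + 2 * C * l2n lborel (indicator (cball 0 2) :: real^3 \<Rightarrow> real))"
proof -
  have r: "r > 0" using s by simp
  define X where "X z = 2 * C * indicator (cball 0 2) z" for z :: "real^3"
  have X: "X \<in> sq_int lborel" unfolding X_def by (rule sq_int_indicator_cball)
  define P where "P z = cpot s z - cpot r z" for z
  have Pt: "P \<in> test_functions UNIV"
    using test_add[OF cpot_test[OF s(1)] test_mult_smooth[OF cpot_test[OF r] smooth_const[of "-1"]]] by (simp add: P_def[abs_def])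
  have P0: "P z \<ge> 0" for z
  proof -
    have "npot (-1/2) r z \<le> npot (-1/2) s z"
      unfolding npot_def using s npot_base_pos[OF s(1), of z] by (intro powr_mono2') (auto simp: power_mono)
    then show ?thesis using cutoff_bounds(1)[of z] by (simp add: P_def cpot_def mult_left_mono)
  qed
  have lP: "(\<Sum>i\<in>UNIV. pderiv i (pderiv i P) z) = (cerr s z - ckern s z) - (cerr r z - ckern r z)" for z
  proof -
    have d: "cpot a differentiable (at y)" "pderiv i (cpot a) differentiable (at y)" if "a > 0" for a y i
      using smooth_differentiable test_smooth[OF cpot_test[OF that]] smooth_pderiv by blast+
    have 1: "pderiv i P = (\<lambda>z. pderiv i (cpot s) z + (-1) * pderiv i (cpot r) z)" for i
    proof
      fix y
      have "pderiv i (\<lambda>z. cpot s z + (-1) * cpot r z) y = pderiv i (cpot s) y + pderiv i (\<lambda>z. (-1) * cpot r z) y"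
        using d s r by (intro pderiv_add) (auto intro: differentiable_mult)
      then show "pderiv i P y = pderiv i (cpot s) y + (-1) * pderiv i (cpot r) y"
        unfolding pderiv_cmult[OF d(1)[OF r]] by (simp add: P_def[abs_def])
    qed
    have 2: "pderiv i (pderiv i P) z = pderiv i (pderiv i (cpot s)) z + (-1) * pderiv i (pderiv i (cpot r)) z" for i
    proof -
      have "pderiv i (\<lambda>z. pderiv i (cpot s) z + (-1) * pderiv i (cpot r) z) z =
          pderiv i (pderiv i (cpot s)) z + pderiv i (\<lambda>z. (-1) * pderiv i (cpot r) z) z"
        using d s r by (intro pderiv_add) (auto intro: differentiable_mult)
      then show ?thesis unfolding 1 pderiv_cmult[OF d(2)[OF r]] .
    qed
    show ?thesis
      by (simp add: 2 sum_subtractf laplacian_cpot[OF s(1)] laplacian_cpot[OF r])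
  qed
  define \<phi> where "\<phi> y = P (y - x)" for y
  have \<phi>: "\<phi> \<in> test_functions UNIV" unfolding \<phi>_def[abs_def] by (rule test_translate[OF Pt])
  have p\<phi>: "pderiv i \<phi> \<in> test_functions UNIV" "pderiv i (pderiv i \<phi>) \<in> test_functions UNIV" for i
    using test_pderiv \<phi> by blast+
  have pp: "pderiv i (pderiv i \<phi>) y = pderiv i (pderiv i P) (y - x)" for i y
    unfolding \<phi>_def[abs_def] test_translate_pderiv[OF Pt] test_translate_pderiv[OF test_pderiv[OF Pt]] ..
  have int: "integrable lborel (\<lambda>y. h y * f y)" if "f \<in> sq_int lborel" for f
    by (rule sq_int_mult[OF H1_D(1)[OF h(1)] that])
  have tr: "(\<lambda>y. f (y - x)) \<in> sq_int lborel" if "f \<in> sq_int lborel" for f :: "real^3 \<Rightarrow> real"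
    using sq_int_translate(1)[OF that] .
  have "(\<Sum>i\<in>UNIV. \<integral>y. B i y * pderiv i \<phi> y \<partial>lborel) = - (\<Sum>i\<in>UNIV. \<integral>y. h y * pderiv i (pderiv i \<phi>) y \<partial>lborel)"
    using H1_D(3)[OF h(1) p\<phi>(1)] by (simp add: sum_negf[symmetric])
  also have "(\<Sum>i\<in>UNIV. \<integral>y. h y * pderiv i (pderiv i \<phi>) y \<partial>lborel) = (\<integral>y. h y * (\<Sum>i\<in>UNIV. pderiv i (pderiv i \<phi>) y) \<partial>lborel)"
    unfolding sum_distrib_left by (subst Bochner_Integration.integral_sum) (auto intro!: int test_sq_int p\<phi>)
  also have "\<dots> = (\<integral>y. h y * ((cerr s (y - x) - ckern s (y - x)) - (cerr r (y - x) - ckern r (y - x))) \<partial>lborel)"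
    by (simp add: pp lP)
  finally have "0 \<le> (\<integral>y. h y * \<phi> y \<partial>lborel) - (\<integral>y. h y * ((cerr s (y - x) - ckern s (y - x)) - (cerr r (y - x) - ckern r (y - x))) \<partial>lborel)"
    using sup[OF \<phi>] P0[of "_ - x", folded \<phi>_def] by simp
  also have "\<dots> = (\<integral>y. h y * (\<phi> y - ((cerr s (y - x) - ckern s (y - x)) - (cerr r (y - x) - ckern r (y - x)))) \<partial>lborel)"
  proof -
    have "(\<lambda>y. (cerr s (y - x) - ckern s (y - x)) - (cerr r (y - x) - ckern r (y - x))) \<in> sq_int lborel"
      by (intro sq_int_diff tr test_sq_int[OF cerr_test] test_sq_int[OF ckern_test] s r)
    then show ?thesis
      using int[OF test_sq_int[OF \<phi>]] int by (subst right_diff_distrib) (rule Bochner_Integration.integral_diff[symmetric], auto)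
  qed
  \<comment> \<open>Since \<open>h\<close> is nonnegative almost everywhere, the term with
    \<open>cpot r\<close> may be dropped and the two cutoff errors replaced by their common bound
    \<open>X\<close>.\<close>
  also have "\<dots> \<le> (\<integral>y. h y * (cpot s (y - x) + X (y - x) + ckern s (y - x) - ckern r (y - x)) \<partial>lborel)"
  proof (rule integral_mono_AE)
    show "integrable lborel (\<lambda>y. h y * (\<phi> y - ((cerr s (y - x) - ckern s (y - x)) - (cerr r (y - x) - ckern r (y - x)))))"
      by (intro int sq_int_diff tr test_sq_int[OF cerr_test] test_sq_int[OF ckern_test] test_sq_int[OF \<phi>] s r)
    show "integrable lborel (\<lambda>y. h y * (cpot s (y - x) + X (y - x) + ckern s (y - x) - ckern r (y - x)))"
      by (intro int sq_int_diff sq_int_add tr X test_sq_int[OF cpot_test] test_sq_int[OF ckern_test] s r)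
    show "AE y in lborel. h y * (\<phi> y - ((cerr s (y - x) - ckern s (y - x)) - (cerr r (y - x) - ckern r (y - x)))) \<le>
        h y * (cpot s (y - x) + X (y - x) + ckern s (y - x) - ckern r (y - x))"
      using h(2)
    proof eventually_elim
      case (elim y)
      have "\<bar>cerr s (y - x)\<bar> + \<bar>cerr r (y - x)\<bar> \<le> X (y - x)"
        using cerr_bound[OF C(2) s(1), of "y - x"] cerr_bound[OF C(2) r, of "y - x"] by (simp add: X_def)
      then show ?case
        using cpot_nonneg[of r "y - x"] elim by (intro mult_left_mono) (auto simp: \<phi>_def P_def)
    qed
  qed
  also have "\<dots> = (\<integral>y. h y * (cpot s (y - x) + X (y - x)) \<partial>lborel) + (\<integral>y. h y * ckern s (y - x) \<partial>lborel) - (\<integral>y. h y * ckern r (y - x) \<partial>lborel)"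
  proof -
    have "integrable lborel (\<lambda>y. h y * (cpot s (y - x) + X (y - x)))" "integrable lborel (\<lambda>y. h y * ckern s (y - x))"
      "integrable lborel (\<lambda>y. h y * ckern r (y - x))"
      by (intro int sq_int_add tr X test_sq_int[OF cpot_test] test_sq_int[OF ckern_test] s r)+
    then show ?thesis
      by (simp add: distrib_left[of _ "_ + _"] right_diff_distrib)
  qed
  also have "(\<integral>y. h y * ckern s (y - x) \<partial>lborel) = conv (ckern s) h x"
    by (simp add: conv_def ckern_minus[of _ x])
  also have "(\<integral>y. h y * ckern r (y - x) \<partial>lborel) = conv (ckern r) h x"
    by (simp add: conv_def ckern_minus[of _ x])
  also have "(\<integral>y. h y * (cpot s (y - x) + X (y - x)) \<partial>lborel) \<le> l2n lborel h * (K + 2 * C * l2n lborel (indicator (cball 0 2) :: real^3 \<Rightarrow> real))"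
  proof -
    have "(\<integral>y. h y * (cpot s (y - x) + X (y - x)) \<partial>lborel) \<le> l2n lborel h * l2n lborel (\<lambda>y. cpot s (y - x) + X (y - x))"
      using CS_ineq[OF H1_D(1)[OF h(1)] sq_int_add[OF tr[OF test_sq_int[OF cpot_test[OF s(1)]]] tr[OF X]]] by linarith
    also have "l2n lborel (\<lambda>y. cpot s (y - x) + X (y - x)) \<le> l2n lborel (\<lambda>y. cpot s (y - x)) + l2n lborel (\<lambda>y. X (y - x))"
      by (intro l2n_triangle tr X test_sq_int[OF cpot_test[OF s(1)]])
    also have "\<dots> = l2n lborel (cpot s) + l2n lborel X"
      using sq_int_translate(2)[OF X] sq_int_translate(2)[OF test_sq_int[OF cpot_test[OF s(1)]]] by simp
    also have "\<dots> \<le> K + 2 * C * l2n lborel (indicator (cball 0 2) :: real^3 \<Rightarrow> real)"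
      using K[OF s(1)] C(1) by (simp add: X_def[abs_def] l2n_cmult)
    finally show ?thesis by (simp add: mult_left_mono)
  qed
  finally show ?thesis by simp
qed

text \<open>Letting \<open>s\<close> tend to 0 along a subsequence in
  \<open>superharmonic_average\<close> replaces the kernel average at scale \<open>s\<close> by the
  mass times \<open>h x\<close>, and the mass is at most \<open>V\<close>. The subsequence does not
  depend on \<open>r\<close>, so one null set of exceptional \<open>x\<close> serves all radii. The
  integral of |w| over a ball is below that of \<open>h\<close>, which \<open>ckern_lower\<close>
  compares with the kernel average.\<close>

theorem maximal_bound:
  obtains A where "A > 0" "\<And>w D. H1 w D \<Longrightarrow> \<exists>h B. H1 h B \<and> h1n h B \<le> 4 * h1n w D \<and>
     (AE x in lborel. \<bar>w x\<bar> \<le> h x) \<and>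
     (AE x in lborel. \<forall>r. 0 < r \<and> r \<le> 1 \<longrightarrow>
        (\<integral>y. \<bar>w y\<bar> * indicator (ball x r) y \<partial>lborel) \<le> A * r ^ 3 * (h x + h1n w D))"
proof -
  obtain C where C: "C > 0" "\<And>z. (\<Sum>i\<in>UNIV. \<bar>pderiv i (pderiv i cutoff) z\<bar> + 2 * \<bar>pderiv i cutoff z\<bar>) \<le> C"
    by (rule cutoff_const) blast
  obtain K where K: "K > 0" "\<And>s. s > 0 \<Longrightarrow> l2n lborel (cpot s) \<le> K"
    by (rule cpot_l2_bound) blast
  define V where "V = (\<integral>z. C * indicator (cball 0 2) (z::real^3) \<partial>lborel)"
  have V0: "V \<ge> 0" unfolding V_def using C(1) by (intro Bochner_Integration.integral_nonneg) auto
  define L where "L = K + 2 * C * l2n lborel (indicator (cball 0 2) :: real^3 \<Rightarrow> real)"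
  have L0: "L > 0" using K(1) C(1) by (simp add: L_def add_pos_nonneg)
  define c where "c = 3 * 2 powr (-5/2 :: real)"
  have c: "c > 0" by (simp add: c_def)
  \<comment> \<open>\<open>c\<close> is the lower bound of the kernel from
    \<open>ckern_lower\<close>; the 4 is the norm of the minimiser relative to that of
    \<open>w\<close>.\<close>
  define A where "A = (V + 4 * L) / c"
  show ?thesis
  proof (rule that[of A])
    show "A > 0" using V0 L0 c by (simp add: A_def add_nonneg_pos)
    fix w D assume w: "H1 w D"
    obtain h B where hB: "H1 h B" "AE x in lborel. \<bar>w x\<bar> \<le> h x" "h1n h B \<le> 4 * h1n w D"
      and sup: "\<And>\<phi>. \<phi> \<in> test_functions UNIV \<Longrightarrow> (\<And>x. \<phi> x \<ge> 0) \<Longrightarrow>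
        0 \<le> (\<integral>x. h x * \<phi> x \<partial>lborel) + (\<Sum>i\<in>UNIV. \<integral>x. B i x * pderiv i \<phi> x \<partial>lborel)"
      by (rule obstacle[OF w]) blast
    have h0: "AE x in lborel. 0 \<le> h x" using hB(2) by eventually_elim linarith
    have [measurable]: "h \<in> borel_measurable borel" "w \<in> borel_measurable borel"
      using H1_meas[OF hB(1)] H1_meas[OF w] by auto
    define k where "k n = ckern (1 / real (Suc n))" for n
    have kt: "k n \<in> test_functions UNIV" for n unfolding k_def by (rule ckern_test) simp
    define m where "m n = (\<integral>z. k n z \<partial>lborel)" for n
    have m: "m n \<le> V" for n unfolding m_def k_def V_def by (rule ckern_mass[OF _ C(2)]) simp
    have k0: "k n z \<ge> 0" for n z by (simp add: k_def ckern_nonneg)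
    have kT: "(\<lambda>n. \<integral>z. k n z * indicator {z. norm z \<ge> d} z \<partial>lborel) \<longlonglongrightarrow> 0" if "d > 0" for d
      unfolding k_def by (rule ckern_tail[OF that])
    note ai = conv_approx_identity[OF H1_D(1)[OF hB(1)] test_sq_int[OF kt] test_integrable[OF kt] k0 m[unfolded m_def] kT]
    obtain \<rho> :: "nat \<Rightarrow> nat" where \<rho>: "strict_mono \<rho>"
      and ae: "AE x in lborel. (\<lambda>n. conv (k (\<rho> n)) h x - m (\<rho> n) * h x) \<longlonglongrightarrow> 0"
      using l2n_AE_subseq[OF ai] unfolding m_def by blast
    have "AE x in lborel. \<forall>r. 0 < r \<and> r \<le> 1 \<longrightarrow>
        (\<integral>y. \<bar>w y\<bar> * indicator (ball x r) y \<partial>lborel) \<le> A * r ^ 3 * (h x + h1n w D)"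
      using ae h0
    proof (eventually_elim, intro allI impI)
      fix x and r :: real assume l: "(\<lambda>n. conv (k (\<rho> n)) h x - m (\<rho> n) * h x) \<longlonglongrightarrow> 0" and hx: "0 \<le> h x" and r: "0 < r \<and> r \<le> 1"
      have "conv (ckern r) h x \<le> V * h x + l2n lborel h * L"
      proof (rule LIMSEQ_le_const)
        show "(\<lambda>n. (conv (k (\<rho> n)) h x - m (\<rho> n) * h x) + (V * h x + l2n lborel h * L)) \<longlonglongrightarrow> V * h x + l2n lborel h * L"
          using tendsto_add[OF l tendsto_const[of "V * h x + l2n lborel h * L"]] by simp
        obtain N where N: "1 / real (Suc N) < r" by (rule nat_approx_posE[of r]) (use r in auto)
        show "\<exists>N. \<forall>n\<ge>N. conv (ckern r) h x \<le> (conv (k (\<rho> n)) h x - m (\<rho> n) * h x) + (V * h x + l2n lborel h * L)"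
        proof (intro exI[of _ N] allI impI)
          fix n assume "N \<le> n"
          then have "N \<le> \<rho> n" using seq_suble[OF \<rho>, of n] by simp
          then have "1 / real (Suc (\<rho> n)) \<le> 1 / real (Suc N)" by (simp add: frac_le)
          then have "1 / real (Suc (\<rho> n)) \<le> r" using N by linarith
          then have "conv (ckern r) h x \<le> conv (k (\<rho> n)) h x + l2n lborel h * L"
            unfolding k_def L_def by (intro superharmonic_average[OF hB(1) h0 sup C K(2)]) auto
          moreover have "m (\<rho> n) * h x \<le> V * h x" using m hx by (intro mult_right_mono)
          ultimately show "conv (ckern r) h x \<le> (conv (k (\<rho> n)) h x - m (\<rho> n) * h x) + (V * h x + l2n lborel h * L)"
            by linarith
        qed
      qed
      moreover have "c * (\<integral>y. \<bar>w y\<bar> * indicator (ball x r) y \<partial>lborel) \<le> r ^ 3 * conv (ckern r) h x"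
      proof -
        have ii: "integrable lborel (\<lambda>y. h y * ckern r (x - y))"
          using r by (intro sq_int_mult H1_D(1)[OF hB(1)] sq_int_reflect test_sq_int[OF ckern_test]) auto
        have "(\<integral>y. c * (\<bar>w y\<bar> * indicator (ball x r) y) \<partial>lborel) \<le> (\<integral>y. r ^ 3 * (h y * ckern r (x - y)) \<partial>lborel)"
        proof (rule integral_mono_AE')
          show "integrable lborel (\<lambda>y. r ^ 3 * (h y * ckern r (x - y)))" using ii by simp
          show "AE y in lborel. 0 \<le> r ^ 3 * (h y * ckern r (x - y))"
            using h0 by eventually_elim (use r ckern_nonneg in simp)
          show "AE y in lborel. c * (\<bar>w y\<bar> * indicator (ball x r) y) \<le> r ^ 3 * (h y * ckern r (x - y))"
            using hB(2)
          proof eventually_elim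
            case (elim y)
            show ?case
            proof (cases "y \<in> ball x r")
              case True
              then have "c \<le> r ^ 3 * ckern r (x - y)"
                unfolding c_def using r by (intro ckern_lower) (auto simp: dist_norm)
              then have "\<bar>w y\<bar> * c \<le> h y * (r ^ 3 * ckern r (x - y))"
                using elim c by (intro mult_mono) auto
              then show ?thesis using True by (simp add: mult_ac)
            next
              case False
              have "0 \<le> h y" using elim by linarith
              then show ?thesis using False r ckern_nonneg[of r "x - y"] by simp
            qed
          qed
        qed
        then show ?thesis by (simp add: conv_def)
      qed
      moreover have "l2n lborel h \<le> 4 * h1n w D" using l2n_le_h1n(1)[of h B] hB(3) by linarith
      ultimately have "c * (\<integral>y. \<bar>w y\<bar> * indicator (ball x r) y \<partial>lborel) \<le> r ^ 3 * (V * h x + (4 * h1n w D) * L)"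
        using r L0 by (smt (verit) mult_left_mono mult_right_mono zero_le_power)
      also have "\<dots> \<le> r ^ 3 * ((V + 4 * L) * (h x + h1n w D))"
        using r V0 L0 hx by (intro mult_left_mono) (auto simp: algebra_simps)
      finally show "(\<integral>y. \<bar>w y\<bar> * indicator (ball x r) y \<partial>lborel) \<le> A * r ^ 3 * (h x + h1n w D)"
        using c by (simp add: A_def field_simps)
    qed
    then show "\<exists>h B. H1 h B \<and> h1n h B \<le> 4 * h1n w D \<and> (AE x in lborel. \<bar>w x\<bar> \<le> h x) \<and>
     (AE x in lborel. \<forall>r. 0 < r \<and> r \<le> 1 \<longrightarrow>
        (\<integral>y. \<bar>w y\<bar> * indicator (ball x r) y \<partial>lborel) \<le> A * r ^ 3 * (h x + h1n w D))"
      using hB by blast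
  qed
qed

section \<open>Sobolev spaces on open sets\<close>

lemma L2_eq: "L2 \<Omega> = sq_int (lebesgue_on \<Omega>)" and L2_norm_eq: "L2_norm \<Omega> = l2n (lebesgue_on \<Omega>)"
  by (auto simp: L2_def sq_int_def L2_norm_def l2n_def fun_eq_iff)

lemma AE_on_iff:
  fixes \<Omega> :: "(real^3) set"
  assumes "open \<Omega>"
  shows "(AE x in lebesgue_on \<Omega>. P x) \<longleftrightarrow> (AE x in lborel. x \<in> \<Omega> \<longrightarrow> P x)"
  using assms by (subst AE_restrict_space_iff) (auto simp: AE_completion_iff)

lemma borel_on [measurable_dest]: "f \<in> borel_measurable borel \<Longrightarrow> f \<in> borel_measurable (lebesgue_on \<Omega>)"
  for f :: "real^3 \<Rightarrow> real"
  by (intro measurable_restrict_space1 measurable_completion) simp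

lemma integral_on:
  fixes f :: "real^3 \<Rightarrow> real"
  assumes f: "f \<in> borel_measurable borel" and \<Omega>: "open \<Omega>"
  shows "integral\<^sup>L (lebesgue_on \<Omega>) f = (\<integral>x. indicator \<Omega> x * f x \<partial>lborel)"
proof -
  have "integral\<^sup>L (lebesgue_on \<Omega>) f = integral\<^sup>L lebesgue (\<lambda>x. indicator \<Omega> x * f x)"
    using \<Omega> by (subst integral_restrict_space) auto
  also have "\<dots> = (\<integral>x. indicator \<Omega> x * f x \<partial>lborel)"
    by (rule integral_completion) (use f \<Omega> in auto)
  finally show ?thesis .
qed

lemma sq_int_on:
  fixes f :: "real^3 \<Rightarrow> real"
  assumes f: "f \<in> sq_int lborel" and \<Omega>: "open \<Omega>"
  shows "f \<in> sq_int (lebesgue_on \<Omega>)" "l2n (lebesgue_on \<Omega>) f \<le> l2n lborel f"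
    "l2n (lebesgue_on \<Omega>) f = l2n lborel (\<lambda>x. indicator \<Omega> x * f x)"
proof -
  have m: "f \<in> borel_measurable borel" using sq_int_meas[OF f] by simp
  have i: "integrable lborel (\<lambda>x. indicator \<Omega> x * (f x)\<^sup>2)"
  proof (rule Bochner_Integration.integrable_bound[OF sq_int_sq[OF f]])
    show "(\<lambda>x. indicator \<Omega> x * (f x)\<^sup>2) \<in> borel_measurable lborel"
      using m \<Omega> by auto
  qed (auto simp: indicator_def)
  have "integrable lebesgue (\<lambda>x. indicator \<Omega> x * (f x)\<^sup>2)"
    using integrable_completion[of "\<lambda>x. indicator \<Omega> x * (f x)\<^sup>2" lborel] i m \<Omega> by auto
  then have "integrable (lebesgue_on \<Omega>) (\<lambda>x. (f x)\<^sup>2)"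
    using \<Omega> by (subst integrable_restrict_space) auto
  then show "f \<in> sq_int (lebesgue_on \<Omega>)"
    using borel_on[OF m] by (simp add: sq_int_def)
  have "(l2n (lebesgue_on \<Omega>) f)\<^sup>2 = (\<integral>x. indicator \<Omega> x * (f x)\<^sup>2 \<partial>lborel)"
    unfolding l2n_sq by (rule integral_on) (use m \<Omega> in auto)
  also have "\<dots> = (l2n lborel (\<lambda>x. indicator \<Omega> x * f x))\<^sup>2"
    unfolding l2n_sq by (rule Bochner_Integration.integral_cong) (auto simp: indicator_def)
  finally show e: "l2n (lebesgue_on \<Omega>) f = l2n lborel (\<lambda>x. indicator \<Omega> x * f x)"
    by (simp add: power2_eq_iff_nonneg)
  show "l2n (lebesgue_on \<Omega>) f \<le> l2n lborel f"
    unfolding e by (rule l2n_mono[OF f]) (auto simp: indicator_def)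
qed

text \<open>Members of the Sobolev spaces are only Lebesgue measurable on \<Omega>. Extending a
  Borel representative by zero brings them to \<open>lborel\<close>, where mollification and the
  fundamental lemma are stated, with the norm unchanged.\<close>

lemma borel_representative:
  fixes u :: "real^3 \<Rightarrow> real"
  assumes u: "u \<in> sq_int (lebesgue_on \<Omega>)" and \<Omega>: "open \<Omega>"
  obtains w where "w \<in> sq_int lborel" "AE x in lebesgue_on \<Omega>. u x = w x"
    "\<And>x. x \<notin> \<Omega> \<Longrightarrow> w x = 0" "l2n lborel w = l2n (lebesgue_on \<Omega>) u"
proof -
  have S: "\<Omega> \<in> sets lebesgue" using \<Omega> by auto
  have "(\<lambda>x. if x \<in> \<Omega> then u x else 0) \<in> borel_measurable lebesgue"
    by (rule borel_measurable_if_I[OF sq_int_meas[OF u] S])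
  from completion_ex_borel_measurable_real[OF this] obtain g where g: "g \<in> borel_measurable borel"
    and ae: "AE x in lborel. (if x \<in> \<Omega> then u x else 0) = g x"
    by auto
  define w where "w x = indicator \<Omega> x * g x" for x
  have wm: "w \<in> borel_measurable borel" unfolding w_def using g \<Omega> by auto
  have uw: "AE x in lebesgue_on \<Omega>. u x = w x"
    unfolding AE_on_iff[OF \<Omega>] using ae by eventually_elim (auto simp: w_def)
  have eq: "(\<integral>x. (w x)\<^sup>2 \<partial>lborel) = integral\<^sup>L (lebesgue_on \<Omega>) (\<lambda>x. (u x)\<^sup>2)"
  proof -
    have "integral\<^sup>L (lebesgue_on \<Omega>) (\<lambda>x. (u x)\<^sup>2) = integral\<^sup>L (lebesgue_on \<Omega>) (\<lambda>x. (w x)\<^sup>2)"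
      using uw sq_int_meas[OF u] borel_on[OF wm] by (intro integral_cong_AE) auto
    also have "\<dots> = (\<integral>x. indicator \<Omega> x * (w x)\<^sup>2 \<partial>lborel)"
      by (rule integral_on) (use wm \<Omega> in auto)
    also have "\<dots> = (\<integral>x. (w x)\<^sup>2 \<partial>lborel)"
      by (rule Bochner_Integration.integral_cong) (auto simp: w_def indicator_def)
    finally show ?thesis ..
  qed
  have "integrable (lebesgue_on \<Omega>) (\<lambda>x. (w x)\<^sup>2)"
    by (rule integrable_cong_AE_imp[OF sq_int_sq[OF u]]) (use uw borel_on[OF wm] in auto)
  then have "integrable lebesgue (\<lambda>x. indicator \<Omega> x * (w x)\<^sup>2)"
    using S by (subst (asm) integrable_restrict_space) auto
  also have "(\<lambda>x. indicator \<Omega> x * (w x)\<^sup>2) = (\<lambda>x. (w x)\<^sup>2)"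
    by (auto simp: w_def indicator_def)
  finally have "integrable lborel (\<lambda>x. (w x)\<^sup>2)"
    using integrable_completion[of "\<lambda>x. (w x)\<^sup>2" lborel] wm by auto
  then have "w \<in> sq_int lborel" using wm by (simp add: sq_int_def)
  then show ?thesis
    using uw eq by (intro that[of w]) (auto simp: w_def l2n_def)
qed

lemma test_integral_on:
  assumes \<phi>: "\<phi> \<in> test_functions \<Omega>" and \<Omega>: "open \<Omega>" and g: "g \<in> borel_measurable borel"
  shows "integral\<^sup>L (lebesgue_on \<Omega>) (\<lambda>x. g x * \<phi> x) = (\<integral>x. g x * \<phi> x \<partial>lborel)"
proof -
  obtain K where K: "K \<subseteq> \<Omega>" "\<And>x. x \<notin> K \<Longrightarrow> \<phi> x = 0" by (metis test_support[OF \<phi>])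
  have "\<phi> \<in> borel_measurable borel" using smooth_borel test_smooth \<phi> by blast
  then have "integral\<^sup>L (lebesgue_on \<Omega>) (\<lambda>x. g x * \<phi> x) = (\<integral>x. indicator \<Omega> x * (g x * \<phi> x) \<partial>lborel)"
    using g by (intro integral_on \<Omega>) auto
  also have "\<dots> = (\<integral>x. g x * \<phi> x \<partial>lborel)"
    using K by (intro Bochner_Integration.integral_cong) (auto simp: indicator_def)
  finally show ?thesis .
qed

lemma integral_on_cong_AE:
  fixes u v h :: "'a \<Rightarrow> real"
  assumes "AE x in M. u x = v x" "u \<in> borel_measurable M" "v \<in> borel_measurable M" "h \<in> borel_measurable M"
  shows "(\<integral>x. u x * h x \<partial>M) = (\<integral>x. v x * h x \<partial>M)"
  using assms by (intro integral_cong_AE) auto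

lemma test_meas_on:
  assumes "\<phi> \<in> test_functions \<Omega>"
  shows "\<phi> \<in> borel_measurable (lebesgue_on \<Omega>)" "pderiv i \<phi> \<in> borel_measurable (lebesgue_on \<Omega>)"
  using borel_on smooth_borel test_smooth smooth_pderiv assms by blast+

lemma is_weak_pderiv_cong_left:
  assumes "u \<in> sq_int (lebesgue_on \<Omega>)" "v \<in> sq_int (lebesgue_on \<Omega>)" "AE x in lebesgue_on \<Omega>. u x = v x"
  shows "is_weak_pderiv \<Omega> i u = is_weak_pderiv \<Omega> i v"
proof
  fix g
  have "(\<integral>x. u x * pderiv i \<phi> x \<partial>lebesgue_on \<Omega>) = (\<integral>x. v x * pderiv i \<phi> x \<partial>lebesgue_on \<Omega>)"
    if "\<phi> \<in> test_functions \<Omega>" for \<phi>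
    by (rule integral_on_cong_AE[OF assms(3) sq_int_meas[OF assms(1)] sq_int_meas[OF assms(2)] test_meas_on(2)[OF that]])
  then show "is_weak_pderiv \<Omega> i u g = is_weak_pderiv \<Omega> i v g"
    unfolding is_weak_pderiv_def by simp
qed

lemma is_weak_pderiv_cong_right:
  assumes "g \<in> sq_int (lebesgue_on \<Omega>)" "h \<in> sq_int (lebesgue_on \<Omega>)" "AE x in lebesgue_on \<Omega>. g x = h x"
  shows "is_weak_pderiv \<Omega> i u g = is_weak_pderiv \<Omega> i u h"
proof -
  have "(\<integral>x. g x * \<phi> x \<partial>lebesgue_on \<Omega>) = (\<integral>x. h x * \<phi> x \<partial>lebesgue_on \<Omega>)"
    if "\<phi> \<in> test_functions \<Omega>" for \<phi>
    by (rule integral_on_cong_AE[OF assms(3) sq_int_meas[OF assms(1)] sq_int_meas[OF assms(2)] test_meas_on(1)[OF that]])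
  then show ?thesis
    unfolding is_weak_pderiv_def by simp
qed

lemma weak_pderiv_unique:
  assumes \<Omega>: "open \<Omega>" and g: "g \<in> sq_int (lebesgue_on \<Omega>)" "is_weak_pderiv \<Omega> i u g"
    and h: "h \<in> sq_int (lebesgue_on \<Omega>)" "is_weak_pderiv \<Omega> i u h"
  shows "AE x in lebesgue_on \<Omega>. g x = h x"
proof -
  have d: "(\<lambda>x. g x - h x) \<in> sq_int (lebesgue_on \<Omega>)" by (intro sq_int_diff g h)
  obtain w where w: "w \<in> sq_int lborel" "AE x in lebesgue_on \<Omega>. g x - h x = w x"
    by (rule borel_representative[OF d \<Omega>]) blast
  have wm: "w \<in> borel_measurable borel" using sq_int_meas[OF w(1)] by simp
  have "AE x in lborel. x \<in> \<Omega> \<longrightarrow> w x = 0"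
  proof (rule fundamental_lemma[OF w(1) \<Omega>])
    fix \<phi> assume \<phi>: "\<phi> \<in> test_functions \<Omega>"
    have \<phi>s: "\<phi> \<in> sq_int (lebesgue_on \<Omega>)" by (intro sq_int_on test_sq_int[OF \<phi>] \<Omega>)
    have "(\<integral>x. w x * \<phi> x \<partial>lborel) = integral\<^sup>L (lebesgue_on \<Omega>) (\<lambda>x. w x * \<phi> x)"
      by (rule test_integral_on[OF \<phi> \<Omega> wm, symmetric])
    also have "\<dots> = integral\<^sup>L (lebesgue_on \<Omega>) (\<lambda>x. (g x - h x) * \<phi> x)"
      by (rule integral_on_cong_AE[symmetric, OF w(2) sq_int_meas[OF d] borel_on[OF wm] test_meas_on(1)[OF \<phi>]])
    also have "\<dots> = integral\<^sup>L (lebesgue_on \<Omega>) (\<lambda>x. g x * \<phi> x) - integral\<^sup>L (lebesgue_on \<Omega>) (\<lambda>x. h x * \<phi> x)"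
      using sq_int_mult[OF g(1) \<phi>s] sq_int_mult[OF h(1) \<phi>s] by (simp add: left_diff_distrib)
    also have "\<dots> = 0"
      using g(2) h(2) \<phi> unfolding is_weak_pderiv_def by simp
    finally show "(\<integral>x. w x * \<phi> x \<partial>lborel) = 0" .
  qed
  then have "AE x in lebesgue_on \<Omega>. w x = 0" by (simp add: AE_on_iff[OF \<Omega>])
  then show ?thesis using w(2) by eventually_elim simp
qed

text \<open>Identifies the chosen representative with any weak derivative found by other means;
  later computations with \<open>weak_pderiv\<close> rest on this.\<close>

lemma weak_pderiv_AE:
  assumes \<Omega>: "open \<Omega>" and g: "g \<in> sq_int (lebesgue_on \<Omega>)" "is_weak_pderiv \<Omega> i u g"
  shows "weak_pderiv \<Omega> i u \<in> sq_int (lebesgue_on \<Omega>)" "is_weak_pderiv \<Omega> i u (weak_pderiv \<Omega> i u)"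
    "AE x in lebesgue_on \<Omega>. weak_pderiv \<Omega> i u x = g x"
proof -
  have "weak_pderiv \<Omega> i u \<in> L2 \<Omega> \<and> is_weak_pderiv \<Omega> i u (weak_pderiv \<Omega> i u)"
    unfolding weak_pderiv_def by (rule someI[of _ g]) (use g in \<open>simp add: L2_eq\<close>)
  then show *: "weak_pderiv \<Omega> i u \<in> sq_int (lebesgue_on \<Omega>)" "is_weak_pderiv \<Omega> i u (weak_pderiv \<Omega> i u)"
    by (auto simp: L2_eq)
  show "AE x in lebesgue_on \<Omega>. weak_pderiv \<Omega> i u x = g x"
    by (rule weak_pderiv_unique[OF \<Omega> * g])
qed

section \<open>Representatives and linear structure\<close>

lemma sobolev_sq_int: "u \<in> sobolev k \<Omega> \<Longrightarrow> u \<in> sq_int (lebesgue_on \<Omega>)"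
  by (cases k) (auto simp: L2_eq)

lemma sobolev_cong:
  assumes u: "u \<in> sobolev k \<Omega>" and v: "v \<in> borel_measurable (lebesgue_on \<Omega>)" and ae: "AE x in lebesgue_on \<Omega>. u x = v x"
  shows "v \<in> sobolev k \<Omega>"
proof -
  have vs: "v \<in> sq_int (lebesgue_on \<Omega>)" by (rule sq_int_cong_AE[OF sobolev_sq_int[OF u] v ae])
  show ?thesis
    using u vs is_weak_pderiv_cong_left[OF sobolev_sq_int[OF u] vs ae] by (cases k) (auto simp: L2_eq)
qed

text \<open>An equality of functions and not only almost everywhere: the predicates handed to the
  choice operator coincide, so the same representative is selected.\<close>

lemma weak_pderiv_cong:
  assumes u: "u \<in> sobolev k \<Omega>" and v: "v \<in> sobolev k \<Omega>" and ae: "AE x in lebesgue_on \<Omega>. u x = v x"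
  shows "weak_pderiv \<Omega> i u = weak_pderiv \<Omega> i v"
  unfolding weak_pderiv_def is_weak_pderiv_cong_left[OF sobolev_sq_int[OF u] sobolev_sq_int[OF v] ae] ..

lemma sobolev_norm_cong:
  assumes u: "u \<in> sobolev k \<Omega>" and v: "v \<in> sobolev k \<Omega>" and ae: "AE x in lebesgue_on \<Omega>. u x = v x"
  shows "sobolev_norm k \<Omega> u = sobolev_norm k \<Omega> v"
proof -
  have "l2n (lebesgue_on \<Omega>) u = l2n (lebesgue_on \<Omega>) v"
    by (rule l2n_cong_AE[OF sq_int_meas[OF sobolev_sq_int[OF u]] sq_int_meas[OF sobolev_sq_int[OF v]] ae])
  then show ?thesis using weak_pderiv_cong[OF u v ae] by (cases k) (auto simp: L2_norm_eq)
qed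

text \<open>The choice in \<open>weak_pderiv\<close> asks only for square integrability. Higher
  regularity passes over from the derivative provided by the definition of the space, since the two
  agree almost everywhere.\<close>

lemma weak_pderiv_sobolev:
  assumes \<Omega>: "open \<Omega>" and u: "u \<in> sobolev (Suc k) \<Omega>"
  shows "weak_pderiv \<Omega> i u \<in> sobolev k \<Omega>" "is_weak_pderiv \<Omega> i u (weak_pderiv \<Omega> i u)"
proof -
  obtain g where g: "g \<in> sobolev k \<Omega>" "is_weak_pderiv \<Omega> i u g" using u by auto
  note w = weak_pderiv_AE[OF \<Omega> sobolev_sq_int[OF g(1)] g(2)]
  show "weak_pderiv \<Omega> i u \<in> sobolev k \<Omega>"
    by (rule sobolev_cong[OF g(1) sq_int_meas[OF w(1)]]) (use w(3) in auto)
  show "is_weak_pderiv \<Omega> i u (weak_pderiv \<Omega> i u)" by (rule w(2))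
qed

lemma is_weak_pderiv_lincomb:
  assumes \<Omega>: "open \<Omega>" and u: "u \<in> sq_int (lebesgue_on \<Omega>)" "g \<in> sq_int (lebesgue_on \<Omega>)" "is_weak_pderiv \<Omega> i u g"
    and v: "v \<in> sq_int (lebesgue_on \<Omega>)" "h \<in> sq_int (lebesgue_on \<Omega>)" "is_weak_pderiv \<Omega> i v h"
  shows "is_weak_pderiv \<Omega> i (\<lambda>x. a * u x + b * v x) (\<lambda>x. a * g x + b * h x)"
  unfolding is_weak_pderiv_def
proof
  fix \<phi> assume \<phi>: "\<phi> \<in> test_functions \<Omega>"
  have s: "\<phi> \<in> sq_int (lebesgue_on \<Omega>)" "pderiv i \<phi> \<in> sq_int (lebesgue_on \<Omega>)"
    by (intro sq_int_on test_sq_int[OF \<phi>] test_sq_int[OF test_pderiv[OF \<phi>]] \<Omega>)+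
  show "integral\<^sup>L (lebesgue_on \<Omega>) (\<lambda>x. (a * u x + b * v x) * pderiv i \<phi> x) =
      - integral\<^sup>L (lebesgue_on \<Omega>) (\<lambda>x. (a * g x + b * h x) * \<phi> x)"
    using u(3) v(3) \<phi> sq_int_mult[OF u(1) s(2)] sq_int_mult[OF v(1) s(2)] sq_int_mult[OF u(2) s(1)] sq_int_mult[OF v(2) s(1)]
    unfolding is_weak_pderiv_def by (simp add: distrib_right mult.assoc)
qed

lemma sobolev_lincomb:
  assumes \<Omega>: "open \<Omega>"
  shows "u \<in> sobolev k \<Omega> \<Longrightarrow> v \<in> sobolev k \<Omega> \<Longrightarrow> (\<lambda>x. a * u x + b * v x) \<in> sobolev k \<Omega>"
proof (induction k arbitrary: u v)
  case 0
  then show ?case by (auto simp: L2_eq intro!: sq_int_add sq_int_cmult)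
next
  case (Suc k)
  have "(\<lambda>x. a * u x + b * v x) \<in> sq_int (lebesgue_on \<Omega>)"
    by (intro sq_int_add sq_int_cmult sobolev_sq_int[OF Suc.prems(1)] sobolev_sq_int[OF Suc.prems(2)])
  moreover have "\<exists>g\<in>sobolev k \<Omega>. is_weak_pderiv \<Omega> i (\<lambda>x. a * u x + b * v x) g" for i
  proof -
    note U = weak_pderiv_sobolev[OF \<Omega> Suc.prems(1), of i] and V = weak_pderiv_sobolev[OF \<Omega> Suc.prems(2), of i]
    show ?thesis
      using is_weak_pderiv_lincomb[OF \<Omega> sobolev_sq_int[OF Suc.prems(1)] sobolev_sq_int[OF U(1)] U(2)
            sobolev_sq_int[OF Suc.prems(2)] sobolev_sq_int[OF V(1)] V(2), of a b] Suc.IH[OF U(1) V(1)] by blast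
  qed
  ultimately show ?case by (simp add: L2_eq)
qed

lemma H1_is_weak_pderiv:
  assumes H: "H1 w D" and \<Omega>: "open \<Omega>"
  shows "is_weak_pderiv \<Omega> i w (D i)"
  unfolding is_weak_pderiv_def
proof
  fix \<phi> assume \<phi>: "\<phi> \<in> test_functions \<Omega>"
  show "integral\<^sup>L (lebesgue_on \<Omega>) (\<lambda>x. w x * pderiv i \<phi> x) = - integral\<^sup>L (lebesgue_on \<Omega>) (\<lambda>x. D i x * \<phi> x)"
    unfolding test_integral_on[OF test_pderiv[OF \<phi>] \<Omega> H1_meas(1)[OF H]] test_integral_on[OF \<phi> \<Omega> H1_meas(2)[OF H]]
    by (rule H1_D(3)[OF H test_mono[OF \<phi>]]) simp
qed

lemma H1_sobolev:
  assumes H: "H1 w D" and \<Omega>: "open \<Omega>"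
  shows "w \<in> sobolev 1 \<Omega>" "AE x in lebesgue_on \<Omega>. weak_pderiv \<Omega> i w x = D i x"
proof -
  note s = sq_int_on(1)[OF H1_D(1)[OF H] \<Omega>] sq_int_on(1)[OF H1_D(2)[OF H] \<Omega>]
  show "w \<in> sobolev 1 \<Omega>"
    using s H1_is_weak_pderiv[OF H \<Omega>] by (auto simp: L2_eq)
  show "AE x in lebesgue_on \<Omega>. weak_pderiv \<Omega> i w x = D i x"
    by (rule weak_pderiv_AE(3)[OF \<Omega> s(2) H1_is_weak_pderiv[OF H \<Omega>]])
qed

lemma sobolev1_norm_components:
  "L2_norm \<Omega> u \<le> sobolev_norm (Suc k) \<Omega> u" "sobolev_norm k \<Omega> (weak_pderiv \<Omega> i u) \<le> sobolev_norm (Suc k) \<Omega> u"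
proof -
  have "(sobolev_norm k \<Omega> (weak_pderiv \<Omega> i u))\<^sup>2 \<le> (\<Sum>i\<in>UNIV. (sobolev_norm k \<Omega> (weak_pderiv \<Omega> i u))\<^sup>2)"
    by (rule member_le_sum) auto
  then show "sobolev_norm k \<Omega> (weak_pderiv \<Omega> i u) \<le> sobolev_norm (Suc k) \<Omega> u"
    by (simp, intro real_le_rsqrt) (simp add: add_increasing)
  show "L2_norm \<Omega> u \<le> sobolev_norm (Suc k) \<Omega> u"
    by (simp, intro real_le_rsqrt) (simp add: sum_nonneg)
qed

lemma sobolev_norm_le_sum:
  "sobolev_norm (Suc k) \<Omega> u \<le> L2_norm \<Omega> u + (\<Sum>i\<in>UNIV. \<bar>sobolev_norm k \<Omega> (weak_pderiv \<Omega> i u)\<bar>)"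
proof -
  have "sobolev_norm (Suc k) \<Omega> u = sqrt ((L2_norm \<Omega> u)\<^sup>2 + (L2_set (\<lambda>i. sobolev_norm k \<Omega> (weak_pderiv \<Omega> i u)) UNIV)\<^sup>2)"
    by (simp add: L2_set_def sum_nonneg)
  also have "\<dots> \<le> L2_norm \<Omega> u + L2_set (\<lambda>i. sobolev_norm k \<Omega> (weak_pderiv \<Omega> i u)) UNIV"
    by (rule sqrt_sum_squares_le_sum) (auto simp: L2_norm_eq)
  also have "L2_set (\<lambda>i. sobolev_norm k \<Omega> (weak_pderiv \<Omega> i u)) UNIV \<le> (\<Sum>i\<in>UNIV. \<bar>sobolev_norm k \<Omega> (weak_pderiv \<Omega> i u)\<bar>)"
    by (rule L2_set_le_sum_abs)
  finally show ?thesis by simp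
qed

lemma sobolev_norm_nonneg: "0 \<le> sobolev_norm k \<Omega> u"
  by (cases k) (auto simp: L2_norm_eq intro!: add_nonneg_nonneg sum_nonneg)

lemma H1_sobolev_norm:
  assumes H: "H1 w D"
  shows "sobolev_norm 1 UNIV w \<le> h1n w D"
proof -
  have "l2n (lebesgue_on UNIV) (weak_pderiv UNIV i w) \<le> l2n lborel (D i)" for i
  proof -
    have "l2n (lebesgue_on UNIV) (weak_pderiv UNIV i w) = l2n (lebesgue_on UNIV) (D i)"
    proof (rule l2n_cong_AE)
      show "weak_pderiv UNIV i w \<in> borel_measurable (lebesgue_on UNIV)"
        by (rule sq_int_meas, rule weak_pderiv_AE(1)[OF _ _ H1_is_weak_pderiv[OF H]])
           (auto intro: sq_int_on(1)[OF H1_D(2)[OF H]])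
    qed (use H1_sobolev(2)[OF H] borel_on[OF H1_meas(2)[OF H]] in auto)
    also have "\<dots> \<le> l2n lborel (D i)" by (rule sq_int_on(2)[OF H1_D(2)[OF H]]) simp
    finally show ?thesis .
  qed
  then have "(\<Sum>i\<in>UNIV. \<bar>l2n (lebesgue_on UNIV) (weak_pderiv UNIV i w)\<bar>) \<le> (\<Sum>i\<in>UNIV. l2n lborel (D i))"
    by (intro sum_mono) simp
  then show ?thesis
    using sobolev_norm_le_sum[of 0 UNIV w] sq_int_on(2)[OF H1_D(1)[OF H], of UNIV] by (simp add: h1n_def L2_norm_eq)
qed

lemma sobolev_UNIV_H1:
  assumes u: "u \<in> sobolev (Suc k) UNIV"
  obtains w D where "H1 w D" "AE x in lborel. u x = w x" "\<And>i. AE x in lborel. weak_pderiv UNIV i u x = D i x"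
    "l2n lborel w = L2_norm UNIV u" "\<And>i. l2n lborel (D i) = L2_norm UNIV (weak_pderiv UNIV i u)"
proof -
  obtain w where w: "w \<in> sq_int lborel" "AE x in lebesgue_on UNIV. u x = w x" "l2n lborel w = l2n (lebesgue_on UNIV) u"
    by (rule borel_representative[OF sobolev_sq_int[OF u]]) auto
  note p = weak_pderiv_sobolev[OF open_UNIV u]
  have ex: "\<exists>d. d \<in> sq_int lborel \<and> (AE x in lebesgue_on UNIV. weak_pderiv UNIV i u x = d x) \<and>
      l2n lborel d = l2n (lebesgue_on UNIV) (weak_pderiv UNIV i u)" for i
    by (rule borel_representative[OF sobolev_sq_int[OF p(1)[of i]]]) auto
  have "\<exists>D. \<forall>i. D i \<in> sq_int lborel \<and> (AE x in lebesgue_on UNIV. weak_pderiv UNIV i u x = D i x) \<and>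
      l2n lborel (D i) = l2n (lebesgue_on UNIV) (weak_pderiv UNIV i u)"
    by (intro choice allI ex)
  then obtain D where D: "\<And>i. D i \<in> sq_int lborel" "\<And>i. AE x in lebesgue_on UNIV. weak_pderiv UNIV i u x = D i x"
      "\<And>i. l2n lborel (D i) = l2n (lebesgue_on UNIV) (weak_pderiv UNIV i u)"
    by blast
  have "H1 w D"
    unfolding H1_def
  proof (intro conjI allI ballI w(1) D(1))
    fix i \<phi> assume \<phi>: "\<phi> \<in> test_functions (UNIV :: (real^3) set)"
    have "is_weak_pderiv UNIV i w (D i)"
      using p(2)[of i] is_weak_pderiv_cong_left[OF sobolev_sq_int[OF u] sq_int_on(1)[OF w(1)] w(2), of i]
        is_weak_pderiv_cong_right[OF sobolev_sq_int[OF p(1)[of i]] sq_int_on(1)[OF D(1)] D(2), of i w]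
      by simp
    then have A: "integral\<^sup>L (lebesgue_on UNIV) (\<lambda>x. w x * pderiv i \<phi> x) = - integral\<^sup>L (lebesgue_on UNIV) (\<lambda>x. D i x * \<phi> x)"
      unfolding is_weak_pderiv_def using \<phi> by blast
    have m: "w \<in> borel_measurable borel" "D i \<in> borel_measurable borel"
      using sq_int_meas[OF w(1)] sq_int_meas[OF D(1)[of i]] by auto
    show "(\<integral>x. w x * pderiv i \<phi> x \<partial>lborel) = - (\<integral>x. D i x * \<phi> x \<partial>lborel)"
      using A unfolding test_integral_on[OF test_pderiv[OF \<phi>] open_UNIV m(1)] test_integral_on[OF \<phi> open_UNIV m(2)] .
  qed
  then show ?thesis
    using w(2,3) D(2,3) AE_on_iff[of "UNIV :: (real^3) set"] by (intro that[of w D]) (auto simp: L2_norm_eq)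
qed

lemma sobolev2_UNIV_H1:
  assumes u: "u \<in> sobolev 2 UNIV"
  obtains w D DD where "H1 w D" "\<And>i. H1 (D i) (DD i)" "AE x in lborel. u x = w x"
    "\<And>i. l2n lborel (D i) \<le> sobolev_norm 2 UNIV u" "\<And>i j. l2n lborel (DD i j) \<le> sobolev_norm 2 UNIV u"
proof -
  have u2: "u \<in> sobolev (Suc (Suc 0)) UNIV" using u by (simp add: numeral_2_eq_2)
  obtain w D where w: "H1 w D" "AE x in lborel. u x = w x" "\<And>i. AE x in lborel. weak_pderiv UNIV i u x = D i x"
    "l2n lborel w = L2_norm UNIV u" "\<And>i. l2n lborel (D i) = L2_norm UNIV (weak_pderiv UNIV i u)"
    by (rule sobolev_UNIV_H1[OF u2]) blast
  have n2: "L2_norm UNIV (weak_pderiv UNIV i u) \<le> sobolev_norm 2 UNIV u"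
    "L2_norm UNIV (weak_pderiv UNIV j (weak_pderiv UNIV i u)) \<le> sobolev_norm 2 UNIV u" for i j
  proof -
    have "sobolev_norm (Suc 0) UNIV (weak_pderiv UNIV i u) \<le> sobolev_norm 2 UNIV u"
      using sobolev1_norm_components(2)[of "Suc 0" UNIV i u] by (simp only: numeral_2_eq_2)
    then show "L2_norm UNIV (weak_pderiv UNIV i u) \<le> sobolev_norm 2 UNIV u"
      "L2_norm UNIV (weak_pderiv UNIV j (weak_pderiv UNIV i u)) \<le> sobolev_norm 2 UNIV u"
      using sobolev1_norm_components[where k=0 and \<Omega>=UNIV and u="weak_pderiv UNIV i u"]
      unfolding sobolev_norm.simps(1) by (blast intro: order_trans)+
  qed
  have "\<exists>E. H1 (D i) E \<and> (\<forall>j. l2n lborel (E j) \<le> sobolev_norm 2 UNIV u)" for i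
  proof -
    obtain v E where v: "H1 v E" "AE x in lborel. weak_pderiv UNIV i u x = v x"
      and ae: "\<And>j. AE x in lborel. weak_pderiv UNIV j (weak_pderiv UNIV i u) x = E j x" and n: "l2n lborel v = L2_norm UNIV (weak_pderiv UNIV i u)"
      "\<And>j. l2n lborel (E j) = L2_norm UNIV (weak_pderiv UNIV j (weak_pderiv UNIV i u))"
      by (rule sobolev_UNIV_H1[OF weak_pderiv_sobolev(1)[OF open_UNIV u2]]) blast
    \<comment> \<open>The representative found for the i-th derivative may differ from
      \<open>D i\<close> on a null set; \<open>H1_cong_AE\<close> replaces it.\<close>
    have "AE x in lborel. v x = D i x" using v(2) w(3)[of i] by eventually_elim simp
    then have "H1 (D i) E"
      by (intro H1_cong_AE[OF v(1)] H1_meas(2)[OF w(1)] H1_meas(2)[OF v(1)]) auto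
    then show ?thesis using n(2) n2(2) by auto
  qed
  then obtain DD where "\<And>i. H1 (D i) (DD i) \<and> (\<forall>j. l2n lborel (DD i j) \<le> sobolev_norm 2 UNIV u)"
    by metis
  then show ?thesis
    using w n2(1) by (intro that[of w D DD]) auto
qed

lemma smooth_test_sobolev:
  assumes \<phi>: "\<phi> \<in> test_functions UNIV" and \<Omega>: "open \<Omega>"
  shows "\<phi> \<in> sobolev k \<Omega>"
  using \<phi>
proof (induction k arbitrary: \<phi>)
  case 0
  then show ?case by (auto simp: L2_eq intro: sq_int_on test_sq_int \<Omega>)
next
  case (Suc k)
  then show ?case
    using H1_is_weak_pderiv[OF H1_test[OF Suc.prems] \<Omega>] test_pderiv[OF Suc.prems]
    by (auto simp: L2_eq intro!: sq_int_on(1) test_sq_int \<Omega>)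
qed

lemma weak_pderiv_test:
  assumes \<phi>: "\<phi> \<in> test_functions UNIV" and \<Omega>: "open \<Omega>"
  shows "AE x in lebesgue_on \<Omega>. weak_pderiv \<Omega> i \<phi> x = pderiv i \<phi> x"
  by (rule H1_sobolev(2)[OF H1_test[OF \<phi>] \<Omega>])

section \<open>Consequences of the extension property\<close>

lemma extension_H1:
  assumes "extension_domain 1 \<Omega>" and u: "u \<in> sobolev 1 \<Omega>"
  obtains w D where "H1 w D" "AE x in lebesgue_on \<Omega>. u x = w x" "\<And>i. AE x in lebesgue_on \<Omega>. weak_pderiv \<Omega> i u x = D i x"
proof -
  obtain E where E: "extension_operator 1 \<Omega> E" and \<Omega>: "open \<Omega>" using assms by (auto simp: extension_domain_def)
  have Eu: "E u \<in> sobolev (Suc 0) UNIV" "AE x in lebesgue_on \<Omega>. E u x = u x"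
    using E u by (auto simp: extension_operator_def)
  obtain w D where w: "H1 w D" "AE x in lborel. E u x = w x"
    and "\<And>i. AE x in lborel. weak_pderiv UNIV i (E u) x = D i x"
    "l2n lborel w = L2_norm UNIV (E u)" "\<And>i. l2n lborel (D i) = L2_norm UNIV (weak_pderiv UNIV i (E u))"
    by (rule sobolev_UNIV_H1[OF Eu(1)]) blast
  have "AE x in lebesgue_on \<Omega>. E u x = w x" unfolding AE_on_iff[OF \<Omega>] using w(2) by eventually_elim simp
  then have uw: "AE x in lebesgue_on \<Omega>. u x = w x" using Eu(2) by eventually_elim simp
  moreover have "weak_pderiv \<Omega> i u = weak_pderiv \<Omega> i w" for i
    by (rule weak_pderiv_cong[OF u H1_sobolev(1)[OF w(1) \<Omega>] uw])
  ultimately show ?thesis using that[OF w(1)] H1_sobolev(2)[OF w(1) \<Omega>] by simp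
qed

text \<open>The bound is recorded for the derivatives of first and second order, as these alone
  enter the Hoelder estimate of the next section.\<close>

lemma extension_H2:
  assumes "extension_domain 2 \<Omega>"
  obtains C where "C > 0" "\<And>u. u \<in> sobolev 2 \<Omega> \<Longrightarrow> \<exists>w D DD. H1 w D \<and> (\<forall>i. H1 (D i) (DD i)) \<and>
      (AE x in lebesgue_on \<Omega>. u x = w x) \<and> (\<forall>i. l2n lborel (D i) \<le> C * sobolev_norm 2 \<Omega> u) \<and>
      (\<forall>i j. l2n lborel (DD i j) \<le> C * sobolev_norm 2 \<Omega> u)"
proof -
  obtain E where E: "extension_operator 2 \<Omega> E" and \<Omega>: "open \<Omega>" using assms by (auto simp: extension_domain_def)
  obtain C where C: "\<And>u. u \<in> sobolev 2 \<Omega> \<Longrightarrow> sobolev_norm 2 UNIV (E u) \<le> C * sobolev_norm 2 \<Omega> u"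
    using E unfolding extension_operator_def by blast
  show ?thesis
  proof (rule that[of "\<bar>C\<bar> + 1"])
    fix u assume u: "u \<in> sobolev 2 \<Omega>"
    have Eu: "E u \<in> sobolev 2 UNIV" "AE x in lebesgue_on \<Omega>. E u x = u x"
      using E u by (auto simp: extension_operator_def)
    obtain w D DD where w: "H1 w D" "\<And>i. H1 (D i) (DD i)" "AE x in lborel. E u x = w x"
      "\<And>i. l2n lborel (D i) \<le> sobolev_norm 2 UNIV (E u)" "\<And>i j. l2n lborel (DD i j) \<le> sobolev_norm 2 UNIV (E u)"
      by (rule sobolev2_UNIV_H1[OF Eu(1)]) blast
    have b: "sobolev_norm 2 UNIV (E u) \<le> (\<bar>C\<bar> + 1) * sobolev_norm 2 \<Omega> u"
      using C[OF u] sobolev_norm_nonneg[of 2 \<Omega> u] by (smt (verit) mult_right_mono abs_ge_self)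
    have "AE x in lebesgue_on \<Omega>. E u x = w x" unfolding AE_on_iff[OF \<Omega>] using w(3) by eventually_elim simp
    then have "AE x in lebesgue_on \<Omega>. u x = w x" using Eu(2) by eventually_elim simp
    then show "\<exists>w D DD. H1 w D \<and> (\<forall>i. H1 (D i) (DD i)) \<and>
      (AE x in lebesgue_on \<Omega>. u x = w x) \<and> (\<forall>i. l2n lborel (D i) \<le> (\<bar>C\<bar> + 1) * sobolev_norm 2 \<Omega> u) \<and>
      (\<forall>i j. l2n lborel (DD i j) \<le> (\<bar>C\<bar> + 1) * sobolev_norm 2 \<Omega> u)"
      using w(1,2) order_trans[OF w(4) b] order_trans[OF w(5) b] by (intro exI[of _ w] exI[of _ D] exI[of _ DD]) simp
  qed simp
qed

section \<open>Hoelder continuity in \<open>H\<^sup>2\<close> and measure density\<close>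

text \<open>Averages are taken over a box rather than a ball because they are differentiated under
  the integral sign with respect to their scale, over a \<open>cbox\<close>.\<close>

definition cube :: "(real^3) set" where
  "cube = cbox (\<chi> i. -1) (\<chi> i. 1)"

lemma cube_coord: "z \<in> cube \<Longrightarrow> \<bar>z $ i\<bar> \<le> 1"
  by (auto simp: cube_def mem_box_cart abs_le_iff minus_le_iff)

lemma cube_content: "measure lborel cube > 0"
proof -
  have "axis i (1::real) \<bullet> (\<chi> i. c) = c" for i :: 3 and c :: real
    by (simp add: inner_axis')
  then show ?thesis
    unfolding cube_def by (subst content_pos_lt_eq) (auto simp: Basis_vec_def inner_commute)
qed

lemma cube_integral_lborel:
  fixes \<phi> :: "real^3 \<Rightarrow> real"
  assumes "continuous_on UNIV \<phi>"
  shows "\<phi> integrable_on cube" "integral cube \<phi> = (\<integral>z. indicator cube z * \<phi> z \<partial>lborel)"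
proof -
  have "set_integrable lborel cube \<phi>"
    unfolding set_integrable_def cube_def
    by (rule borel_integrable_compact) (auto intro: continuous_on_subset[OF assms])
  from set_borel_integral_eq_integral[OF this]
  show "\<phi> integrable_on cube" "integral cube \<phi> = (\<integral>z. indicator cube z * \<phi> z \<partial>lborel)"
    by (auto simp: set_lebesgue_integral_def)
qed

text \<open>Cauchy-Schwarz over the cube; the substitution y = a + s z in dimension 3 turns the L^2
  norm of \<open>h\<close> into its s^(-3/2)-fold.\<close>

lemma cube_integral_bound:
  fixes c h :: "real^3 \<Rightarrow> real"
  assumes c: "continuous_on UNIV c" "\<And>z. z \<in> cube \<Longrightarrow> \<bar>c z\<bar> \<le> M" and h: "continuous_on UNIV h" "h \<in> sq_int lborel"
    and s: "s > 0"
  shows "\<bar>integral cube (\<lambda>z. c z * h (a + s *\<^sub>R z))\<bar> \<le> M * l2n lborel (indicator cube :: real^3 \<Rightarrow> real) * l2n lborel h / (s * sqrt s)"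
proof -
  have cont: "continuous_on UNIV (\<lambda>z. c z * h (a + s *\<^sub>R z))"
    by (intro continuous_intros c continuous_on_compose2[OF h(1)]) auto
  have "bounded cube" by (simp add: cube_def)
  then obtain R where R: "\<And>z. z \<in> cube \<Longrightarrow> norm z \<le> R" unfolding bounded_iff by blast
  have cm: "cube \<in> sets borel" by (simp add: cube_def)
  have "(0::real^3) \<in> cube" by (simp add: cube_def mem_box_cart)
  then have M0: "M \<ge> 0" using c(2) by (meson abs_ge_zero order_trans)
  have iS: "(\<lambda>z. indicator cube z :: real) \<in> sq_int lborel"
    by (rule sq_int_bounded_support[of _ 1 R]) (use cm R in \<open>auto simp: indicator_def not_le[symmetric]\<close>)
  have icS: "(\<lambda>z. indicator cube z * c z) \<in> sq_int lborel"
  proof (rule sq_int_bound[OF iS, of _ M])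
    show "AE x in lborel. \<bar>indicat_real cube x * c x\<bar> \<le> M * \<bar>indicat_real cube x\<bar>"
      using c(2) by (auto simp: indicator_def)
  qed (use cm borel_measurable_continuous_onI[OF c(1)] in auto)
  have hS: "(\<lambda>z. h (a + s *\<^sub>R z)) \<in> sq_int lborel" by (rule sq_int_affine(1)) (use h s in auto)
  have "(l2n lborel h)\<^sup>2 = (s * sqrt s * l2n lborel (\<lambda>z. h (a + s *\<^sub>R z)))\<^sup>2"
    using sq_int_affine(2)[OF h(2), of s a] s by (simp add: power_mult_distrib power2_eq_square power3_eq_cube mult_ac)
  then have hn: "l2n lborel h = s * sqrt s * l2n lborel (\<lambda>z. h (a + s *\<^sub>R z))"
    using s by (subst (asm) power2_eq_iff_nonneg) auto
  have "\<bar>integral cube (\<lambda>z. c z * h (a + s *\<^sub>R z))\<bar> = \<bar>\<integral>z. (indicator cube z * c z) * h (a + s *\<^sub>R z) \<partial>lborel\<bar>"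
    by (simp add: cube_integral_lborel(2)[OF cont] mult.assoc)
  also have "\<dots> \<le> l2n lborel (\<lambda>z. indicator cube z * c z) * l2n lborel (\<lambda>z. h (a + s *\<^sub>R z))"
    by (rule CS_ineq[OF icS hS])
  also have "l2n lborel (\<lambda>z. indicator cube z * c z) \<le> l2n lborel (\<lambda>z. M * indicator cube z)"
  proof (rule l2n_mono[OF sq_int_cmult[OF iS]])
    show "AE x in lborel. \<bar>indicat_real cube x * c x\<bar> \<le> \<bar>M * indicat_real cube x\<bar>"
      using c(2) M0 by (auto simp: indicator_def)
  qed
  also have "\<dots> = M * l2n lborel (indicator cube :: real^3 \<Rightarrow> real)" using M0 by (simp add: l2n_cmult)
  finally show ?thesis
    using s by (simp add: hn mult_right_mono)
qed

text \<open>Takes the place of integrating the bound on \<open>G'\<close>: both \<open>A - G\<close>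
  and \<open>A + G\<close> are nondecreasing.\<close>

lemma deriv_compare:
  fixes G G' A A' :: "real \<Rightarrow> real"
  assumes "a \<le> b" "\<And>t. (G has_real_derivative G' t) (at t)"
    "\<And>t. a \<le> t \<Longrightarrow> t \<le> b \<Longrightarrow> (A has_real_derivative A' t) (at t)" "\<And>t. a \<le> t \<Longrightarrow> t \<le> b \<Longrightarrow> \<bar>G' t\<bar> \<le> A' t"
  shows "\<bar>G b - G a\<bar> \<le> A b - A a"
proof -
  have "A a - G a \<le> A b - G b"
  proof (rule DERIV_nonneg_imp_nondecreasing[OF assms(1)])
    fix t assume t: "a \<le> t" "t \<le> b"
    have "((\<lambda>t. A t - G t) has_real_derivative A' t - G' t) (at t)" by (intro DERIV_diff assms t)
    then show "\<exists>y. ((\<lambda>t. A t - G t) has_real_derivative y) (at t) \<and> 0 \<le> y"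
      using assms(4)[OF t] by (intro exI[of _ "A' t - G' t"]) auto
  qed
  moreover have "A a + G a \<le> A b + G b"
  proof (rule DERIV_nonneg_imp_nondecreasing[OF assms(1)])
    fix t assume t: "a \<le> t" "t \<le> b"
    have "((\<lambda>t. A t + G t) has_real_derivative A' t + G' t) (at t)" by (intro DERIV_add assms t)
    then show "\<exists>y. ((\<lambda>t. A t + G t) has_real_derivative y) (at t) \<and> 0 \<le> y"
      using assms(4)[OF t] by (intro exI[of _ "A' t + G' t"]) auto
  qed
  ultimately show ?thesis by linarith
qed

lemma cube_deriv:
  assumes g: "smooth g" and p: "continuous_on UNIV p"
  shows "((\<lambda>s. integral cube (\<lambda>z. p z * g (x + s *\<^sub>R (z + v)))) has_real_derivative
    (\<Sum>j\<in>UNIV. integral cube (\<lambda>z. p z * (z + v) $ j * pderiv j g (x + s *\<^sub>R (z + v))))) (at s)"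
proof -
  have gc: "continuous_on UNIV g" "continuous_on UNIV (pderiv j g)" for j
    using g smooth_pderiv smooth_continuous by blast+
  have line: "((\<lambda>s. g (x + s *\<^sub>R e)) has_real_derivative (\<Sum>j\<in>UNIV. e $ j * pderiv j g (x + s *\<^sub>R e))) (at s)" for e s
  proof -
    have "((\<lambda>s. g (x + s *\<^sub>R e)) has_derivative (\<lambda>h. \<Sum>j\<in>UNIV. (h *\<^sub>R e) $ j * pderiv j g (x + s *\<^sub>R e))) (at s)"
      by (rule has_derivative_compose[OF _ pderiv_has_derivative[OF smooth_differentiable[OF g]]]) (auto intro!: derivative_eq_intros)
    moreover have "(\<lambda>h. \<Sum>j\<in>UNIV. (h *\<^sub>R e) $ j * pderiv j g (x + s *\<^sub>R e)) = (*) (\<Sum>j\<in>UNIV. e $ j * pderiv j g (x + s *\<^sub>R e))"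
      by (rule ext) (simp add: sum_distrib_left mult_ac)
    ultimately show ?thesis
      unfolding has_field_derivative_def by simp
  qed
  define fx where "fx s z = p z * (\<Sum>j\<in>UNIV. (z + v) $ j * pderiv j g (x + s *\<^sub>R (z + v)))" for s z
  have "((\<lambda>s. integral cube (\<lambda>z. p z * g (x + s *\<^sub>R (z + v)))) has_real_derivative integral cube (fx s)) (at s within UNIV)"
    unfolding cube_def
  proof (rule leibniz_rule_field_derivative)
    show "((\<lambda>s. p z * g (x + s *\<^sub>R (z + v))) has_real_derivative fx s z) (at s within UNIV)" for s z
      unfolding fx_def using DERIV_cmult[OF line[of "z + v" s], of "p z"] by simp
    show "(\<lambda>z. p z * g (x + s *\<^sub>R (z + v))) integrable_on cbox (\<chi> i. -1) (\<chi> i. 1)" for s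
      by (intro integrable_continuous continuous_intros continuous_on_subset[OF p] continuous_on_compose2[OF gc(1)]) auto
    show "continuous_on (UNIV \<times> cbox (\<chi> i. -1) (\<chi> i. 1)) (\<lambda>(s, z). fx s z)"
      unfolding fx_def case_prod_unfold
      by (intro continuous_intros continuous_on_compose2[OF p] continuous_on_compose2[OF gc(2)]) auto
  qed auto
  also have "integral cube (fx s) = (\<Sum>j\<in>UNIV. integral cube (\<lambda>z. p z * (z + v) $ j * pderiv j g (x + s *\<^sub>R (z + v))))"
    unfolding fx_def sum_distrib_left
    by (subst integral_sum)
       (auto simp: mult.assoc intro!: cube_integral_lborel(1) continuous_intros p continuous_on_compose2[OF gc(2)])
  finally show ?thesis by simp
qed

lemma cube_shift: "x + s *\<^sub>R (z + v) = (x + s *\<^sub>R v) + s *\<^sub>R (z :: real^3)"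
  by (simp add: scaleR_add_right)

text \<open>By \<open>cube_integral_bound\<close> the derivative of the weighted average with
  respect to the scale is O(s^(-3/2)), which integrates to O(s^(-1/2)) from s to 1, while at scale 1
  the L^2 norm controls the average. One weak derivative thus gains a full power of s. The weight
  \<open>p\<close> is general because one differentiation produces the weights (z + v)_j.\<close>

lemma cube_average_H1:
  assumes g: "smooth g" "g \<in> sq_int lborel" "\<And>j. pderiv j g \<in> sq_int lborel"
    and p: "continuous_on UNIV p" "\<And>z. z \<in> cube \<Longrightarrow> \<bar>p z\<bar> \<le> M" and v: "\<And>j. \<bar>v $ j\<bar> \<le> 1" and s: "0 < s" "s \<le> 1"
  shows "\<bar>integral cube (\<lambda>z. p z * g (x + s *\<^sub>R (z + v)))\<bar> \<le>
    4 * M * l2n lborel (indicator cube :: real^3 \<Rightarrow> real) * h1n g (\<lambda>j. pderiv j g) / sqrt s"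
proof -
  define k where "k = l2n lborel (indicator cube :: real^3 \<Rightarrow> real)"
  have k: "k \<ge> 0" by (simp add: k_def)
  define G where "G s = integral cube (\<lambda>z. p z * g (x + s *\<^sub>R (z + v)))" for s
  define D where "D = (\<Sum>j\<in>UNIV. l2n lborel (pderiv j g))"
  have D: "D \<ge> 0" by (simp add: D_def sum_nonneg)
  have "(0::real^3) \<in> cube" by (simp add: cube_def mem_box_cart)
  then have M0: "M \<ge> 0" using p(2) by (meson abs_ge_zero order_trans)
  define G' where "G' s = (\<Sum>j\<in>UNIV. integral cube (\<lambda>z. p z * (z + v) $ j * pderiv j g (x + s *\<^sub>R (z + v))))" for s
  have G'b: "\<bar>G' t\<bar> \<le> 2 * M * k * D / (t * sqrt t)" if t: "t > 0" for t
  proof -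
    have "\<bar>G' t\<bar> \<le> (\<Sum>j\<in>UNIV. 2 * M * k * l2n lborel (pderiv j g) / (t * sqrt t))"
      unfolding G'_def
    proof (intro order_trans[OF sum_abs] sum_mono)
      fix j
      have "\<bar>p z * (z + v) $ j\<bar> \<le> 2 * M" if "z \<in> cube" for z
      proof -
        have le2: "\<bar>(z + v) $ j\<bar> \<le> 2" using cube_coord[OF that, of j] v[of j] by simp
        then show ?thesis using mult_mono[OF p(2)[OF that] le2] M0 by (simp add: abs_mult mult.commute)
      qed
      then show "\<bar>integral cube (\<lambda>z. p z * (z + v) $ j * pderiv j g (x + t *\<^sub>R (z + v)))\<bar> \<le> 2 * M * k * l2n lborel (pderiv j g) / (t * sqrt t)"
        unfolding cube_shift k_def using t g smooth_continuous[OF smooth_pderiv[OF g(1)]] p(1)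
        by (intro cube_integral_bound continuous_intros) auto
    qed
    also have "\<dots> = 2 * M * k * D / (t * sqrt t)" by (simp add: D_def sum_distrib_left sum_divide_distrib)
    finally show ?thesis .
  qed
  have "\<bar>G 1 - G s\<bar> \<le> (- (4 * M * k * D) / sqrt 1) - (- (4 * M * k * D) / sqrt s)"
  proof (rule deriv_compare[OF s(2), where G=G and G'=G' and A="\<lambda>t. - (4 * M * k * D) / sqrt t" and A'="\<lambda>t. 2 * M * k * D / (t * sqrt t)"])
    show "(G has_real_derivative G' t) (at t)" for t
      unfolding G_def[abs_def] G'_def by (rule cube_deriv[OF g(1) p(1)])
    fix t assume t: "s \<le> t" "t \<le> 1"
    then have t0: "t > 0" using s by simp
    show "\<bar>G' t\<bar> \<le> 2 * M * k * D / (t * sqrt t)" by (rule G'b[OF t0])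
    show "((\<lambda>t. - (4 * M * k * D) / sqrt t) has_real_derivative 2 * M * k * D / (t * sqrt t)) (at t)"
      using t0 by (auto intro!: derivative_eq_intros simp: field_simps)
  qed
  moreover have "\<bar>G 1\<bar> \<le> M * k * l2n lborel g"
    using cube_integral_bound[OF p smooth_continuous[OF g(1)] g(2), where s=1 and a="x + v"]
    by (simp add: G_def k_def algebra_simps)
  ultimately have "\<bar>G s\<bar> \<le> M * k * l2n lborel g + 4 * M * k * D / sqrt s - 4 * M * k * D"
    by simp
  also have "\<dots> \<le> 4 * M * k * l2n lborel g / sqrt s + 4 * M * k * D / sqrt s"
  proof -
    have "M * k * l2n lborel g \<le> 4 * (M * k * l2n lborel g) / sqrt s"
    proof -
      have "sqrt s \<le> 1" using s by simp
      have "M * k * l2n lborel g * sqrt s \<le> M * k * l2n lborel g * 4"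
        by (intro mult_left_mono order_trans[OF \<open>sqrt s \<le> 1\<close>]) (use M0 k in auto)
      then show ?thesis using s by (simp add: field_simps)
    qed
    moreover have "4 * M * k * D \<ge> 0" using M0 k D by simp
    moreover have "4 * (M * k * l2n lborel g) / sqrt s = 4 * M * k * l2n lborel g / sqrt s" by (simp add: mult.assoc)
    ultimately show ?thesis by linarith
  qed
  also have "\<dots> = 4 * M * k * h1n g (\<lambda>j. pderiv j g) / sqrt s"
    by (simp add: h1n_def D_def distrib_left add_divide_distrib)
  finally show ?thesis by (simp add: G_def k_def)
qed

text \<open>One order higher, the derivative with respect to the scale is O(s^(-1/2)) by
  \<open>cube_average_H1\<close>. This is integrable down to scale 0, where the average degenerates
  to the value at x, and leaves s^(1/2): the exponent is 2 - 3/2.\<close>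

lemma cube_average_H2:
  assumes f: "smooth f" "\<And>i. pderiv i f \<in> sq_int lborel" "\<And>i j. pderiv j (pderiv i f) \<in> sq_int lborel"
    and v: "\<And>j. \<bar>v $ j\<bar> \<le> 1" and s: "0 < s" "s \<le> 1"
  shows "\<bar>integral cube (\<lambda>z. f (x + s *\<^sub>R (z + v))) - measure lborel cube * f x\<bar> \<le>
    16 * l2n lborel (indicator cube :: real^3 \<Rightarrow> real) * (\<Sum>i\<in>UNIV. h1n (pderiv i f) (\<lambda>j. pderiv j (pderiv i f))) * sqrt s"
proof -
  define k where "k = l2n lborel (indicator cube :: real^3 \<Rightarrow> real)"
  define N where "N = (\<Sum>i\<in>UNIV. h1n (pderiv i f) (\<lambda>j. pderiv j (pderiv i f)))"
  define F where "F s = integral cube (\<lambda>z. 1 * f (x + s *\<^sub>R (z + v)))" for s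
  define F' where "F' s = (\<Sum>j\<in>UNIV. integral cube (\<lambda>z. 1 * (z + v) $ j * pderiv j f (x + s *\<^sub>R (z + v))))" for s
  have F: "(F has_real_derivative F' t) (at t)" for t
    unfolding F_def[abs_def] F'_def by (rule cube_deriv[OF f(1)]) auto
  have F'b: "\<bar>F' t\<bar> \<le> 8 * k * N / sqrt t" if t: "0 < t" "t \<le> 1" for t
  proof -
    have "\<bar>F' t\<bar> \<le> (\<Sum>i\<in>UNIV. 4 * 2 * k * h1n (pderiv i f) (\<lambda>j. pderiv j (pderiv i f)) / sqrt t)"
      unfolding F'_def k_def
    proof (intro order_trans[OF sum_abs] sum_mono cube_average_H1 t v smooth_pderiv f)
      fix i and z :: "real^3" assume "z \<in> cube"
      then show "\<bar>1 * (z + v) $ i\<bar> \<le> 2" using cube_coord[of z i] v[of i] by simp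
    qed (auto intro!: continuous_intros)
    also have "\<dots> = 8 * k * N / sqrt t" by (simp add: N_def sum_distrib_left sum_divide_distrib)
    finally show ?thesis .
  qed
  have step: "\<bar>F s - F t\<bar> \<le> 16 * k * N * sqrt s - 16 * k * N * sqrt t" if t: "0 < t" "t \<le> s" for t
  proof (rule deriv_compare[OF t(2) F, where A'="\<lambda>t. 8 * k * N / sqrt t"])
    fix r assume r: "t \<le> r" "r \<le> s"
    show "((\<lambda>r. 16 * k * N * sqrt r) has_real_derivative 8 * k * N / sqrt r) (at r)"
      using r t by (auto intro!: derivative_eq_intros simp: field_simps)
    show "\<bar>F' r\<bar> \<le> 8 * k * N / sqrt r" using r t s by (intro F'b) auto
  qed
  \<comment> \<open>The comparison function, a multiple of the square root, is not differentiable at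
    0, so scale 0 is reached as a limit of positive scales.\<close>
  have "\<bar>F s - F 0\<bar> \<le> 16 * k * N * sqrt s"
  proof (rule LIMSEQ_le_const2)
    have "(\<lambda>n. s * (1 / real (Suc n))) \<longlonglongrightarrow> s * 0"
      by (intro tendsto_mult tendsto_const LIMSEQ_Suc[OF lim_1_over_n])
    then have "(\<lambda>n. F (s / real (Suc n))) \<longlonglongrightarrow> F 0"
      using DERIV_isCont[OF F, of 0] by (intro isCont_tendsto_compose[of 0 F]) auto
    then show "(\<lambda>n. \<bar>F s - F (s / real (Suc n))\<bar>) \<longlonglongrightarrow> \<bar>F s - F 0\<bar>" by (intro tendsto_intros)
    have kN: "k * N \<ge> 0" by (simp add: k_def N_def sum_nonneg)
    show "\<exists>M. \<forall>n\<ge>M. \<bar>F s - F (s / real (Suc n))\<bar> \<le> 16 * k * N * sqrt s"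
    proof (intro exI[of _ 0] allI impI)
      fix n
      have "s / real (Suc n) \<le> s" "0 < s / real (Suc n)" using s by (auto simp: field_simps)
      from step[OF this(2,1)] show "\<bar>F s - F (s / real (Suc n))\<bar> \<le> 16 * k * N * sqrt s"
        using mult_nonneg_nonneg[OF kN, of "sqrt (s / real (Suc n))"] s by (simp add: mult.assoc del: real_sqrt_divide)
    qed
  qed
  moreover have "F 0 = measure lborel cube * f x" by (simp add: F_def cube_def)
  ultimately show ?thesis by (simp add: F_def k_def N_def)
qed

text \<open>For s = |x - y| and v = (y - x)/s the cube x + s (z + v) coincides with y + s z, so a
  single average is compared with both f x and f y. This is what the offset \<open>v\<close> in the
  averages is for.\<close>

lemma holder_smooth:
  assumes f: "smooth f" "\<And>i. pderiv i f \<in> sq_int lborel" "\<And>i j. pderiv j (pderiv i f) \<in> sq_int lborel"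
    and xy: "dist x y \<le> 1"
  shows "measure lborel cube * \<bar>f x - f y\<bar> \<le>
    32 * l2n lborel (indicator cube :: real^3 \<Rightarrow> real) * (\<Sum>i\<in>UNIV. h1n (pderiv i f) (\<lambda>j. pderiv j (pderiv i f))) * sqrt (dist x y)"
proof (cases "x = y")
  case False
  define s where "s = dist x y"
  have s: "0 < s" "s \<le> 1" using False xy by (auto simp: s_def)
  define v where "v = (1 / s) *\<^sub>R (y - x)"
  have v: "\<bar>v $ j\<bar> \<le> 1" for j
  proof -
    have "\<bar>v $ j\<bar> \<le> norm v" by (rule component_le_norm_cart)
    also have "norm v = 1" using s by (simp add: v_def s_def dist_norm norm_minus_commute)
    finally show ?thesis .
  qed
  have "x + s *\<^sub>R (z + v) = y + s *\<^sub>R (z + 0)" for z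
    using s by (simp add: v_def scaleR_add_right)
  then have "integral cube (\<lambda>z. f (x + s *\<^sub>R (z + v))) = integral cube (\<lambda>z. f (y + s *\<^sub>R (z + 0)))" by simp
  then have "\<bar>measure lborel cube * f x - measure lborel cube * f y\<bar> \<le>
    32 * l2n lborel (indicator cube :: real^3 \<Rightarrow> real) * (\<Sum>i\<in>UNIV. h1n (pderiv i f) (\<lambda>j. pderiv j (pderiv i f))) * sqrt s"
    using cube_average_H2[OF f v s, of x] cube_average_H2[OF f _ s, of 0 y] by simp
  then show ?thesis
    using cube_content by (simp add: s_def right_diff_distrib[symmetric] abs_mult)
qed simp

text \<open>Instead of a continuous representative, the set \<open>S\<close> of points at which a
  subsequence of the mollifications converges is used: on \<open>S\<close> the estimate for smooth
  functions passes to the limit.\<close>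

lemma holder_H2:
  obtains C where "C > 0" "\<And>w D DD. H1 w D \<Longrightarrow> (\<And>i. H1 (D i) (DD i)) \<Longrightarrow>
    \<exists>S. (AE x in lborel. x \<in> S) \<and> (\<forall>x\<in>S. \<forall>y\<in>S. dist x y \<le> 1 \<longrightarrow>
      \<bar>w x - w y\<bar> \<le> C * (\<Sum>i\<in>UNIV. h1n (D i) (DD i)) * sqrt (dist x y))"
proof -
  define k where "k = l2n lborel (indicator cube :: real^3 \<Rightarrow> real)"
  define C where "C = 32 * k / measure lborel cube + 1"
  have C: "C > 0" using cube_content by (simp add: C_def k_def add_nonneg_pos)
  show ?thesis
  proof (rule that[OF C])
    fix w D DD assume H: "H1 w D" and HD: "\<And>i. H1 (D i) (DD i)"
    obtain r :: "nat \<Rightarrow> nat" where r: "strict_mono r" and ae: "AE x in lborel. (\<lambda>n. conv (mollifier (r n)) w x - w x) \<longlonglongrightarrow> 0"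
      using l2n_AE_subseq[OF sq_int_diff[OF mollify_tendsto(1)[OF H1_D(1)[OF H]] H1_D(1)[OF H]] mollify_tendsto(2)[OF H1_D(1)[OF H]]] by auto
    define f where "f n = conv (mollifier n) w" for n
    have fs: "smooth (f n)" for n unfolding f_def by (rule mollify_H1(1)[OF H])
    have f1: "pderiv i (f n) = conv (mollifier n) (D i)" for n i unfolding f_def by (rule mollify_H1(3)[OF H])
    have f2: "pderiv j (pderiv i (f n)) = conv (mollifier n) (DD i j)" for n i j unfolding f1 by (rule mollify_H1(3)[OF HD])
    have fS: "pderiv i (f n) \<in> sq_int lborel" "pderiv j (pderiv i (f n)) \<in> sq_int lborel" for n i j
      unfolding f2 unfolding f1 by (intro mollify_tendsto(1) H1_D(2)[OF H] H1_D(2)[OF HD])+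
    have lim: "(\<lambda>n. h1n (pderiv i (f n)) (\<lambda>j. pderiv j (pderiv i (f n)))) \<longlonglongrightarrow> h1n (D i) (DD i)" for i
      unfolding h1n_def f2 unfolding f1
      by (intro tendsto_add tendsto_sum l2n_tendsto mollify_tendsto H1_D(2)[OF H] H1_D(2)[OF HD])
    define S where "S = {x. (\<lambda>n. f (r n) x) \<longlonglongrightarrow> w x}"
    have "AE x in lborel. x \<in> S"
      using ae by eventually_elim (simp add: S_def f_def LIM_zero_iff)
    moreover have "\<bar>w x - w y\<bar> \<le> C * (\<Sum>i\<in>UNIV. h1n (D i) (DD i)) * sqrt (dist x y)" if "x \<in> S" "y \<in> S" "dist x y \<le> 1" for x y
    proof -
      have "measure lborel cube * \<bar>w x - w y\<bar> \<le> 32 * k * (\<Sum>i\<in>UNIV. h1n (D i) (DD i)) * sqrt (dist x y)"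
      proof (rule LIMSEQ_le)
        show "(\<lambda>n. measure lborel cube * \<bar>f (r n) x - f (r n) y\<bar>) \<longlonglongrightarrow> measure lborel cube * \<bar>w x - w y\<bar>"
          using that by (intro tendsto_intros) (auto simp: S_def)
        show "(\<lambda>n. 32 * k * (\<Sum>i\<in>UNIV. h1n (pderiv i (f (r n))) (\<lambda>j. pderiv j (pderiv i (f (r n))))) * sqrt (dist x y))
            \<longlonglongrightarrow> 32 * k * (\<Sum>i\<in>UNIV. h1n (D i) (DD i)) * sqrt (dist x y)"
          using LIMSEQ_subseq_LIMSEQ[OF lim r] by (intro tendsto_intros) (simp add: o_def)
        show "\<exists>N. \<forall>n\<ge>N. measure lborel cube * \<bar>f (r n) x - f (r n) y\<bar> \<le>
            32 * k * (\<Sum>i\<in>UNIV. h1n (pderiv i (f (r n))) (\<lambda>j. pderiv j (pderiv i (f (r n))))) * sqrt (dist x y)"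
          unfolding k_def by (intro exI allI impI holder_smooth fs fS that)
      qed
      then have "\<bar>w x - w y\<bar> \<le> (32 * k / measure lborel cube) * (\<Sum>i\<in>UNIV. h1n (D i) (DD i)) * sqrt (dist x y)"
        using cube_content by (simp add: field_simps)
      also have "\<dots> \<le> C * (\<Sum>i\<in>UNIV. h1n (D i) (DD i)) * sqrt (dist x y)"
        unfolding C_def by (intro mult_right_mono) (auto simp: sum_nonneg)
      finally show ?thesis .
    qed
    ultimately show "\<exists>S. (AE x in lborel. x \<in> S) \<and> (\<forall>x\<in>S. \<forall>y\<in>S. dist x y \<le> 1 \<longrightarrow>
      \<bar>w x - w y\<bar> \<le> C * (\<Sum>i\<in>UNIV. h1n (D i) (DD i)) * sqrt (dist x y))" by blast
  qed
qed

section \<open>Measure density at the boundary\<close>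

lemma AE_open_witness:
  fixes U :: "(real^3) set" and P :: "real^3 \<Rightarrow> bool"
  assumes "AE x in lborel. P x" "open U" "U \<noteq> {}"
  obtains x where "x \<in> U" "P x"
proof -
  have "\<exists>x\<in>U. P x"
  proof (rule ccontr)
    assume no: "\<not> ?thesis"
    have "AE x in lborel. x \<notin> U" using assms(1) by eventually_elim (use no in auto)
    then have "emeasure lborel U = 0"
      using assms(2) by (subst (asm) AE_iff_measurable[of U]) auto
    then have "negligible U"
      using assms(2) by (auto simp: negligible_iff_null_sets null_sets_completion_iff null_sets_def)
    then show False using open_not_negligible assms by blast
  qed
  then show ?thesis using that by blast
qed

text \<open>A cutoff function at scale \<open>r\<close> around a boundary point oscillates by \<open>1\<close> while its \<open>H\<^sup>2\<close> norm is at most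
  \<open>r\<^sup>-\<^sup>2 (\<lambda>(\<Omega> \<inter> B\<^sub>r))\<^bsup>1/2\<^esup>\<close>; the Hoelder exponent \<open>1/2\<close> of \<open>H\<^sup>2\<close> then forces \<open>\<lambda>(\<Omega> \<inter> B\<^sub>r) \<ge> c r\<^sup>3\<close>.\<close>

lemma scaled_cutoff:
  assumes r: "r > 0"
  shows "(\<lambda>y. cutoff ((4 / r) *\<^sub>R (y - x))) \<in> test_functions UNIV"
    "pderiv i (\<lambda>y. cutoff ((4 / r) *\<^sub>R (y - x))) = (\<lambda>y. (4 / r) * pderiv i cutoff ((4 / r) *\<^sub>R (y - x)))"
    "pderiv j (\<lambda>y. (4 / r) * pderiv i cutoff ((4 / r) *\<^sub>R (y - x))) y = (4 / r)\<^sup>2 * pderiv j (pderiv i cutoff) ((4 / r) *\<^sub>R (y - x))"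
proof -
  have eq: "(4 / r) *\<^sub>R (y - x) = (- (4 / r) *\<^sub>R x) + (4 / r) *\<^sub>R y" for y :: "real^3"
    by (simp add: scaleR_diff_right)
  have sm: "smooth (\<lambda>y. cutoff ((4 / r) *\<^sub>R (y - x)))" "smooth (\<lambda>y. pderiv i cutoff ((4 / r) *\<^sub>R (y - x)))" for i
    unfolding eq by (intro smooth_affine smooth_pderiv smooth_cutoff)+
  show "(\<lambda>y. cutoff ((4 / r) *\<^sub>R (y - x))) \<in> test_functions UNIV"
  proof (rule test_functionsI[OF sm(1), of "cball x (r / 2)"])
    fix y assume "y \<notin> cball x (r / 2)"
    then have "4 / r * norm (y - x) \<ge> 2"
      using r by (simp add: dist_norm norm_minus_commute field_simps)
    moreover have "norm ((4 / r) *\<^sub>R (y - x)) = 4 / r * norm (y - x)" using r by simp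
    ultimately have "norm ((4 / r) *\<^sub>R (y - x)) \<ge> 2" by (simp only:)
    then show "cutoff ((4 / r) *\<^sub>R (y - x)) = 0" by (rule cutoff_zero)
  qed auto
  show "pderiv i (\<lambda>y. cutoff ((4 / r) *\<^sub>R (y - x))) = (\<lambda>y. (4 / r) * pderiv i cutoff ((4 / r) *\<^sub>R (y - x)))"
    unfolding eq by (rule ext, rule pderiv_affine[OF smooth_differentiable[OF smooth_cutoff]])
  have "pderiv j (\<lambda>y. (4 / r) * pderiv i cutoff ((4 / r) *\<^sub>R (y - x))) y = (4 / r) * pderiv j (\<lambda>y. pderiv i cutoff ((4 / r) *\<^sub>R (y - x))) y"
    by (rule pderiv_cmult[OF smooth_differentiable[OF sm(2)]])
  also have "pderiv j (\<lambda>y. pderiv i cutoff ((4 / r) *\<^sub>R (y - x))) y = (4 / r) * pderiv j (pderiv i cutoff) ((4 / r) *\<^sub>R (y - x))"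
    unfolding eq by (rule pderiv_affine[OF smooth_differentiable[OF smooth_pderiv[OF smooth_cutoff]]])
  finally show "pderiv j (\<lambda>y. (4 / r) * pderiv i cutoff ((4 / r) *\<^sub>R (y - x))) y = (4 / r)\<^sup>2 * pderiv j (pderiv i cutoff) ((4 / r) *\<^sub>R (y - x))"
    by (simp add: power2_eq_square)
qed

lemma l2n_on_ball_bound:
  fixes f :: "real^3 \<Rightarrow> real"
  assumes \<Omega>: "open \<Omega>" and f: "f \<in> sq_int lborel" and b: "\<And>y. \<bar>f y\<bar> \<le> B" "\<And>y. y \<notin> ball x r \<Longrightarrow> f y = 0"
  shows "l2n (lebesgue_on \<Omega>) f \<le> B * sqrt (measure lebesgue (\<Omega> \<inter> ball x r))"
proof -
  have B0: "B \<ge> 0" using b(1)[of 0] by linarith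
  have fin: "emeasure lborel (\<Omega> \<inter> ball x r) < \<infinity>"
    by (rule emeasure_bounded_finite) auto
  have [measurable]: "\<Omega> \<inter> ball x r \<in> sets borel" using \<Omega> by auto
  have pw: "(\<lambda>y. (indicator (\<Omega> \<inter> ball x r) y :: real)\<^sup>2) = indicator (\<Omega> \<inter> ball x r)"
    by (auto simp: indicator_def)
  have i: "(indicator (\<Omega> \<inter> ball x r) :: real^3 \<Rightarrow> real) \<in> sq_int lborel"
    using \<Omega> fin by (simp add: sq_int_def pw integrable_indicator_iff)
  have "l2n (lebesgue_on \<Omega>) f = l2n lborel (\<lambda>y. indicator \<Omega> y * f y)" by (rule sq_int_on(3)[OF f \<Omega>])
  also have "\<dots> \<le> l2n lborel (\<lambda>y. B * indicator (\<Omega> \<inter> ball x r) y)"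
    by (rule l2n_mono[OF sq_int_cmult[OF i]]) (use b B0 in \<open>auto simp: indicator_def\<close>)
  also have "\<dots> = B * sqrt (measure lebesgue (\<Omega> \<inter> ball x r))"
    using B0 \<Omega> by (simp add: l2n_cmult l2n_def pw measure_completion)
  finally show ?thesis .
qed

lemma measure_density:
  assumes ext: "extension_domain 2 \<Omega>"
  obtains c \<rho> where "c > 0" "\<rho> > 0" "\<rho> \<le> 1"
    "\<And>x r. x \<in> frontier \<Omega> \<Longrightarrow> 0 < r \<Longrightarrow> r \<le> \<rho> \<Longrightarrow> c * r ^ 3 \<le> measure lebesgue (\<Omega> \<inter> ball x r)"
proof (cases "\<Omega> = {}")
  case True
  then show ?thesis by (intro that[of 1 1]) auto
next
  case False
  have \<Omega>: "open \<Omega>" and con: "connected \<Omega>" using ext by (auto simp: extension_domain_def)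
  obtain CE where CE: "CE > 0" "\<And>u. u \<in> sobolev 2 \<Omega> \<Longrightarrow> \<exists>w D DD. H1 w D \<and> (\<forall>i. H1 (D i) (DD i)) \<and>
      (AE x in lebesgue_on \<Omega>. u x = w x) \<and> (\<forall>i. l2n lborel (D i) \<le> CE * sobolev_norm 2 \<Omega> u) \<and>
      (\<forall>i j. l2n lborel (DD i j) \<le> CE * sobolev_norm 2 \<Omega> u)"
    by (rule extension_H2[OF ext]) blast
  obtain CH where CH: "CH > 0" "\<And>w D DD. H1 w D \<Longrightarrow> (\<And>i. H1 (D i) (DD i)) \<Longrightarrow>
    \<exists>S. (AE x in lborel. x \<in> S) \<and> (\<forall>x\<in>S. \<forall>y\<in>S. dist x y \<le> 1 \<longrightarrow>
      \<bar>w x - w y\<bar> \<le> CH * (\<Sum>i\<in>UNIV. h1n (D i) (DD i)) * sqrt (dist x y))"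
    by (rule holder_H2) blast
  have "\<exists>M. \<forall>x. \<bar>pderiv j (pderiv i cutoff) x\<bar> \<le> M" for i j
    using test_bounded[OF test_pderiv[OF test_pderiv[OF test_cutoff]]] by metis
  then have "\<exists>M. \<forall>x. \<bar>pderiv (snd ij) (pderiv (fst ij) cutoff) x\<bar> \<le> M" for ij by blast
  then have "\<exists>M. \<forall>ij. \<forall>x. \<bar>pderiv (snd ij) (pderiv (fst ij) cutoff) x\<bar> \<le> M ij" by (intro choice allI)
  then obtain M where M: "\<And>ij x. \<bar>pderiv (snd ij) (pderiv (fst ij) cutoff) x\<bar> \<le> M ij" by blast
  have "\<exists>M. \<forall>x. \<bar>pderiv i cutoff x\<bar> \<le> M" for i
    using test_bounded[OF test_pderiv[OF test_cutoff]] by metis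
  then have "\<exists>M. \<forall>i. \<forall>x. \<bar>pderiv i cutoff x\<bar> \<le> M i" by (intro choice allI)
  then obtain N where N: "\<And>i x. \<bar>pderiv i cutoff x\<bar> \<le> N i" by blast
  have MN0: "M ij \<ge> 0" "N i \<ge> 0" for ij i
    using M[where ij=ij and x=0] N[of i 0] abs_ge_zero order_trans by blast+
  define K where "K = 1 + (\<Sum>i\<in>UNIV. N i) + (\<Sum>ij\<in>UNIV. M ij)"
  have K: "1 \<le> K" "N i \<le> K" "M ij \<le> K" for i ij
  proof -
    have "N i \<le> (\<Sum>i\<in>UNIV. N i)" "M ij \<le> (\<Sum>ij\<in>UNIV. M ij)" by (rule member_le_sum; simp add: MN0)+
    moreover have "(\<Sum>i\<in>UNIV. N i) \<ge> 0" "(\<Sum>ij\<in>UNIV. M ij) \<ge> 0" by (simp_all add: sum_nonneg MN0)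
    ultimately show "1 \<le> K" "N i \<le> K" "M ij \<le> K" unfolding K_def by linarith+
  qed
  \<comment> \<open>The product of all constants met below: 16K/r^2 bounds the scaled cutoff with
    its derivatives, 13 = 1 + 3 * 4 counts the terms of the second-order norm, 4 and 3 those of
    \<open>h1n\<close> and of the sum over the derivatives, and the root of 2 comes from |p - q|
    \<le> 2r.\<close>
  define T where "T = CH * (3 * (4 * (CE * (13 * (16 * K))))) * sqrt 2"
  have T: "T > 0" using CH(1) CE(1) K(1) by (simp add: T_def)
  obtain a where a: "a \<in> \<Omega>" using False by auto
  obtain e where e: "e > 0" "ball a e \<subseteq> \<Omega>" using \<Omega> a open_contains_ball by metis
  \<comment> \<open>Two points of \<Omega> at distance e/2 keep \<Omega> from fitting into a ball of
    radius 3r/4, because r \<le> e/4 makes its diameter smaller than e/2.\<close>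
  define b where "b = a + (e / 2) *\<^sub>R axis 1 1"
  have ab: "dist a b = e / 2" using e by (simp add: b_def dist_norm)
  have b: "b \<in> \<Omega>" using e ab by (intro subsetD[OF e(2)]) auto
  define \<rho> where "\<rho> = min (1/2) (e / 4)"
  show ?thesis
  proof (rule that[of "1 / T\<^sup>2" \<rho>])
    show "1 / T\<^sup>2 > 0" "\<rho> > 0" "\<rho> \<le> 1" using T e by (auto simp: \<rho>_def)
    fix x r assume x: "x \<in> frontier \<Omega>" and r: "0 < r" "r \<le> \<rho>"
    define A where "A = measure lebesgue (\<Omega> \<inter> ball x r)"
    define u where "u y = cutoff ((4 / r) *\<^sub>R (y - x))" for y
    have ut: "u \<in> test_functions UNIV" unfolding u_def[abs_def] by (rule scaled_cutoff(1)[OF r(1)])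
    have u1: "pderiv i u = (\<lambda>y. (4 / r) * pderiv i cutoff ((4 / r) *\<^sub>R (y - x)))" for i
      unfolding u_def[abs_def] by (rule scaled_cutoff(2)[OF r(1)])
    have u2: "pderiv j (pderiv i u) y = (4 / r)\<^sup>2 * pderiv j (pderiv i cutoff) ((4 / r) *\<^sub>R (y - x))" for i j y
      unfolding u1 by (rule scaled_cutoff(3)[OF r(1)])
    have far: "norm ((4 / r) *\<^sub>R (y - x)) > 2" if "y \<notin> ball x r" for y
    proof -
      have "4 / r * norm (y - x) > 2"
        using that r by (simp add: dist_norm norm_minus_commute field_simps)
      moreover have "norm ((4 / r) *\<^sub>R (y - x)) = 4 / r * norm (y - x)" using r by simp
      ultimately show ?thesis by (simp only:)
    qed
    have r1: "r \<le> 1" using r by (simp add: \<rho>_def)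
    have r2: "1 \<le> 16 / r\<^sup>2" "4 / r \<le> 16 / r\<^sup>2"
      using r(1) r1 power_le_one[of r 2] by (auto simp: field_simps power2_eq_square)
    have rK: "0 \<le> 16 / r\<^sup>2" by simp
    have bu: "l2n (lebesgue_on \<Omega>) u \<le> 16 * K / r\<^sup>2 * sqrt A"
      unfolding A_def
    proof (rule l2n_on_ball_bound[OF \<Omega> test_sq_int[OF ut]])
      have "1 * 1 \<le> 16 / r\<^sup>2 * K" using r2(1) K(1) by (intro mult_mono) auto
      then show "\<bar>u y\<bar> \<le> 16 * K / r\<^sup>2" for y using cutoff_bounds[of "(4 / r) *\<^sub>R (y - x)"] by (simp add: u_def)
      show "y \<notin> ball x r \<Longrightarrow> u y = 0" for y using far[of y] by (simp add: u_def cutoff_zero)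
    qed
    have bu1: "l2n (lebesgue_on \<Omega>) (pderiv i u) \<le> 16 * K / r\<^sup>2 * sqrt A" for i
      unfolding A_def
    proof (rule l2n_on_ball_bound[OF \<Omega> test_sq_int[OF test_pderiv[OF ut]]])
      fix y
      have "4 / r * \<bar>pderiv i cutoff ((4 / r) *\<^sub>R (y - x))\<bar> \<le> 16 / r\<^sup>2 * K"
        using r2(2) order_trans[OF N K(2)] r by (intro mult_mono) auto
      then show "\<bar>pderiv i u y\<bar> \<le> 16 * K / r\<^sup>2" using r by (simp add: u1 abs_mult)
      show "y \<notin> ball x r \<Longrightarrow> pderiv i u y = 0" using cutoff_derivs_zero(1)[of "(4 / r) *\<^sub>R (y - x)" i] far[of y] by (simp add: u1)
    qed
    have bu2: "l2n (lebesgue_on \<Omega>) (pderiv j (pderiv i u)) \<le> 16 * K / r\<^sup>2 * sqrt A" for i j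
      unfolding A_def
    proof (rule l2n_on_ball_bound[OF \<Omega> test_sq_int[OF test_pderiv[OF test_pderiv[OF ut]]]])
      fix y
      have "16 / r\<^sup>2 * \<bar>pderiv j (pderiv i cutoff) ((4 / r) *\<^sub>R (y - x))\<bar> \<le> 16 / r\<^sup>2 * K"
        using order_trans[OF M[of "(i, j)"] K(3)] by (intro mult_left_mono) auto
      then show "\<bar>pderiv j (pderiv i u) y\<bar> \<le> 16 * K / r\<^sup>2" by (simp add: u2 abs_mult power_divide)
      show "y \<notin> ball x r \<Longrightarrow> pderiv j (pderiv i u) y = 0" using cutoff_derivs_zero(2)[of "(4 / r) *\<^sub>R (y - x)" j i] far[of y] by (simp add: u2)
    qed
    define L where "L = 16 * K / r\<^sup>2 * sqrt A"
    have L0: "L \<ge> 0" by (rule order_trans[OF l2n_nonneg bu[folded L_def]])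
    have us: "u \<in> sobolev 2 \<Omega>" by (rule smooth_test_sobolev[OF ut \<Omega>])
    have wS: "weak_pderiv \<Omega> i u \<in> sobolev 1 \<Omega>" for i
      using weak_pderiv_sobolev(1)[OF \<Omega>, of u 1] us by (simp only: numeral_2_eq_2 One_nat_def)
    have norm1: "sobolev_norm 1 \<Omega> (weak_pderiv \<Omega> i u) \<le> 4 * L" for i
    proof -
      have "sobolev_norm 1 \<Omega> (weak_pderiv \<Omega> i u) = sobolev_norm 1 \<Omega> (pderiv i u)"
        by (rule sobolev_norm_cong[OF wS smooth_test_sobolev[OF test_pderiv[OF ut] \<Omega>] weak_pderiv_test[OF ut \<Omega>]])
      also have "\<dots> \<le> L2_norm \<Omega> (pderiv i u) + (\<Sum>j\<in>UNIV. \<bar>L2_norm \<Omega> (weak_pderiv \<Omega> j (pderiv i u))\<bar>)"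
        using sobolev_norm_le_sum[of 0 \<Omega> "pderiv i u"] by simp
      also have "\<dots> \<le> L + (\<Sum>j\<in>(UNIV::3 set). L)"
      proof (intro add_mono sum_mono)
        show "L2_norm \<Omega> (pderiv i u) \<le> L" using bu1[of i] by (simp add: L_def L2_norm_eq)
        fix j
        have pS: "pderiv i u \<in> sobolev (Suc 0) \<Omega>" by (rule smooth_test_sobolev[OF test_pderiv[OF ut] \<Omega>])
        have "l2n (lebesgue_on \<Omega>) (weak_pderiv \<Omega> j (pderiv i u)) = l2n (lebesgue_on \<Omega>) (pderiv j (pderiv i u))"
          using sq_int_meas[OF sobolev_sq_int[OF weak_pderiv_sobolev(1)[OF \<Omega> pS]]]
            borel_on[OF smooth_borel[OF smooth_pderiv[OF smooth_pderiv[OF test_smooth[OF ut]]]]] weak_pderiv_test[OF test_pderiv[OF ut] \<Omega>]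
          by (intro l2n_cong_AE)
        then show "\<bar>L2_norm \<Omega> (weak_pderiv \<Omega> j (pderiv i u))\<bar> \<le> L" using bu2[of j i] by (simp add: L_def L2_norm_eq)
      qed
      finally show ?thesis by simp
    qed
    have norm2: "sobolev_norm 2 \<Omega> u \<le> 13 * L"
    proof -
      have "sobolev_norm 2 \<Omega> u \<le> L2_norm \<Omega> u + (\<Sum>i\<in>UNIV. \<bar>sobolev_norm 1 \<Omega> (weak_pderiv \<Omega> i u)\<bar>)"
        using sobolev_norm_le_sum[of 1 \<Omega> u] by (simp only: numeral_2_eq_2 One_nat_def)
      also have "\<dots> \<le> L + (\<Sum>i\<in>(UNIV::3 set). 4 * L)"
      proof (intro add_mono sum_mono)
        show "L2_norm \<Omega> u \<le> L" using bu by (simp add: L_def L2_norm_eq)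
        show "\<bar>sobolev_norm 1 \<Omega> (weak_pderiv \<Omega> i u)\<bar> \<le> 4 * L" for i
          using norm1[of i] by (simp only: abs_of_nonneg[OF sobolev_norm_nonneg])
      qed
      finally show ?thesis by simp
    qed
    obtain w D DD where w: "H1 w D" "\<And>i. H1 (D i) (DD i)" "AE y in lebesgue_on \<Omega>. u y = w y"
      "\<And>i. l2n lborel (D i) \<le> CE * sobolev_norm 2 \<Omega> u" "\<And>i j. l2n lborel (DD i j) \<le> CE * sobolev_norm 2 \<Omega> u"
      using CE(2)[OF us] by blast
    obtain S where S: "AE y in lborel. y \<in> S"
      "\<And>y z. y \<in> S \<Longrightarrow> z \<in> S \<Longrightarrow> dist y z \<le> 1 \<Longrightarrow> \<bar>w y - w z\<bar> \<le> CH * (\<Sum>i\<in>UNIV. h1n (D i) (DD i)) * sqrt (dist y z)"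
      using CH(2)[OF w(1,2)] by blast
    have good: "AE y in lborel. y \<in> S \<and> (y \<in> \<Omega> \<longrightarrow> u y = w y)"
      using S(1) w(3)[unfolded AE_on_iff[OF \<Omega>]] by eventually_elim blast
    have cl: "x \<in> closure \<Omega>" using x by (simp add: frontier_def)
    have ne: "\<Omega> \<inter> ball x d \<noteq> {}" if d: "d > 0" for d
    proof -
      obtain y where "y \<in> \<Omega>" "dist y x < d" using cl d unfolding closure_approachable by blast
      then show ?thesis by (auto simp: dist_commute)
    qed
    obtain p where p: "p \<in> \<Omega> \<inter> ball x (r / 4)" "p \<in> S \<and> (p \<in> \<Omega> \<longrightarrow> u p = w p)"
      by (rule AE_open_witness[OF good, of "\<Omega> \<inter> ball x (r / 4)"]) (use \<Omega> ne[of "r/4"] r in auto)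
    \<comment> \<open>The cutoff is 1 within distance r/4 of \<open>x\<close> and 0 beyond r/2.
      Points of \<Omega> of the first kind exist because \<open>x\<close> is in the closure;
      connectedness yields one at distance exactly 3r/4, hence an open piece of \<Omega> in the
      shell between r/2 and r. In both pieces a point is picked at which the extension agrees with
      the cutoff and the Hoelder estimate holds.\<close>
    have "\<Omega> \<inter> frontier (ball x (3 * r / 4)) \<noteq> {}"
    proof (rule connected_Int_frontier[OF con ne])
      show "\<Omega> - ball x (3 * r / 4) \<noteq> {}"
      proof
        assume "\<Omega> - ball x (3 * r / 4) = {}"
        then have "dist x a < 3 * r / 4" "dist x b < 3 * r / 4" using a b by auto
        then have "dist a b < 3 * r / 2" using dist_triangle2[of a b x] by (simp add: dist_commute)
        then show False using r ab by (simp add: \<rho>_def)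
      qed
    qed (use r in simp)
    then obtain q0 where q0: "q0 \<in> \<Omega>" "dist x q0 = 3 * r / 4" using r by (auto simp: frontier_ball)
    obtain q where q: "q \<in> \<Omega> \<inter> (ball x r \<inter> - cball x (r / 2))" "q \<in> S \<and> (q \<in> \<Omega> \<longrightarrow> u q = w q)"
      by (rule AE_open_witness[OF good, of "\<Omega> \<inter> (ball x r \<inter> - cball x (r / 2))"]) (use \<Omega> q0 r in \<open>auto intro!: open_Int open_Compl exI[of _ q0]\<close>)
    have nr: "norm ((4 / r) *\<^sub>R (y - x)) = 4 / r * dist x y" for y
      using r by (simp add: dist_norm norm_minus_commute)
    have "4 / r * dist x p \<le> 1" using p(1) r by (simp add: field_simps)
    then have up: "u p = 1" unfolding u_def nr[symmetric] by (rule cutoff_one)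
    have "4 / r * dist x q \<ge> 2" using q(1) r by (simp add: field_simps)
    then have uq: "u q = 0" unfolding u_def nr[symmetric] by (rule cutoff_zero)
    have dpq: "dist p q \<le> 2 * r" using dist_triangle2[of p q x] p(1) q(1) r by (simp add: dist_commute)
    have "1 \<le> CH * (\<Sum>i\<in>UNIV. h1n (D i) (DD i)) * sqrt (dist p q)"
      using S(2)[of p q] p q up uq dpq r by (simp add: \<rho>_def)
    also have "\<dots> \<le> CH * (3 * (4 * (CE * (13 * L)))) * sqrt (2 * r)"
    proof (intro mult_mono mult_left_mono)
      have b: "CE * sobolev_norm 2 \<Omega> u \<le> CE * (13 * L)" using norm2 CE(1) by simp
      have "h1n (D i) (DD i) \<le> 4 * (CE * (13 * L))" for i
      proof -
        have "(\<Sum>j\<in>UNIV. l2n lborel (DD i j)) \<le> (\<Sum>j\<in>(UNIV::3 set). CE * (13 * L))"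
          by (intro sum_mono order_trans[OF w(5) b])
        then show ?thesis using order_trans[OF w(4)[of i] b] by (simp add: h1n_def)
      qed
      then have "(\<Sum>i\<in>UNIV. h1n (D i) (DD i)) \<le> (\<Sum>i\<in>(UNIV::3 set). 4 * (CE * (13 * L)))" by (intro sum_mono)
      then show "(\<Sum>i\<in>UNIV. h1n (D i) (DD i)) \<le> 3 * (4 * (CE * (13 * L)))" by simp
    qed (use CH(1) CE(1) L0 dpq in \<open>auto simp: sum_nonneg\<close>)
    also have "\<dots> = T * (sqrt r / r\<^sup>2 * sqrt A)"
      by (simp add: T_def L_def real_sqrt_mult field_simps)
    finally have "1\<^sup>2 \<le> (T * (sqrt r / r\<^sup>2 * sqrt A))\<^sup>2" by (rule power_mono) simp
    also have "\<dots> = T\<^sup>2 * (A / r ^ 3)"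
    proof -
      have "(T * (sqrt r / r\<^sup>2 * sqrt A))\<^sup>2 = T\<^sup>2 * (r / (r\<^sup>2)\<^sup>2 * A)"
        using r by (simp add: power_mult_distrib power_divide A_def)
      also have "r / (r\<^sup>2)\<^sup>2 = 1 / r ^ 3"
        using r by (simp add: field_simps power2_eq_square power3_eq_cube)
      finally show ?thesis by simp
    qed
    finally show "1 / T\<^sup>2 * r ^ 3 \<le> measure lebesgue (\<Omega> \<inter> ball x r)"
      using T r by (simp add: A_def field_simps)
  qed
qed

section \<open>Sets of capacity zero and the trace\<close>

text \<open>Vanishing capacity in terms of \<open>H1\<close> and \<open>h1n\<close>. Replacing the
  Hilbert norm by an equivalent one is harmless, since only arbitrarily small values matter.\<close>

definition null_cap :: "(real^3) set \<Rightarrow> bool" where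
  "null_cap A \<longleftrightarrow> (\<forall>e>0. \<exists>h B U. H1 h B \<and> h1n h B < e \<and> open U \<and> A \<subseteq> U \<and> (AE x in lborel. x \<in> U \<longrightarrow> h x \<ge> 1))"

lemma capacity_eq_0_iff: "capacity A = 0 \<longleftrightarrow> null_cap A"
proof
  assume c: "capacity A = 0"
  show "null_cap A"
    unfolding null_cap_def
  proof (intro allI impI)
    fix e :: real assume e: "e > 0"
    have "capacity A < ennreal ((e / 8)\<^sup>2)" using c e by simp
    then obtain u where u: "u \<in> sobolev 1 UNIV" and U: "\<exists>U. open U \<and> A \<subseteq> U \<and> (AE x in lebesgue. x \<in> U \<longrightarrow> u x \<ge> 1)"
      and n: "ennreal ((sobolev_norm 1 UNIV u)\<^sup>2) < ennreal ((e / 8)\<^sup>2)"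
      unfolding capacity_def INF_less_iff by blast
    have "(sobolev_norm 1 UNIV u)\<^sup>2 < (e / 8)\<^sup>2" using n by (subst (asm) ennreal_less_iff) auto
    then have n: "sobolev_norm 1 UNIV u < e / 8" by (rule power2_less_imp_less) (use e in simp)
    have u': "u \<in> sobolev (Suc 0) UNIV" using u by simp
    obtain w D where w: "H1 w D" "AE x in lborel. u x = w x" and "\<And>i. AE x in lborel. weak_pderiv UNIV i u x = D i x"
      and l: "l2n lborel w = L2_norm UNIV u" "\<And>i. l2n lborel (D i) = L2_norm UNIV (weak_pderiv UNIV i u)"
      by (rule sobolev_UNIV_H1[OF u']) blast
    define s where "s = sobolev_norm 1 UNIV u"
    have "h1n w D \<le> s + (\<Sum>i\<in>(UNIV::3 set). s)"
      unfolding h1n_def l s_def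
      using sobolev1_norm_components[where k=0 and \<Omega>=UNIV and u=u] by (intro add_mono sum_mono) (simp_all only: One_nat_def sobolev_norm.simps(1))
    then have "h1n w D < e" using n[folded s_def] e by simp
    moreover obtain U where U: "open U" "A \<subseteq> U" "AE x in lebesgue. x \<in> U \<longrightarrow> u x \<ge> 1" using U by blast
    moreover have "AE x in lborel. x \<in> U \<longrightarrow> w x \<ge> 1"
      using U(3)[unfolded AE_completion_iff] w(2) by eventually_elim auto
    ultimately show "\<exists>h B U. H1 h B \<and> h1n h B < e \<and> open U \<and> A \<subseteq> U \<and> (AE x in lborel. x \<in> U \<longrightarrow> h x \<ge> 1)"
      using w(1) by blast
  qed
next
  assume n: "null_cap A"
  show "capacity A = 0"
  proof (rule ccontr)
    assume "capacity A \<noteq> 0"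
    then have "0 < capacity A" by (simp add: zero_less_iff_neq_zero)
    then obtain e :: real where e: "e > 0" "ennreal e < capacity A"
      by (metis ennreal_0 ennreal_less_zero_iff ex_gt_or_lt dense ennreal_cases infinity_ennreal_def not_less_iff_gr_or_eq order_less_trans top.extremum_strict ennreal_less_top)
    obtain h B U where h: "H1 h B" "h1n h B < sqrt e" "open U" "A \<subseteq> U" "AE x in lborel. x \<in> U \<longrightarrow> h x \<ge> 1"
      using n[unfolded null_cap_def, rule_format, of "sqrt e"] e(1) by auto
    have "capacity A \<le> ennreal ((sobolev_norm 1 UNIV h)\<^sup>2)"
      unfolding capacity_def
    proof (rule INF_lower, intro CollectI conjI H1_sobolev(1)[OF h(1) open_UNIV] exI[of _ U] h(3,4))
      show "AE x in lebesgue. x \<in> U \<longrightarrow> 1 \<le> h x" using h(5) by (simp add: AE_completion_iff)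
    qed
    also have "\<dots> \<le> ennreal e"
    proof (rule ennreal_leI)
      have "sobolev_norm 1 UNIV h \<le> sqrt e" using H1_sobolev_norm[OF h(1)] h(2) by linarith
      then have "(sobolev_norm 1 UNIV h)\<^sup>2 \<le> (sqrt e)\<^sup>2" by (rule power_mono) (rule sobolev_norm_nonneg)
      then show "(sobolev_norm 1 UNIV h)\<^sup>2 \<le> e" using e(1) by simp
    qed
    finally show False using e(2) by simp
  qed
qed

lemma qe_eq_iff: "qe_eq \<Omega> f g \<longleftrightarrow> null_cap {x \<in> frontier \<Omega>. f x \<noteq> g x}"
  by (simp add: qe_eq_def capacity_eq_0_iff)

lemma null_cap_subset: "null_cap A \<Longrightarrow> B \<subseteq> A \<Longrightarrow> null_cap B"
  unfolding null_cap_def by (meson order_trans)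

lemma null_cap_empty: "null_cap {}"
  unfolding null_cap_def
  by (intro allI impI exI[of _ "\<lambda>x. 0"] exI[of _ "\<lambda>i x. 0"] exI[of _ "{}"]) (auto simp: H1_zero h1n_def)

text \<open>Absolute values are taken before adding, because an admissible function has no sign off
  its own open set.\<close>

lemma null_cap_Un:
  assumes A: "null_cap A" and B: "null_cap B"
  shows "null_cap (A \<union> B)"
  unfolding null_cap_def
proof (intro allI impI)
  fix e :: real assume e: "e > 0"
  obtain h B1 U where h: "H1 h B1" "h1n h B1 < e / 2" "open U" "A \<subseteq> U" "AE x in lborel. x \<in> U \<longrightarrow> h x \<ge> 1"
    using A[unfolded null_cap_def, rule_format, of "e / 2"] e by auto
  obtain g B2 V where g: "H1 g B2" "h1n g B2 < e / 2" "open V" "B \<subseteq> V" "AE x in lborel. x \<in> V \<longrightarrow> g x \<ge> 1"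
    using B[unfolded null_cap_def, rule_format, of "e / 2"] e by auto
  have "h1n (\<lambda>x. \<bar>h x\<bar> + \<bar>g x\<bar>) (\<lambda>i x. sgn (h x) * B1 i x + sgn (g x) * B2 i x) < e"
    using h1n_add[OF H1_abs(1)[OF h(1)] H1_abs(1)[OF g(1)]] H1_abs(2)[OF h(1)] H1_abs(2)[OF g(1)] h(2) g(2) by linarith
  moreover have "AE x in lborel. x \<in> U \<union> V \<longrightarrow> \<bar>h x\<bar> + \<bar>g x\<bar> \<ge> 1"
    using h(5) g(5) by eventually_elim auto
  ultimately show "\<exists>h B' W. H1 h B' \<and> h1n h B' < e \<and> open W \<and> A \<union> B \<subseteq> W \<and> (AE x in lborel. x \<in> W \<longrightarrow> h x \<ge> 1)"
    using H1_add[OF H1_abs(1)[OF h(1)] H1_abs(1)[OF g(1)]] h g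
    by (intro exI[of _ "\<lambda>x. \<bar>h x\<bar> + \<bar>g x\<bar>"] exI[of _ "\<lambda>i x. sgn (h x) * B1 i x + sgn (g x) * B2 i x"] exI[of _ "U \<union> V"]) auto
qed

lemma qe_eq_refl: "qe_eq \<Omega> f f"
  by (simp add: qe_eq_iff null_cap_empty)

lemma qe_eq_sym: "qe_eq \<Omega> f g \<Longrightarrow> qe_eq \<Omega> g f"
  by (auto simp: qe_eq_iff elim: null_cap_subset)

lemma qe_eq_trans: "qe_eq \<Omega> f g \<Longrightarrow> qe_eq \<Omega> g h \<Longrightarrow> qe_eq \<Omega> f h"
  unfolding qe_eq_iff by (drule (1) null_cap_Un, erule null_cap_subset) auto

lemma qe_eq_lincomb: "qe_eq \<Omega> f f' \<Longrightarrow> qe_eq \<Omega> g g' \<Longrightarrow> qe_eq \<Omega> (\<lambda>x. a * f x + b * g x) (\<lambda>x. a * f' x + b * g' x)"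
  unfolding qe_eq_iff by (drule (1) null_cap_Un, erule null_cap_subset) auto

section \<open>Ball integrals and approximation outside small open sets\<close>

lemma indicator_ball_sq_int: "(indicator (ball x r) :: real^3 \<Rightarrow> real) \<in> sq_int lborel"
proof -
  have "(indicator (ball x r) :: real^3 \<Rightarrow> real) \<in> borel_measurable borel" by (rule borel_measurable_indicator) auto
  moreover have "norm y \<le> norm x + r" if "y \<in> ball x r" for y
    using that norm_triangle_sub[of y x] by (simp add: dist_norm norm_minus_commute)
  ultimately show ?thesis
    by (intro sq_int_bounded_support[of _ 1 "norm x + r"]) (auto simp: indicator_def not_le[symmetric])
qed

lemma ball_integrable: "f \<in> sq_int lborel \<Longrightarrow> integrable lborel (\<lambda>y. f y * indicator (ball x r) (y::real^3))"
  by (rule sq_int_mult[OF _ indicator_ball_sq_int])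

text \<open>Shrinking the radius a little loses arbitrarily little mass, and every nearby ball of
  radius \<open>r\<close> contains the shrunken one. Openness matters because capacity is tested on
  open sets.\<close>

lemma open_ball_integral:
  fixes f :: "real^3 \<Rightarrow> real"
  assumes f: "f \<in> sq_int lborel" and f0: "\<And>x. f x \<ge> 0" and r: "r > 0"
  shows "open {x. (\<integral>y. f y * indicator (ball x r) y \<partial>lborel) > t}"
  unfolding open_contains_ball
proof
  fix x assume "x \<in> {x. (\<integral>y. f y * indicator (ball x r) y \<partial>lborel) > t}"
  then have x: "(\<integral>y. f y * indicator (ball x r) y \<partial>lborel) > t" by simp
  have [measurable]: "f \<in> borel_measurable borel" using sq_int_meas[OF f] by simp
  have im: "(\<lambda>y. f y * indicator (ball z s) y) \<in> borel_measurable lborel" for z s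
    using ball_integrable[OF f] by auto
  have "(\<lambda>n. \<integral>y. f y * indicator (ball x (r - 1 / real (Suc n))) y \<partial>lborel) \<longlonglongrightarrow> (\<integral>y. f y * indicator (ball x r) y \<partial>lborel)"
  proof (rule integral_dominated_convergence[where w="\<lambda>y. f y * indicator (ball x r) y"])
    show "AE y in lborel. (\<lambda>n. f y * indicator (ball x (r - 1 / real (Suc n))) y) \<longlonglongrightarrow> f y * indicator (ball x r) y"
    proof (rule AE_I2)
      fix y
      show "(\<lambda>n. f y * indicator (ball x (r - 1 / real (Suc n))) y) \<longlonglongrightarrow> f y * indicator (ball x r) y"
      proof (cases "dist x y < r")
        case True
        obtain N where N: "1 / real (Suc N) < r - dist x y" by (rule nat_approx_posE[of "r - dist x y"]) (use True in auto)
        show ?thesis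
        proof (rule tendsto_eventually, rule eventually_sequentiallyI[of N])
          fix n assume "N \<le> n"
          then have "1 / real (Suc n) \<le> 1 / real (Suc N)" by (simp add: frac_le)
          then show "f y * indicator (ball x (r - 1 / real (Suc n))) y = f y * indicator (ball x r) y"
            using N True by (auto simp: indicator_def simp del: of_nat_Suc)
        qed
      next
        case False
        have "\<not> dist x y < r - 1 / real (Suc n)" for n
        proof -
          have "1 / real (Suc n) > 0" by simp
          then show ?thesis using False by linarith
        qed
        then have "f y * indicator (ball x (r - 1 / real (Suc n))) y = 0" for n by (simp add: indicator_def del: of_nat_Suc)
        moreover have "f y * indicator (ball x r) y = 0" using False by (simp add: indicator_def)
        ultimately show ?thesis by (simp only: tendsto_const)
      qed
    qed
    show "AE y in lborel. norm (f y * indicator (ball x (r - 1 / real (Suc n))) y) \<le> f y * indicator (ball x r) y" for n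
    proof (rule AE_I2)
      fix y
      have "ball x (r - 1 / real (Suc n)) \<subseteq> ball x r" by (rule subset_ball) simp
      then show "norm (f y * indicator (ball x (r - 1 / real (Suc n))) y) \<le> f y * indicator (ball x r) y"
        using f0[of y] by (auto simp: indicator_def simp del: of_nat_Suc)
    qed
  qed (use im ball_integrable[OF f] in auto)
  from order_tendstoD(1)[OF this x]
  obtain n where n: "t < (\<integral>y. f y * indicator (ball x (r - 1 / real (Suc n))) y \<partial>lborel)"
    using eventually_happens'[OF sequentially_bot] by blast
  have "ball x (1 / real (Suc n)) \<subseteq> {x. (\<integral>y. f y * indicator (ball x r) y \<partial>lborel) > t}"
  proof
    fix z assume z: "z \<in> ball x (1 / real (Suc n))"
    have "ball x (r - 1 / real (Suc n)) \<subseteq> ball z r"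
    proof
      fix y assume "y \<in> ball x (r - 1 / real (Suc n))"
      then show "y \<in> ball z r" using z dist_triangle[of z y x] by (simp add: dist_commute del: of_nat_Suc)
    qed
    then have "(\<integral>y. f y * indicator (ball x (r - 1 / real (Suc n))) y \<partial>lborel) \<le> (\<integral>y. f y * indicator (ball z r) y \<partial>lborel)"
      using f0 by (intro integral_mono ball_integrable f) (auto simp: indicator_def simp del: of_nat_Suc)
    then show "z \<in> {x. (\<integral>y. f y * indicator (ball x r) y \<partial>lborel) > t}" using n by simp
  qed
  then show "\<exists>e>0. ball x e \<subseteq> {x. (\<integral>y. f y * indicator (ball x r) y \<partial>lborel) > t}"
    by (intro exI[of _ "1 / real (Suc n)"]) simp
qed

text \<open>Outside the open set \<open>G N\<close>, of capacity at most \<open>2\<^sup>-\<^sup>N\<close>, the ball averages of \<open>w\<close> are uniformly close to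
  those of the smooth functions \<open>v n\<close>; the functions \<open>h N\<close> are admissible for \<open>G N\<close> and also control the
  pointwise difference.\<close>

lemma capacitary_approximation:
  assumes w: "H1 w D"
  obtains v h B G K where "K > 0" "\<And>n. smooth (v n)" "\<And>n. v n \<in> sq_int lborel"
    "\<And>N. H1 (h N) (B N)" "\<And>N. h1n (h N) (B N) \<le> (1/2) ^ N" "\<And>N. open (G N)"
    "\<And>N. AE x in lborel. h N x \<ge> 0" "\<And>N. AE x in lborel. x \<in> G N \<longrightarrow> h N x \<ge> 1"
    "\<And>N. AE x in lborel. h N x < 1 \<longrightarrow> (\<forall>n\<ge>N. \<bar>w x - v n x\<bar> \<le> K * (1/2) ^ n)"
    "\<And>N n x r. x \<notin> G N \<Longrightarrow> N \<le> n \<Longrightarrow> 0 < r \<Longrightarrow> r \<le> 1 \<Longrightarrow>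
       (\<integral>y. \<bar>v n y - w y\<bar> * indicator (ball x r) y \<partial>lborel) \<le> K * (1/2) ^ n * r ^ 3"
proof -
  obtain A where A: "A > 0" "\<And>w D. H1 w D \<Longrightarrow> \<exists>h B. H1 h B \<and> h1n h B \<le> 4 * h1n w D \<and>
     (AE x in lborel. \<bar>w x\<bar> \<le> h x) \<and>
     (AE x in lborel. \<forall>r. 0 < r \<and> r \<le> 1 \<longrightarrow>
        (\<integral>y. \<bar>w y\<bar> * indicator (ball x r) y \<partial>lborel) \<le> A * r ^ 3 * (h x + h1n w D))"
    by (rule maximal_bound) blast
  \<comment> \<open>The error 16^(-n)/(32 A) remains summable after the scaling by c_n = 2A 2^n and
    the factor 4 of the weak-type estimate: the result is (1/4) 8^(-n).\<close>
  define \<kappa> where "\<kappa> n = (1/16) ^ n / (32 * A)" for n :: nat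
  have \<kappa>: "\<kappa> n > 0" for n using A(1) by (simp add: \<kappa>_def)
  obtain v where v: "\<And>n. smooth (v n)" "\<And>n. H1 (v n) (\<lambda>i. pderiv i (v n))"
    "\<And>n. h1n (\<lambda>x. v n x - w x) (\<lambda>i x. pderiv i (v n) x - D i x) < \<kappa> n"
    by (rule H1_smooth_seq[OF w, of \<kappa>, OF \<kappa>]) blast
  have vw: "H1 (\<lambda>x. v n x - w x) (\<lambda>i x. pderiv i (v n) x - D i x)" for n by (rule H1_diff[OF v(2) w])
  have "\<exists>HB. H1 (fst HB) (snd HB) \<and> h1n (fst HB) (snd HB) \<le> 4 * \<kappa> n \<and>
     (AE x in lborel. \<bar>v n x - w x\<bar> \<le> fst HB x) \<and>
     (AE x in lborel. \<forall>r. 0 < r \<and> r \<le> 1 \<longrightarrow>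
        (\<integral>y. \<bar>v n y - w y\<bar> * indicator (ball x r) y \<partial>lborel) \<le> A * r ^ 3 * (fst HB x + \<kappa> n))" for n
  proof -
    obtain h B where h: "H1 h B" "h1n h B \<le> 4 * h1n (\<lambda>x. v n x - w x) (\<lambda>i x. pderiv i (v n) x - D i x)"
      "AE x in lborel. \<bar>v n x - w x\<bar> \<le> h x"
      "AE x in lborel. \<forall>r. 0 < r \<and> r \<le> 1 \<longrightarrow>
        (\<integral>y. \<bar>v n y - w y\<bar> * indicator (ball x r) y \<partial>lborel) \<le> A * r ^ 3 * (h x + h1n (\<lambda>x. v n x - w x) (\<lambda>i x. pderiv i (v n) x - D i x))"
      using A(2)[OF vw] by blast
    have "AE x in lborel. \<forall>r. 0 < r \<and> r \<le> 1 \<longrightarrow>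
        (\<integral>y. \<bar>v n y - w y\<bar> * indicator (ball x r) y \<partial>lborel) \<le> A * r ^ 3 * (h x + \<kappa> n)"
      using h(4)
    proof (eventually_elim, intro allI impI)
      fix x r :: _ assume a: "\<forall>r. 0 < r \<and> r \<le> 1 \<longrightarrow>
        (\<integral>y. \<bar>v n y - w y\<bar> * indicator (ball x r) y \<partial>lborel) \<le> A * r ^ 3 * (h x + h1n (\<lambda>x. v n x - w x) (\<lambda>i x. pderiv i (v n) x - D i x))"
        and r: "0 < r \<and> r \<le> (1::real)"
      have "A * r ^ 3 * (h x + h1n (\<lambda>x. v n x - w x) (\<lambda>i x. pderiv i (v n) x - D i x)) \<le> A * r ^ 3 * (h x + \<kappa> n)"
        using v(3)[of n] A(1) r by (intro mult_left_mono) auto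
      then show "(\<integral>y. \<bar>v n y - w y\<bar> * indicator (ball x r) y \<partial>lborel) \<le> A * r ^ 3 * (h x + \<kappa> n)"
        using a r by (meson order_trans)
    qed
    then show ?thesis using h v(3)[of n] by (intro exI[of _ "(h, B)"]) auto
  qed
  then have "\<exists>HB. \<forall>n. H1 (fst (HB n)) (snd (HB n)) \<and> h1n (fst (HB n)) (snd (HB n)) \<le> 4 * \<kappa> n \<and>
     (AE x in lborel. \<bar>v n x - w x\<bar> \<le> fst (HB n) x) \<and>
     (AE x in lborel. \<forall>r. 0 < r \<and> r \<le> 1 \<longrightarrow>
        (\<integral>y. \<bar>v n y - w y\<bar> * indicator (ball x r) y \<partial>lborel) \<le> A * r ^ 3 * (fst (HB n) x + \<kappa> n))"
    by (intro choice allI)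
  then obtain HB where HB: "\<And>n. H1 (fst (HB n)) (snd (HB n))" "\<And>n. h1n (fst (HB n)) (snd (HB n)) \<le> 4 * \<kappa> n"
     "\<And>n. AE x in lborel. \<bar>v n x - w x\<bar> \<le> fst (HB n) x"
     "\<And>n. AE x in lborel. \<forall>r. 0 < r \<and> r \<le> 1 \<longrightarrow>
        (\<integral>y. \<bar>v n y - w y\<bar> * indicator (ball x r) y \<partial>lborel) \<le> A * r ^ 3 * (fst (HB n) x + \<kappa> n)"
    by blast
  \<comment> \<open>If a ball integral of the n-th error exceeds 2^(-n) r^3, then A 2^n times its
    majorant exceeds 31/32, at almost every such centre; the further factor 2 lifts the scaled
    majorant above 1.\<close>
  define c where "c n = 2 * A * 2 ^ n" for n :: nat
  have c: "c n > 0" for n using A(1) by (simp add: c_def)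
  define f where "f n x = c n * fst (HB n) x" for n x
  define F where "F n i x = c n * snd (HB n) i x" for n i x
  have fF: "H1 (f n) (F n)" for n unfolding f_def[abs_def] F_def[abs_def] by (rule H1_cmult[OF HB(1)])
  have nf: "h1n (f n) (F n) \<le> (1/4) * (1/8) ^ n" for n
  proof -
    have "h1n (f n) (F n) = c n * h1n (fst (HB n)) (snd (HB n))"
      unfolding f_def[abs_def] F_def[abs_def] h1n_cmult using c[of n] by simp
    also have "\<dots> \<le> c n * (4 * \<kappa> n)" using c[of n] HB(2)[of n] by (intro mult_left_mono) auto
    also have "\<dots> = (1/4) * (2 ^ n * (1/16) ^ n)" using A(1) by (simp add: c_def \<kappa>_def)
    also have "2 ^ n * (1/16) ^ n = (1/8 :: real) ^ n" by (simp add: power_mult_distrib[symmetric])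
    finally show ?thesis .
  qed
  have sg: "summable (\<lambda>n. (1/4) * (1/8 :: real) ^ n)" by (intro summable_mult summable_geometric) simp
  have s: "summable (\<lambda>n. h1n (f (n + N)) (F (n + N)))" for N
    by (rule summable_comparison_test'[OF summable_ignore_initial_segment[OF sg, of N], of 0]) (use nf in simp)
  have "\<exists>hB. H1 (fst hB) (snd hB) \<and> (AE x in lborel. (\<lambda>n. f (n + N) x) sums fst hB x) \<and>
      h1n (fst hB) (snd hB) \<le> (\<Sum>n. h1n (f (n + N)) (F (n + N)))" for N
  proof -
    obtain h B where "H1 h B" "AE x in lborel. (\<lambda>n. f (n + N) x) sums h x" "h1n h B \<le> (\<Sum>n. h1n (f (n + N)) (F (n + N)))"
      and "(\<lambda>n. l2n lborel (\<lambda>x. (\<Sum>k<n. f (k + N) x) - h x)) \<longlonglongrightarrow> 0" "\<forall>i. (\<lambda>n. l2n lborel (\<lambda>x. (\<Sum>k<n. F (k + N) i x) - B i x)) \<longlonglongrightarrow> 0"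
      by (rule H1_series[OF fF s])
    then show ?thesis by (intro exI[of _ "(h, B)"]) auto
  qed
  then have "\<exists>hB. \<forall>N. H1 (fst (hB N)) (snd (hB N)) \<and> (AE x in lborel. (\<lambda>n. f (n + N) x) sums fst (hB N) x) \<and>
      h1n (fst (hB N)) (snd (hB N)) \<le> (\<Sum>n. h1n (f (n + N)) (F (n + N)))"
    by (intro choice allI)
  then obtain hB where hB: "\<And>N. H1 (fst (hB N)) (snd (hB N))" "\<And>N. AE x in lborel. (\<lambda>n. f (n + N) x) sums fst (hB N) x"
      "\<And>N. h1n (fst (hB N)) (snd (hB N)) \<le> (\<Sum>n. h1n (f (n + N)) (F (n + N)))"
    by blast
  have fpos: "AE x in lborel. \<forall>n. f n x \<ge> 0"
    unfolding AE_all_countable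
  proof
    fix n show "AE x in lborel. f n x \<ge> 0"
      using HB(3)[of n]
    proof eventually_elim
      case (elim x)
      then have "0 \<le> fst (HB n) x" by linarith
      then show ?case using c[of n] by (simp add: f_def)
    qed
  qed
  have dom: "AE x in lborel. fst (hB N) x \<ge> 0 \<and> (\<forall>n\<ge>N. f n x \<le> fst (hB N) x)" for N
    using fpos hB(2)[of N]
  proof eventually_elim
    case (elim x)
    have "f n x \<le> fst (hB N) x" if "n \<ge> N" for n
      using sum_le_suminf[of "\<lambda>n. f (n + N) x" "{n - N}"] elim that by (simp add: sums_iff)
    moreover have "fst (hB N) x \<ge> 0" using elim suminf_nonneg[of "\<lambda>n. f (n + N) x"] by (simp add: sums_iff)
    ultimately show ?case by blast
  qed
  \<comment> \<open>All n \<ge> N and all radii enter at once. The function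
    \<open>fst (hB N)\<close> sums the nonnegative \<open>f n\<close> from n = N on, so it dominates
    each of them and is at least 1 almost everywhere on \<open>G N\<close>. Off \<open>G N\<close>
    the estimates hold at every single point, as a statement up to sets of capacity zero
    requires.\<close>
  define G where "G N = (\<Union>n\<in>{N..}. \<Union>r\<in>{0<..1}. {x. (\<integral>y. \<bar>v n y - w y\<bar> * indicator (ball x r) y \<partial>lborel) > (1/2) ^ n * r ^ 3})" for N
  define K where "K = 1 / (2 * A) + 1"
  have K: "K > 0" "1 \<le> K" "1 / (2 * A) \<le> K" using A(1) by (auto simp: K_def add_pos_pos)
  show ?thesis
  proof (rule that[of K v "\<lambda>N. fst (hB N)" "\<lambda>N. snd (hB N)" G])
    show "K > 0" by (rule K)
    show "smooth (v n)" "v n \<in> sq_int lborel" for n using v(1) H1_D(1)[OF v(2)] by auto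
    show "H1 (fst (hB N)) (snd (hB N))" for N by (rule hB(1))
    show "h1n (fst (hB N)) (snd (hB N)) \<le> (1/2) ^ N" for N
    proof -
      have "(\<Sum>n. h1n (f (n + N)) (F (n + N))) \<le> (\<Sum>n. (1/4) * (1/8) ^ N * (1/8) ^ n)"
      proof (rule suminf_le[OF _ s])
        show "h1n (f (n + N)) (F (n + N)) \<le> (1/4) * (1/8) ^ N * (1/8) ^ n" for n
          using nf[of "n + N"] by (simp add: power_add mult_ac)
        show "summable (\<lambda>n. (1/4) * (1/8) ^ N * (1/8 :: real) ^ n)" by (intro summable_mult summable_geometric) simp
      qed
      also have "\<dots> = (1/4) * (1/8) ^ N * (8/7)"
      proof -
        have "(\<lambda>n. (1/4) * (1/8) ^ N * (1/8 :: real) ^ n) sums ((1/4) * (1/8) ^ N * (1 / (1 - 1/8)))"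
          by (intro sums_mult geometric_sums) simp
        then show ?thesis by (simp add: sums_iff)
      qed
      also have "\<dots> \<le> 1 * (1/8) ^ N" by simp
      also have "\<dots> \<le> (1/2 :: real) ^ N" by (simp add: power_mono)
      finally show ?thesis using hB(3)[of N] by linarith
    qed
    show "open (G N)" for N
      unfolding G_def using sq_int_abs[OF H1_D(1)[OF vw]] by (intro open_UN ballI open_ball_integral) auto
    show "AE x in lborel. fst (hB N) x \<ge> 0" for N using dom[of N] by eventually_elim blast
    show "AE x in lborel. x \<in> G N \<longrightarrow> fst (hB N) x \<ge> 1" for N
    proof -
      have "AE x in lborel. \<forall>n r. 0 < r \<and> r \<le> 1 \<longrightarrow>
          (\<integral>y. \<bar>v n y - w y\<bar> * indicator (ball x r) y \<partial>lborel) \<le> A * r ^ 3 * (fst (HB n) x + \<kappa> n)"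
        using HB(4) by (simp add: AE_all_countable)
      then show ?thesis
        using dom[of N]
      proof (eventually_elim, intro impI)
        fix x assume a: "\<forall>n r. 0 < r \<and> r \<le> 1 \<longrightarrow>
            (\<integral>y. \<bar>v n y - w y\<bar> * indicator (ball x r) y \<partial>lborel) \<le> A * r ^ 3 * (fst (HB n) x + \<kappa> n)"
          and d: "fst (hB N) x \<ge> 0 \<and> (\<forall>n\<ge>N. f n x \<le> fst (hB N) x)" and "x \<in> G N"
        then obtain n r where nr: "N \<le> n" "0 < r" "r \<le> 1" "(1/2) ^ n * r ^ 3 < (\<integral>y. \<bar>v n y - w y\<bar> * indicator (ball x r) y \<partial>lborel)"
          unfolding G_def by auto
        have "(\<integral>y. \<bar>v n y - w y\<bar> * indicator (ball x r) y \<partial>lborel) \<le> A * r ^ 3 * (fst (HB n) x + \<kappa> n)"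
          using a nr(2,3) by blast
        from less_le_trans[OF nr(4) this] have "(1/2) ^ n * r ^ 3 < (A * (fst (HB n) x + \<kappa> n)) * r ^ 3"
          by (simp only: mult_ac)
        then have "(1/2) ^ n < A * (fst (HB n) x + \<kappa> n)" using nr(2) by (simp add: mult_less_cancel_right)
        then have "2 ^ n * (1/2) ^ n < 2 ^ n * (A * (fst (HB n) x + \<kappa> n))" by (intro mult_strict_left_mono) auto
        then have "1 < 2 ^ n * (A * fst (HB n) x) + 2 ^ n * (A * \<kappa> n)"
          by (simp add: power_mult_distrib[symmetric] distrib_left)
        moreover have "2 ^ n * (A * \<kappa> n) \<le> 1 / 32"
        proof -
          have "2 ^ n * (A * \<kappa> n) = (2 ^ n * (1/16) ^ n) / 32" using A(1) by (simp add: \<kappa>_def)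
          also have "2 ^ n * (1/16) ^ n = (1/8 :: real) ^ n" by (simp add: power_mult_distrib[symmetric])
          also have "(1/8 :: real) ^ n / 32 \<le> 1 / 32" by (simp add: power_le_one)
          finally show ?thesis .
        qed
        ultimately have "1 \<le> f n x" by (simp add: f_def c_def mult_ac)
        then show "fst (hB N) x \<ge> 1" using d nr(1) by (meson order_trans)
      qed
    qed
    show "AE x in lborel. fst (hB N) x < 1 \<longrightarrow> (\<forall>n\<ge>N. \<bar>w x - v n x\<bar> \<le> K * (1/2) ^ n)" for N
    proof -
      have "AE x in lborel. \<forall>n. \<bar>v n x - w x\<bar> \<le> fst (HB n) x" using HB(3) by (simp add: AE_all_countable)
      then show ?thesis
        using dom[of N]
      proof (eventually_elim, intro impI allI)
        fix x n assume a: "\<forall>n. \<bar>v n x - w x\<bar> \<le> fst (HB n) x" and d: "fst (hB N) x \<ge> 0 \<and> (\<forall>n\<ge>N. f n x \<le> fst (hB N) x)"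
          and l: "fst (hB N) x < 1" and n: "N \<le> n"
        have "c n * fst (HB n) x \<le> 1" using d n l unfolding f_def by force
        then have "fst (HB n) x \<le> 1 / c n" using c[of n] by (simp add: field_simps)
        also have "\<dots> = 1 / (2 * A) * (1/2) ^ n" by (simp add: c_def power_divide)
        also have "\<dots> \<le> K * (1/2) ^ n" using K(3) by (intro mult_right_mono) auto
        finally show "\<bar>w x - v n x\<bar> \<le> K * (1/2) ^ n" using a by (metis abs_minus_commute order_trans)
      qed
    qed
    fix N n x and r :: real assume a: "x \<notin> G N" "N \<le> n" "0 < r" "r \<le> 1"
    then have "(\<integral>y. \<bar>v n y - w y\<bar> * indicator (ball x r) y \<partial>lborel) \<le> (1/2) ^ n * r ^ 3"
      unfolding G_def by (force simp: not_less)
    also have "\<dots> \<le> K * (1/2) ^ n * r ^ 3"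
      using K(2) a(3) by (intro mult_right_mono) auto
    finally show "(\<integral>y. \<bar>v n y - w y\<bar> * indicator (ball x r) y \<partial>lborel) \<le> K * (1/2) ^ n * r ^ 3" .
  qed
qed

lemma null_cap_Inter:
  assumes "\<And>N. H1 (h N) (B N)" "\<And>N. h1n (h N) (B N) \<le> (1/2) ^ N" "\<And>N. open (G N)"
    "\<And>N. AE x in lborel. x \<in> G N \<longrightarrow> h N x \<ge> 1"
  shows "null_cap (\<Inter>N. G N)"
  unfolding null_cap_def
proof (intro allI impI)
  fix e :: real assume "e > 0"
  then obtain N where N: "(1/2) ^ N < e" using real_arch_pow_inv[of e "1/2"] by auto
  have "h1n (h N) (B N) < e" using assms(2)[of N] N by linarith
  then show "\<exists>h B U. H1 h B \<and> h1n h B < e \<and> open U \<and> (\<Inter>N. G N) \<subseteq> U \<and> (AE x in lborel. x \<in> U \<longrightarrow> h x \<ge> 1)"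
    using assms by (intro exI[of _ "h N"] exI[of _ "B N"] exI[of _ "G N"]) auto
qed

section \<open>The trace as a limit of averages\<close>

definition ball_average :: "(real^3) set \<Rightarrow> (real^3 \<Rightarrow> real) \<Rightarrow> real^3 \<Rightarrow> real \<Rightarrow> real" where
  "ball_average \<Omega> u x r = 1 / measure lebesgue (\<Omega> \<inter> ball x r) * integral\<^sup>L (lebesgue_on (\<Omega> \<inter> ball x r)) u"

lemma Tr_eqI: "(ball_average \<Omega> u x \<longlongrightarrow> L) (at_right 0) \<Longrightarrow> Tr \<Omega> u x = L"
  unfolding Tr_def ball_average_def[abs_def] by (rule tendsto_Lim) simp_all

lemma ball_average_cong:
  assumes u: "u \<in> sq_int (lebesgue_on \<Omega>)" and w: "w \<in> sq_int lborel" and \<Omega>: "open \<Omega>" and ae: "AE x in lebesgue_on \<Omega>. u x = w x"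
  shows "ball_average \<Omega> u x r = ball_average \<Omega> w x r"
proof -
  have o: "open (\<Omega> \<inter> ball x r)" using \<Omega> by auto
  have wm: "w \<in> borel_measurable borel" using sq_int_meas[OF w] by simp
  have "integral\<^sup>L (lebesgue_on (\<Omega> \<inter> ball x r)) u = integral\<^sup>L (lebesgue_on (\<Omega> \<inter> ball x r)) w"
  proof (rule integral_cong_AE)
    show "u \<in> borel_measurable (lebesgue_on (\<Omega> \<inter> ball x r))"
      by (rule measurable_restrict_mono[OF sq_int_meas[OF u]]) auto
    show "w \<in> borel_measurable (lebesgue_on (\<Omega> \<inter> ball x r))" by (rule borel_on[OF wm])
    show "AE x in lebesgue_on (\<Omega> \<inter> ball x r). u x = w x"
      using ae unfolding AE_on_iff[OF o] AE_on_iff[OF \<Omega>] by eventually_elim auto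
  qed
  then show ?thesis by (simp add: ball_average_def)
qed

lemma ball_average_eq:
  assumes w: "w \<in> sq_int lborel" and \<Omega>: "open \<Omega>"
  shows "ball_average \<Omega> w x r = (\<integral>y. indicator (\<Omega> \<inter> ball x r) y * w y \<partial>lborel) / measure lebesgue (\<Omega> \<inter> ball x r)"
    "integrable lborel (\<lambda>y. indicator (\<Omega> \<inter> ball x r) y * w y)"
proof -
  have o: "open (\<Omega> \<inter> ball x r)" using \<Omega> by auto
  have wm: "w \<in> borel_measurable borel" using sq_int_meas[OF w] by simp
  show "ball_average \<Omega> w x r = (\<integral>y. indicator (\<Omega> \<inter> ball x r) y * w y \<partial>lborel) / measure lebesgue (\<Omega> \<inter> ball x r)"
    by (simp add: ball_average_def integral_on[OF wm o])
  show "integrable lborel (\<lambda>y. indicator (\<Omega> \<inter> ball x r) y * w y)"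
  proof (rule Bochner_Integration.integrable_bound[OF ball_integrable[OF w, of x r]])
    show "(\<lambda>y. indicator (\<Omega> \<inter> ball x r) y * w y) \<in> borel_measurable lborel"
      using wm o by (intro borel_measurable_times borel_measurable_indicator) auto
  qed (auto simp: indicator_def)
qed

text \<open>Measure density turns the bound K 2^(-n) r^3 for integrals over the full ball into (K/c)
  2^(-n) for averages over \<Omega> \<inter> B_r(x). As v_n is continuous at \<open>x\<close>, its
  own averages converge to v_n(x); hence the averages of \<open>w\<close> are squeezed around the
  numbers v_n(x), which form a Cauchy sequence.\<close>

lemma trace_limit:
  assumes w: "w \<in> sq_int lborel" and v: "\<And>n. smooth (v n)" "\<And>n. v n \<in> sq_int lborel" and \<Omega>: "open \<Omega>"
    and c: "c > 0" "\<rho> > 0" "\<rho> \<le> 1" "\<And>r. 0 < r \<Longrightarrow> r \<le> \<rho> \<Longrightarrow> c * r ^ 3 \<le> measure lebesgue (\<Omega> \<inter> ball x r)"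
    and K: "K > 0" "\<And>n r. N \<le> n \<Longrightarrow> 0 < r \<Longrightarrow> r \<le> 1 \<Longrightarrow>
       (\<integral>y. \<bar>v n y - w y\<bar> * indicator (ball x r) y \<partial>lborel) \<le> K * (1/2) ^ n * r ^ 3"
  obtains L where "(ball_average \<Omega> w x \<longlongrightarrow> L) (at_right 0)" "\<And>n. N \<le> n \<Longrightarrow> \<bar>L - v n x\<bar> \<le> K / c * (1/2) ^ n"
proof -
  define M where "M = K / c"
  have M: "M > 0" using K c by (simp add: M_def)
  have close: "\<forall>\<^sub>F r in at_right 0. \<bar>ball_average \<Omega> w x r - v n x\<bar> \<le> M * (1/2) ^ n + e" if n: "N \<le> n" and e: "e > 0" for n e
  proof -
    obtain d where d: "d > 0" "\<And>y. dist y x < d \<Longrightarrow> dist (v n y) (v n x) < e"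
      using smooth_isCont[OF v(1)[of n], of x] e unfolding continuous_at_eps_delta by metis
    have "\<bar>ball_average \<Omega> w x r - v n x\<bar> \<le> M * (1/2) ^ n + e" if r: "0 < r" "r < min d \<rho>" for r
    proof -
      define m where "m = measure lebesgue (\<Omega> \<inter> ball x r)"
      have m: "c * r ^ 3 \<le> m" "m > 0"
        using c(4)[of r] r c(1) by (auto simp: m_def intro: less_le_trans[of _ "c * r ^ 3"])
      define I :: "real^3 \<Rightarrow> real" where "I y = indicator (\<Omega> \<inter> ball x r) y" for y
      have Im: "(\<integral>y. I y \<partial>lborel) = m"
        using \<Omega> by (simp add: I_def m_def measure_completion)
      have iI: "integrable lborel I"
        unfolding I_def using \<Omega> emeasure_bounded_finite[OF bounded_subset[OF bounded_ball Int_lower2], of \<Omega> x r]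
        by (simp add: integrable_indicator_iff)
      have iw: "integrable lborel (\<lambda>y. I y * w y)" unfolding I_def by (rule ball_average_eq(2)[OF w \<Omega>])
      have iv: "integrable lborel (\<lambda>y. I y * v n y)" unfolding I_def by (rule ball_average_eq(2)[OF v(2) \<Omega>])
      have a: "\<bar>\<integral>y. I y * (w y - v n y) \<partial>lborel\<bar> \<le> K * (1/2) ^ n * r ^ 3"
      proof -
        have "\<bar>\<integral>y. I y * (w y - v n y) \<partial>lborel\<bar> \<le> (\<integral>y. \<bar>I y * (w y - v n y)\<bar> \<partial>lborel)"
          by (rule integral_abs_bound)
        also have "\<dots> \<le> (\<integral>y. \<bar>v n y - w y\<bar> * indicator (ball x r) y \<partial>lborel)"
          using iw iv by (intro integral_mono integrable_abs ball_integrable sq_int_abs sq_int_diff v w)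
             (auto simp: I_def right_diff_distrib indicator_def)
        also have "\<dots> \<le> K * (1/2) ^ n * r ^ 3" using r c(3) n by (intro K) auto
        finally show ?thesis .
      qed
      have b: "\<bar>\<integral>y. I y * (v n y - v n x) \<partial>lborel\<bar> \<le> e * m"
      proof -
        have "\<bar>\<integral>y. I y * (v n y - v n x) \<partial>lborel\<bar> \<le> (\<integral>y. \<bar>I y * (v n y - v n x)\<bar> \<partial>lborel)"
          by (rule integral_abs_bound)
        also have "\<dots> \<le> (\<integral>y. e * I y \<partial>lborel)"
        proof (rule integral_mono)
          show "integrable lborel (\<lambda>y. \<bar>I y * (v n y - v n x)\<bar>)"
            using iv iI by (simp add: right_diff_distrib)
          fix y show "\<bar>I y * (v n y - v n x)\<bar> \<le> e * I y"
            using d(2)[of y] r by (auto simp: I_def indicator_def dist_real_def dist_commute)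
        qed (use iI in simp)
        also have "\<dots> = e * m" using Im by simp
        finally show ?thesis .
      qed
      have "(\<integral>y. I y * w y \<partial>lborel) - m * v n x = (\<integral>y. I y * (w y - v n y) \<partial>lborel) + (\<integral>y. I y * (v n y - v n x) \<partial>lborel)"
        using iw iv iI by (simp add: right_diff_distrib Im)
      then have "\<bar>(\<integral>y. I y * w y \<partial>lborel) - m * v n x\<bar> \<le> K * (1/2) ^ n * r ^ 3 + e * m" using a b by linarith
      also have "K * (1/2) ^ n * r ^ 3 \<le> M * (1/2) ^ n * m"
      proof -
        have "K * r ^ 3 \<le> M * m" using mult_left_mono[OF m(1), of M] M c(1) by (simp add: M_def)
        then show ?thesis by (simp add: mult.commute mult.left_commute mult_left_mono)
      qed
      finally have "\<bar>(\<integral>y. I y * w y \<partial>lborel) - m * v n x\<bar> \<le> (M * (1/2) ^ n + e) * m" by (simp add: distrib_right)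
      moreover have "ball_average \<Omega> w x r - v n x = ((\<integral>y. I y * w y \<partial>lborel) - m * v n x) / m"
        using m(2) by (simp add: ball_average_eq(1)[OF w \<Omega>] I_def m_def diff_divide_distrib)
      ultimately show ?thesis using m(2) by (simp add: pos_divide_le_eq)
    qed
    then show ?thesis
      using d(1) c(2) by (intro eventually_at_rightI[of 0 "min d \<rho>"]) auto
  qed
  \<comment> \<open>The two values are compared through the average of \<open>w\<close> at one
    common small radius, after which the slack \<open>e\<close> is let go to 0.\<close>
  have vv: "\<bar>v n x - v k x\<bar> \<le> M * (1/2) ^ n + M * (1/2) ^ k" if nk: "N \<le> n" "N \<le> k" for n k
  proof (rule field_le_epsilon)
    fix e :: real assume e: "e > 0"
    have "\<forall>\<^sub>F r in at_right 0. \<bar>ball_average \<Omega> w x r - v n x\<bar> \<le> M * (1/2) ^ n + e / 2 \<and> \<bar>ball_average \<Omega> w x r - v k x\<bar> \<le> M * (1/2) ^ k + e / 2"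
      using close[OF nk(1), of "e/2"] close[OF nk(2), of "e/2"] e by (intro eventually_conj) auto
    then obtain r where "\<bar>ball_average \<Omega> w x r - v n x\<bar> \<le> M * (1/2) ^ n + e / 2 \<and> \<bar>ball_average \<Omega> w x r - v k x\<bar> \<le> M * (1/2) ^ k + e / 2"
      using eventually_happens'[of "at_right (0::real)"] by (metis (mono_tags, lifting) trivial_limit_at_right_real)
    then show "\<bar>v n x - v k x\<bar> \<le> M * (1/2) ^ n + M * (1/2) ^ k + e" by linarith
  qed
  have pow0: "(\<lambda>n. M * (1/2) ^ n) \<longlonglongrightarrow> 0"
    using tendsto_mult_right_zero[OF LIMSEQ_power_zero[of "1/2 :: real"], of M] by simp
  have "Cauchy (\<lambda>n. v n x)"
  proof (rule metric_CauchyI)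
    fix e :: real assume e: "e > 0"
    have "\<forall>\<^sub>F n in sequentially. M * (1/2) ^ n < e / 2" using order_tendstoD(2)[OF pow0, of "e/2"] e by simp
    then obtain N1 where N1: "\<And>n. n \<ge> N1 \<Longrightarrow> M * (1/2) ^ n < e / 2" unfolding eventually_sequentially by blast
    show "\<exists>N. \<forall>n\<ge>N. \<forall>k\<ge>N. dist (v n x) (v k x) < e"
    proof (intro exI[of _ "max N N1"] allI impI)
      fix n k assume "max N N1 \<le> n" "max N N1 \<le> k"
      then show "dist (v n x) (v k x) < e"
        using vv[of n k] N1[of n] N1[of k] by (simp add: dist_real_def)
    qed
  qed
  then obtain L where L: "(\<lambda>n. v n x) \<longlonglongrightarrow> L" using Cauchy_convergent_iff convergent_def by blast
  have Lb: "\<bar>L - v n x\<bar> \<le> M * (1/2) ^ n" if n: "N \<le> n" for n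
  proof (rule LIMSEQ_le)
    show "(\<lambda>k. \<bar>v k x - v n x\<bar>) \<longlonglongrightarrow> \<bar>L - v n x\<bar>" by (intro tendsto_intros L)
    show "(\<lambda>k. M * (1/2) ^ k + M * (1/2) ^ n) \<longlonglongrightarrow> M * (1/2) ^ n" using tendsto_add[OF pow0 tendsto_const] by simp
    show "\<exists>k0. \<forall>k\<ge>k0. \<bar>v k x - v n x\<bar> \<le> M * (1/2) ^ k + M * (1/2) ^ n" using vv n by blast
  qed
  have "(ball_average \<Omega> w x \<longlongrightarrow> L) (at_right 0)"
  proof (rule tendstoI)
    fix e :: real assume e: "e > 0"
    have "\<forall>\<^sub>F n in sequentially. M * (1/2) ^ n < e / 3" using order_tendstoD(2)[OF pow0, of "e/3"] e by simp
    then obtain N1 where N1: "\<And>n. n \<ge> N1 \<Longrightarrow> M * (1/2) ^ n < e / 3" unfolding eventually_sequentially by blast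
    define n where "n = max N N1"
    have n: "N \<le> n" "M * (1/2) ^ n < e / 3" using N1[of n] by (auto simp: n_def)
    have e3: "e / 3 > 0" using e by simp
    from close[OF n(1) e3] show "\<forall>\<^sub>F r in at_right 0. dist (ball_average \<Omega> w x r) L < e"
    proof eventually_elim
      case (elim r)
      then show ?case using Lb[OF n(1)] n(2) by (simp add: dist_real_def)
    qed
  qed
  then show ?thesis using that Lb by (simp add: M_def)
qed

section \<open>Functions with vanishing trace\<close>

text \<open>The integral over \<Omega> of D_i E_j - D_j E_i. Encoding \<Omega> by an indicator on
  the first factor keeps the form on \<open>lborel\<close>, on which the tools for H^1 are
  formulated.\<close>

definition curl_pair :: "(real^3) set \<Rightarrow> 3 \<Rightarrow> 3 \<Rightarrow> (3 \<Rightarrow> real^3 \<Rightarrow> real) \<Rightarrow> (3 \<Rightarrow> real^3 \<Rightarrow> real) \<Rightarrow> real" where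
  "curl_pair \<Omega> i j D E = (\<integral>x. (indicator \<Omega> x * D i x) * E j x \<partial>lborel) - (\<integral>x. (indicator \<Omega> x * D j x) * E i x \<partial>lborel)"

lemma sq_int_indicator:
  fixes f :: "real^3 \<Rightarrow> real"
  assumes f: "f \<in> sq_int lborel" and \<Omega>: "open \<Omega>"
  shows "(\<lambda>x. indicator \<Omega> x * f x) \<in> sq_int lborel" "l2n lborel (\<lambda>x. indicator \<Omega> x * f x) \<le> l2n lborel f"
proof -
  have m: "(indicator \<Omega> :: real^3 \<Rightarrow> real) \<in> borel_measurable lborel" using \<Omega> by auto
  show "(\<lambda>x. indicator \<Omega> x * f x) \<in> sq_int lborel"
    by (rule sq_int_bounded_mult[OF f m, of 1]) (auto simp: indicator_def)
  show "l2n lborel (\<lambda>x. indicator \<Omega> x * f x) \<le> l2n lborel f"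
    by (rule l2n_mono[OF f]) (auto simp: indicator_def)
qed

lemma curl_pair_bound:
  assumes \<Omega>: "open \<Omega>" and D: "\<And>i. D i \<in> sq_int lborel" and E: "\<And>i. E i \<in> sq_int lborel"
  shows "\<bar>curl_pair \<Omega> i j D E\<bar> \<le> l2n lborel (D i) * l2n lborel (E j) + l2n lborel (D j) * l2n lborel (E i)"
proof -
  have "\<bar>\<integral>x. (indicator \<Omega> x * D a x) * E b x \<partial>lborel\<bar> \<le> l2n lborel (D a) * l2n lborel (E b)" for a b
    using CS_ineq[OF sq_int_indicator(1)[OF D \<Omega>] E, of a b] sq_int_indicator(2)[OF D \<Omega>, of a]
    by (meson l2n_nonneg mult_right_mono order_trans)
  from this[of i j] this[of j i] show ?thesis unfolding curl_pair_def by linarith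
qed

lemma curl_pair_diff:
  assumes \<Omega>: "open \<Omega>" and D: "\<And>i. D i \<in> sq_int lborel" and R: "\<And>i. R i \<in> sq_int lborel" and E: "\<And>i. E i \<in> sq_int lborel"
  shows "curl_pair \<Omega> i j (\<lambda>i x. D i x - R i x) E = curl_pair \<Omega> i j D E - curl_pair \<Omega> i j R E"
proof -
  have "(\<integral>x. (indicator \<Omega> x * (D a x - R a x)) * E b x \<partial>lborel) =
      (\<integral>x. (indicator \<Omega> x * D a x) * E b x \<partial>lborel) - (\<integral>x. (indicator \<Omega> x * R a x) * E b x \<partial>lborel)" for a b
    using sq_int_mult[OF sq_int_indicator(1)[OF D \<Omega>] E, of a b] sq_int_mult[OF sq_int_indicator(1)[OF R \<Omega>] E, of a b]
    by (subst Bochner_Integration.integral_diff[symmetric]) (auto simp: algebra_simps)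
  then show ?thesis by (simp add: curl_pair_def)
qed

lemma curl_pair_tendsto:
  assumes \<Omega>: "open \<Omega>" and D: "\<And>n i. D n i \<in> sq_int lborel" and R: "\<And>i. R i \<in> sq_int lborel" and E: "\<And>i. E i \<in> sq_int lborel"
    and lim: "\<And>i. (\<lambda>n. l2n lborel (\<lambda>x. D n i x - R i x)) \<longlonglongrightarrow> 0"
  shows "(\<lambda>n. curl_pair \<Omega> i j (D n) E) \<longlonglongrightarrow> curl_pair \<Omega> i j R E"
proof (rule LIM_zero_cancel, rule Lim_null_comparison)
  have "\<bar>curl_pair \<Omega> i j (D n) E - curl_pair \<Omega> i j R E\<bar> \<le>
      l2n lborel (\<lambda>x. D n i x - R i x) * l2n lborel (E j) + l2n lborel (\<lambda>x. D n j x - R j x) * l2n lborel (E i)" for n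
    unfolding curl_pair_diff[OF \<Omega> D R E, symmetric] by (rule curl_pair_bound[OF \<Omega> sq_int_diff[OF D R] E])
  then show "\<forall>\<^sub>F n in sequentially. norm (curl_pair \<Omega> i j (D n) E - curl_pair \<Omega> i j R E) \<le>
      l2n lborel (\<lambda>x. D n i x - R i x) * l2n lborel (E j) + l2n lborel (\<lambda>x. D n j x - R j x) * l2n lborel (E i)" by simp
  have "(\<lambda>n. l2n lborel (\<lambda>x. D n i x - R i x) * l2n lborel (E j) + l2n lborel (\<lambda>x. D n j x - R j x) * l2n lborel (E i))
      \<longlonglongrightarrow> 0 * l2n lborel (E j) + 0 * l2n lborel (E i)"
    by (intro tendsto_intros lim)
  then show "(\<lambda>n. l2n lborel (\<lambda>x. D n i x - R i x) * l2n lborel (E j) + l2n lborel (\<lambda>x. D n j x - R j x) * l2n lborel (E i)) \<longlonglongrightarrow> 0"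
    by simp
qed

lemma curl_pair_cong_AE:
  assumes \<Omega>: "open \<Omega>" and D: "\<And>i. D i \<in> borel_measurable borel" and R: "\<And>i. R i \<in> borel_measurable borel"
    and E: "\<And>i. E i \<in> borel_measurable borel" and ae: "\<And>i. AE x in lborel. x \<in> \<Omega> \<longrightarrow> D i x = R i x"
  shows "curl_pair \<Omega> i j D E = curl_pair \<Omega> i j R E"
proof -
  have m: "(\<lambda>x. indicator \<Omega> x * D a x * E b x) \<in> borel_measurable lborel" "(\<lambda>x. indicator \<Omega> x * R a x * E b x) \<in> borel_measurable lborel" for a b
    using D R E \<Omega> by (auto intro!: borel_measurable_times borel_measurable_indicator)
  have "(\<integral>x. (indicator \<Omega> x * D a x) * E b x \<partial>lborel) = (\<integral>x. (indicator \<Omega> x * R a x) * E b x \<partial>lborel)" for a b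
  proof (rule integral_cong_AE[OF m])
    show "AE x in lborel. indicator \<Omega> x * D a x * E b x = indicator \<Omega> x * R a x * E b x"
      using ae[of a] by eventually_elim (simp add: indicator_def)
  qed
  then show ?thesis by (simp add: curl_pair_def)
qed

text \<open>Since \<open>\<psi>\<close> vanishes near the boundary, cutting it off sharply at
  \<Omega> creates no jump. The mollifications g of the result are test functions, and integrating
  \<partial>_j \<partial>_i g = \<partial>_i \<partial>_j g by parts against \<open>\<phi>\<close>
  gives the identity for them; mollification then passes to the limit in L^2.\<close>

lemma curl_pair_compact_support:
  assumes \<Omega>: "open \<Omega>" "bounded \<Omega>" and \<psi>: "H1 \<psi> P" and \<phi>: "H1 \<phi> E"
    and V: "open V" "frontier \<Omega> \<subseteq> V" "AE x in lborel. x \<in> V \<longrightarrow> \<psi> x = 0"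
  shows "curl_pair \<Omega> i j P E = 0"
proof -
  define K where "K = closure \<Omega> - V"
  have K: "compact K" unfolding K_def using \<Omega> V by (intro compact_diff) (auto simp: compact_closure)
  have K\<Omega>: "K \<subseteq> \<Omega>" unfolding K_def using V(2) \<Omega>(1) by (auto simp: frontier_def interior_open)
  obtain d where d: "d > 0" "(\<Union>x\<in>K. ball x d) \<subseteq> \<Omega>"
    by (rule compact_subset_open_imp_ball_epsilon_subset[OF K \<Omega>(1) K\<Omega>])
  have PV: "AE x in lborel. x \<in> V \<longrightarrow> P a x = 0" for a
  proof (rule fundamental_lemma[OF H1_D(2)[OF \<psi>] V(1)])
    fix \<zeta> assume \<zeta>: "\<zeta> \<in> test_functions V"
    obtain C where C: "C \<subseteq> V" "\<And>x. x \<notin> C \<Longrightarrow> pderiv a \<zeta> x = 0" by (metis test_support[OF \<zeta>])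
    have "(\<integral>x. \<psi> x * pderiv a \<zeta> x \<partial>lborel) = (\<integral>x. 0 \<partial>(lborel :: (real^3) measure))"
    proof (rule integral_cong_AE)
      show "AE x in lborel. \<psi> x * pderiv a \<zeta> x = 0" using V(3) by eventually_elim (use C in auto)
    qed (use H1_meas(1)[OF \<psi>] smooth_borel[OF smooth_pderiv[OF test_smooth[OF \<zeta>]]] in auto)
    then show "(\<integral>x. P a x * \<zeta> x \<partial>lborel) = 0"
      using H1_D(3)[OF \<psi> test_mono[OF \<zeta>], of a] by simp
  qed
  define \<psi>1 where "\<psi>1 x = indicator \<Omega> x * \<psi> x" for x
  define P1 where "P1 a x = indicator \<Omega> x * P a x" for a x
  have \<psi>1: "\<psi>1 \<in> sq_int lborel" and P1: "P1 a \<in> sq_int lborel" for a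
    unfolding \<psi>1_def[abs_def] P1_def[abs_def] by (intro sq_int_indicator H1_D(1)[OF \<psi>] H1_D(2)[OF \<psi>] \<Omega>)+
  have z\<psi>: "AE y in lborel. y \<notin> K \<longrightarrow> \<psi>1 y = 0"
    using V(3) by eventually_elim (use closure_subset[of \<Omega>] in \<open>auto simp: \<psi>1_def K_def indicator_def\<close>)
  have zP: "AE y in lborel. y \<notin> K \<longrightarrow> P1 a y = 0" for a
    using PV[of a] by eventually_elim (use closure_subset[of \<Omega>] in \<open>auto simp: P1_def K_def indicator_def\<close>)
  have supp_pd: "pderiv a \<eta> z = 0" if "\<And>z. norm z > e \<Longrightarrow> \<eta> z = 0" "norm z > e" for a and \<eta> :: "real^3 \<Rightarrow> real" and z and e :: real
  proof (rule pderiv_locally_const[of "- cball 0 e"])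
    show "open (- cball (0::real^3) e)" by (rule open_Compl) simp
  qed (use that in auto)
  \<comment> \<open>In substance \<open>P1\<close> is the weak gradient of \<open>\<psi>1\<close>.
    If x is farther than \<open>e\<close> from \<open>K\<close>, both convolutions vanish. Otherwise
    the kernel centred at x is supported within 2e < d of a point of \<open>K\<close>, hence inside
    \<Omega>, where the indicators may be removed and the derivative of \<open>\<psi>\<close> itself
    is tested.\<close>
  have key: "pderiv a (conv \<eta> \<psi>1) = conv \<eta> (P1 a)" if \<eta>: "\<eta> \<in> test_functions UNIV" and e: "2 * e < d" "\<And>z. norm z > e \<Longrightarrow> \<eta> z = 0" for \<eta> and e :: real and a
  proof
    fix x
    have m: "\<psi>1 \<in> borel_measurable borel" "P1 a \<in> borel_measurable borel" "(\<lambda>y. \<eta> (x - y)) \<in> borel_measurable borel"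
      "(\<lambda>y. pderiv a \<eta> (x - y)) \<in> borel_measurable borel"
      using sq_int_meas[OF \<psi>1] sq_int_meas[OF P1] sq_int_meas[OF sq_int_reflect[OF test_sq_int[OF \<eta>]]]
        sq_int_meas[OF sq_int_reflect[OF test_sq_int[OF test_pderiv[OF \<eta>]]]] by auto
    have "conv (pderiv a \<eta>) \<psi>1 x = conv \<eta> (P1 a) x"
    proof (cases "\<exists>k\<in>K. norm (x - k) \<le> e")
      case False
      have "conv (pderiv a \<eta>) \<psi>1 x = (\<integral>y. 0 \<partial>(lborel :: (real^3) measure))"
        unfolding conv_def
      proof (rule integral_cong_AE)
        show "AE y in lborel. \<psi>1 y * pderiv a \<eta> (x - y) = 0"
          using z\<psi> by eventually_elim (use False supp_pd[OF e(2)] in \<open>force simp: not_le\<close>)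
      qed (use m in auto)
      moreover have "conv \<eta> (P1 a) x = (\<integral>y. 0 \<partial>(lborel :: (real^3) measure))"
        unfolding conv_def
      proof (rule integral_cong_AE)
        show "AE y in lborel. P1 a y * \<eta> (x - y) = 0"
          using zP[of a] by eventually_elim (use False e(2) in \<open>force simp: not_le\<close>)
      qed (use m in auto)
      ultimately show ?thesis by simp
    next
      case True
      then obtain k where k: "k \<in> K" "norm (x - k) \<le> e" by blast
      have out: "norm (x - y) > e" if "y \<notin> \<Omega>" for y
      proof (rule ccontr)
        assume "\<not> norm (x - y) > e"
        then have "norm (k - y) < d"
          using norm_triangle_ineq4[of "x - y" "x - k"] k(2) e(1) by simp
        then have "y \<in> ball k d" by (simp add: dist_norm)
        then show False using d(2) k(1) that by blast
      qed
      have "(\<integral>y. \<psi> y * pderiv a (\<lambda>y. \<eta> (x - y)) y \<partial>lborel) = - (\<integral>y. P a y * \<eta> (x - y) \<partial>lborel)"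
        by (rule H1_D(3)[OF \<psi> test_reflect(1)[OF \<eta>]])
      then have "(\<integral>y. \<psi> y * pderiv a \<eta> (x - y) \<partial>lborel) = (\<integral>y. P a y * \<eta> (x - y) \<partial>lborel)"
        by (simp add: test_reflect(2)[OF \<eta>])
      moreover have "\<psi> y * pderiv a \<eta> (x - y) = \<psi>1 y * pderiv a \<eta> (x - y)" for y
        using out[of y] supp_pd[OF e(2), where z="x - y" and a=a] by (cases "y \<in> \<Omega>") (auto simp: \<psi>1_def)
      moreover have "P a y * \<eta> (x - y) = P1 a y * \<eta> (x - y)" for y
        using out[of y] e(2)[of "x - y"] by (cases "y \<in> \<Omega>") (auto simp: P1_def)
      ultimately show ?thesis by (simp add: conv_def)
    qed
    then show "pderiv a (conv \<eta> \<psi>1) x = conv \<eta> (P1 a) x" by (simp add: pderiv_conv[OF \<psi>1 \<eta>])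
  qed
  obtain N where N: "1 / real (Suc N) < d / 2" by (rule nat_approx_posE[of "d / 2"]) (use d in auto)
  define Q where "Q n a = conv (mollifier n) (P1 a)" for n a
  have Qs: "Q n a \<in> sq_int lborel" for n a unfolding Q_def by (rule mollify_tendsto(1)[OF P1])
  have z: "(\<integral>x. Q n i x * E j x \<partial>lborel) - (\<integral>x. Q n j x * E i x \<partial>lborel) = 0" if n: "n \<ge> N" for n
  proof -
    define e where "e = 1 / real (Suc n)"
    have "e \<le> 1 / real (Suc N)" unfolding e_def using n by (simp add: frac_le)
    then have e: "2 * e < d" "\<And>z. norm z > e \<Longrightarrow> mollifier n z = 0" using N mollifier_zero[where n=n] by (auto simp: e_def simp del: of_nat_Suc)
    define \<eta> where "\<eta> = mollifier n"
    have \<eta>: "\<eta> \<in> test_functions UNIV" "\<And>z. norm z > e \<Longrightarrow> \<eta> z = 0" unfolding \<eta>_def by (rule mollifier_test, rule e(2))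
    define g where "g = conv \<eta> \<psi>1"
    have pg: "pderiv a g = Q n a" for a unfolding g_def Q_def \<eta>_def[symmetric] by (rule key[OF \<eta>(1) e(1) \<eta>(2)])
    \<comment> \<open>Applying \<open>key\<close> to the kernel \<open>pderiv a \<eta>\<close> as
      well as to \<open>\<eta>\<close> lets one derivative fall on the kernel and the other on
      \<open>\<psi>1\<close>, in either order.\<close>
    have sym: "pderiv b (pderiv a g) = pderiv a (pderiv b g)" for a b
    proof -
      have "pderiv b (pderiv a g) = pderiv b (conv (pderiv a \<eta>) \<psi>1)" unfolding g_def by (simp add: pderiv_conv[OF \<psi>1 \<eta>(1)])
      also have "\<dots> = conv (pderiv a \<eta>) (P1 b)"
        by (rule key[OF test_pderiv[OF \<eta>(1)] e(1) supp_pd[OF \<eta>(2)]])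
      also have "\<dots> = pderiv a (conv \<eta> (P1 b))" by (simp add: pderiv_conv[OF P1 \<eta>(1)])
      also have "\<dots> = pderiv a (pderiv b g)" by (simp add: pg Q_def \<eta>_def)
      finally show ?thesis .
    qed
    obtain R where R: "\<And>y. y \<in> \<Omega> \<Longrightarrow> norm y \<le> R" using \<Omega>(2) unfolding bounded_iff by blast
    have gt: "g \<in> test_functions UNIV"
    proof (rule test_functionsI[of _ "cball 0 (R + e)"])
      show "smooth g" unfolding g_def by (rule smooth_conv[OF \<psi>1 \<eta>(1)])
      fix x :: "real^3" assume x: "x \<notin> cball 0 (R + e)"
      have "\<psi>1 y * \<eta> (x - y) = 0" for y
      proof (cases "y \<in> \<Omega>")
        case True
        have "norm (x - y) > e" using R[OF True] x norm_triangle_ineq2[of x y] by simp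
        then show ?thesis using \<eta>(2) by simp
      qed (simp add: \<psi>1_def)
      then show "g x = 0" by (simp only: g_def conv_def) simp
    qed auto
    have "(\<integral>x. \<phi> x * pderiv b (pderiv a g) x \<partial>lborel) = - (\<integral>x. E b x * pderiv a g x \<partial>lborel)" for a b
      by (rule H1_D(3)[OF \<phi> test_pderiv[OF gt]])
    from this[of j i] this[of i j] show ?thesis
      unfolding sym[of i j] by (simp add: pg mult.commute)
  qed
  have "(\<lambda>n. (\<integral>x. Q n i x * E j x \<partial>lborel) - (\<integral>x. Q n j x * E i x \<partial>lborel)) \<longlonglongrightarrow> (\<integral>x. P1 i x * E j x \<partial>lborel) - (\<integral>x. P1 j x * E i x \<partial>lborel)"
    using mollify_tendsto(2)[OF P1] unfolding Q_def[symmetric]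
    by (intro tendsto_diff tendsto_integral_l2n Qs P1 H1_D(2)[OF \<phi>])
  moreover have "(\<lambda>n. (\<integral>x. Q n i x * E j x \<partial>lborel) - (\<integral>x. Q n j x * E i x \<partial>lborel)) \<longlonglongrightarrow> 0"
    by (rule tendsto_eventually) (use z in \<open>auto intro: eventually_sequentiallyI[of N]\<close>)
  ultimately show ?thesis
    unfolding curl_pair_def P1_def using LIMSEQ_unique by blast
qed

section \<open>Truncation profiles\<close>

lemma max_sq_deriv: "((\<lambda>s. (max 0 s)\<^sup>2) has_real_derivative 2 * max 0 s) (at (s::real))"
proof -
  consider "s > 0" | "s < 0" | "s = 0" by linarith
  then show ?thesis
  proof cases
    case 1
    have "((\<lambda>s. s\<^sup>2) has_real_derivative 2 * max 0 s) (at s)" using 1 by (auto intro!: derivative_eq_intros)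
    then show ?thesis
      by (rule DERIV_cong_ev[THEN iffD1, rotated -1])
         (use 1 in \<open>auto intro!: eventually_mono[OF eventually_nhds_in_open[of "{0<..}"]]\<close>)
  next
    case 2
    have "((\<lambda>s. 0) has_real_derivative 2 * max 0 s) (at s)" using 2 by simp
    then show ?thesis
      by (rule DERIV_cong_ev[THEN iffD1, rotated -1])
         (use 2 in \<open>auto intro!: eventually_mono[OF eventually_nhds_in_open[of "{..<0}"]]\<close>)
  next
    case 3
    have "((\<lambda>h::real. (max 0 h)\<^sup>2 / h) \<longlongrightarrow> 0) (at 0)"
    proof (rule Lim_null_comparison)
      show "\<forall>\<^sub>F h in at (0::real). norm ((max 0 h)\<^sup>2 / h) \<le> \<bar>h\<bar>"
        by (rule always_eventually) (auto simp: max_def power2_eq_square)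
      show "((\<lambda>h::real. \<bar>h\<bar>) \<longlongrightarrow> 0) (at 0)" using tendsto_rabs[OF tendsto_ident_at, of 0 UNIV] by simp
    qed
    then show ?thesis using 3 by (simp add: has_field_derivative_iff)
  qed
qed

text \<open>A continuously differentiable substitute for the positive part: the square removes the
  corner at 0, the root restores linear growth, and as \<open>e\<close> tends to 0 it converges to
  the positive part.\<close>

definition soft_pos :: "real \<Rightarrow> real \<Rightarrow> real" where
  "soft_pos e s = (max 0 s)\<^sup>2 / sqrt (s\<^sup>2 + e\<^sup>2)"

definition soft_pos' :: "real \<Rightarrow> real \<Rightarrow> real" where
  "soft_pos' e s = 2 * max 0 s / sqrt (s\<^sup>2 + e\<^sup>2) - (max 0 s)\<^sup>2 * s / sqrt (s\<^sup>2 + e\<^sup>2) ^ 3"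

lemma soft_pos_deriv:
  assumes "e > 0"
  shows "(soft_pos e has_real_derivative soft_pos' e s) (at s)"
proof -
  have p: "s\<^sup>2 + e\<^sup>2 > 0" using assms by (simp add: add_nonneg_pos)
  have "((\<lambda>s. sqrt (s\<^sup>2 + e\<^sup>2)) has_real_derivative s / sqrt (s\<^sup>2 + e\<^sup>2)) (at s)"
    using p by (auto intro!: derivative_eq_intros simp: field_simps)
  from DERIV_divide[OF max_sq_deriv this] assms
  have "((\<lambda>s. (max 0 s)\<^sup>2 / sqrt (s\<^sup>2 + e\<^sup>2)) has_real_derivative
      (2 * max 0 s * sqrt (s\<^sup>2 + e\<^sup>2) - (max 0 s)\<^sup>2 * (s / sqrt (s\<^sup>2 + e\<^sup>2))) / (sqrt (s\<^sup>2 + e\<^sup>2) * sqrt (s\<^sup>2 + e\<^sup>2))) (at s)"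
    by simp
  also have "(2 * max 0 s * sqrt (s\<^sup>2 + e\<^sup>2) - (max 0 s)\<^sup>2 * (s / sqrt (s\<^sup>2 + e\<^sup>2))) / (sqrt (s\<^sup>2 + e\<^sup>2) * sqrt (s\<^sup>2 + e\<^sup>2)) = soft_pos' e s"
  proof -
    have "(2 * m * q - m\<^sup>2 * (s / q)) / (q * q) = 2 * m / q - m\<^sup>2 * s / q ^ 3" if "q > 0" for m q :: real
      using that by (simp add: field_simps power3_eq_cube)
    from this[OF real_sqrt_gt_zero[OF p]] show ?thesis unfolding soft_pos'_def .
  qed
  finally show ?thesis by (simp add: soft_pos_def[abs_def])
qed

lemma soft_pos'_continuous: "e > 0 \<Longrightarrow> continuous_on UNIV (soft_pos' e)"
proof -
  assume e: "e > 0"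
  have "s\<^sup>2 + e\<^sup>2 \<noteq> 0" for s :: real using e by (metis add_nonneg_pos less_irrefl zero_le_power2 zero_less_power)
  then show ?thesis unfolding soft_pos'_def by (intro continuous_intros) auto
qed

lemma soft_pos'_bound:
  assumes "e > 0"
  shows "\<bar>soft_pos' e s\<bar> \<le> 3"
proof -
  define q where "q = sqrt (s\<^sup>2 + e\<^sup>2)"
  have q: "q > 0" using assms by (simp add: q_def add_nonneg_pos)
  have sq: "\<bar>s\<bar> \<le> q" unfolding q_def by (rule real_le_rsqrt) simp
  then have mq: "max 0 s \<le> q" using q by simp
  have "2 * max 0 s / q \<le> 2" using mq q by (simp add: field_simps)
  moreover have "\<bar>(max 0 s)\<^sup>2 * s / q ^ 3\<bar> \<le> 1"
  proof -
    have "(max 0 s)\<^sup>2 * \<bar>s\<bar> \<le> q\<^sup>2 * q" using mq sq by (intro mult_mono power_mono) auto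
    also have "\<dots> = q ^ 3" by (simp add: power2_eq_square power3_eq_cube)
    finally show ?thesis using q by (simp add: abs_mult)
  qed
  moreover have "0 \<le> 2 * max 0 s / q" using q by simp
  ultimately show ?thesis unfolding soft_pos'_def q_def[symmetric] by linarith
qed

definition eps :: "nat \<Rightarrow> real" where "eps n = 1 / real (Suc n)"

lemma eps: "eps n > 0" "eps \<longlonglongrightarrow> 0"
  unfolding eps_def[abs_def] using LIMSEQ_Suc[OF lim_1_over_n] by auto

text \<open>Soft thresholding: values of modulus at most \<open>eps n\<close> are sent to 0, and the
  functions converge to the identity with derivatives bounded by 6. The same \<open>eps n\<close>
  serves as threshold and as smoothing parameter. The derivatives at 0 stay 0 and hence do not
  converge to 1 there.\<close>

definition trunc0 :: "nat \<Rightarrow> real \<Rightarrow> real" where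
  "trunc0 n t = soft_pos (eps n) (t - eps n) - soft_pos (eps n) (- t - eps n)"

definition trunc0' :: "nat \<Rightarrow> real \<Rightarrow> real" where
  "trunc0' n t = soft_pos' (eps n) (t - eps n) + soft_pos' (eps n) (- t - eps n)"

lemma trunc0_deriv: "(trunc0 n has_real_derivative trunc0' n t) (at t)"
  unfolding trunc0_def[abs_def] trunc0'_def
  by (auto intro!: derivative_eq_intros DERIV_chain2[OF soft_pos_deriv[OF eps(1)]])

lemma trunc0'_continuous: "continuous_on UNIV (trunc0' n)"
  unfolding trunc0'_def by (intro continuous_intros continuous_on_compose2[OF soft_pos'_continuous[OF eps(1)]]) auto

lemma trunc0'_bound: "\<bar>trunc0' n t\<bar> \<le> 6"
  unfolding trunc0'_def using soft_pos'_bound[OF eps(1), of n "t - eps n"] soft_pos'_bound[OF eps(1), of n "- t - eps n"] by linarith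

lemma trunc0_zero: "\<bar>t\<bar> \<le> eps n \<Longrightarrow> trunc0 n t = 0"
  by (simp add: trunc0_def soft_pos_def)

lemma soft_pos_limits:
  assumes "s \<noteq> 0" and "x \<longlonglongrightarrow> s"
  shows "(\<lambda>n. soft_pos (eps n) (x n)) \<longlonglongrightarrow> max 0 s" "(\<lambda>n. soft_pos' (eps n) (x n)) \<longlonglongrightarrow> (if s > 0 then 1 else 0)"
proof -
  have "(\<lambda>n. soft_pos (eps n) (x n)) \<longlonglongrightarrow> (max 0 s)\<^sup>2 / sqrt (s\<^sup>2 + 0\<^sup>2)"
    unfolding soft_pos_def by (intro tendsto_intros tendsto_max assms eps(2)) (use assms in auto)
  also have "(max 0 s)\<^sup>2 / sqrt (s\<^sup>2 + 0\<^sup>2) = max 0 s"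
    using assms(1) by (cases "s > 0") (auto simp: power2_eq_square)
  finally show "(\<lambda>n. soft_pos (eps n) (x n)) \<longlonglongrightarrow> max 0 s" .
  have "(\<lambda>n. soft_pos' (eps n) (x n)) \<longlonglongrightarrow> 2 * max 0 s / sqrt (s\<^sup>2 + 0\<^sup>2) - (max 0 s)\<^sup>2 * s / sqrt (s\<^sup>2 + 0\<^sup>2) ^ 3"
    unfolding soft_pos'_def by (intro tendsto_intros tendsto_max assms eps(2)) (use assms in auto)
  also have "2 * max 0 s / sqrt (s\<^sup>2 + 0\<^sup>2) - (max 0 s)\<^sup>2 * s / sqrt (s\<^sup>2 + 0\<^sup>2) ^ 3 = (if s > 0 then 1 else 0)"
    using assms(1) by (auto simp: power2_eq_square power3_eq_cube)
  finally show "(\<lambda>n. soft_pos' (eps n) (x n)) \<longlonglongrightarrow> (if s > 0 then 1 else 0)" .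
qed

lemma trunc0_limits: "(\<lambda>n. trunc0 n t) \<longlonglongrightarrow> t" "(\<lambda>n. trunc0' n t) \<longlonglongrightarrow> (if t = 0 then 0 else 1)"
proof -
  have l: "(\<lambda>n. t - eps n) \<longlonglongrightarrow> t" "(\<lambda>n. - t - eps n) \<longlonglongrightarrow> - t"
    using tendsto_diff[OF tendsto_const eps(2), of t] tendsto_diff[OF tendsto_const eps(2), of "- t"] by auto
  have "(\<lambda>n. trunc0 n t) \<longlonglongrightarrow> t \<and> (\<lambda>n. trunc0' n t) \<longlonglongrightarrow> (if t = 0 then 0 else 1)"
  proof (cases "t = 0")
    case True
    then show ?thesis using less_imp_le[OF eps(1)] by (simp add: trunc0_def trunc0'_def soft_pos_def soft_pos'_def)
  next
    case False
    have "(\<lambda>n. trunc0 n t) \<longlonglongrightarrow> max 0 t - max 0 (- t)"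
      unfolding trunc0_def using False by (intro tendsto_diff soft_pos_limits(1) l) auto
    moreover have "(\<lambda>n. trunc0' n t) \<longlonglongrightarrow> (if t > 0 then 1 else 0) + (if - t > 0 then 1 else 0)"
      unfolding trunc0'_def using False by (intro tendsto_add soft_pos_limits(2) l) auto
    moreover have "max 0 t - max 0 (- t) = t" "(if t > 0 then 1 else 0) + (if - t > 0 then 1 else 0) = (1 :: real)" using False by auto
    ultimately show ?thesis using False by simp
  qed
  then show "(\<lambda>n. trunc0 n t) \<longlonglongrightarrow> t" "(\<lambda>n. trunc0' n t) \<longlonglongrightarrow> (if t = 0 then 0 else 1)" by auto
qed

text \<open>A bounded approximation of the identity with derivative at most 1 in modulus.
  Boundedness is what the product rule \<open>H1_mult_bounded\<close> asks for.\<close>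

definition trunc1 :: "nat \<Rightarrow> real \<Rightarrow> real" where
  "trunc1 n t = t / (1 + eps n * t\<^sup>2)"

definition trunc1' :: "nat \<Rightarrow> real \<Rightarrow> real" where
  "trunc1' n t = (1 - eps n * t\<^sup>2) / (1 + eps n * t\<^sup>2)\<^sup>2"

lemma trunc1_base: "1 + eps n * t\<^sup>2 \<ge> 1" "1 + eps n * t\<^sup>2 \<noteq> 0"
proof -
  show "1 + eps n * t\<^sup>2 \<ge> 1" using eps(1)[of n] by simp
  then show "1 + eps n * t\<^sup>2 \<noteq> 0" by linarith
qed

lemma trunc1_deriv: "(trunc1 n has_real_derivative trunc1' n t) (at t)"
  unfolding trunc1_def[abs_def] trunc1'_def using trunc1_base[of n t]
  by (auto intro!: derivative_eq_intros simp: power2_eq_square algebra_simps)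

lemma trunc1'_continuous: "continuous_on UNIV (trunc1' n)"
  unfolding trunc1'_def by (intro continuous_intros) (use trunc1_base in auto)

lemma trunc1'_bound: "\<bar>trunc1' n t\<bar> \<le> 1"
proof -
  define a where "a = eps n * t\<^sup>2"
  have a: "a \<ge> 0" using eps(1)[of n] by (simp add: a_def)
  have "\<bar>1 - a\<bar> \<le> (1 + a)\<^sup>2" using a by (simp add: abs_le_iff power2_eq_square algebra_simps)
  then show ?thesis using a by (simp add: trunc1'_def a_def[symmetric])
qed

lemma trunc1_bound: "\<bar>trunc1 n t\<bar> \<le> real (Suc n)"
proof -
  have p: "1 + eps n * t\<^sup>2 > 0" using trunc1_base[of n t] by linarith
  have "\<bar>t\<bar> \<le> 1 + t\<^sup>2"
  proof -
    have "0 \<le> (\<bar>t\<bar> - 1)\<^sup>2" by simp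
    then have "2 * \<bar>t\<bar> \<le> 1 + t\<^sup>2" by (simp add: power2_diff)
    then show ?thesis by simp
  qed
  also have "\<dots> \<le> real (Suc n) * (1 + eps n * t\<^sup>2)" by (simp add: eps_def distrib_left)
  finally show ?thesis using p by (simp add: trunc1_def abs_mult pos_divide_le_eq mult.commute)
qed

lemma trunc1_limits: "(\<lambda>n. trunc1 n t) \<longlonglongrightarrow> t" "(\<lambda>n. trunc1' n t) \<longlonglongrightarrow> 1"
proof -
  have "(\<lambda>n. trunc1 n t) \<longlonglongrightarrow> t / (1 + 0 * t\<^sup>2)"
    unfolding trunc1_def by (intro tendsto_intros eps(2)) auto
  then show "(\<lambda>n. trunc1 n t) \<longlonglongrightarrow> t" by simp
  have "(\<lambda>n. trunc1' n t) \<longlonglongrightarrow> (1 - 0 * t\<^sup>2) / (1 + 0 * t\<^sup>2)\<^sup>2"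
    unfolding trunc1'_def by (intro tendsto_intros eps(2)) auto
  then show "(\<lambda>n. trunc1' n t) \<longlonglongrightarrow> 1" by simp
qed

text \<open>Rises from 0 at t = 0 to the constant 1 for t \<ge> 1, with bounded derivative. By the
  chain rule, \<open>sat\<close> of a function small in H^1 is small in H^1.\<close>

definition sat :: "real \<Rightarrow> real" where "sat t = 1 - (max 0 (1 - t\<^sup>2))\<^sup>2"

definition sat' :: "real \<Rightarrow> real" where "sat' t = 4 * t * max 0 (1 - t\<^sup>2)"

lemma sat_deriv: "(sat has_real_derivative sat' t) (at t)"
proof -
  have "((\<lambda>t. 1 - t\<^sup>2) has_real_derivative - 2 * t) (at t)" by (auto intro!: derivative_eq_intros)
  from DERIV_chain2[OF max_sq_deriv this]
  have "((\<lambda>t. (max 0 (1 - t\<^sup>2))\<^sup>2) has_real_derivative 2 * max 0 (1 - t\<^sup>2) * (- 2 * t)) (at t)" .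
  from DERIV_diff[OF DERIV_const this, of 1] show ?thesis
    by (simp add: sat_def[abs_def] sat'_def mult_ac)
qed

lemma sat'_continuous: "continuous_on UNIV sat'"
  unfolding sat'_def by (intro continuous_intros)

lemma sat'_bound: "\<bar>sat' t\<bar> \<le> 4"
proof (cases "\<bar>t\<bar> \<le> 1")
  case True
  then have "\<bar>t\<bar> * \<bar>max 0 (1 - t\<^sup>2)\<bar> \<le> 1 * 1"
    by (intro mult_mono) (auto simp: abs_square_le_1)
  then show ?thesis by (simp add: sat'_def abs_mult)
next
  case False
  then have "1 - t\<^sup>2 \<le> 0" by (simp add: abs_square_le_1[symmetric] not_le)
  then show ?thesis by (simp add: sat'_def)
qed

lemma sat_bounds: "0 \<le> sat t" "sat t \<le> 1"
proof -
  have "(max 0 (1 - t\<^sup>2))\<^sup>2 \<le> 1\<^sup>2" by (rule power_mono) auto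
  then show "0 \<le> sat t" by (simp add: sat_def)
qed (simp add: sat_def)

lemma sat_one: "t \<ge> 1 \<Longrightarrow> sat t = 1"
proof -
  assume "t \<ge> 1"
  then have "t\<^sup>2 \<ge> 1" by (simp add: one_le_power)
  then show ?thesis by (simp add: sat_def)
qed

lemma sat_zero: "sat 0 = 0" by (simp add: sat_def)

section \<open>Vanishing of the form for zero trace\<close>

lemma compact_AE_cover:
  fixes S :: "'a::euclidean_space set"
  assumes S: "compact S" and loc: "\<And>x. x \<in> S \<Longrightarrow> \<exists>V. open V \<and> x \<in> V \<and> (AE y in M. y \<in> V \<longrightarrow> Z y)"
  obtains V where "open V" "S \<subseteq> V" "AE y in M. y \<in> V \<longrightarrow> Z y"
proof -
  define C where "C = {V. open V \<and> (AE y in M. y \<in> V \<longrightarrow> Z y)}"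
  have "S \<subseteq> \<Union>C" using loc unfolding C_def by blast
  \<comment> \<open>Finiteness of the subcover is what allows the exceptional null sets of the
    pieces to be united.\<close>
  then obtain D where D: "D \<subseteq> C" "finite D" "S \<subseteq> \<Union>D" using compactE[OF S, of C] unfolding C_def by blast
  have "AE y in M. \<forall>V\<in>D. y \<in> V \<longrightarrow> Z y" using D(1,2) by (intro AE_finite_allI) (auto simp: C_def)
  then have "AE y in M. y \<in> \<Union>D \<longrightarrow> Z y" by eventually_elim blast
  moreover have "open (\<Union>D)" using D(1) unfolding C_def by blast
  ultimately show ?thesis using D(3) that by blast
qed

text \<open>Multiplying \<open>f\<close> by \<open>1 - sat g\<close>, with \<open>g\<close> small in \<open>H\<^sup>1\<close> but at least \<open>1\<close> near the exceptional part of the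
  boundary, yields functions vanishing near \<open>\<partial>\<Omega>\<close>.\<close>

lemma curl_pair_cutoff:
  assumes \<Omega>: "open \<Omega>" "bounded \<Omega>"
    and dens: "c > 0" "\<rho> > 0" "\<rho> \<le> 1" "\<And>x r. x \<in> frontier \<Omega> \<Longrightarrow> 0 < r \<Longrightarrow> r \<le> \<rho> \<Longrightarrow> c * r ^ 3 \<le> measure lebesgue (\<Omega> \<inter> ball x r)"
    and w: "H1 w D" and null: "null_cap {x \<in> frontier \<Omega>. Tr \<Omega> w x \<noteq> 0}" and \<phi>: "H1 \<phi> E"
    and f: "H1 f F" "\<And>x. \<bar>f x\<bar> \<le> M" and \<epsilon>: "\<epsilon> > 0" "AE x in lborel. \<bar>w x\<bar> \<le> \<epsilon> \<longrightarrow> f x = 0"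
  shows "curl_pair \<Omega> i j F E = 0"
proof -
  obtain v h B G K where K: "K > 0" and v: "\<And>n. smooth (v n)" "\<And>n. v n \<in> sq_int lborel"
    and h: "\<And>N. H1 (h N) (B N)" "\<And>N. h1n (h N) (B N) \<le> (1/2) ^ N" and G: "\<And>N. open (G N)"
    and h0: "\<And>N. AE x in lborel. h N x \<ge> 0" and hG: "\<And>N. AE x in lborel. x \<in> G N \<longrightarrow> h N x \<ge> 1"
    and pw: "\<And>N. AE x in lborel. h N x < 1 \<longrightarrow> (\<forall>n\<ge>N. \<bar>w x - v n x\<bar> \<le> K * (1/2) ^ n)"
    and av: "\<And>N n x r. x \<notin> G N \<Longrightarrow> N \<le> n \<Longrightarrow> 0 < r \<Longrightarrow> r \<le> 1 \<Longrightarrow>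
       (\<integral>y. \<bar>v n y - w y\<bar> * indicator (ball x r) y \<partial>lborel) \<le> K * (1/2) ^ n * r ^ 3"
    by (rule capacitary_approximation[OF w]) blast
  define A where "A = {x \<in> frontier \<Omega>. Tr \<Omega> w x \<noteq> 0}"
  define Q where "Q N p \<longleftrightarrow> H1 (fst p) (fst (snd p)) \<and> h1n (fst p) (fst (snd p)) < (1/2) ^ N \<and> open (snd (snd p)) \<and> A \<subseteq> snd (snd p) \<and>
     (AE x in lborel. x \<in> snd (snd p) \<longrightarrow> fst p x \<ge> 1)" for N p
  have "\<exists>p. Q N p" for N
  proof -
    obtain h' B' U where "H1 h' B'" "h1n h' B' < (1/2) ^ N" "open U" "A \<subseteq> U" "AE x in lborel. x \<in> U \<longrightarrow> h' x \<ge> 1"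
      using null[unfolded null_cap_def, rule_format, of "(1/2) ^ N"] unfolding A_def by auto
    then show ?thesis by (intro exI[of _ "(h', B', U)"]) (simp add: Q_def)
  qed
  then have "\<forall>N. \<exists>p. Q N p" by blast
  then obtain p where p: "\<forall>N. Q N (p N)" by (rule choice[THEN exE])
  define h' B' U where "h' N = fst (p N)" and "B' N = fst (snd (p N))" and "U N = snd (snd (p N))" for N
  have h': "H1 (h' N) (B' N)" "h1n (h' N) (B' N) < (1/2) ^ N" and U: "open (U N)" "A \<subseteq> U N" "AE x in lborel. x \<in> U N \<longrightarrow> h' N x \<ge> 1" for N
    using p unfolding Q_def h'_def B'_def U_def by auto
  \<comment> \<open>\<open>h N\<close> is at least 1 where the smooth approximation fails to be
    uniform, \<open>h' N\<close> where the trace fails to be 0. Their sum is still of size 2^(-N) in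
    H^1.\<close>
  define g HH where "g N x = h N x + \<bar>h' N x\<bar>" and "HH N i x = B N i x + sgn (h' N x) * B' N i x" for N i x
  have gH: "H1 (g N) (HH N)" for N unfolding g_def[abs_def] HH_def[abs_def] by (rule H1_add[OF h(1) H1_abs(1)[OF h'(1)]])
  have gn: "h1n (g N) (HH N) \<le> 2 * (1/2) ^ N" for N
  proof -
    have "h1n (g N) (HH N) \<le> h1n (h N) (B N) + h1n (\<lambda>x. \<bar>h' N x\<bar>) (\<lambda>i x. sgn (h' N x) * B' N i x)"
      unfolding g_def[abs_def] HH_def[abs_def] by (rule h1n_add[OF h(1) H1_abs(1)[OF h'(1)]])
    then show ?thesis using H1_abs(2)[OF h'(1)[of N]] h(2)[of N] h'(2)[of N] by linarith
  qed
  define T where "T N i x = f x * (sat' (g N x) * HH N i x)" for N i x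
  have sH: "H1 (\<lambda>x. sat (g N x)) (\<lambda>i x. sat' (g N x) * HH N i x)" for N
    by (rule H1_chain[OF gH sat_deriv sat'_continuous sat'_bound sat_zero])
  have sb: "\<bar>sat t\<bar> \<le> 1" for t using sat_bounds[of t] by simp
  have pH: "H1 (\<lambda>x. f x * sat (g N x)) (\<lambda>i x. F i x * sat (g N x) + T N i x)" for N
    unfolding T_def by (rule H1_mult_bounded[OF f(1) sH f(2) sb])
  define R where "R N i x = F i x - (F i x * sat (g N x) + T N i x)" for N i x
  have RH: "H1 (\<lambda>x. f x - f x * sat (g N x)) (R N)" for N unfolding R_def[abs_def] by (rule H1_diff[OF f(1) pH])
  have zero: "curl_pair \<Omega> i j (R N) E = 0" for N
  proof -
    have "\<exists>V. open V \<and> x \<in> V \<and> (AE y in lborel. y \<in> V \<longrightarrow> f y - f y * sat (g N y) = 0)" if x: "x \<in> frontier \<Omega>" for x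
    proof -
      consider "x \<in> G N" | "x \<in> U N" | "x \<notin> G N" "x \<notin> U N" by blast
      then show ?thesis
      proof cases
        case 1
        have "AE y in lborel. y \<in> G N \<longrightarrow> f y - f y * sat (g N y) = 0"
          using hG[of N] by eventually_elim (auto simp: g_def intro!: sat_one)
        then show ?thesis using 1 G by blast
      next
        case 2
        have "AE y in lborel. y \<in> U N \<longrightarrow> f y - f y * sat (g N y) = 0"
          using h0[of N] U(3)[of N] by eventually_elim (auto simp: g_def intro!: sat_one)
        then show ?thesis using 2 U by blast
      next
        case 3
        obtain L where L: "(ball_average \<Omega> w x \<longlongrightarrow> L) (at_right 0)" "\<And>n. N \<le> n \<Longrightarrow> \<bar>L - v n x\<bar> \<le> K / c * (1/2) ^ n"
        proof (rule trace_limit[OF H1_D(1)[OF w] v \<Omega>(1) dens(1-3) dens(4)[OF x] K av[OF 3(1)]])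
          fix L assume "(ball_average \<Omega> w x \<longlongrightarrow> L) (at_right 0)" "\<And>n. N \<le> n \<Longrightarrow> \<bar>L - v n x\<bar> \<le> K / c * (1/2) ^ n"
          then show thesis by (rule that)
        qed
        have "Tr \<Omega> w x = 0" using 3(2) U(2)[of N] x unfolding A_def by blast
        then have L0: "L = 0" using Tr_eqI[OF L(1)] by simp
        have "(\<lambda>n. (K / c + K) * (1/2) ^ n) \<longlonglongrightarrow> 0"
          using tendsto_mult_right_zero[OF LIMSEQ_power_zero[of "1/2 :: real"]] by simp
        from order_tendstoD(2)[OF this \<epsilon>(1)] obtain n0 where n0: "\<And>n. n \<ge> n0 \<Longrightarrow> (K / c + K) * (1/2) ^ n < \<epsilon>"
          unfolding eventually_sequentially by blast
        define n where "n = max N n0"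
        have n: "N \<le> n" "K / c * (1/2) ^ n + K * (1/2) ^ n < \<epsilon>" using n0[of n] by (auto simp: n_def distrib_right)
        \<comment> \<open>At this point the averages of \<open>w\<close> converge to the trace 0, so
          |v_n(x)| \<le> (K/c) 2^(-n), and the choice of \<open>n\<close> puts \<open>x\<close> into
          this set. On it, wherever \<open>h N\<close> is below 1, \<open>w\<close> differs from v_n
          by at most K 2^(-n), so |w| \<le> \<epsilon> and \<open>f\<close> vanishes; where
          \<open>h N\<close> is at least 1, the factor 1 - sat(g) vanishes.\<close>
        define V where "V = {y. \<bar>v n y\<bar> < \<epsilon> - K * (1/2) ^ n}"
        have "open V" unfolding V_def
          by (intro open_Collect_less continuous_intros smooth_continuous v)
        moreover have "x \<in> V" using L(2)[OF n(1)] L0 n(2) by (simp add: V_def)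
        moreover have "AE y in lborel. y \<in> V \<longrightarrow> f y - f y * sat (g N y) = 0"
          using pw[of N] \<epsilon>(2)
        proof (eventually_elim, intro impI)
          fix y assume a: "h N y < 1 \<longrightarrow> (\<forall>n\<ge>N. \<bar>w y - v n y\<bar> \<le> K * (1/2) ^ n)" "\<bar>w y\<bar> \<le> \<epsilon> \<longrightarrow> f y = 0" and y: "y \<in> V"
          show "f y - f y * sat (g N y) = 0"
          proof (cases "h N y < 1")
            case True
            then have "\<bar>w y - v n y\<bar> \<le> K * (1/2) ^ n" using a(1) n(1) by blast
            then have "\<bar>w y\<bar> \<le> \<epsilon>" using y by (simp add: V_def)
            then show ?thesis using a(2) by simp
          next
            case False
            then show ?thesis by (simp add: g_def sat_one)
          qed
        qed
        ultimately show ?thesis by blast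
      qed
    qed
    with compact_frontier_bounded[OF \<Omega>(2)]
    obtain V where V: "open V" "frontier \<Omega> \<subseteq> V" "AE y in lborel. y \<in> V \<longrightarrow> f y - f y * sat (g N y) = 0"
      by (rule compact_AE_cover)
    show ?thesis by (rule curl_pair_compact_support[OF \<Omega> RH \<phi> V])
  qed
  have pow0: "(\<lambda>N. a * (1/2) ^ N) \<longlonglongrightarrow> 0" for a :: real
    using tendsto_mult_right_zero[OF LIMSEQ_power_zero[of "1/2 :: real"]] by simp
  have gm: "g N \<in> borel_measurable borel" for N by (rule H1_meas(1)[OF gH])
  \<comment> \<open>\<open>T\<close> is \<open>f\<close> times the gradient of the cutoff.
    Boundedness of \<open>f\<close> turns the smallness of \<open>g\<close> in H^1 into smallness of
    \<open>T\<close>: the 4 comes from \<open>sat'_bound\<close>, the 2 from the norm of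
    \<open>g\<close>.\<close>
  have Tb: "T N a \<in> sq_int lborel" "l2n lborel (T N a) \<le> M * 4 * 2 * (1/2) ^ N" for N a
  proof -
    have M0: "M \<ge> 0" using f(2)[of 0] by linarith
    have b: "\<bar>f x * sat' (g N x)\<bar> \<le> M * 4" for x
      unfolding abs_mult by (intro mult_mono f(2) sat'_bound) (use M0 in auto)
    have m: "(\<lambda>x. f x * sat' (g N x)) \<in> borel_measurable lborel"
      using H1_meas(1)[OF f(1)] borel_measurable_continuous_on[OF sat'_continuous gm[of N]] by simp
    have e: "T N a = (\<lambda>x. f x * sat' (g N x) * HH N a x)" by (simp add: T_def fun_eq_iff mult.assoc)
    show "T N a \<in> sq_int lborel" unfolding e by (rule sq_int_bounded_mult[OF H1_D(2)[OF gH] m b])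
    have "l2n lborel (T N a) \<le> l2n lborel (\<lambda>x. M * 4 * HH N a x)"
    proof (rule l2n_mono[OF sq_int_cmult[OF H1_D(2)[OF gH]] AE_I2])
      fix x show "\<bar>T N a x\<bar> \<le> \<bar>M * 4 * HH N a x\<bar>"
        unfolding e abs_mult[of _ "HH N a x"] using b[of x] M0 by (intro mult_right_mono) auto
    qed
    also have "\<dots> = M * 4 * l2n lborel (HH N a)" using M0 by (simp add: l2n_cmult)
    also have "\<dots> \<le> M * 4 * (2 * (1/2) ^ N)"
      using l2n_le_h1n(2)[of "HH N" a "g N"] gn[of N] M0 by (intro mult_left_mono) auto
    finally show "l2n lborel (T N a) \<le> M * 4 * 2 * (1/2) ^ N" by simp
  qed
  have gl: "AE x in lborel. (\<lambda>N. g N x) \<longlonglongrightarrow> 0"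
  proof (rule l2n_summable_AE_tendsto[OF H1_D(1)[OF gH]])
    have "summable (\<lambda>N. 2 * (1/2) ^ N :: real)" by (intro summable_mult summable_geometric) simp
    moreover have "norm (l2n lborel (g N)) \<le> 2 * (1/2) ^ N" for N
      using l2n_le_h1n(1)[of "g N" "HH N"] gn[of N] l2n_nonneg[of lborel "g N"] by simp
    ultimately show "summable (\<lambda>N. l2n lborel (g N))" by (rule summable_comparison_test')
  qed
  have Fs: "(\<lambda>x. F a x * sat (g N x)) \<in> sq_int lborel" for N a
  proof -
    have "(\<lambda>x. sat (g N x)) \<in> borel_measurable lborel" using H1_meas(1)[OF sH[of N]] by simp
    from sq_int_bounded_mult[OF H1_D(2)[OF f(1)] this sb] show ?thesis by (simp add: mult.commute)
  qed
  have lim: "(\<lambda>N. l2n lborel (\<lambda>x. R N a x - F a x)) \<longlonglongrightarrow> 0" for a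
  proof (rule tendsto_sandwich[OF _ _ tendsto_const])
    have eq: "(\<lambda>x. R N a x - F a x) = (\<lambda>x. - 1 * (F a x * sat (g N x) + T N a x))" for N by (simp add: R_def fun_eq_iff)
    have "l2n lborel (\<lambda>x. R N a x - F a x) \<le> l2n lborel (\<lambda>x. F a x * sat (g N x)) + M * 4 * 2 * (1/2) ^ N" for N
      unfolding eq l2n_cmult using l2n_triangle[OF Fs Tb(1), of a N N a] Tb(2)[of N a] by simp
    then show "\<forall>\<^sub>F N in sequentially. l2n lborel (\<lambda>x. R N a x - F a x) \<le> l2n lborel (\<lambda>x. F a x * sat (g N x)) + M * 4 * 2 * (1/2) ^ N"
      by (rule always_eventually[OF allI])
    have "(\<lambda>N. l2n lborel (\<lambda>x. F a x * sat (g N x))) \<longlonglongrightarrow> 0"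
    proof (rule l2n_dominated[OF sq_int_meas[OF Fs] sq_int_abs[OF H1_D(2)[OF f(1)]]])
      show "\<bar>F a x * sat (g N x)\<bar> \<le> \<bar>F a x\<bar>" for N x
        using mult_left_mono[OF sb[of "g N x"], of "\<bar>F a x\<bar>"] by (simp add: abs_mult)
      show "AE x in lborel. (\<lambda>N. F a x * sat (g N x)) \<longlonglongrightarrow> 0"
        using gl
      proof eventually_elim
        fix x assume "(\<lambda>N. g N x) \<longlonglongrightarrow> 0"
        then have "(\<lambda>N. sat (g N x)) \<longlonglongrightarrow> sat 0" by (rule isCont_tendsto_compose[OF DERIV_isCont[OF sat_deriv]])
        from tendsto_mult_left[OF this] show "(\<lambda>N. F a x * sat (g N x)) \<longlonglongrightarrow> 0" by (simp add: sat_zero)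
      qed
    qed
    from tendsto_add[OF this pow0] show "(\<lambda>N. l2n lborel (\<lambda>x. F a x * sat (g N x)) + M * 4 * 2 * (1/2) ^ N) \<longlonglongrightarrow> 0" by simp
  qed (auto simp: l2n_nonneg)
  have "(\<lambda>N. curl_pair \<Omega> i j (R N) E) \<longlonglongrightarrow> curl_pair \<Omega> i j F E"
    by (rule curl_pair_tendsto[OF \<Omega>(1) H1_D(2)[OF RH] H1_D(2)[OF f(1)] H1_D(2)[OF \<phi>] lim])
  then show ?thesis unfolding zero using LIMSEQ_unique[OF tendsto_const] by fastforce
qed

text \<open>Two truncations bring \<open>w\<close> within reach of \<open>curl_pair_cutoff\<close>:
  \<open>trunc0 k\<close> makes the function vanish where |w| is small, \<open>trunc1 l\<close>
  makes it bounded. The limits are taken first in \<open>l\<close>, then in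
  \<open>k\<close>.\<close>

lemma curl_pair_zero_trace:
  assumes \<Omega>: "open \<Omega>" "bounded \<Omega>"
    and dens: "c > 0" "\<rho> > 0" "\<rho> \<le> 1" "\<And>x r. x \<in> frontier \<Omega> \<Longrightarrow> 0 < r \<Longrightarrow> r \<le> \<rho> \<Longrightarrow> c * r ^ 3 \<le> measure lebesgue (\<Omega> \<inter> ball x r)"
    and w: "H1 w D" and null: "null_cap {x \<in> frontier \<Omega>. Tr \<Omega> w x \<noteq> 0}" and \<phi>: "H1 \<phi> E"
  shows "curl_pair \<Omega> i j D E = 0"
proof -
  have t00: "trunc0 k 0 = 0" for k by (rule trunc0_zero) (simp add: less_imp_le[OF eps(1)])
  have t10: "trunc1 l 0 = 0" for l by (simp add: trunc1_def)
  have f: "H1 (\<lambda>x. trunc0 k (w x)) (\<lambda>i x. trunc0' k (w x) * D i x)" for k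
    by (rule H1_chain[OF w trunc0_deriv trunc0'_continuous trunc0'_bound t00])
  have ff: "H1 (\<lambda>x. trunc1 l (trunc0 k (w x))) (\<lambda>i x. trunc1' l (trunc0 k (w x)) * (trunc0' k (w x) * D i x))" for k l
    by (rule H1_chain[OF f trunc1_deriv trunc1'_continuous trunc1'_bound t10])
  have z: "curl_pair \<Omega> i j (\<lambda>i x. trunc1' l (trunc0 k (w x)) * (trunc0' k (w x) * D i x)) E = 0" for k l
    by (rule curl_pair_cutoff[OF \<Omega> dens w null \<phi> ff trunc1_bound eps(1)[of k]]) (auto simp: trunc0_zero t10)
  have z: "curl_pair \<Omega> i j (\<lambda>i x. trunc0' k (w x) * D i x) E = 0" for k
  proof -
    have "(\<lambda>l. l2n lborel (\<lambda>x. trunc1' l (trunc0 k (w x)) * (trunc0' k (w x) * D a x) - trunc0' k (w x) * D a x)) \<longlonglongrightarrow> 0" for a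
      using H1_chain_limit(3)[OF f trunc1_deriv trunc1'_continuous trunc1'_bound t10 trunc1_limits] by simp
    then have "(\<lambda>l. curl_pair \<Omega> i j (\<lambda>i x. trunc1' l (trunc0 k (w x)) * (trunc0' k (w x) * D i x)) E) \<longlonglongrightarrow>
        curl_pair \<Omega> i j (\<lambda>i x. trunc0' k (w x) * D i x) E"
      by (rule curl_pair_tendsto[OF \<Omega>(1) H1_D(2)[OF ff] H1_D(2)[OF f] H1_D(2)[OF \<phi>]])
    then show ?thesis unfolding z using LIMSEQ_unique[OF tendsto_const] by fastforce
  qed
  note lim = H1_chain_limit[OF w trunc0_deriv trunc0'_continuous trunc0'_bound t00 trunc0_limits]
  have "(\<lambda>k. curl_pair \<Omega> i j (\<lambda>i x. trunc0' k (w x) * D i x) E) \<longlonglongrightarrow>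
      curl_pair \<Omega> i j (\<lambda>i x. (if w x = 0 then 0 else 1) * D i x) E"
    by (rule curl_pair_tendsto[OF \<Omega>(1) H1_D(2)[OF f] H1_D(2)[OF lim(1)] H1_D(2)[OF \<phi>] lim(3)])
  then have "curl_pair \<Omega> i j (\<lambda>i x. (if w x = 0 then 0 else 1) * D i x) E = 0" unfolding z using LIMSEQ_unique[OF tendsto_const] by fastforce
  \<comment> \<open>The limit of the truncated gradients is \<open>D\<close> with its values on the
    zero set of \<open>w\<close> replaced by 0. Both are weak gradients of \<open>w\<close>, so
    uniqueness shows that \<open>D\<close> vanishes almost everywhere on that set.\<close>
  moreover have "curl_pair \<Omega> i j (\<lambda>i x. (if w x = 0 then 0 else 1) * D i x) E = curl_pair \<Omega> i j D E"
  proof (rule curl_pair_cong_AE[OF \<Omega>(1) H1_meas(2)[OF lim(1)] H1_meas(2)[OF w] H1_meas(2)[OF \<phi>]])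
    show "AE x in lborel. x \<in> \<Omega> \<longrightarrow> (if w x = 0 then 0 else 1) * D a x = D a x" for a
      using H1_unique[OF lim(1) w, of a] by eventually_elim simp
  qed
  ultimately show ?thesis by simp
qed

text \<open>The averages of the extension converge at every boundary point outside some
  \<open>G N\<close>; the exceptional set is the intersection of all \<open>G N\<close>, whose
  capacity is 0.\<close>

lemma trace_exists:
  assumes ext: "extension_domain 1 \<Omega>" "extension_domain 2 \<Omega>" and u: "u \<in> sobolev 1 \<Omega>"
  obtains N where "null_cap N" "\<And>x. x \<in> frontier \<Omega> \<Longrightarrow> x \<notin> N \<Longrightarrow> (ball_average \<Omega> u x \<longlongrightarrow> Tr \<Omega> u x) (at_right 0)"
proof -
  have \<Omega>: "open \<Omega>" using ext(1) by (simp add: extension_domain_def)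
  obtain c \<rho> where dens: "c > 0" "\<rho> > 0" "\<rho> \<le> 1" "\<And>x r. x \<in> frontier \<Omega> \<Longrightarrow> 0 < r \<Longrightarrow> r \<le> \<rho> \<Longrightarrow> c * r ^ 3 \<le> measure lebesgue (\<Omega> \<inter> ball x r)"
    by (rule measure_density[OF ext(2)]) blast
  obtain w D where w: "H1 w D" "AE x in lebesgue_on \<Omega>. u x = w x" by (rule extension_H1[OF ext(1) u]) blast
  obtain v h B G K where K: "K > 0" and v: "\<And>n. smooth (v n)" "\<And>n. v n \<in> sq_int lborel"
    and h: "\<And>N. H1 (h N) (B N)" "\<And>N. h1n (h N) (B N) \<le> (1/2) ^ N" "\<And>N. open (G N)" "\<And>N. AE x in lborel. x \<in> G N \<longrightarrow> h N x \<ge> 1"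
    and av: "\<And>N n x r. x \<notin> G N \<Longrightarrow> N \<le> n \<Longrightarrow> 0 < r \<Longrightarrow> r \<le> 1 \<Longrightarrow>
       (\<integral>y. \<bar>v n y - w y\<bar> * indicator (ball x r) y \<partial>lborel) \<le> K * (1/2) ^ n * r ^ 3"
    by (rule capacitary_approximation[OF w(1)]) blast
  show ?thesis
  proof (rule that[OF null_cap_Inter[OF h]])
    fix x assume x: "x \<in> frontier \<Omega>" "x \<notin> (\<Inter>N. G N)"
    then obtain N where N: "x \<notin> G N" by blast
    obtain L where L: "(ball_average \<Omega> w x \<longlongrightarrow> L) (at_right 0)"
      by (rule trace_limit[OF H1_D(1)[OF w(1)] v \<Omega> dens(1-3) dens(4)[OF x(1)] K av[OF N]]) blast
    have "ball_average \<Omega> u x = ball_average \<Omega> w x"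
      by (rule HOL.ext, rule ball_average_cong[OF sobolev_sq_int[OF u] H1_D(1)[OF w(1)] \<Omega> w(2)])
    then show "(ball_average \<Omega> u x \<longlongrightarrow> Tr \<Omega> u x) (at_right 0)" using L Tr_eqI[of \<Omega> u x L] by simp
  qed
qed

text \<open>\<open>Tr\<close> is defined through \<open>Lim\<close>, whose value means nothing where
  the averages diverge. Linearity is therefore read off where both limits exist, which is
  quasi-everywhere.\<close>

lemma Tr_lincomb:
  assumes ext: "extension_domain 1 \<Omega>" "extension_domain 2 \<Omega>" and u: "u \<in> sobolev 1 \<Omega>" and v: "v \<in> sobolev 1 \<Omega>"
  shows "qe_eq \<Omega> (Tr \<Omega> (\<lambda>x. a * u x + b * v x)) (\<lambda>x. a * Tr \<Omega> u x + b * Tr \<Omega> v x)"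
proof -
  have \<Omega>: "open \<Omega>" using ext(1) by (simp add: extension_domain_def)
  obtain N1 where N1: "null_cap N1" "\<And>x. x \<in> frontier \<Omega> \<Longrightarrow> x \<notin> N1 \<Longrightarrow> (ball_average \<Omega> u x \<longlongrightarrow> Tr \<Omega> u x) (at_right 0)"
    by (rule trace_exists[OF ext u]) blast
  obtain N2 where N2: "null_cap N2" "\<And>x. x \<in> frontier \<Omega> \<Longrightarrow> x \<notin> N2 \<Longrightarrow> (ball_average \<Omega> v x \<longlongrightarrow> Tr \<Omega> v x) (at_right 0)"
    by (rule trace_exists[OF ext v]) blast
  obtain u' where u': "u' \<in> sq_int lborel" "AE x in lebesgue_on \<Omega>. u x = u' x" by (rule borel_representative[OF sobolev_sq_int[OF u] \<Omega>]) blast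
  obtain v' where v': "v' \<in> sq_int lborel" "AE x in lebesgue_on \<Omega>. v x = v' x" by (rule borel_representative[OF sobolev_sq_int[OF v] \<Omega>]) blast
  have lin: "ball_average \<Omega> (\<lambda>x. a * u x + b * v x) x r = a * ball_average \<Omega> u x r + b * ball_average \<Omega> v x r" for x r
  proof -
    have s: "(\<lambda>x. a * u' x + b * v' x) \<in> sq_int lborel" by (intro sq_int_add sq_int_cmult u' v')
    have "ball_average \<Omega> (\<lambda>x. a * u x + b * v x) x r = ball_average \<Omega> (\<lambda>x. a * u' x + b * v' x) x r"
    proof (rule ball_average_cong[OF sobolev_sq_int[OF sobolev_lincomb[OF \<Omega> u v]] s \<Omega>])
      show "AE x in lebesgue_on \<Omega>. a * u x + b * v x = a * u' x + b * v' x" using u'(2) v'(2) by eventually_elim simp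
    qed
    also have "\<dots> = a * ball_average \<Omega> u' x r + b * ball_average \<Omega> v' x r"
    proof -
      let ?I = "\<lambda>y. indicator (\<Omega> \<inter> ball x r) y :: real"
      have "(\<integral>y. ?I y * (a * u' y + b * v' y) \<partial>lborel) = (\<integral>y. a * (?I y * u' y) + b * (?I y * v' y) \<partial>lborel)"
        by (simp add: algebra_simps)
      also have "\<dots> = a * (\<integral>y. ?I y * u' y \<partial>lborel) + b * (\<integral>y. ?I y * v' y \<partial>lborel)"
        using ball_average_eq(2)[OF u'(1) \<Omega>, of x r] ball_average_eq(2)[OF v'(1) \<Omega>, of x r] by simp
      finally show ?thesis
        by (simp add: ball_average_eq(1)[OF s \<Omega>] ball_average_eq(1)[OF u'(1) \<Omega>] ball_average_eq(1)[OF v'(1) \<Omega>] add_divide_distrib)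
    qed
    finally show ?thesis
      by (simp only: ball_average_cong[OF sobolev_sq_int[OF u] u'(1) \<Omega> u'(2)] ball_average_cong[OF sobolev_sq_int[OF v] v'(1) \<Omega> v'(2)])
  qed
  show ?thesis
    unfolding qe_eq_iff
  proof (rule null_cap_subset[OF null_cap_Un[OF N1(1) N2(1)]], rule subsetI, rule ccontr)
    fix x assume x: "x \<in> {x \<in> frontier \<Omega>. Tr \<Omega> (\<lambda>x. a * u x + b * v x) x \<noteq> a * Tr \<Omega> u x + b * Tr \<Omega> v x}" and "x \<notin> N1 \<union> N2"
    then have l: "(ball_average \<Omega> u x \<longlongrightarrow> Tr \<Omega> u x) (at_right 0)" "(ball_average \<Omega> v x \<longlongrightarrow> Tr \<Omega> v x) (at_right 0)"
      using N1(2)[of x] N2(2)[of x] by auto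
    have "ball_average \<Omega> (\<lambda>x. a * u x + b * v x) x = (\<lambda>r. a * ball_average \<Omega> u x r + b * ball_average \<Omega> v x r)"
      by (rule HOL.ext, rule lin)
    then have "(ball_average \<Omega> (\<lambda>x. a * u x + b * v x) x \<longlongrightarrow> a * Tr \<Omega> u x + b * Tr \<Omega> v x) (at_right 0)"
      using tendsto_add[OF tendsto_mult_left[OF l(1)] tendsto_mult_left[OF l(2)]] by simp
    from Tr_eqI[OF this] show False using x by simp
  qed
qed

text \<open>Averages over \<Omega> \<inter> B_r(x) do not see the extension outside \<Omega>, so
  \<open>u\<close> and its extension have the same trace and the result for the whole space
  applies.\<close>

lemma curl_form_zero_trace:
  assumes ext: "extension_domain 1 \<Omega>" "extension_domain 2 \<Omega>" and u: "u \<in> sobolev 1 \<Omega>" and v: "v \<in> sobolev 1 \<Omega>"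
    and z: "qe_eq \<Omega> (Tr \<Omega> u) (\<lambda>x. 0)"
  shows "(\<integral>x. weak_pderiv \<Omega> i u x * weak_pderiv \<Omega> j v x \<partial>lebesgue_on \<Omega>) = (\<integral>x. weak_pderiv \<Omega> j u x * weak_pderiv \<Omega> i v x \<partial>lebesgue_on \<Omega>)"
proof -
  have \<Omega>: "open \<Omega>" "bounded \<Omega>" using ext(1) by (simp_all add: extension_domain_def)
  obtain c \<rho> where dens: "c > 0" "\<rho> > 0" "\<rho> \<le> 1" "\<And>x r. x \<in> frontier \<Omega> \<Longrightarrow> 0 < r \<Longrightarrow> r \<le> \<rho> \<Longrightarrow> c * r ^ 3 \<le> measure lebesgue (\<Omega> \<inter> ball x r)"
    by (rule measure_density[OF ext(2)]) blast
  obtain w D where w: "H1 w D" "AE x in lebesgue_on \<Omega>. u x = w x" "\<And>i. AE x in lebesgue_on \<Omega>. weak_pderiv \<Omega> i u x = D i x"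
    by (rule extension_H1[OF ext(1) u]) blast
  obtain \<phi> E where \<phi>: "H1 \<phi> E" "\<And>i. AE x in lebesgue_on \<Omega>. weak_pderiv \<Omega> i v x = E i x"
    by (rule extension_H1[OF ext(1) v]) blast
  have "ball_average \<Omega> u x = ball_average \<Omega> w x" for x
    by (rule HOL.ext, rule ball_average_cong[OF sobolev_sq_int[OF u] H1_D(1)[OF w(1)] \<Omega>(1) w(2)])
  then have "Tr \<Omega> w = Tr \<Omega> u" unfolding Tr_def ball_average_def[abs_def] by simp
  then have null: "null_cap {x \<in> frontier \<Omega>. Tr \<Omega> w x \<noteq> 0}" using z by (simp add: qe_eq_iff)
  have m: "weak_pderiv \<Omega> a u \<in> borel_measurable (lebesgue_on \<Omega>)" "weak_pderiv \<Omega> a v \<in> borel_measurable (lebesgue_on \<Omega>)" for a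
    using sobolev_sq_int[OF weak_pderiv_sobolev(1)[OF \<Omega>(1), of _ 0]] u v sq_int_meas by auto
  have eq: "(\<integral>x. weak_pderiv \<Omega> a u x * weak_pderiv \<Omega> b v x \<partial>lebesgue_on \<Omega>) = (\<integral>x. (indicator \<Omega> x * D a x) * E b x \<partial>lborel)" for a b
  proof -
    have DE: "(\<lambda>x. D a x * E b x) \<in> borel_measurable borel" using H1_meas(2)[OF w(1)] H1_meas(2)[OF \<phi>(1)] by simp
    have "(\<integral>x. weak_pderiv \<Omega> a u x * weak_pderiv \<Omega> b v x \<partial>lebesgue_on \<Omega>) = (\<integral>x. D a x * E b x \<partial>lebesgue_on \<Omega>)"
    proof (rule integral_cong_AE)
      show "AE x in lebesgue_on \<Omega>. weak_pderiv \<Omega> a u x * weak_pderiv \<Omega> b v x = D a x * E b x"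
        using w(3)[of a] \<phi>(2)[of b] by eventually_elim simp
    qed (use m borel_on[OF DE] in auto)
    also have "\<dots> = (\<integral>x. (indicator \<Omega> x * D a x) * E b x \<partial>lborel)" by (simp add: integral_on[OF DE \<Omega>(1)] mult.assoc)
    finally show ?thesis .
  qed
  have "curl_pair \<Omega> i j D E = 0" by (rule curl_pair_zero_trace[OF \<Omega> dens w(1) null \<phi>(1)])
  then show ?thesis by (simp add: eq curl_pair_def)
qed

section \<open>The tangential trace of a gradient\<close>

text \<open>After convolution with a test function, one derivative can be moved to the kernel and
  the other kept on the function, in either order. The convolutions of both mixed derivatives
  therefore coincide, and mollifiers recover the derivatives themselves.\<close>

lemma H1_mixed_derivatives:
  assumes w: "H1 w D" and D: "\<And>i. H1 (D i) (DD i)"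
  shows "AE x in lborel. DD i j x = DD j i x"
proof -
  have eq: "conv \<kappa> (DD i j) = conv \<kappa> (DD j i)" if \<kappa>: "\<kappa> \<in> test_functions UNIV" for \<kappa>
  proof -
    have "conv \<kappa> (DD i j) = conv (pderiv j \<kappa>) (D i)"
      using pderiv_conv_H1[OF D \<kappa>] pderiv_conv[OF H1_D(2)[OF w] \<kappa>] by metis
    also have "\<dots> = pderiv i (pderiv j (conv \<kappa> w))"
      using pderiv_conv_H1[OF w test_pderiv[OF \<kappa>]] pderiv_conv[OF H1_D(1)[OF w] \<kappa>] by metis
    also have "\<dots> = conv \<kappa> (DD j i)"
      by (simp only: pderiv_conv_H1[OF w \<kappa>] pderiv_conv_H1[OF D \<kappa>])
    finally show ?thesis .
  qed
  define c where "c n = conv (mollifier n) (DD i j)" for n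
  note s = H1_D(2)[OF D]
  have "l2n lborel (\<lambda>x. DD i j x - DD j i x) \<le> 0"
  proof (rule LIMSEQ_le_const)
    have c: "(\<lambda>n. l2n lborel (\<lambda>x. c n x - DD i j x)) \<longlonglongrightarrow> 0" "(\<lambda>n. l2n lborel (\<lambda>x. c n x - DD j i x)) \<longlonglongrightarrow> 0"
      using mollify_tendsto(2)[OF s, of i j] mollify_tendsto(2)[OF s, of j i] by (simp_all only: c_def eq[OF mollifier_test])
    from tendsto_add[OF this] show "(\<lambda>n. l2n lborel (\<lambda>x. c n x - DD i j x) + l2n lborel (\<lambda>x. c n x - DD j i x)) \<longlonglongrightarrow> 0" by simp
    have cs: "c n \<in> sq_int lborel" for n unfolding c_def by (rule mollify_tendsto(1)[OF s])
    have "l2n lborel (\<lambda>x. DD i j x - DD j i x) \<le> l2n lborel (\<lambda>x. c n x - DD i j x) + l2n lborel (\<lambda>x. c n x - DD j i x)" for n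
      using l2n_triangle_diff[OF sq_int_diff[OF cs s] sq_int_diff[OF cs s], of n j i n i j] by simp
    then show "\<exists>N. \<forall>n\<ge>N. l2n lborel (\<lambda>x. DD i j x - DD j i x) \<le> l2n lborel (\<lambda>x. c n x - DD i j x) + l2n lborel (\<lambda>x. c n x - DD j i x)"
      by blast
  qed
  then have "l2n lborel (\<lambda>x. DD i j x - DD j i x) = 0" using l2n_nonneg by (metis order_antisym)
  from l2n_eq_0[OF sq_int_diff[OF s s] this] show ?thesis by eventually_elim simp
qed

section \<open>Gradients of H^2 functions\<close>

lemma sobolev_2:
  assumes \<Omega>: "open \<Omega>" and v: "v \<in> sobolev 2 \<Omega>"
  shows "v \<in> sobolev 1 \<Omega>" "weak_pderiv \<Omega> i v \<in> sobolev 1 \<Omega>"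
proof -
  have v': "v \<in> sobolev (Suc 1) \<Omega>" using v by (simp only: numeral_2_eq_2 One_nat_def)
  show "weak_pderiv \<Omega> i v \<in> sobolev 1 \<Omega>" by (rule weak_pderiv_sobolev(1)[OF \<Omega> v'])
  show "v \<in> sobolev 1 \<Omega>" using v' sobolev_sq_int by (fastforce simp: L2_eq)
qed

lemma weak_pderiv_commute:
  assumes ext: "extension_domain 2 \<Omega>" and v: "v \<in> sobolev 2 \<Omega>"
  shows "AE x in lebesgue_on \<Omega>. weak_pderiv \<Omega> i (weak_pderiv \<Omega> j v) x = weak_pderiv \<Omega> j (weak_pderiv \<Omega> i v) x"
proof -
  have \<Omega>: "open \<Omega>" using ext by (simp add: extension_domain_def)
  obtain w D DD where w: "H1 w D" "\<And>i. H1 (D i) (DD i)" "AE x in lebesgue_on \<Omega>. v x = w x"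
    using extension_H2[OF ext] v by metis
  note s = sobolev_2[OF \<Omega> v]
  have d: "AE x in lebesgue_on \<Omega>. weak_pderiv \<Omega> a v x = D a x" for a
    unfolding weak_pderiv_cong[OF s(1) H1_sobolev(1)[OF w(1) \<Omega>] w(3)] by (rule H1_sobolev(2)[OF w(1) \<Omega>])
  have dd: "AE x in lebesgue_on \<Omega>. weak_pderiv \<Omega> b (weak_pderiv \<Omega> a v) x = DD a b x" for a b
    unfolding weak_pderiv_cong[OF s(2) H1_sobolev(1)[OF w(2) \<Omega>] d] by (rule H1_sobolev(2)[OF w(2) \<Omega>])
  have "AE x in lebesgue_on \<Omega>. DD i j x = DD j i x"
    unfolding AE_on_iff[OF \<Omega>] using H1_mixed_derivatives[OF w(1,2), of i j] by eventually_elim simp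
  then show ?thesis using dd[of i j] dd[of j i] by eventually_elim simp
qed

lemma weak_grad_component: "(\<lambda>x. weak_grad \<Omega> v x $ i) = weak_pderiv \<Omega> i v"
  by (simp add: weak_grad_def fun_eq_iff)

lemma weak_grad_vsobolev: "open \<Omega> \<Longrightarrow> v \<in> sobolev 2 \<Omega> \<Longrightarrow> weak_grad \<Omega> v \<in> vsobolev 1 \<Omega>"
  by (simp only: vsobolev_def weak_grad_component mem_Collect_eq sobolev_2 simp_thms)

lemma weak_grad_norm: "vsobolev_norm 1 \<Omega> (weak_grad \<Omega> v) \<le> sobolev_norm 2 \<Omega> v"
proof -
  have "sobolev_norm 2 \<Omega> v = sqrt ((L2_norm \<Omega> v)\<^sup>2 + (\<Sum>i\<in>UNIV. (sobolev_norm 1 \<Omega> (weak_pderiv \<Omega> i v))\<^sup>2))"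
    by (simp only: numeral_2_eq_2 sobolev_norm.simps(2)[of "Suc 0"] One_nat_def)
  then show ?thesis by (simp only: vsobolev_norm_def L2_set_def weak_grad_component) simp
qed

lemma weak_curl_grad:
  assumes "extension_domain 2 \<Omega>" "v \<in> sobolev 2 \<Omega>"
  shows "AE x in lebesgue_on \<Omega>. weak_curl \<Omega> (weak_grad \<Omega> v) x = 0"
  using weak_pderiv_commute[OF assms, of 2 3] weak_pderiv_commute[OF assms, of 3 1] weak_pderiv_commute[OF assms, of 1 2]
proof eventually_elim
  case (elim x)
  then show ?case by (simp add: weak_curl_def Let_def weak_grad_component vec_eq_iff forall_3)
qed

section \<open>The antisymmetric form on the domain and on traces\<close>

definition curl_form :: "(real^3) set \<Rightarrow> 3 \<Rightarrow> 3 \<Rightarrow> (real^3 \<Rightarrow> real) \<Rightarrow> (real^3 \<Rightarrow> real) \<Rightarrow> real" where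
  "curl_form \<Omega> i j u v = (\<integral>x. weak_pderiv \<Omega> i u x * weak_pderiv \<Omega> j v x \<partial>lebesgue_on \<Omega>) -
     (\<integral>x. weak_pderiv \<Omega> j u x * weak_pderiv \<Omega> i v x \<partial>lebesgue_on \<Omega>)"

lemma curl_form_swap: "curl_form \<Omega> i j u v = - curl_form \<Omega> i j v u"
  by (simp add: curl_form_def mult.commute)

lemma weak_pderiv_sq_int:
  assumes "open \<Omega>" "u \<in> sobolev 1 \<Omega>"
  shows "weak_pderiv \<Omega> i u \<in> sq_int (lebesgue_on \<Omega>)"
  using sobolev_sq_int[OF weak_pderiv_sobolev(1)[of \<Omega> u 0 i]] assms by simp

lemma weak_pderiv_lincomb:
  assumes \<Omega>: "open \<Omega>" and u: "u \<in> sobolev 1 \<Omega>" and v: "v \<in> sobolev 1 \<Omega>"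
  shows "AE x in lebesgue_on \<Omega>. weak_pderiv \<Omega> i (\<lambda>x. a * u x + b * v x) x = a * weak_pderiv \<Omega> i u x + b * weak_pderiv \<Omega> i v x"
proof (rule weak_pderiv_AE(3)[OF \<Omega>])
  note s = weak_pderiv_sq_int[OF \<Omega> u, of i] weak_pderiv_sq_int[OF \<Omega> v, of i]
  show "(\<lambda>x. a * weak_pderiv \<Omega> i u x + b * weak_pderiv \<Omega> i v x) \<in> sq_int (lebesgue_on \<Omega>)"
    by (intro sq_int_add sq_int_cmult s)
  show "is_weak_pderiv \<Omega> i (\<lambda>x. a * u x + b * v x) (\<lambda>x. a * weak_pderiv \<Omega> i u x + b * weak_pderiv \<Omega> i v x)"
    using weak_pderiv_sobolev(2)[OF \<Omega>, of u 0 i] weak_pderiv_sobolev(2)[OF \<Omega>, of v 0 i] u v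
    by (intro is_weak_pderiv_lincomb[OF \<Omega> sobolev_sq_int[OF u] s(1) _ sobolev_sq_int[OF v] s(2)]) auto
qed

lemma curl_form_lincomb:
  assumes \<Omega>: "open \<Omega>" and u: "u \<in> sobolev 1 \<Omega>" "u' \<in> sobolev 1 \<Omega>" and v: "v \<in> sobolev 1 \<Omega>"
  shows "curl_form \<Omega> i j (\<lambda>x. a * u x + b * u' x) v = a * curl_form \<Omega> i j u v + b * curl_form \<Omega> i j u' v"
    "curl_form \<Omega> i j v (\<lambda>x. a * u x + b * u' x) = a * curl_form \<Omega> i j v u + b * curl_form \<Omega> i j v u'"
proof -
  note s = weak_pderiv_sq_int[OF \<Omega>]
  have "(\<integral>x. weak_pderiv \<Omega> k (\<lambda>x. a * u x + b * u' x) x * weak_pderiv \<Omega> l v x \<partial>lebesgue_on \<Omega>) =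
      a * (\<integral>x. weak_pderiv \<Omega> k u x * weak_pderiv \<Omega> l v x \<partial>lebesgue_on \<Omega>) + b * (\<integral>x. weak_pderiv \<Omega> k u' x * weak_pderiv \<Omega> l v x \<partial>lebesgue_on \<Omega>)" for k l
  proof -
    have "(\<integral>x. weak_pderiv \<Omega> k (\<lambda>x. a * u x + b * u' x) x * weak_pderiv \<Omega> l v x \<partial>lebesgue_on \<Omega>) =
        (\<integral>x. (a * weak_pderiv \<Omega> k u x + b * weak_pderiv \<Omega> k u' x) * weak_pderiv \<Omega> l v x \<partial>lebesgue_on \<Omega>)"
      by (rule integral_on_cong_AE[OF weak_pderiv_lincomb[OF \<Omega> u]]; rule sq_int_meas)
         (intro s sobolev_lincomb[OF \<Omega>] sq_int_add sq_int_cmult u v)+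
    also have "\<dots> = (\<integral>x. a * (weak_pderiv \<Omega> k u x * weak_pderiv \<Omega> l v x) + b * (weak_pderiv \<Omega> k u' x * weak_pderiv \<Omega> l v x) \<partial>lebesgue_on \<Omega>)"
      by (simp add: algebra_simps)
    also have "\<dots> = a * (\<integral>x. weak_pderiv \<Omega> k u x * weak_pderiv \<Omega> l v x \<partial>lebesgue_on \<Omega>) + b * (\<integral>x. weak_pderiv \<Omega> k u' x * weak_pderiv \<Omega> l v x \<partial>lebesgue_on \<Omega>)"
      using sq_int_mult[OF s[OF u(1)] s[OF v], of k l] sq_int_mult[OF s[OF u(2)] s[OF v], of k l] by simp
    finally show ?thesis .
  qed
  then show "curl_form \<Omega> i j (\<lambda>x. a * u x + b * u' x) v = a * curl_form \<Omega> i j u v + b * curl_form \<Omega> i j u' v"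
    by (simp add: curl_form_def algebra_simps)
  then show "curl_form \<Omega> i j v (\<lambda>x. a * u x + b * u' x) = a * curl_form \<Omega> i j v u + b * curl_form \<Omega> i j v u'"
    by (simp add: curl_form_swap[of \<Omega> i j v])
qed

lemma curl_form_bound:
  assumes \<Omega>: "open \<Omega>" and u: "u \<in> sobolev 1 \<Omega>" and v: "v \<in> sobolev 1 \<Omega>"
  shows "\<bar>curl_form \<Omega> i j u v\<bar> \<le> 2 * sobolev_norm 1 \<Omega> u * sobolev_norm 1 \<Omega> v"
proof -
  have n: "l2n (lebesgue_on \<Omega>) (weak_pderiv \<Omega> k w) \<le> sobolev_norm 1 \<Omega> w" for k w
    using sobolev1_norm_components(2)[of 0 \<Omega> k w] by (simp only: sobolev_norm.simps(1) One_nat_def L2_norm_eq)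
  have "\<bar>\<integral>x. weak_pderiv \<Omega> k u x * weak_pderiv \<Omega> l v x \<partial>lebesgue_on \<Omega>\<bar> \<le> sobolev_norm 1 \<Omega> u * sobolev_norm 1 \<Omega> v" for k l
    by (rule order_trans[OF CS_ineq[OF weak_pderiv_sq_int[OF \<Omega> u] weak_pderiv_sq_int[OF \<Omega> v]] mult_mono[OF n n sobolev_norm_nonneg l2n_nonneg]])
  from this[of i j] this[of j i] show ?thesis unfolding curl_form_def by linarith
qed

text \<open>By linearity of the trace the difference of the two functions has trace zero;
  antisymmetry carries the statement over to the second argument.\<close>

lemma curl_form_trace_cong:
  assumes ext: "extension_domain 1 \<Omega>" "extension_domain 2 \<Omega>" and u: "u \<in> sobolev 1 \<Omega>" "u' \<in> sobolev 1 \<Omega>" and v: "v \<in> sobolev 1 \<Omega>"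
    and t: "qe_eq \<Omega> (Tr \<Omega> u) (Tr \<Omega> u')"
  shows "curl_form \<Omega> i j u v = curl_form \<Omega> i j u' v" "curl_form \<Omega> i j v u = curl_form \<Omega> i j v u'"
proof -
  have \<Omega>: "open \<Omega>" using ext(1) by (simp add: extension_domain_def)
  have "qe_eq \<Omega> (\<lambda>x. 1 * Tr \<Omega> u x + (- 1) * Tr \<Omega> u' x) (\<lambda>x. 1 * Tr \<Omega> u' x + (- 1) * Tr \<Omega> u' x)"
    by (rule qe_eq_lincomb[OF t qe_eq_refl])
  from qe_eq_trans[OF Tr_lincomb[OF ext u] this]
  have "qe_eq \<Omega> (Tr \<Omega> (\<lambda>x. 1 * u x + (- 1) * u' x)) (\<lambda>x. 0)" by simp
  from curl_form_zero_trace[OF ext sobolev_lincomb[OF \<Omega> u] v this, of i j]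
  have "curl_form \<Omega> i j (\<lambda>x. 1 * u x + (- 1) * u' x) v = 0" by (simp add: curl_form_def)
  then show "curl_form \<Omega> i j u v = curl_form \<Omega> i j u' v" unfolding curl_form_lincomb(1)[OF \<Omega> u v] by simp
  then show "curl_form \<Omega> i j v u = curl_form \<Omega> i j v u'" by (simp add: curl_form_swap[of \<Omega> i j v])
qed

text \<open>The curl of a gradient vanishes, so only the product of grad v with curl w contributes.
  Sorting its six terms by the component of \<open>w\<close> they contain gives one form for each
  cyclic pair of indices.\<close>

lemma integral_curl_grad:
  assumes ext: "extension_domain 2 \<Omega>" and v: "v \<in> sobolev 2 \<Omega>" and w: "w \<in> vsobolev 1 \<Omega>"
  shows "(\<integral>x. weak_grad \<Omega> v x \<bullet> weak_curl \<Omega> w x - w x \<bullet> weak_curl \<Omega> (weak_grad \<Omega> v) x \<partial>lebesgue_on \<Omega>) =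
    curl_form \<Omega> 1 2 v (\<lambda>x. w x $ 3) + curl_form \<Omega> 2 3 v (\<lambda>x. w x $ 1) + curl_form \<Omega> 3 1 v (\<lambda>x. w x $ 2)"
proof -
  have \<Omega>: "open \<Omega>" using ext by (simp add: extension_domain_def)
  define d where "d k l x = weak_pderiv \<Omega> k v x * weak_pderiv \<Omega> (fst l) (\<lambda>x. w x $ snd l) x" for k l x
  have w': "(\<lambda>x. w x $ k) \<in> sobolev 1 \<Omega>" for k using w by (simp only: vsobolev_def mem_Collect_eq)
  have i: "integrable (lebesgue_on \<Omega>) (d k l)" for k l
    unfolding d_def[abs_def] by (intro sq_int_mult weak_pderiv_sq_int \<Omega> sobolev_2(1) v w')
  have m: "(\<lambda>x. w x $ k) \<in> borel_measurable (lebesgue_on \<Omega>)" for k by (rule sq_int_meas[OF sobolev_sq_int[OF w']])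
  have mm: "weak_pderiv \<Omega> k u \<in> borel_measurable (lebesgue_on \<Omega>)" if "u \<in> sobolev 1 \<Omega>" for k u
    by (rule sq_int_meas[OF weak_pderiv_sq_int[OF \<Omega> that]])
  note mms = mm[OF w'] mm[OF sobolev_2(1)[OF \<Omega> v]] mm[OF sobolev_2(2)[OF \<Omega> v]] m
  have "(\<integral>x. weak_grad \<Omega> v x \<bullet> weak_curl \<Omega> w x - w x \<bullet> weak_curl \<Omega> (weak_grad \<Omega> v) x \<partial>lebesgue_on \<Omega>) =
    (\<integral>x. d 1 (2, 3) x - d 1 (3, 2) x + (d 2 (3, 1) x - d 2 (1, 3) x) + (d 3 (1, 2) x - d 3 (2, 1) x) \<partial>lebesgue_on \<Omega>)"
  proof (rule integral_cong_AE)
    show "AE x in lebesgue_on \<Omega>. weak_grad \<Omega> v x \<bullet> weak_curl \<Omega> w x - w x \<bullet> weak_curl \<Omega> (weak_grad \<Omega> v) x =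
      d 1 (2, 3) x - d 1 (3, 2) x + (d 2 (3, 1) x - d 2 (1, 3) x) + (d 3 (1, 2) x - d 3 (2, 1) x)"
      using weak_curl_grad[OF ext v]
      by eventually_elim (simp add: inner_vec_def sum_3 weak_grad_def weak_curl_def[of \<Omega> w] Let_def d_def algebra_simps)
    show "(\<lambda>x. weak_grad \<Omega> v x \<bullet> weak_curl \<Omega> w x - w x \<bullet> weak_curl \<Omega> (weak_grad \<Omega> v) x) \<in> borel_measurable (lebesgue_on \<Omega>)"
      unfolding inner_vec_def sum_3 weak_curl_def weak_grad_component Let_def weak_grad_def
      by (simp add: vector_3, intro borel_measurable_add borel_measurable_diff borel_measurable_times mms)
    show "(\<lambda>x. d 1 (2, 3) x - d 1 (3, 2) x + (d 2 (3, 1) x - d 2 (1, 3) x) + (d 3 (1, 2) x - d 3 (2, 1) x)) \<in> borel_measurable (lebesgue_on \<Omega>)"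
      by (intro borel_measurable_integrable Bochner_Integration.integrable_add Bochner_Integration.integrable_diff i)
  qed
  also have "\<dots> = integral\<^sup>L (lebesgue_on \<Omega>) (d 1 (2, 3)) - integral\<^sup>L (lebesgue_on \<Omega>) (d 1 (3, 2)) +
      (integral\<^sup>L (lebesgue_on \<Omega>) (d 2 (3, 1)) - integral\<^sup>L (lebesgue_on \<Omega>) (d 2 (1, 3))) +
      (integral\<^sup>L (lebesgue_on \<Omega>) (d 3 (1, 2)) - integral\<^sup>L (lebesgue_on \<Omega>) (d 3 (2, 1)))"
    by (simp add: i Bochner_Integration.integral_add Bochner_Integration.integral_diff)
  finally show ?thesis by (simp add: curl_form_def d_def[abs_def])
qed

text \<open>Evaluates the form at a boundary function through an arbitrary lift;
  \<open>trace_form_eq\<close> shows that the choice is immaterial.\<close>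

definition trace_form :: "(real^3) set \<Rightarrow> 3 \<Rightarrow> 3 \<Rightarrow> (real^3 \<Rightarrow> real) \<Rightarrow> (real^3 \<Rightarrow> real) \<Rightarrow> real" where
  "trace_form \<Omega> i j v g = curl_form \<Omega> i j v (SOME q. q \<in> sobolev 1 \<Omega> \<and> qe_eq \<Omega> (Tr \<Omega> q) g)"

lemma trace_form_eq:
  assumes ext: "extension_domain 1 \<Omega>" "extension_domain 2 \<Omega>" and v: "v \<in> sobolev 1 \<Omega>"
    and q: "q \<in> sobolev 1 \<Omega>" "qe_eq \<Omega> (Tr \<Omega> q) g"
  shows "trace_form \<Omega> i j v g = curl_form \<Omega> i j v q"
proof -
  define p where "p = (SOME q. q \<in> sobolev 1 \<Omega> \<and> qe_eq \<Omega> (Tr \<Omega> q) g)"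
  have "p \<in> sobolev 1 \<Omega> \<and> qe_eq \<Omega> (Tr \<Omega> p) g" unfolding p_def by (rule someI[of _ q]) (use q in blast)
  then have p: "p \<in> sobolev 1 \<Omega>" "qe_eq \<Omega> (Tr \<Omega> p) g" by blast+
  show ?thesis
    unfolding trace_form_def p_def[symmetric]
    by (rule curl_form_trace_cong(2)[OF ext p(1) q(1) v qe_eq_trans[OF p(2) qe_eq_sym[OF q(2)]]])
qed

lemma trace_space_lincomb:
  assumes ext: "extension_domain 1 \<Omega>" "extension_domain 2 \<Omega>" and u: "u \<in> sobolev 1 \<Omega>" "qe_eq \<Omega> (Tr \<Omega> u) f"
    and v: "v \<in> sobolev 1 \<Omega>" "qe_eq \<Omega> (Tr \<Omega> v) g"
  shows "qe_eq \<Omega> (Tr \<Omega> (\<lambda>x. a * u x + b * v x)) (\<lambda>x. a * f x + b * g x)"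
  by (rule qe_eq_trans[OF Tr_lincomb[OF ext u(1) v(1)] qe_eq_lincomb[OF u(2) v(2)]])

lemma trace_form_lincomb:
  assumes ext: "extension_domain 1 \<Omega>" "extension_domain 2 \<Omega>" and v: "v \<in> sobolev 1 \<Omega>"
    and f: "f \<in> trace_space 1 \<Omega>" and g: "g \<in> trace_space 1 \<Omega>"
  shows "trace_form \<Omega> i j v (\<lambda>x. a * f x + b * g x) = a * trace_form \<Omega> i j v f + b * trace_form \<Omega> i j v g"
proof -
  have \<Omega>: "open \<Omega>" using ext(1) by (simp add: extension_domain_def)
  obtain p q where p: "p \<in> sobolev 1 \<Omega>" "qe_eq \<Omega> (Tr \<Omega> p) f" and q: "q \<in> sobolev 1 \<Omega>" "qe_eq \<Omega> (Tr \<Omega> q) g"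
    using f g unfolding trace_space_def by blast
  show ?thesis
    unfolding trace_form_eq[OF ext v sobolev_lincomb[OF \<Omega> p(1) q(1)] trace_space_lincomb[OF ext p q]]
      trace_form_eq[OF ext v p] trace_form_eq[OF ext v q]
    by (rule curl_form_lincomb(2)[OF \<Omega> p(1) q(1) v])
qed

lemma trace_form_bound:
  assumes ext: "extension_domain 1 \<Omega>" "extension_domain 2 \<Omega>" and v: "v \<in> sobolev 1 \<Omega>" and g: "g \<in> trace_space 1 \<Omega>"
  shows "\<bar>trace_form \<Omega> i j v g\<bar> \<le> (2 * sobolev_norm 1 \<Omega> v + 1) * trace_norm 1 \<Omega> g"
proof -
  have \<Omega>: "open \<Omega>" using ext(1) by (simp add: extension_domain_def)
  \<comment> \<open>The added 1 makes \<open>C\<close> positive, so that the estimate can be divided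
    by it before the infimum over all lifts is taken.\<close>
  define C where "C = 2 * sobolev_norm 1 \<Omega> v + 1"
  have C: "C > 0" using sobolev_norm_nonneg[of 1 \<Omega> v] unfolding C_def by linarith
  have "\<bar>trace_form \<Omega> i j v g\<bar> / C \<le> trace_norm 1 \<Omega> g"
    unfolding trace_norm_def
  proof (rule cInf_greatest)
    show "sobolev_norm 1 \<Omega> ` {v \<in> sobolev 1 \<Omega>. qe_eq \<Omega> (Tr \<Omega> v) g} \<noteq> {}" using g unfolding trace_space_def by blast
    fix t assume "t \<in> sobolev_norm 1 \<Omega> ` {v \<in> sobolev 1 \<Omega>. qe_eq \<Omega> (Tr \<Omega> v) g}"
    then obtain q where q: "q \<in> sobolev 1 \<Omega>" "qe_eq \<Omega> (Tr \<Omega> q) g" and t: "t = sobolev_norm 1 \<Omega> q" by blast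
    have "\<bar>trace_form \<Omega> i j v g\<bar> \<le> 2 * sobolev_norm 1 \<Omega> v * t"
      unfolding trace_form_eq[OF ext v q] t by (rule curl_form_bound[OF \<Omega> v q(1)])
    also have "\<dots> \<le> C * t" using sobolev_norm_nonneg[of 1 \<Omega> q] by (intro mult_right_mono) (auto simp: C_def t simp del: One_nat_def)
    finally show "\<bar>trace_form \<Omega> i j v g\<bar> / C \<le> t" using C by (simp add: pos_divide_le_eq mult.commute)
  qed
  then show ?thesis using C by (simp add: pos_divide_le_eq mult.commute C_def[symmetric] del: One_nat_def)
qed

text \<open>The explicit candidate for the tangential trace of a gradient. It is 0 off the trace
  space, in keeping with the convention in \<open>vtrace_dual\<close>.\<close>

definition grad_functional :: "(real^3) set \<Rightarrow> (real^3 \<Rightarrow> real) \<Rightarrow> (real^3 \<Rightarrow> real^3) \<Rightarrow> real" where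
  "grad_functional \<Omega> v f = (if f \<in> vtrace_space \<Omega>
     then trace_form \<Omega> 1 2 v (\<lambda>x. f x $ 3) + trace_form \<Omega> 2 3 v (\<lambda>x. f x $ 1) + trace_form \<Omega> 3 1 v (\<lambda>x. f x $ 2) else 0)"

lemma vtrace_space_component: "f \<in> vtrace_space \<Omega> \<Longrightarrow> (\<lambda>x. f x $ i) \<in> trace_space 1 \<Omega>"
  by (simp add: vtrace_space_def)

lemma vTr_component: "(\<lambda>x. vTr \<Omega> w x $ i) = Tr \<Omega> (\<lambda>x. w x $ i)"
  by (simp add: vTr_def fun_eq_iff)

lemma vtrace_space_lift:
  assumes "f \<in> vtrace_space \<Omega>"
  obtains w where "w \<in> vsobolev 1 \<Omega>" "vqe_eq \<Omega> (vTr \<Omega> w) f"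
proof -
  have "\<forall>i. \<exists>q. q \<in> sobolev 1 \<Omega> \<and> qe_eq \<Omega> (Tr \<Omega> q) (\<lambda>x. f x $ i)"
    using vtrace_space_component[OF assms] unfolding trace_space_def by blast
  then obtain q where q: "\<forall>i. q i \<in> sobolev 1 \<Omega> \<and> qe_eq \<Omega> (Tr \<Omega> (q i)) (\<lambda>x. f x $ i)" by (rule choice[THEN exE])
  show ?thesis
    by (rule that[of "\<lambda>x. \<chi> i. q i x"]) (use q in \<open>simp_all add: vsobolev_def vqe_eq_def vTr_component del: One_nat_def\<close>)
qed

lemma vTr_vtrace_space: "w \<in> vsobolev 1 \<Omega> \<Longrightarrow> vTr \<Omega> w \<in> vtrace_space \<Omega>"
  unfolding vtrace_space_def vsobolev_def trace_space_def by (auto simp: vTr_component simp del: One_nat_def intro: qe_eq_refl)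

lemma vtrace_space_lincomb:
  assumes ext: "extension_domain 1 \<Omega>" "extension_domain 2 \<Omega>" and f: "f \<in> vtrace_space \<Omega>" and g: "g \<in> vtrace_space \<Omega>"
  shows "(\<lambda>x. a *\<^sub>R f x + b *\<^sub>R g x) \<in> vtrace_space \<Omega>"
proof -
  have \<Omega>: "open \<Omega>" using ext(1) by (simp add: extension_domain_def)
  have "(\<lambda>x. a * (f x $ i) + b * (g x $ i)) \<in> trace_space 1 \<Omega>" for i
  proof -
    obtain p q where p: "p \<in> sobolev 1 \<Omega>" "qe_eq \<Omega> (Tr \<Omega> p) (\<lambda>x. f x $ i)" and q: "q \<in> sobolev 1 \<Omega>" "qe_eq \<Omega> (Tr \<Omega> q) (\<lambda>x. g x $ i)"
      using vtrace_space_component[OF f, of i] vtrace_space_component[OF g, of i] unfolding trace_space_def by blast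
    show ?thesis
      unfolding trace_space_def using sobolev_lincomb[OF \<Omega> p(1) q(1)] trace_space_lincomb[OF ext p q] by blast
  qed
  then show ?thesis by (simp add: vtrace_space_def del: One_nat_def)
qed

lemma grad_functional_dual:
  assumes ext: "extension_domain 1 \<Omega>" "extension_domain 2 \<Omega>" and v: "v \<in> sobolev 1 \<Omega>"
  shows "grad_functional \<Omega> v \<in> vtrace_dual \<Omega>"
  unfolding vtrace_dual_def
proof (intro CollectI conjI allI ballI impI)
  fix f assume "f \<notin> vtrace_space \<Omega>"
  then show "grad_functional \<Omega> v f = 0" by (simp add: grad_functional_def)
next
  fix f g assume f: "f \<in> vtrace_space \<Omega>" and g: "g \<in> vtrace_space \<Omega>" and fg: "vqe_eq \<Omega> f g"
  have "trace_form \<Omega> i j v (\<lambda>x. f x $ k) = trace_form \<Omega> i j v (\<lambda>x. g x $ k)" for i j k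
  proof -
    obtain p where p: "p \<in> sobolev 1 \<Omega>" "qe_eq \<Omega> (Tr \<Omega> p) (\<lambda>x. f x $ k)"
      using vtrace_space_component[OF f, of k] unfolding trace_space_def by blast
    have "qe_eq \<Omega> (Tr \<Omega> p) (\<lambda>x. g x $ k)" using qe_eq_trans[OF p(2)] fg by (simp add: vqe_eq_def)
    then show ?thesis by (simp only: trace_form_eq[OF ext v p] trace_form_eq[OF ext v p(1)])
  qed
  then show "grad_functional \<Omega> v f = grad_functional \<Omega> v g" using f g by (simp add: grad_functional_def)
next
  fix f g a b assume f: "f \<in> vtrace_space \<Omega>" and g: "g \<in> vtrace_space \<Omega>"
  have "trace_form \<Omega> i j v (\<lambda>x. (a *\<^sub>R f x + b *\<^sub>R g x) $ k) = a * trace_form \<Omega> i j v (\<lambda>x. f x $ k) + b * trace_form \<Omega> i j v (\<lambda>x. g x $ k)" for i j k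
    using trace_form_lincomb[OF ext v vtrace_space_component[OF f] vtrace_space_component[OF g], of i j a k b k] by simp
  then show "grad_functional \<Omega> v (\<lambda>x. a *\<^sub>R f x + b *\<^sub>R g x) = a * grad_functional \<Omega> v f + b * grad_functional \<Omega> v g"
    using f g vtrace_space_lincomb[OF ext f g, of a b] unfolding grad_functional_def by (simp add: algebra_simps del: vector_add_component vector_scaleR_component)
next
  define C where "C = 2 * sobolev_norm 1 \<Omega> v + 1"
  have C: "C \<ge> 0" using sobolev_norm_nonneg[of 1 \<Omega> v] unfolding C_def by linarith
  show "\<exists>C. \<forall>f\<in>vtrace_space \<Omega>. \<bar>grad_functional \<Omega> v f\<bar> \<le> C * vtrace_norm \<Omega> f"
  proof (intro exI[of _ "3 * C"] ballI)
    fix f assume f: "f \<in> vtrace_space \<Omega>"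
    have "\<bar>trace_form \<Omega> i j v (\<lambda>x. f x $ k)\<bar> \<le> C * vtrace_norm \<Omega> f" for i j k
    proof -
      have "0 \<le> trace_norm 1 \<Omega> (\<lambda>x. f x $ k)"
        unfolding trace_norm_def
        by (rule cInf_greatest) (use vtrace_space_component[OF f, of k] in \<open>auto simp: trace_space_def sobolev_norm_nonneg simp del: One_nat_def\<close>)
      then have "trace_norm 1 \<Omega> (\<lambda>x. f x $ k) \<le> vtrace_norm \<Omega> f"
        unfolding vtrace_norm_def L2_set_def by (intro real_le_rsqrt member_le_sum) auto
      from mult_left_mono[OF this C] trace_form_bound[OF ext v vtrace_space_component[OF f], of i j k]
      show ?thesis unfolding C_def[symmetric] by linarith
    qed
    from this[of 1 2 3] this[of 2 3 1] this[of 3 1 2] show "\<bar>grad_functional \<Omega> v f\<bar> \<le> 3 * C * vtrace_norm \<Omega> f"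
      using f unfolding grad_functional_def by simp
  qed
qed

lemma grad_functional_vTr:
  assumes ext: "extension_domain 1 \<Omega>" "extension_domain 2 \<Omega>" and v: "v \<in> sobolev 2 \<Omega>" and w: "w \<in> vsobolev 1 \<Omega>"
  shows "grad_functional \<Omega> v (vTr \<Omega> w) =
    (\<integral>x. weak_grad \<Omega> v x \<bullet> weak_curl \<Omega> w x - w x \<bullet> weak_curl \<Omega> (weak_grad \<Omega> v) x \<partial>lebesgue_on \<Omega>)"
proof -
  have \<Omega>: "open \<Omega>" using ext(1) by (simp add: extension_domain_def)
  have w': "(\<lambda>x. w x $ k) \<in> sobolev 1 \<Omega>" for k using w by (simp only: vsobolev_def mem_Collect_eq)
  show ?thesis
    unfolding integral_curl_grad[OF ext(2) v w] grad_functional_def vTr_component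
      trace_form_eq[OF ext sobolev_2(1)[OF \<Omega> v] w' qe_eq_refl]
    using vTr_vtrace_space[OF w] by simp
qed

text \<open>Existence in the definite description is the candidate \<open>grad_functional\<close>.
  Uniqueness holds because every element of the trace space agrees quasi-everywhere with some
  \<open>vTr \<Omega> w\<close>, where the value is prescribed, and all functionals in the dual are
  0 elsewhere.\<close>

lemma tangential_trace_grad:
  assumes ext: "extension_domain 1 \<Omega>" "extension_domain 2 \<Omega>" and v: "v \<in> sobolev 2 \<Omega>"
  shows "tangential_trace \<Omega> (weak_grad \<Omega> v) = grad_functional \<Omega> v"
  unfolding tangential_trace_def
proof (rule the_equality)
  have \<Omega>: "open \<Omega>" using ext(1) by (simp add: extension_domain_def)
  show "grad_functional \<Omega> v \<in> vtrace_dual \<Omega> \<and> (\<forall>w\<in>vsobolev 1 \<Omega>. grad_functional \<Omega> v (vTr \<Omega> w) =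
    (\<integral>x. weak_grad \<Omega> v x \<bullet> weak_curl \<Omega> w x - w x \<bullet> weak_curl \<Omega> (weak_grad \<Omega> v) x \<partial>lebesgue_on \<Omega>))"
    using grad_functional_dual[OF ext sobolev_2(1)[OF \<Omega> v]] grad_functional_vTr[OF ext v] by blast
  note dual = grad_functional_dual[OF ext sobolev_2(1)[OF \<Omega> v]]
  fix l assume l: "l \<in> vtrace_dual \<Omega> \<and> (\<forall>w\<in>vsobolev 1 \<Omega>. l (vTr \<Omega> w) =
    (\<integral>x. weak_grad \<Omega> v x \<bullet> weak_curl \<Omega> w x - w x \<bullet> weak_curl \<Omega> (weak_grad \<Omega> v) x \<partial>lebesgue_on \<Omega>))"
  show "l = grad_functional \<Omega> v"
  proof
    fix f
    show "l f = grad_functional \<Omega> v f"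
    proof (cases "f \<in> vtrace_space \<Omega>")
      case True
      obtain w where w: "w \<in> vsobolev 1 \<Omega>" "vqe_eq \<Omega> (vTr \<Omega> w) f" by (rule vtrace_space_lift[OF True])
      have "l (vTr \<Omega> w) = l f" "grad_functional \<Omega> v (vTr \<Omega> w) = grad_functional \<Omega> v f"
        using l dual vTr_vtrace_space[OF w(1)] True w(2) unfolding vtrace_dual_def by blast+
      then show ?thesis using l w(1) grad_functional_vTr[OF ext v w(1)] by simp
    next
      case False
      then show ?thesis using l dual unfolding vtrace_dual_def by simp
    qed
  qed
qed

lemma grad_functional_trace_cong:
  assumes ext: "extension_domain 1 \<Omega>" "extension_domain 2 \<Omega>" and u: "u \<in> sobolev 1 \<Omega>" and v: "v \<in> sobolev 1 \<Omega>"
    and t: "qe_eq \<Omega> (Tr \<Omega> u) (Tr \<Omega> v)"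
  shows "grad_functional \<Omega> u = grad_functional \<Omega> v"
proof
  fix f
  have "trace_form \<Omega> i j u (\<lambda>x. f x $ k) = trace_form \<Omega> i j v (\<lambda>x. f x $ k)" if f: "f \<in> vtrace_space \<Omega>" for i j k
  proof -
    obtain p where p: "p \<in> sobolev 1 \<Omega>" "qe_eq \<Omega> (Tr \<Omega> p) (\<lambda>x. f x $ k)"
      using vtrace_space_component[OF f, of k] unfolding trace_space_def by blast
    show ?thesis
      unfolding trace_form_eq[OF ext u p] trace_form_eq[OF ext v p] by (rule curl_form_trace_cong(1)[OF ext u v p(1) t])
  qed
  then show "grad_functional \<Omega> u f = grad_functional \<Omega> v f" by (simp add: grad_functional_def)
qed

lemma grad_functional_lincomb:
  assumes ext: "extension_domain 1 \<Omega>" "extension_domain 2 \<Omega>" and u: "u \<in> sobolev 1 \<Omega>" and v: "v \<in> sobolev 1 \<Omega>"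
  shows "grad_functional \<Omega> (\<lambda>x. a * u x + b * v x) = (\<lambda>f. a * grad_functional \<Omega> u f + b * grad_functional \<Omega> v f)"
proof
  have \<Omega>: "open \<Omega>" using ext(1) by (simp add: extension_domain_def)
  fix f
  have "trace_form \<Omega> i j (\<lambda>x. a * u x + b * v x) (\<lambda>x. f x $ k) = a * trace_form \<Omega> i j u (\<lambda>x. f x $ k) + b * trace_form \<Omega> i j v (\<lambda>x. f x $ k)"
    if f: "f \<in> vtrace_space \<Omega>" for i j k
  proof -
    obtain p where p: "p \<in> sobolev 1 \<Omega>" "qe_eq \<Omega> (Tr \<Omega> p) (\<lambda>x. f x $ k)"
      using vtrace_space_component[OF f, of k] unfolding trace_space_def by blast
    show ?thesis
      unfolding trace_form_eq[OF ext u p] trace_form_eq[OF ext v p] trace_form_eq[OF ext sobolev_lincomb[OF \<Omega> u v] p]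
      by (rule curl_form_lincomb(1)[OF \<Omega> u v p(1)])
  qed
  then show "grad_functional \<Omega> (\<lambda>x. a * u x + b * v x) f = a * grad_functional \<Omega> u f + b * grad_functional \<Omega> v f"
    by (simp add: grad_functional_def algebra_simps)
qed

text \<open>Two lifts of \<open>f\<close> have quasi-everywhere equal traces and so induce the same
  functional, which is what the definite description in \<open>curl_T\<close> needs.\<close>

lemma curl_T_eq:
  assumes ext: "extension_domain 1 \<Omega>" "extension_domain 2 \<Omega>" and v: "v \<in> sobolev 2 \<Omega>" and f: "qe_eq \<Omega> (Tr \<Omega> v) f"
  shows "curl_T \<Omega> f = tangential_trace \<Omega> (weak_grad \<Omega> v)"
  unfolding curl_T_def
proof (rule the_equality)
  have \<Omega>: "open \<Omega>" using ext(1) by (simp add: extension_domain_def)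
  show "\<exists>w\<in>sobolev 2 \<Omega>. qe_eq \<Omega> (Tr \<Omega> w) f \<and> tangential_trace \<Omega> (weak_grad \<Omega> v) = tangential_trace \<Omega> (weak_grad \<Omega> w)"
    using v f by blast
  fix l assume "\<exists>w\<in>sobolev 2 \<Omega>. qe_eq \<Omega> (Tr \<Omega> w) f \<and> l = tangential_trace \<Omega> (weak_grad \<Omega> w)"
  then obtain w where w: "w \<in> sobolev 2 \<Omega>" "qe_eq \<Omega> (Tr \<Omega> w) f" "l = tangential_trace \<Omega> (weak_grad \<Omega> w)" by blast
  show "l = tangential_trace \<Omega> (weak_grad \<Omega> v)"
    unfolding w(3) tangential_trace_grad[OF ext w(1)] tangential_trace_grad[OF ext v]
    by (rule grad_functional_trace_cong[OF ext sobolev_2(1)[OF \<Omega> w(1)] sobolev_2(1)[OF \<Omega> v] qe_eq_trans[OF w(2) qe_eq_sym[OF f]]])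
qed

theorem theorem6p11:
  fixes \<Omega> :: "(real^3) set"
  assumes "extension_domain 1 \<Omega>" and "extension_domain 2 \<Omega>"
  shows
    "(\<forall>v\<in>sobolev 2 \<Omega>. weak_grad \<Omega> v \<in> vsobolev 1 \<Omega>) \<and>
     (\<forall>v\<in>sobolev 2 \<Omega>. \<forall>f. qe_eq \<Omega> (Tr \<Omega> v) f \<longrightarrow>
        curl_T \<Omega> f = tangential_trace \<Omega> (weak_grad \<Omega> v)) \<and>
     (\<forall>f\<in>trace_space 2 \<Omega>. curl_T \<Omega> f \<in> B_perp \<Omega>) \<and>
     (\<forall>f\<in>trace_space 2 \<Omega>. \<forall>g\<in>trace_space 2 \<Omega>. \<forall>a b.
        curl_T \<Omega> (\<lambda>x. a * f x + b * g x) = (\<lambda>\<phi>. a * curl_T \<Omega> f \<phi> + b * curl_T \<Omega> g \<phi>)) \<and>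
     (\<exists>C. \<forall>f\<in>trace_space 2 \<Omega>. B_perp_norm \<Omega> (curl_T \<Omega> f) \<le> C * trace_norm 2 \<Omega> f)"
proof (intro conjI ballI allI impI)
  have \<Omega>: "open \<Omega>" using assms(1) by (simp add: extension_domain_def)
  note eq = curl_T_eq[OF assms] and grad = weak_grad_vsobolev[OF \<Omega>]
  show "weak_grad \<Omega> v \<in> vsobolev 1 \<Omega>" if "v \<in> sobolev 2 \<Omega>" for v by (rule grad[OF that])
  show "curl_T \<Omega> f = tangential_trace \<Omega> (weak_grad \<Omega> v)" if "v \<in> sobolev 2 \<Omega>" "qe_eq \<Omega> (Tr \<Omega> v) f" for v f
    by (rule eq[OF that])
  show "curl_T \<Omega> f \<in> B_perp \<Omega>" if "f \<in> trace_space 2 \<Omega>" for f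
  proof -
    obtain v where v: "v \<in> sobolev 2 \<Omega>" "qe_eq \<Omega> (Tr \<Omega> v) f" using \<open>f \<in> trace_space 2 \<Omega>\<close> unfolding trace_space_def by blast
    show ?thesis unfolding B_perp_def eq[OF v] by (rule imageI[OF grad[OF v(1)]])
  qed
  show "curl_T \<Omega> (\<lambda>x. a * f x + b * g x) = (\<lambda>\<phi>. a * curl_T \<Omega> f \<phi> + b * curl_T \<Omega> g \<phi>)"
    if fg: "f \<in> trace_space 2 \<Omega>" "g \<in> trace_space 2 \<Omega>" for f g a b
  proof -
    obtain u v where u: "u \<in> sobolev 2 \<Omega>" "qe_eq \<Omega> (Tr \<Omega> u) f" and v: "v \<in> sobolev 2 \<Omega>" "qe_eq \<Omega> (Tr \<Omega> v) g"
      using fg unfolding trace_space_def by blast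
    note uv = sobolev_2(1)[OF \<Omega> u(1)] sobolev_2(1)[OF \<Omega> v(1)] and s = sobolev_lincomb[OF \<Omega> u(1) v(1)]
    show ?thesis
      unfolding eq[OF u] eq[OF v] eq[OF s trace_space_lincomb[OF assms uv(1) u(2) uv(2) v(2)]]
        tangential_trace_grad[OF assms u(1)] tangential_trace_grad[OF assms v(1)] tangential_trace_grad[OF assms s]
      by (rule grad_functional_lincomb[OF assms uv])
  qed
  show "\<exists>C. \<forall>f\<in>trace_space 2 \<Omega>. B_perp_norm \<Omega> (curl_T \<Omega> f) \<le> C * trace_norm 2 \<Omega> f"
  \<comment> \<open>For every lift \<open>v\<close> of \<open>f\<close> the weak gradient competes
    in the infimum on the left and has norm at most that of \<open>v\<close> in H^2; the infimum
    over the lifts then gives the constant 1.\<close>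
  proof (intro exI[of _ 1] ballI)
    fix f assume f: "f \<in> trace_space 2 \<Omega>"
    have "B_perp_norm \<Omega> (curl_T \<Omega> f) \<le> trace_norm 2 \<Omega> f"
      unfolding trace_norm_def
    proof (rule cInf_greatest)
      show "sobolev_norm 2 \<Omega> ` {v \<in> sobolev 2 \<Omega>. qe_eq \<Omega> (Tr \<Omega> v) f} \<noteq> {}" using f unfolding trace_space_def by blast
      fix t assume "t \<in> sobolev_norm 2 \<Omega> ` {v \<in> sobolev 2 \<Omega>. qe_eq \<Omega> (Tr \<Omega> v) f}"
      then obtain v where v: "v \<in> sobolev 2 \<Omega>" "qe_eq \<Omega> (Tr \<Omega> v) f" and t: "t = sobolev_norm 2 \<Omega> v" by blast
      have "B_perp_norm \<Omega> (curl_T \<Omega> f) \<le> vsobolev_norm 1 \<Omega> (weak_grad \<Omega> v)"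
        unfolding B_perp_norm_def
      proof (rule cInf_lower)
        show "vsobolev_norm 1 \<Omega> (weak_grad \<Omega> v) \<in> vsobolev_norm 1 \<Omega> ` {v \<in> vsobolev 1 \<Omega>. tangential_trace \<Omega> v = curl_T \<Omega> f}"
          by (rule imageI) (use grad[OF v(1)] eq[OF v] in simp)
        show "bdd_below (vsobolev_norm 1 \<Omega> ` {v \<in> vsobolev 1 \<Omega>. tangential_trace \<Omega> v = curl_T \<Omega> f})"
          by (rule bdd_belowI[of _ 0]) (auto simp: vsobolev_norm_def)
      qed
      then show "B_perp_norm \<Omega> (curl_T \<Omega> f) \<le> t" using weak_grad_norm[of \<Omega> v] t by linarith
    qed
    then show "B_perp_norm \<Omega> (curl_T \<Omega> f) \<le> 1 * trace_norm 2 \<Omega> f" by simp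
  qed
qed

end
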